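(* Let $p,q>1$ and suppose that $$(u_0,u_1)\in(H^1\cap L^1)\times(L^2\cap L^1\cap L^q),\qquad (v_0,v_1)\in H^1\times(L^2\cap L^1),$$ and that $\operatorname{supp}(u_0,u_1,v_0,v_1)\subset[-R,R]$ for some $R>0$. Suppose additionally that $$\int_{\mathbb{R}}\big(u_0(x)+u_1(x)\big)\,\mathrm{d}x>0\qquad\text{and}\qquad\int_{\mathbb{R}}v_1(x)\,\mathrm{d}x>0.$$ Let $T_\varepsilon$ be the lifespan of the unique maximal mild energy solution of the one-dimensional Nakao problem with initial data $\varepsilon(u_0,u_1)$, $\varepsilon(v_0,v_1)$. If $(p,q)\in\Omega_{\mathrm{Nakao},1}$, then $$T_\varepsilon\approx\varepsilon^{-\frac{pq-1}{q+2}},$$ i.e. there exist constants $\varepsilon_0>0$ and $0<c\leqslant C$, independent of $\varepsilon$ (they may depend on $p,q$ and the fixed profiles $u_0,u_1,v_0,v_1$), such that $c\,\varepsilon^{-\frac{pq-1}{q+2}}\leqslant T_\varepsilon\leqslant C\,\varepsilon^{-\frac{pq-1}{q+2}}$ for every $\varepsilon\in(0,\varepsilon_0]$.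
   Context: All function spaces are over $\mathbb{R}$. For $p,q>1$ and $\varepsilon>0$, the one-dimensional Nakao problem is the Cauchy problem $$u_{tt}-u_{xx}+u_t=|v|^p,\qquad v_{tt}-v_{xx}=|u|^q\qquad (x\in\mathbb{R},\ t>0),$$ $$(u,u_t)(0,x)=\varepsilon(u_0,u_1)(x),\qquad (v,v_t)(0,x)=\varepsilon(v_0,v_1)(x).$$ For data $(u_0,u_1),(v_0,v_1)\in H^1\times L^2$ it has, for every $\varepsilon>0$, a unique maximal mild energy solution $(u,v)$ on $[0,T_\varepsilon)$ with $u,v\in\mathcal{C}([0,T_\varepsilon),H^1)\cap\mathcal{C}^1([0,T_\varepsilon),L^2)$ (mild means satisfying the Duhamel integral formulas for the damped wave and wave equations); $T_\varepsilon\in(0,\infty]$ is called the lifespan, and if $T_\varepsilon<\infty$ then $\limsup_{t\to T_\varepsilon^-}\big(\|(u,u_t)(t,\cdot)\|_{H^1\times L^2}+\|(v,v_t)(t,\cdot)\|_{H^1\times L^2}\big)=+\infty$. $\operatorname{supp}(f_1,\dots,f_k):=\bigcup_{j}\operatorname{supp}f_j$. The region is $$\Omega_{\mathrm{Nakao},1}:=\Big\{(p,q)\in(1,\infty)^2:\ q\geqslant3,\ \text{ or }\ \Big(1<q<3\ \text{ and }\ p\leqslant\frac{2q^2+q-1}{q(3-q)}\Big)\Big\}.$$ *)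

theory Defs
  imports "HOL-Analysis.Analysis"
begin

section \<open>Function spaces on the real line\<close>

text \<open>Elements of the spaces below are represented by functions; almost everywhere equal
  functions stand for the same element.\<close>

definition Lp_space :: "real \<Rightarrow> (real \<Rightarrow> real) set" where
  "Lp_space r = {f. f \<in> borel_measurable lebesgue \<and> integrable lebesgue (\<lambda>x. \<bar>f x\<bar> powr r)}"

definition Lp_norm :: "real \<Rightarrow> (real \<Rightarrow> real) \<Rightarrow> real" where
  "Lp_norm r f = (\<integral>x. \<bar>f x\<bar> powr r \<partial>lebesgue) powr (1 / r)"

definition test_function :: "(real \<Rightarrow> real) \<Rightarrow> bool" where
  "test_function \<phi> \<longleftrightarrow>
     (\<forall>n x. (deriv ^^ n) \<phi> field_differentiable (at x)) \<and> compact (closure {x. \<phi> x \<noteq> 0})"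

text \<open>Used only for functions in \<open>L\<^sup>2\<close>, for which both integrals below exist.\<close>

definition weak_derivative :: "(real \<Rightarrow> real) \<Rightarrow> (real \<Rightarrow> real) \<Rightarrow> bool" where
  "weak_derivative f g \<longleftrightarrow>
     (\<forall>\<phi>. test_function \<phi> \<longrightarrow>
        (\<integral>x. f x * deriv \<phi> x \<partial>lebesgue) = - (\<integral>x. g x * \<phi> x \<partial>lebesgue))"

definition H1_space :: "(real \<Rightarrow> real) set" where
  "H1_space = {f \<in> Lp_space 2. \<exists>g \<in> Lp_space 2. weak_derivative f g}"

text \<open>The weak derivative is unique up to null sets, so the norm does not depend on the choice.\<close>

definition H1_norm :: "(real \<Rightarrow> real) \<Rightarrow> real" where
  "H1_norm f = sqrt ((Lp_norm 2 f)\<^sup>2 + (Lp_norm 2 (SOME g. g \<in> Lp_space 2 \<and> weak_derivative f g))\<^sup>2)"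

text \<open>The complement of the largest open set on which the function vanishes almost everywhere.\<close>

definition ess_supp :: "(real \<Rightarrow> real) \<Rightarrow> real set" where
  "ess_supp f = - \<Union>{U. open U \<and> (AE x in lebesgue. x \<in> U \<longrightarrow> f x = 0)}"

text \<open>\<open>C(S, X)\<close> and \<open>C\<^sup>1(S, X)\<close> for a time set \<open>S\<close> and a function space \<open>X\<close> with norm \<open>N\<close>;
  the derivative is the limit of the difference quotients in the norm \<open>N\<close>.\<close>

definition C0_curve ::
  "real set \<Rightarrow> (real \<Rightarrow> real) set \<Rightarrow> ((real \<Rightarrow> real) \<Rightarrow> real) \<Rightarrow> (real \<Rightarrow> real \<Rightarrow> real) \<Rightarrow> bool" where
  "C0_curve S X N u \<longleftrightarrow>
     (\<forall>t\<in>S. u t \<in> X \<and> ((\<lambda>s. N (\<lambda>x. u s x - u t x)) \<longlongrightarrow> 0) (at t within S))"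

definition C1_curve ::
  "real set \<Rightarrow> (real \<Rightarrow> real) set \<Rightarrow> ((real \<Rightarrow> real) \<Rightarrow> real) \<Rightarrow> (real \<Rightarrow> real \<Rightarrow> real) \<Rightarrow> bool" where
  "C1_curve S X N u \<longleftrightarrow>
     (\<forall>t\<in>S. u t \<in> X) \<and>
     (\<exists>w. C0_curve S X N w \<and>
       (\<forall>t\<in>S. ((\<lambda>s. N (\<lambda>x. (u s x - u t x) / (s - t) - w t x)) \<longlongrightarrow> 0) (at t within S)))"


section \<open>Linear propagators\<close>

text \<open>d'Alembert's formula: the solution at time \<open>t\<close> of \<open>v_tt - v_xx = 0\<close> with
  \<open>(v, v_t)(0) = (f, g)\<close>.\<close>

definition wave_prop :: "real \<Rightarrow> (real \<Rightarrow> real) \<Rightarrow> (real \<Rightarrow> real) \<Rightarrow> real \<Rightarrow> real" where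
  "wave_prop t f g x =
     (f (x + t) + f (x - t)) / 2 + (LINT y:{x - t..x + t}|lebesgue. g y) / 2"

text \<open>The modified Bessel function of the first kind of order \<open>n\<close>.\<close>

definition bessel_I :: "nat \<Rightarrow> real \<Rightarrow> real" where
  "bessel_I n z = (\<Sum>k. (z / 2) ^ (2 * k + n) / (fact k * fact (k + n)))"

text \<open>The solution at time \<open>t\<close> of \<open>u_tt - u_xx + u_t = 0\<close> with \<open>(u, u_t)(0) = (f, g)\<close>:
  the function \<open>w = exp (t/2) u\<close> solves \<open>w_tt - w_xx = w/4\<close> with
  \<open>(w, w_t)(0) = (f, g + f/2)\<close>, and hence \<open>w(t) = W(t)(g + f/2) + d/dt W(t)f\<close>, where \<open>W(t)h(x)\<close> is
  one half of the integral of \<open>I\<^sub>0(\<rho>/2) h(y)\<close> over \<open>\<bar>x - y\<bar> \<le> t\<close>, and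
  \<open>\<rho> = sqrt (t\<^sup>2 - (x - y)\<^sup>2)\<close>. The term with \<open>I\<^sub>1\<close> comes from differentiating \<open>I\<^sub>0(\<rho>/2)\<close> in \<open>t\<close>.\<close>

definition damped_wave_prop :: "real \<Rightarrow> (real \<Rightarrow> real) \<Rightarrow> (real \<Rightarrow> real) \<Rightarrow> real \<Rightarrow> real" where
  "damped_wave_prop t f g x =
     exp (- t / 2) *
       ((f (x + t) + f (x - t)) / 2 +
        (LINT y:{x - t..x + t}|lebesgue.
           (let \<rho> = sqrt (t\<^sup>2 - (x - y)\<^sup>2)
            in bessel_I 0 (\<rho> / 2) * (g y + f y / 2) + t / (2 * \<rho>) * bessel_I 1 (\<rho> / 2) * f y)) / 2)"


section \<open>The Nakao problem\<close>

text \<open>Mild energy solutions on \<open>[0,T)\<close> of \<open>u_tt - u_xx + u_t = \<bar>v\<bar>\<^sup>p\<close>, \<open>v_tt - v_xx = \<bar>u\<bar>\<^sup>q\<close> with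
  \<open>(u, u_t)(0) = (u0, u1)\<close> and \<open>(v, v_t)(0) = (v0, v1)\<close>. For \<open>u, v\<close> in \<open>C([0,T), H\<^sup>1)\<close> the Duhamel
  integrands are continuous in \<open>s\<close> for every \<open>x\<close>, so the integrals in \<open>s\<close> can be taken pointwise
  in \<open>x\<close>.\<close>

definition Nakao_mild_solution ::
  "real \<Rightarrow> real \<Rightarrow> (real \<Rightarrow> real) \<Rightarrow> (real \<Rightarrow> real) \<Rightarrow> (real \<Rightarrow> real) \<Rightarrow> (real \<Rightarrow> real) \<Rightarrow>
   ereal \<Rightarrow> (real \<Rightarrow> real \<Rightarrow> real) \<Rightarrow> (real \<Rightarrow> real \<Rightarrow> real) \<Rightarrow> bool" where
  "Nakao_mild_solution p q u0 u1 v0 v1 T u v \<longleftrightarrow>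
     0 < T \<and>
     (let S = {t. 0 \<le> t \<and> ereal t < T} in
        C0_curve S H1_space H1_norm u \<and> C1_curve S (Lp_space 2) (Lp_norm 2) u \<and>
        C0_curve S H1_space H1_norm v \<and> C1_curve S (Lp_space 2) (Lp_norm 2) v \<and>
        (\<forall>t\<in>S. AE x in lebesgue.
           u t x = damped_wave_prop t u0 u1 x +
             (LINT s:{0..t}|lebesgue.
                damped_wave_prop (t - s) (\<lambda>y. 0) (\<lambda>y. \<bar>v s y\<bar> powr p) x)) \<and>
        (\<forall>t\<in>S. AE x in lebesgue.
           v t x = wave_prop t v0 v1 x +
             (LINT s:{0..t}|lebesgue.
                wave_prop (t - s) (\<lambda>y. 0) (\<lambda>y. \<bar>u s y\<bar> powr q) x)))"

definition Nakao_maximal_solution ::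
  "real \<Rightarrow> real \<Rightarrow> (real \<Rightarrow> real) \<Rightarrow> (real \<Rightarrow> real) \<Rightarrow> (real \<Rightarrow> real) \<Rightarrow> (real \<Rightarrow> real) \<Rightarrow>
   ereal \<Rightarrow> (real \<Rightarrow> real \<Rightarrow> real) \<Rightarrow> (real \<Rightarrow> real \<Rightarrow> real) \<Rightarrow> bool" where
  "Nakao_maximal_solution p q u0 u1 v0 v1 T u v \<longleftrightarrow>
     Nakao_mild_solution p q u0 u1 v0 v1 T u v \<and>
     \<not> (\<exists>T' u' v'. T < T' \<and> Nakao_mild_solution p q u0 u1 v0 v1 T' u' v' \<and>
          (\<forall>t. 0 \<le> t \<and> ereal t < T \<longrightarrow>
             (AE x in lebesgue. u' t x = u t x \<and> v' t x = v t x)))"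

text \<open>For \<open>p, q > 1\<close> and data in \<open>H\<^sup>1 \<times> L\<^sup>2\<close> the maximal solution exists and is unique up to
  null sets, so that its existence time is well defined.\<close>

definition Nakao_lifespan ::
  "real \<Rightarrow> real \<Rightarrow> (real \<Rightarrow> real) \<Rightarrow> (real \<Rightarrow> real) \<Rightarrow> (real \<Rightarrow> real) \<Rightarrow> (real \<Rightarrow> real) \<Rightarrow> ereal" where
  "Nakao_lifespan p q u0 u1 v0 v1 = (THE T. \<exists>u v. Nakao_maximal_solution p q u0 u1 v0 v1 T u v)"

definition Omega_Nakao_1 :: "(real \<times> real) set" where
  "Omega_Nakao_1 =
     {(p, q). 1 < p \<and> 1 < q \<and>
        (3 \<le> q \<or> (1 < q \<and> q < 3 \<and> p \<le> (2 * q\<^sup>2 + q - 1) / (q * (3 - q))))}"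

end

theory Submission
  imports Defs
begin

text \<open>
  Write \<open>\<kappa> = (p q - 1) / (q + 2)\<close>. Both propagators are convolutions with nonnegative kernels on the
  backward light cone, \<open>ker_w\<close> for the wave equation and \<open>ker_d\<close>, \<open>ker_f\<close> for the damped one, up to
  translates of the initial value. With \<open>duh\<close> for the Duhamel integral of a kernel, a mild solution satisfies
  \<open>u = ul + duh ker_d (\<bar>v\<bar>\<^sup>p)\<close> and \<open>v = vl + duh ker_w (\<bar>u\<bar>\<^sup>q)\<close>, where \<open>ul\<close> and \<open>vl\<close> solve the free
  equations. Three properties of the kernels decide the theorem: \<open>ker_w t\<close> has mass \<open>t\<close>, \<open>ker_d t\<close> has
  mass \<open>1 - exp (- t)\<close>, and \<open>ker_d t\<close>, \<open>ker_f t\<close> are at most \<open>1 / sqrt (1 + t)\<close>.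

  Upper bound. The solution lives in \<open>\<bar>x\<bar> \<le> R + t\<close>, so the spatial integrals \<open>m\<close> of \<open>u\<close> and \<open>n\<close> of \<open>v\<close>
  obey, by Jensen's inequality, \<open>m(t) \<ge> \<integral> (1 - exp (s - t)) \<bar>n(s)\<bar>\<^sup>p (2 (R + s))\<^sup>1\<^sup>-\<^sup>p ds\<close> and
  \<open>n(t) \<ge> A t + \<integral> (t - s) \<bar>m(s)\<bar>\<^sup>q (2 (R + s))\<^sup>1\<^sup>-\<^sup>q ds\<close> with \<open>A\<close> half of the integral of the initial velocity of
  \<open>v\<close>. On the window \<open>[\<tau>, 4 \<tau>]\<close> a bound \<open>n(t) \<ge> A t\<close> improves to \<open>n(t) \<ge> c \<tau>\<^sup>q\<^sup>+\<^sup>2 A\<^sup>p\<^sup>q t\<close> on a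
  slightly smaller window. If \<open>\<tau>\<^sup>q\<^sup>+\<^sup>2 A\<^sup>p\<^sup>q\<^sup>-\<^sup>1\<close> is large, iteration on windows that shrink geometrically
  drives \<open>n(4 \<tau>)\<close> to infinity (\<open>blowup_iteration\<close>, \<open>lifespan_upper_bound\<close>). Since \<open>A\<close> is proportional to \<open>\<epsilon>\<close>, a
  solution cannot reach \<open>4 \<tau>\<close> when \<open>\<tau>\<close> is a large multiple of \<open>\<epsilon> powr (- \<kappa>)\<close>.

  Lower bound. On \<open>[0, T]\<close> the ball \<open>\<bar>v\<bar> \<le> K \<epsilon>\<close> is invariant under the Picard map: the first Duhamel
  term is at most \<open>T (K \<epsilon>)\<^sup>p\<close>, and it contributes at most a multiple of \<open>T\<^sup>2 (T (K \<epsilon>)\<^sup>p)\<^sup>q\<close> to \<open>v\<close>, which is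
  of order \<open>\<epsilon>\<close> exactly for \<open>T\<close> of order \<open>\<epsilon> powr (- \<kappa>)\<close>. The free part contributes the time integral of
  \<open>\<integral> \<bar>ul\<bar>\<^sup>q dx\<close>, which decays like \<open>(1 + s) powr (- (q - 1) / 2)\<close> times \<open>\<epsilon>\<^sup>q\<close>; the region for \<open>(p, q)\<close> is what
  keeps this integral below a multiple of \<open>\<epsilon>\<close> up to that time (\<open>Omega_exponent\<close>, \<open>existence_time\<close>).

  Passage to energy solutions. Elements of \<open>H\<^sup>1\<close> have continuous representatives bounded by the norm, so a mild
  solution is represented by continuous bounded functions that solve the two integral equations
  (\<open>mild_to_sol\<close>), and these are unique by contraction in an exponentially weighted norm
  (\<open>sol_unique_on\<close>). Conversely the integral equations have solutions that are energy curves, because cone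
  convolutions of \<open>L\<^sup>2\<close> data can be differentiated under the integral (\<open>sol_to_mild\<close>). By uniqueness all
  mild solutions glue to a maximal one, whose lifespan is the supremum of all existence times (\<open>lifespan_eq_Sup\<close>).
\<close>

abbreviation plane :: "(real \<times> real) measure" where "plane \<equiv> lborel \<Otimes>\<^sub>M lborel"

lemmas lint_cong = Bochner_Integration.integral_cong and int_bound = Bochner_Integration.integrable_bound
 and set_int_def = set_lebesgue_integral_def

section \<open>Smooth bumps and plateaus\<close>

text \<open>Finite orders of differentiability, so that the closure properties below are inductions on the
  order.\<close>

definition diff_upto :: "nat => (real => real) => bool" where
 "diff_upto n f \<longleftrightarrow> (\<forall>k\<le>n. \<forall>x. (deriv ^^ k) f field_differentiable (at x))"

lemma diff_upto_0: "diff_upto 0 f \<longleftrightarrow> (\<forall>x. f field_differentiable (at x))"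
 by (simp add: diff_upto_def)

lemma diff_upto_Suc:
 "diff_upto (Suc n) f \<longleftrightarrow> (\<forall>x. f field_differentiable (at x)) \<and> diff_upto n (deriv f)"
 (is "?L \<longleftrightarrow> ?R")
proof -
 have *: "(deriv ^^ Suc k) f = (deriv ^^ k) (deriv f)" for k
  by (simp add: funpow_swap1)
 show ?thesis
 proof
  assume L: ?L
  have "(deriv ^^ k) (deriv f) field_differentiable (at x)" if "k <= n" for k x
   using L that unfolding diff_upto_def *[symmetric] by (meson Suc_le_mono)
  moreover have "f field_differentiable (at x)" for x
   using L[unfolded diff_upto_def, rule_format, of 0 x] by simp
  ultimately show ?R by (auto simp: diff_upto_def)
 next
  assume R: ?R
  have "(deriv ^^ k) f field_differentiable (at x)" if "k <= Suc n" for k x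
  proof (cases k)
   case 0
   then show ?thesis using R by simp
  next
   case (Suc j)
   then show ?thesis using R that unfolding diff_upto_def Suc * by simp
  qed
  then show ?L by (auto simp: diff_upto_def)
 qed
qed

lemma diff_upto_diff: "diff_upto n f ==> f field_differentiable (at x)"
 by (cases n) (auto simp: diff_upto_0 diff_upto_Suc)

lemma diff_upto_mono: "diff_upto (Suc n) f ==> diff_upto n f"
 by (auto simp: diff_upto_def)

lemma diff_upto_add: "diff_upto n f ==> diff_upto n g ==> diff_upto n (\<lambda>x. f x + g x)"
proof (induction n arbitrary: f g)
 case 0
 then show ?case by (auto simp: diff_upto_0 intro: field_differentiable_add)
next
 case (Suc n)
 then have "deriv (\<lambda>x. f x + g x) = (\<lambda>x. deriv f x + deriv g x)"
  by (auto simp: diff_upto_Suc fun_eq_iff)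
 then show ?case using Suc by (auto simp: diff_upto_Suc intro: field_differentiable_add)
qed

lemma diff_upto_mult: "diff_upto n f ==> diff_upto n g ==> diff_upto n (\<lambda>x. f x * g x)"
proof (induction n arbitrary: f g)
 case 0
 then show ?case by (auto simp: diff_upto_0 intro: field_differentiable_mult)
next
 case (Suc n)
 then have "deriv (\<lambda>x. f x * g x) = (\<lambda>x. f x * deriv g x + deriv f x * g x)"
  by (auto simp: diff_upto_Suc fun_eq_iff)
 moreover have "diff_upto n f" "diff_upto n g" using Suc.prems by (auto intro: diff_upto_mono)
 ultimately show ?case using Suc
  by (auto simp: diff_upto_Suc intro!: field_differentiable_mult diff_upto_add)
qed

lemma diff_upto_const: "diff_upto n (\<lambda>x. c)"
 by (induction n arbitrary: c) (auto simp: diff_upto_0 diff_upto_Suc)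

lemma diff_upto_affine: "diff_upto n f ==> diff_upto n (\<lambda>x. f (a * x + b))"
proof (induction n arbitrary: f)
 case 0
 show ?case unfolding diff_upto_0
 proof
  fix x
  have "f field_differentiable (at (a * x + b))" using 0 by (auto simp: diff_upto_0)
  then have "(f has_field_derivative deriv f (a * x + b)) (at (a * x + b))"
   using DERIV_deriv_iff_field_differentiable by blast
  then have "((\<lambda>x. f (a * x + b)) has_field_derivative deriv f (a * x + b) * a) (at x)"
   by (rule DERIV_chain2) (auto intro!: derivative_eq_intros)
  then show "(\<lambda>x. f (a * x + b)) field_differentiable (at x)"
   by (auto simp: field_differentiable_def)
 qed
next
 case (Suc n)
 have d: "((\<lambda>x. f (a * x + b)) has_field_derivative deriv f (a * x + b) * a) (at x)" for x
 proof -
  have "f field_differentiable (at (a * x + b))" using Suc by (auto simp: diff_upto_Suc)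
  then have "(f has_field_derivative deriv f (a * x + b)) (at (a * x + b))"
   using DERIV_deriv_iff_field_differentiable by blast
  then show ?thesis
   by (rule DERIV_chain2) (auto intro!: derivative_eq_intros)
 qed
 have "deriv (\<lambda>x. f (a * x + b)) = (\<lambda>x. deriv f (a * x + b) * a)"
  using d by (auto intro: DERIV_imp_deriv)
 then show ?case using d Suc
  by (auto simp: diff_upto_Suc field_differentiable_def intro!: diff_upto_mult diff_upto_const)
qed

text \<open>The derivatives of \<open>exp (- 1 / x)\<close> at positive \<open>x\<close> are linear combinations
  of these functions, so the family is closed under differentiation.\<close>

definition flat_exp :: "nat => real => real" where
 "flat_exp k x = (if x <= 0 then 0 else inverse x ^ k * exp (- inverse x))"

lemma flat_exp_tendsto_0: "(flat_exp k \<longlongrightarrow> 0) (at_right 0)"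
proof -
 have "((\<lambda>y::real. y ^ k / exp y) \<longlongrightarrow> 0) at_top"
  by (rule tendsto_power_div_exp_0)
 then have "((\<lambda>x::real. inverse x ^ k / exp (inverse x)) \<longlongrightarrow> 0) (at_right 0)"
  by (rule filterlim_compose) (rule filterlim_inverse_at_top_right)
 then show ?thesis
  by (rule Lim_transform_eventually)
    (auto simp: eventually_at_right_less flat_exp_def exp_minus divide_inverse
       intro!: eventually_at_rightI[of 0 1])
qed

lemma flat_exp_deriv:
 "(flat_exp k has_field_derivative flat_exp (k + 2) x - k * flat_exp (Suc k) x) (at x)"
proof -
 consider "x < 0" | "x > 0" | "x = 0" by linarith
 then show ?thesis
 proof cases
  case 1
  have "((\<lambda>x. 0) has_field_derivative 0) (at x)" by simp
  then have "(flat_exp k has_field_derivative 0) (at x)"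
   by (rule has_field_derivative_transform_within_open[of _ _ _ "{..<0}"])
     (use 1 in \<open>auto simp: flat_exp_def\<close>)
  then show ?thesis using 1 by (simp add: flat_exp_def)
 next
  case 2
  have "((\<lambda>x. inverse x ^ k * exp (- inverse x)) has_field_derivative
    flat_exp (k + 2) x - k * flat_exp (Suc k) x) (at x)"
  proof (cases k)
   case 0
   then show ?thesis using 2
    by (auto intro!: derivative_eq_intros simp: flat_exp_def power2_eq_square)
  next
   case (Suc j)
   have "((\<lambda>x. inverse x ^ Suc j) has_field_derivative - (real (Suc j) * inverse x ^ (Suc (Suc j)))) (at x)"
    by (rule DERIV_cong[OF DERIV_power[OF DERIV_inverse]]) (use 2 in \<open>auto simp: algebra_simps\<close>)
   moreover have "((\<lambda>x. exp (- inverse x)) has_field_derivative inverse x * inverse x * exp (- inverse x)) (at x)"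
    using 2 by (auto intro!: derivative_eq_intros)
   ultimately have "((\<lambda>x. inverse x ^ Suc j * exp (- inverse x)) has_field_derivative
     - (real (Suc j) * inverse x ^ (Suc (Suc j))) * exp (- inverse x)
     + inverse x * inverse x * exp (- inverse x) * inverse x ^ Suc j) (at x)"
    by (rule DERIV_mult)
   then show ?thesis unfolding Suc
    by (rule DERIV_cong) (use 2 in \<open>simp add: flat_exp_def power_add algebra_simps\<close>)
  qed
  then show ?thesis
   by (rule has_field_derivative_transform_within_open[of _ _ _ "{0<..}"])
     (use 2 in \<open>auto simp: flat_exp_def\<close>)
 next
  case 3
  have "((\<lambda>h. (flat_exp k (0 + h) - flat_exp k 0) / h) \<longlongrightarrow> 0) (at_right 0)"
   by (rule Lim_transform_eventually[OF flat_exp_tendsto_0[of "Suc k"]])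
     (auto simp: flat_exp_def field_simps intro!: eventually_at_rightI[of 0 1])
  moreover have "((\<lambda>h. (flat_exp k (0 + h) - flat_exp k 0) / h) \<longlongrightarrow> 0) (at_left 0)"
   by (rule Lim_transform_eventually[OF tendsto_const])
     (auto simp: flat_exp_def intro!: eventually_at_leftI[of "-1" 0])
  ultimately have "((\<lambda>h. (flat_exp k (0 + h) - flat_exp k 0) / h) \<longlongrightarrow> 0) (at 0)"
   by (simp add: filterlim_split_at)
  then show ?thesis using 3 by (simp add: DERIV_def flat_exp_def)
 qed
qed

lemma diff_upto_flat_exp: "diff_upto n (flat_exp k)"
proof (induction n arbitrary: k)
 case 0
 then show ?case using flat_exp_deriv by (auto simp: diff_upto_0 field_differentiable_def)
next
 case (Suc n)
 have "deriv (flat_exp k) = (\<lambda>x. flat_exp (k + 2) x + (- real k) * flat_exp (Suc k) x)"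
  using flat_exp_deriv[of k] by (auto intro!: DERIV_imp_deriv simp: fun_eq_iff)
 moreover have "diff_upto n (\<lambda>x. flat_exp (k + 2) x + (- real k) * flat_exp (Suc k) x)"
  by (intro diff_upto_add diff_upto_mult diff_upto_const Suc)
 ultimately show ?case using flat_exp_deriv[of k]
  by (auto simp: diff_upto_Suc field_differentiable_def)
qed

definition bump :: "real => real" where "bump x = flat_exp 0 x * flat_exp 0 (1 - x)"

lemma diff_upto_bump: "diff_upto n bump"
proof -
 have "diff_upto n (\<lambda>x. flat_exp 0 x * flat_exp 0 ((-1) * x + 1))"
  by (rule diff_upto_mult[OF diff_upto_flat_exp diff_upto_affine[OF diff_upto_flat_exp]])
 then show ?thesis by (simp add: bump_def[abs_def])
qed

lemma test_functionI:
 assumes "!!n. diff_upto n \<phi>" "!!x. x < a \<or> b < x ==> \<phi> x = 0"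
 shows "test_function \<phi>"
proof -
 have "{x. \<phi> x \<noteq> 0} \<subseteq> {a..b}" using assms(2) by force
 then have "closure {x. \<phi> x \<noteq> 0} \<subseteq> {a..b}" by (rule closure_minimal) auto
 then have "compact (closure {x. \<phi> x \<noteq> 0})"
  by (meson bounded_closed_interval bounded_subset closed_closure compact_eq_bounded_closed)
 then show ?thesis using assms(1) by (auto simp: test_function_def diff_upto_def)
qed

lemma test_function_diff_upto: "test_function \<phi> ==> diff_upto n \<phi>"
 by (simp add: test_function_def diff_upto_def)

lemma test_function_bounded_support:
 assumes "test_function \<phi>" obtains L where "L > 0" "!!x. \<bar>x\<bar> \<ge> L ==> \<phi> x = 0"
proof -
 have "bounded {x. \<phi> x \<noteq> 0}"
  by (rule bounded_subset[OF compact_imp_bounded closure_subset])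
    (use assms in \<open>simp add: test_function_def\<close>)
 then obtain L where "L > 0" "!!x. \<phi> x \<noteq> 0 ==> \<bar>x\<bar> < L"
  by (auto simp: bounded_pos_less)
 then show ?thesis using that[of L] by force
qed

definition primitive :: "(real => real) => real => real" where
 "primitive g x = (LINT y:{..x}|lborel. g y)"

lemma set_integrable_of_integrable:
 fixes g :: "real => real"
 shows "integrable lborel g ==> A \<in> sets borel ==> set_integrable lborel A g"
 unfolding set_integrable_def by (rule integrable_mult_indicator) auto

lemma primitive_diff:
 assumes "integrable lborel g" "a <= b"
 shows "primitive g b - primitive g a = (LINT y:{a<..b}|lborel. g y)"
proof -
 have "{..b} = {..a} \<union> {a<..b}" using assms by auto
 then have "primitive g b = primitive g a + (LINT y:{a<..b}|lborel. g y)"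
  unfolding primitive_def
  by (simp only:) (rule set_integral_Un; use assms in \<open>auto intro: set_integrable_of_integrable\<close>)
 then show ?thesis by simp
qed

lemma set_integral_Ioc_Icc:
 fixes a b :: real and g :: "real => real"
 shows "(LINT y:{a<..b}|lborel. g y) = (LINT y:{a..b}|lborel. g y)"
 by (rule set_integral_discrete_difference[where X="{a}"]) auto

lemma primitive_diff_integral:
 fixes g :: "real => real"
 assumes "integrable lborel g" "a <= b"
 shows "primitive g b - primitive g a = integral {a..b} g"
 unfolding primitive_diff[OF assms] set_integral_Ioc_Icc
 by (rule set_borel_integral_eq_integral(2)) (auto intro: set_integrable_of_integrable assms)

lemma primitive_deriv:
 fixes g :: "real => real"
 assumes "integrable lborel g" "continuous_on UNIV g"
 shows "(primitive g has_field_derivative g x) (at x)"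
proof -
 have "((\<lambda>y. primitive g (x - 1) + integral {x - 1..y} g) has_field_derivative g x) (at x within {x-1..x+1})"
 proof (rule DERIV_cong[OF DERIV_add[OF DERIV_const integral_has_real_derivative]])
  show "continuous_on {x - 1..x + 1} g" using assms(2) continuous_on_subset by blast
 qed auto
 then have "((\<lambda>y. primitive g (x - 1) + integral {x - 1..y} g) has_field_derivative g x) (at x)"
  by (subst (asm) at_within_interior) auto
 then show ?thesis
  by (rule has_field_derivative_transform_within_open[of _ _ _ "{x-1<..<x+1}"])
    (use primitive_diff_integral[OF assms(1), of "x - 1", symmetric] in auto)
qed

lemma primitive_eq_0: "(!!y. y <= x ==> g y = 0) ==> primitive g x = 0"
proof -
 assume "!!y. y <= x ==> g y = 0"
 then have "(\<lambda>y. indicator {..x} y *\<^sub>R g y) = (\<lambda>y. 0)" by (auto simp: indicator_def)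
 then show ?thesis unfolding primitive_def set_int_def by simp
qed

lemma primitive_eq_total: "(!!y. y > x ==> g y = 0) ==> primitive g x = (LINT y|lborel. g y)"
proof -
 assume "!!y. y > x ==> g y = 0"
 then have "(\<lambda>y. indicator {..x} y *\<^sub>R g y) = g" by (force simp: indicator_def fun_eq_iff)
 then show ?thesis unfolding primitive_def set_int_def by simp
qed

lemma integrable_compact_support:
 fixes g :: "real => real"
 assumes "continuous_on UNIV g" "!!x. x < a \<or> b < x ==> g x = 0"
 shows "integrable lborel g"
proof -
 have "(\<lambda>x. indicator {a..b} x *\<^sub>R g x) = g" using assms(2) by (force simp: indicator_def fun_eq_iff)
 moreover have "set_integrable lborel {a..b} g"
  by (rule borel_integrable_atLeastAtMost') (use assms in \<open>auto intro: continuous_on_subset\<close>)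
 ultimately show ?thesis by (simp add: set_integrable_def)
qed

lemma diff_upto_continuous: "diff_upto n f ==> continuous_on UNIV f"
 using diff_upto_diff field_differentiable_imp_continuous_at
 by (metis continuous_at_imp_continuous_on)

lemma diff_upto_primitive:
 assumes "!!n. diff_upto n g" "integrable lborel g"
 shows "diff_upto n (primitive g)" "deriv (primitive g) = g"
proof -
 have d: "(primitive g has_field_derivative g x) (at x)" for x
  using primitive_deriv assms diff_upto_continuous by blast
 then show dd: "deriv (primitive g) = g" by (auto intro: DERIV_imp_deriv)
 show "diff_upto n (primitive g)"
  by (cases n) (use d assms dd in \<open>auto simp: diff_upto_0 diff_upto_Suc field_differentiable_def\<close>)
qed

lemma bump_nonneg: "bump x \<ge> 0" and bump_pos: "0 < x ==> x < 1 ==> bump x > 0"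
 and bump_outside: "x <= 0 \<or> x \<ge> 1 ==> bump x = 0"
 by (auto simp: bump_def flat_exp_def)

lemma continuous_bump: "continuous_on UNIV bump"
 using diff_upto_bump diff_upto_continuous by blast

lemma integrable_bump: "integrable lborel bump"
 by (rule integrable_compact_support[of _ 0 1]) (auto simp: continuous_bump bump_outside)

lemma integral_bump_pos: "(LINT x|lborel. bump x) > 0"
proof -
 have b0: "AE x in lborel. bump x = 0" if "(LINT x|lborel. bump x) = 0"
  using that integral_nonneg_eq_0_iff_AE[OF integrable_bump] bump_nonneg by auto
 have "AE x in lborel. x \<notin> {0<..<1::real}" if "(LINT x|lborel. bump x) = 0"
  by (rule eventually_mono[OF b0[OF that]]) (use bump_pos in force)
 moreover have "\<not> (AE x in lborel. x \<notin> {0<..<1::real})"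
 proof
  assume "AE x in lborel. x \<notin> {0<..<1::real}"
  then have "emeasure lborel {0<..<1::real} = 0"
   by (subst (asm) AE_iff_measurable[of "{0<..<1}"]) auto
  then show False by simp
 qed
 ultimately have "(LINT x|lborel. bump x) \<noteq> 0" by blast
 moreover have "(LINT x|lborel. bump x) \<ge> 0" by (rule integral_nonneg_AE) (simp add: bump_nonneg)
 ultimately show ?thesis by simp
qed

definition smooth_step :: "real => real" where
 "smooth_step x = primitive bump x / (LINT x|lborel. bump x)"

lemma diff_upto_smooth_step: "diff_upto n smooth_step"
proof -
 have "diff_upto n (\<lambda>x. primitive bump x * inverse (LINT x|lborel. bump x))"
  by (rule diff_upto_mult[OF diff_upto_primitive(1)[OF diff_upto_bump integrable_bump] diff_upto_const])
 then show ?thesis by (simp add: smooth_step_def[abs_def] divide_inverse)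
qed

lemma smooth_step_0: "x <= 0 ==> smooth_step x = 0"
 by (simp add: smooth_step_def primitive_eq_0 bump_outside)

lemma smooth_step_1: "x \<ge> 1 ==> smooth_step x = 1"
 using integral_bump_pos by (simp add: smooth_step_def primitive_eq_total bump_outside)

lemma smooth_step_bounds: "0 <= smooth_step x" "smooth_step x <= 1"
proof -
 have *: "smooth_step x <= smooth_step y" if "x <= y" for x y
 proof -
  have "primitive bump y - primitive bump x \<ge> 0"
   unfolding primitive_diff[OF integrable_bump that] set_int_def
   by (rule integral_nonneg_AE) (auto simp: bump_nonneg)
  then show ?thesis using integral_bump_pos by (simp add: smooth_step_def divide_right_mono)
 qed
 show "0 <= smooth_step x" using *[of "min x 0" x] smooth_step_0[of "min x 0"] by simp
 show "smooth_step x <= 1" using *[of x "max x 1"] smooth_step_1[of "max x 1"] by simp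
qed

text \<open>Test functions that converge to the indicator of an interval as \<open>n\<close> grows; they turn
  statements about test functions into statements about intervals.\<close>

definition plateau :: "real => real => nat => real => real" where
 "plateau a b n x = smooth_step (real n * (x - a)) - smooth_step (real n * (x - b))"

lemma test_function_plateau:
 assumes "a <= b" shows "test_function (plateau a b n)"
proof (rule test_functionI[of _ a "b + 1"])
 fix k
 have *: "diff_upto k (\<lambda>x. smooth_step (real n * x + c))" for c
  by (rule diff_upto_affine[OF diff_upto_smooth_step])
 have "diff_upto k (\<lambda>x. smooth_step (real n * x + (- real n * a)) + (-1) * smooth_step (real n * x + (- real n * b)))"
  by (rule diff_upto_add[OF * diff_upto_mult[OF diff_upto_const *]])
 then show "diff_upto k (plateau a b n)" by (simp add: plateau_def[abs_def] algebra_simps)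
next
 fix x assume "x < a \<or> b + 1 < x"
 then show "plateau a b n x = 0"
 proof
  assume "x < a"
  then show ?thesis using assms by (simp add: plateau_def smooth_step_0 mult_nonneg_nonpos)
 next
  assume x: "b + 1 < x"
  show ?thesis
  proof (cases "n = 0")
   case False
   have "1 * 1 <= real n * (x - b)" "1 * 1 <= real n * (x - a)"
    using False x assms by (intro mult_mono; simp)+
   then show ?thesis by (simp add: plateau_def smooth_step_1)
  qed (simp add: plateau_def)
 qed
qed

lemma plateau_abs_le: "a <= b ==> \<bar>plateau a b n x\<bar> <= indicator {a..b+1} x"
proof (cases "x \<in> {a..b+1}")
 case True
 then show ?thesis using smooth_step_bounds by (simp add: plateau_def) (smt (verit))
next
 case False
 moreover assume "a <= b"
 ultimately show ?thesis
 proof (cases "x < a")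
  case True
  then show ?thesis using \<open>a <= b\<close> by (simp add: plateau_def smooth_step_0 mult_nonneg_nonpos)
 next
  case 2: False
  then have x: "b + 1 < x" using False by auto
  show ?thesis
  proof (cases "n = 0")
   case False
   have "1 * 1 <= real n * (x - b)" "1 * 1 <= real n * (x - a)"
    using False x \<open>a <= b\<close> by (intro mult_mono; simp)+
   then show ?thesis by (simp add: plateau_def smooth_step_1)
  qed (simp add: plateau_def)
 qed
qed

lemma smooth_step_limit:
 "(\<lambda>n. smooth_step (real n * y)) \<longlonglongrightarrow> (if y > 0 then 1 else 0)"
proof (cases "y > 0")
 case True
 then obtain N where N: "real N * y > 1" using reals_Archimedean3 by blast
 have "eventually (\<lambda>n. smooth_step (real n * y) = 1) sequentially"
  unfolding eventually_sequentially
 proof (intro exI allI impI)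
  fix n assume "N <= n"
  then have "real N * y <= real n * y" using True by (intro mult_right_mono) auto
  then show "smooth_step (real n * y) = 1" using N by (intro smooth_step_1) auto
 qed
 then show ?thesis using True by (simp add: tendsto_eventually)
next
 case False
 then show ?thesis by (auto simp: smooth_step_0 mult_nonneg_nonpos)
qed

lemma plateau_limit:
 assumes "a <= b" shows "(\<lambda>n. plateau a b n x) \<longlonglongrightarrow> indicator {a<..b} x"
proof -
 have "(\<lambda>n. plateau a b n x) \<longlonglongrightarrow> (if x - a > 0 then 1 else 0) - (if x - b > 0 then 1 else 0)"
  unfolding plateau_def by (intro tendsto_diff smooth_step_limit)
 then show ?thesis using assms by (auto simp: indicator_def split: if_splits)
qed

section \<open>The fundamental lemma of the calculus of variations\<close>

lemma integrable_AE_zero: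
 fixes h :: "real => real"
 assumes h: "integrable lborel h" and 0: "!!a. (LINT x:{a<..}|lborel. h x) = 0"
 shows "AE x in lborel. h x = 0"
proof -
 have hm[measurable]: "h \<in> borel_measurable borel" using h by auto
 let ?p = "\<lambda>x. ennreal (max 0 (h x))" and ?n = "\<lambda>x. ennreal (max 0 (- h x))"
 have ip: "integrable lborel (\<lambda>x. max 0 (h x))" "integrable lborel (\<lambda>x. max 0 (- h x))"
  using h by (auto intro!: Bochner_Integration.integrable_max)
 have fin: "(\<integral>\<^sup>+x. ?p x \<partial>lborel) \<noteq> \<infinity>" 
  using ip by (subst nn_integral_eq_integral) auto
 have em: "emeasure (density lborel (\<lambda>x. ennreal (max 0 (g x)))) {a<..}
   = ennreal (LINT x:{a<..}|lborel. max 0 (g x))"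
  if g: "integrable lborel (\<lambda>x. max 0 (g x))" "g \<in> borel_measurable borel" for g :: "real => real" and a
 proof -
  note [measurable] = g(2)
  have "emeasure (density lborel (\<lambda>x. ennreal (max 0 (g x)))) {a<..} =
    (\<integral>\<^sup>+x. ennreal (max 0 (g x)) * indicator {a<..} x \<partial>lborel)"
   by (rule emeasure_density) auto
  also have "\<dots> = (\<integral>\<^sup>+x. ennreal (indicator {a<..} x *\<^sub>R max 0 (g x)) \<partial>lborel)"
   by (rule nn_integral_cong) (auto simp: indicator_def)
  also have "\<dots> = ennreal (LINT x:{a<..}|lborel. max 0 (g x))"
   unfolding set_int_def
   by (rule nn_integral_eq_integral) (use set_integrable_of_integrable[OF g(1)] in \<open>auto simp: set_integrable_def\<close>)
  finally show ?thesis .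
 qed
 have "density lborel ?p = density lborel ?n"
 proof (rule measure_eqI_lessThan)
  fix a :: real
  show "emeasure (density lborel ?p) {a<..} < \<infinity>" by (subst em) (use ip in auto)
  have "(LINT x:{a<..}|lborel. max 0 (h x)) - (LINT x:{a<..}|lborel. max 0 (- h x))
   = (LINT x:{a<..}|lborel. max 0 (h x) - max 0 (- h x))"
   by (rule set_integral_diff(2)[symmetric]) (auto intro: set_integrable_of_integrable ip)
  also have "\<dots> = (LINT x:{a<..}|lborel. h x)"
   by (rule arg_cong[where f="set_lebesgue_integral lborel _"]) (auto simp: fun_eq_iff)
  finally show "emeasure (density lborel ?p) {a<..} = emeasure (density lborel ?n) {a<..}"
   by (subst (1 2) em) (use ip 0 in auto)
 qed auto
 then have "AE x in lborel. ?p x = ?n x"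
  using finite_density_unique[of ?p lborel ?n] fin by simp
 then show ?thesis by eventually_elim (auto simp: max_def split: if_splits)
qed

lemma locally_integrable_AE_zero:
 fixes h :: "real => real"
 assumes h: "!!a b. set_integrable lborel {a..b} h"
  and 0: "!!a b. a <= b ==> (LINT x:{a<..b}|lborel. h x) = 0"
 shows "AE x in lborel. h x = 0"
proof -
 have *: "AE x in lborel. x \<in> {-real n..real n} --> h x = 0" for n :: nat
 proof -
  let ?f = "\<lambda>x. indicator {-real n..real n} x *\<^sub>R h x"
  have "AE x in lborel. ?f x = 0"
  proof (rule integrable_AE_zero)
   show "integrable lborel ?f" using h by (simp add: set_integrable_def)
   fix a
   show "(LINT x:{a<..}|lborel. ?f x) = 0"
   proof (cases "a < - real n")
    case True
    have "(LINT x:{a<..}|lborel. ?f x) = (LINT x:{-real n..real n}|lborel. h x)"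
     unfolding set_int_def
     by (rule lint_cong) (use True in \<open>auto simp: indicator_def\<close>)
    then show ?thesis using 0[of "-real n" "real n"] by (simp add: set_integral_Ioc_Icc)
   next
    case False
    have "(LINT x:{a<..}|lborel. ?f x) = (LINT x:{min a (real n)<..real n}|lborel. h x)"
     unfolding set_int_def
     by (rule lint_cong) (use False in \<open>auto simp: indicator_def\<close>)
    then show ?thesis using 0[of "min a (real n)" "real n"] by simp
   qed
  qed
  then show ?thesis by eventually_elim (auto simp: indicator_def)
 qed
 have "AE x in lborel. \<forall>n::nat. x \<in> {-real n..real n} --> h x = 0"
  unfolding AE_all_countable using * by blast
 then show ?thesis
 proof eventually_elim
  case (elim x)
  obtain n :: nat where "\<bar>x\<bar> <= real n" using real_arch_simple by blast
  then show ?case using elim by (auto simp: abs_le_iff)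
 qed
qed

text \<open>Plateaus converge boundedly to indicators, so the integral of \<open>h\<close> over every interval
  vanishes.\<close>

lemma fundamental_lemma:
 fixes h :: "real => real"
 assumes h: "!!a b. set_integrable lborel {a..b} h"
  and 0: "!!\<phi>. test_function \<phi> ==> (LINT x|lborel. h x * \<phi> x) = 0"
 shows "AE x in lborel. h x = 0"
proof (rule locally_integrable_AE_zero[OF h])
 fix a b :: real assume ab: "a <= b"
 have hm: "(\<lambda>x. indicator {a..b+1} x * h x) \<in> borel_measurable lborel"
  using h[of a "b+1"] by (auto simp: set_integrable_def)
 have eq: "h x * plateau a b n x = (indicator {a..b+1} x * h x) * plateau a b n x" for n x
  using plateau_abs_le[OF ab, of n x] by (cases "x \<in> {a..b+1}") auto
 have "(\<lambda>n. LINT x|lborel. h x * plateau a b n x) \<longlonglongrightarrow> (LINT x|lborel. indicator {a<..b} x *\<^sub>R h x)"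
 proof (rule integral_dominated_convergence[where w = "\<lambda>x. indicator {a..b+1} x * \<bar>h x\<bar>"])
  have "(\<lambda>x. indicator {a<..b} x *\<^sub>R h x) = (\<lambda>x. indicator {a<..b} x * (indicator {a..b+1} x * h x))"
   by (auto simp: indicator_def fun_eq_iff)
  then show "(\<lambda>x. indicator {a<..b} x *\<^sub>R h x) \<in> borel_measurable lborel"
   using hm by simp
  have "plateau a b n \<in> borel_measurable lborel" for n
   using diff_upto_continuous[OF test_function_diff_upto[OF test_function_plateau[OF ab]]]
   by (simp add: borel_measurable_continuous_onI)
  then show "(\<lambda>x. h x * plateau a b n x) \<in> borel_measurable lborel" for n
   unfolding eq using hm by measurable
  show "integrable lborel (\<lambda>x. indicator {a..b+1} x * \<bar>h x\<bar>)"
   using integrable_abs[OF h[of a "b+1", unfolded set_integrable_def]] by (simp add: abs_mult)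
  show "AE x in lborel. (\<lambda>n. h x * plateau a b n x) \<longlonglongrightarrow> indicator {a<..b} x *\<^sub>R h x"
   using tendsto_mult[OF tendsto_const plateau_limit[OF ab]] by (auto simp: mult.commute)
  show "AE x in lborel. norm (h x * plateau a b n x) <= indicator {a..b+1} x * \<bar>h x\<bar>" for n
   using mult_right_mono[OF plateau_abs_le[OF ab], of "\<bar>h _\<bar>"] by (auto simp: abs_mult mult.commute)
 qed
 then have "(\<lambda>n. 0) \<longlonglongrightarrow> (LINT x:{a<..b}|lborel. h x)"
  using 0[OF test_function_plateau[OF ab]] by (simp add: set_int_def)
 then show "(LINT x:{a<..b}|lborel. h x) = 0" by (simp add: LIMSEQ_const_iff)
qed

lemma integrable_pair_product:
 fixes g h :: "real => real"
 assumes "integrable lborel g" "integrable lborel h"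
 shows "integrable plane (\<lambda>(x, y). g x * h y)"
proof -
 have [measurable]: "g \<in> borel_measurable borel" "h \<in> borel_measurable borel" using assms by auto
 show ?thesis
 proof (rule lborel_pair.Fubini_integrable)
  have "(\<lambda>x. LINT y|lborel. norm (case (x, y) of (x, y) => g x * h y))
    = (\<lambda>x. \<bar>g x\<bar> * (LINT y|lborel. \<bar>h y\<bar>))"
   by (simp add: abs_mult)
  then show "integrable lborel (\<lambda>x. LINT y|lborel. norm (case (x, y) of (x, y) => g x * h y))"
   using assms by simp
 qed (use assms in auto)
qed

lemma integrable_pair_bound:
 fixes f :: "real => real => real"
 assumes "(\<lambda>(x, y). f x y) \<in> borel_measurable plane"
  and "integrable lborel g" "integrable lborel h" "!!x y. \<bar>f x y\<bar> <= g x * h y"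
 shows "integrable plane (\<lambda>(x, y). f x y)"
proof (rule int_bound[OF integrable_pair_product[OF assms(2,3)] assms(1)])
 show "AE p in lborel \<Otimes>\<^sub>M lborel. norm (case p of (x, y) => f x y) <= norm (case p of (x, y) => g x * h y)"
  using assms(4) by (auto intro!: AE_I2 order_trans[OF assms(4) abs_ge_self])
qed

lemma tendsto_integral_dominated:
 fixes f :: "'p::first_countable_topology => 'a => real"
 assumes meas: "!!p. f p \<in> borel_measurable M"
  and lim: "AE y in M. ((\<lambda>p. f p y) \<longlongrightarrow> f p0 y) (at p0 within S)"
  and bound: "!!p y. p \<in> S ==> \<bar>f p y\<bar> <= w y" and w: "integrable M w"
 shows "((\<lambda>p. LINT y|M. f p y) \<longlongrightarrow> (LINT y|M. f p0 y)) (at p0 within S)"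
 unfolding tendsto_at_iff_sequentially
proof (intro allI impI)
 fix X :: "nat => 'p" assume X: "\<forall>i. X i \<in> S - {p0}" "X \<longlonglongrightarrow> p0"
 show "((\<lambda>p. LINT y|M. f p y) \<circ> X) \<longlonglongrightarrow> (LINT y|M. f p0 y)"
  unfolding comp_def
 proof (rule integral_dominated_convergence[where w=w])
  show "AE y in M. (\<lambda>i. f (X i) y) \<longlonglongrightarrow> f p0 y"
   using lim by eventually_elim (use X in \<open>auto simp: tendsto_at_iff_sequentially comp_def\<close>)
  show "AE y in M. norm (f (X i) y) <= w y" for i
   using bound X by auto
 qed (use meas w in auto)
qed

lemma continuous_primitive:
 assumes g: "integrable lborel g" shows "continuous_on UNIV (primitive g)"
 unfolding continuous_on_def primitive_def set_int_def
proof
 fix x0 :: real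
 have [measurable]: "g \<in> borel_measurable borel" using g by auto
 show "((\<lambda>x. LINT y|lborel. indicator {..x} y *\<^sub>R g y) \<longlongrightarrow> (LINT y|lborel. indicator {..x0} y *\<^sub>R g y)) (at x0 within UNIV)"
 proof (rule tendsto_integral_dominated[where w = "\<lambda>y. \<bar>g y\<bar>"])
  have "((\<lambda>x. indicator {..x} y *\<^sub>R g y) \<longlongrightarrow> indicator {..x0} y *\<^sub>R g y) (at x0 within UNIV)"
   if "y \<noteq> x0" for y
  proof (rule tendsto_eventually)
   consider "y < x0" | "y > x0" using \<open>y \<noteq> x0\<close> by linarith
   then show "eventually (\<lambda>x. indicator {..x} y *\<^sub>R g y = indicator {..x0} y *\<^sub>R g y) (at x0)"
   proof cases
    case 1
    then have "eventually (\<lambda>x. y < x) (at x0)" using order_tendstoD(1)[OF tendsto_ident_at] by blast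
    then show ?thesis by eventually_elim (use 1 in auto)
   next
    case 2
    then have "eventually (\<lambda>x. x < y) (at x0)" using order_tendstoD(2)[OF tendsto_ident_at] by blast
    then show ?thesis by eventually_elim (use 2 in auto)
   qed
  qed
  with AE_lborel_singleton[of x0] show "AE y in lborel. ((\<lambda>x. indicator {..x} y *\<^sub>R g y) \<longlongrightarrow> indicator {..x0} y *\<^sub>R g y) (at x0 within UNIV)"
   by (rule eventually_mono)
 qed (use g in \<open>auto simp: indicator_def\<close>)
qed

lemma lebesgue_integral_cong_AE:
 fixes f g :: "real => real"
 assumes "AE x in lborel. f x = g x"
 shows "integral\<^sup>L lebesgue f = integral\<^sup>L lebesgue g" "integrable lebesgue f \<longleftrightarrow> integrable lebesgue g"
  "f \<in> borel_measurable lebesgue \<longleftrightarrow> g \<in> borel_measurable lebesgue"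
proof -
 have ae: "AE x in lebesgue. f x = g x" "AE x in lebesgue. g x = f x"
  using AE_completion[OF assms] AE_completion[OF AE_symmetric[OF assms]] by blast+
 show m: "f \<in> borel_measurable lebesgue \<longleftrightarrow> g \<in> borel_measurable lebesgue"
  using borel_measurable_AE[OF _ ae(1)] borel_measurable_AE[OF _ ae(2)] by iprover
 show i: "integrable lebesgue f \<longleftrightarrow> integrable lebesgue g"
  using integrable_cong_AE[OF _ _ ae(1)] m borel_measurable_integrable[of lebesgue f]
   borel_measurable_integrable[of lebesgue g] by iprover
 show "integral\<^sup>L lebesgue f = integral\<^sup>L lebesgue g"
 proof (cases "f \<in> borel_measurable lebesgue")
  case True
  then show ?thesis using m ae(1) by (intro integral_cong_AE) auto
 next
  case False
  then have "\<not> integrable lebesgue f" "\<not> integrable lebesgue g"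
   using m by auto
  then show ?thesis by (simp add: not_integrable_integral_eq)
 qed
qed

lemma lebesgue_eq_lborel:
 fixes f :: "real => real"
 assumes "f \<in> borel_measurable borel"
 shows "integral\<^sup>L lebesgue f = integral\<^sup>L lborel f" "integrable lebesgue f \<longleftrightarrow> integrable lborel f"
  "f \<in> borel_measurable lebesgue"
proof -
 have f: "f \<in> borel_measurable lborel" using assms by simp
 show "integral\<^sup>L lebesgue f = integral\<^sup>L lborel f" by (rule integral_completion[OF f])
 show "integrable lebesgue f \<longleftrightarrow> integrable lborel f" by (rule integrable_completion[OF f])
 show "f \<in> borel_measurable lebesgue" by (rule measurable_completion[OF f])
qed

lemma lebesgue_borel_representative:
 fixes f :: "real => real"
 assumes "f \<in> borel_measurable lebesgue"
 shows "\<exists>g. g \<in> borel_measurable borel \<and> (AE x in lborel. f x = g x)"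
 using completion_ex_borel_measurable_real[OF assms] by (simp add: Bex_def)

section \<open>Borel representatives of square integrable functions\<close>

definition sq_int :: "(real => real) => bool" where
 "sq_int g \<longleftrightarrow> g \<in> borel_measurable borel \<and> integrable lborel (\<lambda>x. (g x)\<^sup>2)"

definition sq_norm :: "(real => real) => real" where
 "sq_norm g = (LINT x|lborel. (g x)\<^sup>2)"

lemma sq_int_measurable: "sq_int g ==> g \<in> borel_measurable borel"
  "sq_int g ==> (\<lambda>x. (g x)\<^sup>2) \<in> borel_measurable borel"
 by (auto simp: sq_int_def)

lemma abs_powr_2: "\<bar>y\<bar> powr 2 = (y::real)\<^sup>2"
 by (cases "y = 0") (auto simp: powr_numeral)

text \<open>The function spaces are defined with Lebesgue measurable functions. Everything below works with
  Borel representatives, for which the product measure and Fubini are available.\<close>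

lemma Lp_space_2_iff: "f \<in> Lp_space 2 \<longleftrightarrow> (\<exists>g. sq_int g \<and> (AE x in lborel. f x = g x))"
proof
 assume f: "f \<in> Lp_space 2"
 then have "f \<in> borel_measurable lebesgue" by (simp add: Lp_space_def)
 from lebesgue_borel_representative[OF this]
 obtain g where g: "g \<in> borel_measurable borel" "AE x in lborel. f x = g x" by iprover
 have "integrable lebesgue (\<lambda>x. (f x)\<^sup>2)" using f by (simp add: Lp_space_def abs_powr_2)
 moreover have ae: "AE x in lborel. (f x)\<^sup>2 = (g x)\<^sup>2" using g(2) by eventually_elim simp
 ultimately have "integrable lebesgue (\<lambda>x. (g x)\<^sup>2)" using lebesgue_integral_cong_AE(2)[OF ae] by simp
 moreover have "(\<lambda>x. (g x)\<^sup>2) \<in> borel_measurable borel" using g(1) by measurable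
 ultimately have "sq_int g" using g(1) lebesgue_eq_lborel(2)[of "\<lambda>x. (g x)\<^sup>2"] by (simp add: sq_int_def)
 with g(2) show "\<exists>g. sq_int g \<and> (AE x in lborel. f x = g x)" by iprover
next
 assume "\<exists>g. sq_int g \<and> (AE x in lborel. f x = g x)"
 then obtain g where g: "sq_int g" "AE x in lborel. f x = g x" by iprover
 have "integrable lebesgue (\<lambda>x. (g x)\<^sup>2)"
  using g(1) lebesgue_eq_lborel(2)[OF sq_int_measurable(2)[OF g(1)]] by (simp add: sq_int_def)
 moreover have ae: "AE x in lborel. (f x)\<^sup>2 = (g x)\<^sup>2" using g(2) by eventually_elim simp
 ultimately have "integrable lebesgue (\<lambda>x. (f x)\<^sup>2)" using lebesgue_integral_cong_AE(2)[OF ae] by simp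
 moreover have "f \<in> borel_measurable lebesgue"
  using lebesgue_integral_cong_AE(3)[OF g(2)] lebesgue_eq_lborel(3)[OF sq_int_measurable(1)[OF g(1)]]
  by simp
 ultimately show "f \<in> Lp_space 2" by (simp add: Lp_space_def abs_powr_2)
qed

lemma Lp_norm_2_eq:
 assumes "sq_int g" "AE x in lborel. f x = g x" shows "Lp_norm 2 f = sqrt (sq_norm g)"
proof -
 have "AE x in lborel. (f x)\<^sup>2 = (g x)\<^sup>2" using assms(2) by eventually_elim simp
 then have "(LINT x|lebesgue. (f x)\<^sup>2) = (LINT x|lebesgue. (g x)\<^sup>2)"
  by (rule lebesgue_integral_cong_AE(1))
 also have "\<dots> = sq_norm g"
  using lebesgue_eq_lborel(1)[OF sq_int_measurable(2)[OF assms(1)]] by (simp add: sq_norm_def)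
 finally show ?thesis
  by (simp add: Lp_norm_def abs_powr_2 powr_half_sqrt sq_norm_def)
qed

lemma sq_norm_nonneg: "sq_norm g \<ge> 0"
 by (simp add: sq_norm_def)

lemma sq_int_mult:
 assumes "sq_int f" "sq_int g" shows "integrable lborel (\<lambda>x. f x * g x)"
proof (rule int_bound)
 show "integrable lborel (\<lambda>x. (f x)\<^sup>2 + (g x)\<^sup>2)" using assms by (auto simp: sq_int_def)
 have "\<bar>f x * g x\<bar> <= (f x)\<^sup>2 + (g x)\<^sup>2" for x
 proof -
  have "2 * (\<bar>f x\<bar> * \<bar>g x\<bar>) <= (f x)\<^sup>2 + (g x)\<^sup>2"
   using sum_squares_bound[of "\<bar>f x\<bar>" "\<bar>g x\<bar>"] by (simp add: mult.assoc)
  moreover have "0 <= \<bar>f x\<bar> * \<bar>g x\<bar>" by simp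
  ultimately show ?thesis unfolding abs_mult by linarith
 qed
 then show "AE x in lborel. norm (f x * g x) <= norm ((f x)\<^sup>2 + (g x)\<^sup>2)" by simp
qed (use assms in \<open>auto simp: sq_int_def\<close>)

lemma sq_int_add:
 assumes "sq_int f" "sq_int g" shows "sq_int (\<lambda>x. f x + g x)"
proof -
 have "integrable lborel (\<lambda>x. (f x)\<^sup>2 + (g x)\<^sup>2 + 2 * (f x * g x))"
  using sq_int_mult[OF assms] assms by (auto simp: sq_int_def)
 then show ?thesis using assms by (auto simp: sq_int_def power2_sum mult.assoc)
qed

lemma sq_int_cmult: "sq_int f ==> sq_int (\<lambda>x. c * f x)"
 by (auto simp: sq_int_def power_mult_distrib)

lemma sq_int_diff: "sq_int f ==> sq_int g ==> sq_int (\<lambda>x. f x - g x)"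
 using sq_int_add[of f "\<lambda>x. (-1) * g x"] sq_int_cmult[of g "-1"] by simp

lemma sq_norm_add_le:
 assumes "sq_int f" "sq_int g"
 shows "sq_norm (\<lambda>x. f x + g x) <= 2 * sq_norm f + 2 * sq_norm g"
proof -
 have "sq_norm (\<lambda>x. f x + g x) <= (LINT x|lborel. 2 * (f x)\<^sup>2 + 2 * (g x)\<^sup>2)"
  unfolding sq_norm_def
 proof (rule integral_mono)
  show "integrable lborel (\<lambda>x. (f x + g x)\<^sup>2)" using sq_int_add[OF assms] by (simp add: sq_int_def)
  show "integrable lborel (\<lambda>x. 2 * (f x)\<^sup>2 + 2 * (g x)\<^sup>2)" using assms by (simp add: sq_int_def)
  show "(f x + g x)\<^sup>2 <= 2 * (f x)\<^sup>2 + 2 * (g x)\<^sup>2" for x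
   using sum_squares_bound[of "f x" "g x"] by (simp add: power2_sum)
 qed
 also have "\<dots> = 2 * sq_norm f + 2 * sq_norm g"
  using assms by (simp add: sq_int_def sq_norm_def)
 finally show ?thesis .
qed

lemma sq_norm_cmult: "sq_norm (\<lambda>x. c * f x) = c\<^sup>2 * sq_norm f"
 by (simp add: sq_norm_def power_mult_distrib)

lemma sq_int_bounded_support:
 assumes "g \<in> borel_measurable borel" "!!x. \<bar>g x\<bar> <= C" "!!x. x < a \<or> b < x ==> g x = 0"
 shows "sq_int g"
 unfolding sq_int_def
proof
 show "integrable lborel (\<lambda>x. (g x)\<^sup>2)"
 proof (rule int_bound[of _ "\<lambda>x. indicator {a..b} x * C\<^sup>2"])
  show "integrable lborel (\<lambda>x. indicator {a..b} x * C\<^sup>2)" by (auto intro!: integrable_mult_left integrable_real_indicator simp: emeasure_lborel_Icc_eq)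
  show "(\<lambda>x. (g x)\<^sup>2) \<in> borel_measurable lborel" using assms(1) by simp
  have "(g x)\<^sup>2 <= indicator {a..b} x * C\<^sup>2" for x
  proof (cases "x \<in> {a..b}")
   case True
   then show ?thesis using power_mono[OF assms(2)[of x], of 2] by simp
  next
   case False
   then show ?thesis using assms(3)[of x] by auto
  qed
  then show "AE x in lborel. norm ((g x)\<^sup>2) <= norm (indicator {a..b} x * C\<^sup>2)" by simp
 qed
qed (rule assms(1))

lemma sq_int_integrable_support:
 assumes "sq_int g" "!!x. x < a \<or> b < x ==> g x = 0"
 shows "integrable lborel g"
proof -
 have "sq_int (indicator {a..b})"
  by (rule sq_int_bounded_support[where C=1 and a=a and b=b]) (auto simp: indicator_def)
 from sq_int_mult[OF assms(1) this] show ?thesis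
 proof (rule Bochner_Integration.integrable_cong[THEN iffD1, rotated 2])
  show "g x * indicator {a..b} x = g x" for x using assms(2)[of x] by (cases "x \<in> {a..b}") auto
 qed simp
qed

lemma sq_int_indicator: "sq_int (indicator {a..b})"
 by (rule sq_int_bounded_support[where C=1 and a=a and b=b]) (auto simp: indicator_def)

lemma sq_int_set_integrable: "sq_int g ==> set_integrable lborel {a..b} g"
 using sq_int_mult[OF sq_int_indicator[of a b], of g] by (simp add: set_integrable_def)

lemma set_integral_square_le:
 assumes g: "sq_int g" and ab: "a <= b"
 shows "(LINT x:{a..b}|lborel. g x)\<^sup>2 <= (b - a) * sq_norm g"
proof -
 let ?i = "indicator {a..b} :: real => real"
 define I where "I = (LINT x:{a..b}|lborel. g x)"
 have I: "I = (LINT x|lborel. ?i x * g x)" by (simp add: I_def set_int_def)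
 have si: "sq_int ?i" by (rule sq_int_bounded_support[where C=1 and a=a and b=b]) (auto simp: indicator_def)
 have ii: "sq_norm ?i = b - a"
 proof -
  have "(?i x)\<^sup>2 = ?i x" for x by (auto simp: indicator_def)
  then show ?thesis using ab by (simp add: sq_norm_def)
 qed
 have "0 <= (LINT x|lborel. ((b - a) * g x - I * ?i x)\<^sup>2)" by simp
 also have "\<dots> = (LINT x|lborel. (b - a)\<^sup>2 * (g x)\<^sup>2 - 2 * (b - a) * I * (?i x * g x) + I\<^sup>2 * (?i x)\<^sup>2)"
  by (rule lint_cong) (auto simp: power2_eq_square algebra_simps)
 also have "\<dots> = (b - a)\<^sup>2 * sq_norm g - 2 * (b - a) * I * I + I\<^sup>2 * sq_norm ?i"
  using g si sq_int_mult[OF si g] by (simp add: sq_int_def sq_norm_def I)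
 also have "\<dots> = (b - a) * ((b - a) * sq_norm g - I\<^sup>2)"
  unfolding ii by (simp add: power2_eq_square algebra_simps)
 finally have 0: "0 <= (b - a) * ((b - a) * sq_norm g - I\<^sup>2)" .
 show ?thesis
 proof (cases "a = b")
  case True
  then show ?thesis using set_integral_Ioc_Icc[of a b g] by (simp add: set_int_def)
 next
  case False
  then show ?thesis using 0 ab by (simp add: zero_le_mult_iff I_def)
 qed
qed

section \<open>Weak derivatives and absolutely continuous representatives\<close>

lemma test_function_deriv:
 assumes "test_function \<phi>"
 shows "diff_upto n (deriv \<phi>)" "continuous_on UNIV (deriv \<phi>)" "continuous_on UNIV \<phi>"
  "(\<phi> has_field_derivative deriv \<phi> x) (at x)"
proof -
 show *: "diff_upto n (deriv \<phi>)" for n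
  using test_function_diff_upto[OF assms, of "Suc n"] by (simp add: diff_upto_Suc)
 show "continuous_on UNIV (deriv \<phi>)" "continuous_on UNIV \<phi>"
  using diff_upto_continuous[OF *] diff_upto_continuous[OF test_function_diff_upto[OF assms]] by auto
 show "(\<phi> has_field_derivative deriv \<phi> x) (at x)"
  using diff_upto_diff[OF test_function_diff_upto[OF assms, of 0]] DERIV_deriv_iff_field_differentiable by blast
qed

lemma test_function_deriv_support:
 assumes "test_function \<phi>"
 shows "\<exists>L>0. (\<forall>x. x < - L \<or> L < x --> \<phi> x = 0) \<and> (\<forall>x. x < - L \<or> L < x --> deriv \<phi> x = 0)"
proof -
 obtain L where L: "L > 0" "!!x. \<bar>x\<bar> \<ge> L ==> \<phi> x = 0"
  using test_function_bounded_support[OF assms] by blast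
 have "deriv \<phi> x = 0" if "x < - L \<or> L < x" for x
 proof -
  have "((\<lambda>x. 0) has_field_derivative 0) (at x)" by simp
  then have "(\<phi> has_field_derivative 0) (at x)"
   by (rule has_field_derivative_transform_within_open[of _ _ _ "{..<-L} \<union> {L<..}"])
     (use that L in \<open>auto simp: abs_if\<close>)
  then show ?thesis by (rule DERIV_imp_deriv)
 qed
 then show ?thesis using L by (intro exI[of _ L]) auto
qed

lemma test_function_integrable:
 assumes "test_function \<phi>" shows "integrable lborel \<phi>" "integrable lborel (deriv \<phi>)"
proof -
 obtain L where L: "L > 0" "!!x. x < - L \<or> L < x ==> \<phi> x = 0" "!!x. x < - L \<or> L < x ==> deriv \<phi> x = 0"
  using test_function_deriv_support[OF assms] by blast
 show "integrable lborel \<phi>" "integrable lborel (deriv \<phi>)"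
  by (rule integrable_compact_support[OF test_function_deriv(3)[OF assms] L(2)], assumption,
    rule integrable_compact_support[OF test_function_deriv(2)[OF assms] L(3)])
qed

lemma test_function_eq_primitive:
 assumes "test_function \<phi>" shows "\<phi> x = primitive (deriv \<phi>) x" "(LINT x|lborel. deriv \<phi> x) = 0"
proof -
 obtain L where L: "L > 0" "!!x. x < - L \<or> L < x ==> \<phi> x = 0" "!!x. x < - L \<or> L < x ==> deriv \<phi> x = 0"
  using test_function_deriv_support[OF assms] by blast
 have d: "((\<lambda>x. \<phi> x - primitive (deriv \<phi>) x) has_field_derivative 0) (at x)" for x
  using DERIV_diff[OF test_function_deriv(4)[OF assms]
    primitive_deriv[OF test_function_integrable(2)[OF assms] test_function_deriv(2)[OF assms]], of x]
  by simp
 have eq: "\<phi> x - primitive (deriv \<phi>) x = \<phi> y - primitive (deriv \<phi>) y" for x y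
  by (rule DERIV_isconst_all) (use d in blast)
 have "primitive (deriv \<phi>) (- L - 1) = 0" by (rule primitive_eq_0) (use L in auto)
 then show p: "\<phi> x = primitive (deriv \<phi>) x" for x using eq[of x "-L-1"] L(2)[of "-L-1"] by simp
 have "primitive (deriv \<phi>) (L + 1) = (LINT x|lborel. deriv \<phi> x)" by (rule primitive_eq_total) (use L in auto)
 then show "(LINT x|lborel. deriv \<phi> x) = 0" using p[of "L + 1"] L(2)[of "L+1"] by simp
qed

lemma test_function_borel:
 assumes "test_function \<phi>" shows "\<phi> \<in> borel_measurable borel" "deriv \<phi> \<in> borel_measurable borel"
 using test_function_deriv(2,3)[OF assms] by (auto intro: borel_measurable_continuous_onI)

text \<open>Fubini's theorem on the half plane \<open>y \<le> x\<close>.\<close>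

lemma primitive_by_parts:
 assumes g: "integrable lborel g" and \<phi>: "test_function \<phi>"
 shows "(LINT x|lborel. primitive g x * deriv \<phi> x) = - (LINT x|lborel. g x * \<phi> x)"
proof -
 let ?\<psi> = "deriv \<phi>"
 have [measurable]: "g \<in> borel_measurable borel" using g by auto
 note [measurable] = test_function_borel[OF \<phi>]
 note i = test_function_integrable(2)[OF \<phi>]
 let ?f = "\<lambda>x y. (if y <= x then 1 else 0) * (?\<psi> x * g y)"
 have int: "integrable plane (\<lambda>(x, y). ?f x y)"
  by (rule integrable_pair_bound[where g="\<lambda>x. \<bar>?\<psi> x\<bar>" and h="\<lambda>y. \<bar>g y\<bar>"])
    (use g i in \<open>auto simp: abs_mult\<close>)
 have "(LINT x|lborel. primitive g x * ?\<psi> x) = (LINT x|lborel. LINT y|lborel. ?f x y)"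
 proof (rule lint_cong[OF refl])
  fix x
  have "(LINT y|lborel. ?f x y) = (LINT y|lborel. ?\<psi> x * (indicator {..x} y *\<^sub>R g y))"
   by (rule lint_cong) auto
  then show "primitive g x * ?\<psi> x = (LINT y|lborel. ?f x y)"
   by (simp add: primitive_def set_int_def)
 qed
 also have "\<dots> = (LINT y|lborel. LINT x|lborel. ?f x y)"
  by (rule lborel_pair.Fubini_integral[OF int, symmetric])
 also have "\<dots> = (LINT y|lborel. - (g y * \<phi> y))"
 proof (rule lint_cong[OF refl])
  fix y
  have "(LINT x|lborel. ?f x y) = (LINT x|lborel. g y * (indicator {y..} x *\<^sub>R ?\<psi> x))"
   by (rule lint_cong) auto
  also have "\<dots> = g y * (LINT x:{y..}|lborel. ?\<psi> x)" by (simp add: set_int_def)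
  also have "(LINT x:{y..}|lborel. ?\<psi> x) = (LINT x:{y<..}|lborel. ?\<psi> x)"
   by (rule set_integral_discrete_difference[where X="{y}"]) auto
  also have "(LINT x:{y<..}|lborel. ?\<psi> x) = - primitive ?\<psi> y"
  proof -
   have "(LINT x|lborel. ?\<psi> x) = (LINT x:{..y} \<union> {y<..}|lborel. ?\<psi> x)"
    unfolding set_int_def
    by (rule lint_cong) (auto simp: indicator_def)
   also have "\<dots> = primitive ?\<psi> y + (LINT x:{y<..}|lborel. ?\<psi> x)"
    unfolding primitive_def by (rule set_integral_Un) (auto intro: set_integrable_of_integrable i)
   finally show ?thesis using test_function_eq_primitive(2)[OF \<phi>] by simp
  qed
  finally show "(LINT x|lborel. ?f x y) = - (g y * \<phi> y)"
   using test_function_eq_primitive(1)[OF \<phi>, of y] by simp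
 qed
 finally show ?thesis by simp
qed

text \<open>The integrand is only locally integrable, hence the base point \<open>0\<close> instead of minus
  infinity.\<close>

definition antideriv :: "(real => real) => real => real" where
 "antideriv g x = (if 0 <= x then LINT y:{0..x}|lborel. g y else - (LINT y:{x..0}|lborel. g y))"

definition trunc :: "real => (real => real) => real => real" where
 "trunc L g y = indicator {-L..L} y * g y"

lemma integrable_trunc:
 assumes "!!a b. set_integrable lborel {a..b} g" shows "integrable lborel (trunc L g)"
 using assms[of "-L" L] by (simp add: set_integrable_def trunc_def[abs_def])

lemma primitive_trunc_diff:
 assumes "!!a b. set_integrable lborel {a..b} g" "- L <= a" "a <= b" "b <= L"
 shows "primitive (trunc L g) b - primitive (trunc L g) a = (LINT y:{a..b}|lborel. g y)"
proof -
 have "primitive (trunc L g) b - primitive (trunc L g) a = (LINT y:{a..b}|lborel. trunc L g y)"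
  using primitive_diff[OF integrable_trunc[OF assms(1)] assms(3)] by (simp add: set_integral_Ioc_Icc)
 also have "\<dots> = (LINT y:{a..b}|lborel. g y)"
  unfolding set_int_def
  by (rule lint_cong) (use assms in \<open>auto simp: indicator_def trunc_def\<close>)
 finally show ?thesis .
qed

lemma antideriv_eq:
 assumes "!!a b. set_integrable lborel {a..b} g" "-L <= x" "x <= L"
 shows "antideriv g x = primitive (trunc L g) x - primitive (trunc L g) 0"
proof (cases "0 <= x")
 case True
 then show ?thesis using primitive_trunc_diff[OF assms(1), of L 0 x] assms by (simp add: antideriv_def)
next
 case False
 then show ?thesis using primitive_trunc_diff[OF assms(1), of L x 0] assms by (simp add: antideriv_def)
qed

lemma antideriv_diff:
 assumes "!!a b. set_integrable lborel {a..b} g" "a <= b"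
 shows "antideriv g b - antideriv g a = (LINT y:{a..b}|lborel. g y)"
proof -
 let ?L = "\<bar>a\<bar> + \<bar>b\<bar>"
 show ?thesis
  using primitive_trunc_diff[OF assms(1), of ?L a b] antideriv_eq[OF assms(1), of ?L a]
   antideriv_eq[OF assms(1), of ?L b] assms(2) by (simp add: abs_if split: if_splits)
qed

lemma continuous_antideriv:
 assumes "!!a b. set_integrable lborel {a..b} g"
 shows "continuous_on UNIV (antideriv g)"
proof -
 have "continuous_on {-L<..<L} (antideriv g)" for L
 proof -
  have "continuous_on {-L<..<L} (\<lambda>x. primitive (trunc L g) x - primitive (trunc L g) 0)"
   using continuous_primitive[OF integrable_trunc[OF assms]]
   by (intro continuous_intros) (auto intro: continuous_on_subset)
  then show ?thesis
   by (rule continuous_on_cong[THEN iffD1, rotated -1]) (use antideriv_eq[OF assms, of L] in auto)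
 qed
 then have "isCont (antideriv g) x" for x
 proof -
  have "x \<in> {-(\<bar>x\<bar>+1)<..<\<bar>x\<bar>+1}" by (auto simp: abs_if)
  then show ?thesis
   using continuous_on_eq_continuous_at[of "{-(\<bar>x\<bar>+1)<..<\<bar>x\<bar>+1}" "antideriv g"]
    \<open>!!L. continuous_on {-L<..<L} (antideriv g)\<close>[of "\<bar>x\<bar>+1"] by simp
 qed
 then show ?thesis by (simp add: continuous_at_imp_continuous_on)
qed

lemma antideriv_by_parts:
 assumes g: "!!a b. set_integrable lborel {a..b} g" and \<phi>: "test_function \<phi>"
 shows "(LINT x|lborel. antideriv g x * deriv \<phi> x) = - (LINT x|lborel. g x * \<phi> x)"
proof -
 obtain L where L: "L > 0" "!!x. x < - L \<or> L < x ==> \<phi> x = 0" "!!x. x < - L \<or> L < x ==> deriv \<phi> x = 0"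
  using test_function_deriv_support[OF \<phi>] by blast
 note it = integrable_trunc[OF g, of L]
 note i = test_function_integrable(2)[OF \<phi>]
 have ip: "integrable lborel (\<lambda>x. primitive (trunc L g) x * deriv \<phi> x)"
  by (rule integrable_compact_support[of _ "-L" L])
    (use L continuous_primitive[OF it] test_function_deriv(2)[OF \<phi>] in \<open>auto intro!: continuous_intros\<close>)
 have "(LINT x|lborel. antideriv g x * deriv \<phi> x)
   = (LINT x|lborel. primitive (trunc L g) x * deriv \<phi> x - primitive (trunc L g) 0 * deriv \<phi> x)"
 proof (rule lint_cong[OF refl])
  fix x show "antideriv g x * deriv \<phi> x = primitive (trunc L g) x * deriv \<phi> x - primitive (trunc L g) 0 * deriv \<phi> x"
  proof (cases "x \<in> {-L..L}")
   case True
   then have "antideriv g x = primitive (trunc L g) x - primitive (trunc L g) 0"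
    using antideriv_eq[OF g, of L x] by simp
   then show ?thesis by (simp only: left_diff_distrib)
  next
   case False
   then have "deriv \<phi> x = 0" by (intro L) auto
   then show ?thesis by simp
  qed
 qed
 also have "\<dots> = - (LINT x|lborel. trunc L g x * \<phi> x)"
  using ip i test_function_eq_primitive(2)[OF \<phi>] primitive_by_parts[OF it \<phi>] by simp
 also have "(LINT x|lborel. trunc L g x * \<phi> x) = (LINT x|lborel. g x * \<phi> x)"
 proof (rule lint_cong[OF refl])
  fix x show "trunc L g x * \<phi> x = g x * \<phi> x"
   using L(2)[of x] by (cases "x \<in> {-L..L}") (auto simp: trunc_def)
 qed
 finally show ?thesis .
qed

text \<open>A test function minus its integral times a fixed bump of integral one is the derivative of a test
  function.\<close>

lemma du_Bois_Reymond:
 fixes h :: "real => real"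
 assumes h: "!!a b. set_integrable lborel {a..b} h"
  and 0: "!!\<phi>. test_function \<phi> ==> (LINT x|lborel. h x * deriv \<phi> x) = 0"
 shows "\<exists>c. AE x in lborel. h x = c"
proof -
 define m where "m = (LINT x|lborel. bump x)"
 define c where "c = (LINT x|lborel. h x * bump x) / m"
 have m: "m > 0" unfolding m_def by (rule integral_bump_pos)
 have hi: "integrable lborel (\<lambda>x. h x * \<psi> x)"
  if "continuous_on UNIV \<psi>" "!!x. x < a \<or> b < x ==> \<psi> x = 0" for \<psi> :: "real => real" and a b
 proof -
  have "compact (\<psi> ` {a..b})" using that(1) by (intro compact_continuous_image) (auto intro: continuous_on_subset)
  then obtain B where B: "!!x. x \<in> {a..b} ==> \<bar>\<psi> x\<bar> <= B"
   by (metis bounded_iff compact_imp_bounded image_eqI real_norm_def)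
  note [measurable] = borel_measurable_continuous_onI[OF that(1)]
  have hm: "(\<lambda>x. indicator {a..b} x *\<^sub>R h x) \<in> borel_measurable lborel"
   using h[of a b] by (auto simp: set_integrable_def)
  have eq: "h x * \<psi> x = (indicator {a..b} x *\<^sub>R h x) * \<psi> x" for x
   using that(2)[of x] by (cases "x \<in> {a..b}") auto
  show ?thesis
  proof (rule int_bound[of _ "\<lambda>x. B * (indicator {a..b} x *\<^sub>R h x)"])
   show "integrable lborel (\<lambda>x. B * (indicator {a..b} x *\<^sub>R h x))"
    using h[of a b] by (intro integrable_mult_right) (simp add: set_integrable_def)
   show "(\<lambda>x. h x * \<psi> x) \<in> borel_measurable lborel" unfolding eq using hm by measurable
   have "\<bar>h x * \<psi> x\<bar> <= \<bar>B * (indicator {a..b} x *\<^sub>R h x)\<bar>" for x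
   proof (cases "x \<in> {a..b}")
    case True
    then have "\<bar>\<psi> x\<bar> <= \<bar>B\<bar>" using B by (meson abs_ge_self order_trans)
    then show ?thesis using True by (simp add: abs_mult mult_mono mult.commute)
   next
    case False
    then show ?thesis using that(2)[of x] by auto
   qed
   then show "AE x in lborel. norm (h x * \<psi> x) <= norm (B * (indicator {a..b} x *\<^sub>R h x))" by simp
  qed
 qed
 have "AE x in lborel. h x - c = 0"
 proof (rule fundamental_lemma)
  show "set_integrable lborel {a..b} (\<lambda>x. h x - c)" for a b
   by (rule set_integral_diff(1)[OF h]) (simp add: set_integrable_def emeasure_lborel_Icc_eq)
  fix \<psi> assume \<psi>: "test_function \<psi>"
  obtain L where L: "L > 0" "!!x. x < - L \<or> L < x ==> \<psi> x = 0"
   using test_function_deriv_support[OF \<psi>] by blast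
  have h1: "integrable lborel (\<lambda>x. h x * \<psi> x)" by (rule hi[OF test_function_deriv(3)[OF \<psi>] L(2)])
  have h2: "integrable lborel (\<lambda>x. h x * bump x)"
   by (rule hi[OF continuous_bump, of 0 1]) (auto intro: bump_outside)
  define k where "k = (LINT x|lborel. \<psi> x)"
  define g where "g = (\<lambda>x. \<psi> x + (- k / m) * bump x)"
  have gd: "diff_upto n g" for n
   unfolding g_def
   by (rule diff_upto_add[OF test_function_diff_upto[OF \<psi>] diff_upto_mult[OF diff_upto_const diff_upto_bump]])
  have gi: "integrable lborel g"
   unfolding g_def using test_function_integrable(1)[OF \<psi>] integrable_bump by simp
  have g0: "(LINT x|lborel. g x) = 0"
   unfolding g_def using test_function_integrable(1)[OF \<psi>] integrable_bump m
   by (simp add: k_def m_def[symmetric])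
  have gs: "g x = 0" if "x < - L \<or> L + 1 < x" for x
   using L(1) L(2)[of x] bump_outside[of x] that by (auto simp: g_def)
  have "test_function (primitive g)"
  proof (rule test_functionI[of _ "-L" "L+1"])
   show "diff_upto n (primitive g)" for n by (rule diff_upto_primitive[OF gd gi])
   fix x assume "x < - L \<or> L + 1 < x"
   then show "primitive g x = 0"
   proof
    assume "x < -L" then show ?thesis by (intro primitive_eq_0 gs) auto
   next
    assume "L + 1 < x" then have "primitive g x = (LINT x|lborel. g x)" by (intro primitive_eq_total gs) auto
    then show ?thesis using g0 by simp
   qed
  qed
  from 0[OF this] have "(LINT x|lborel. h x * g x) = 0"
   using diff_upto_primitive(2)[OF gd gi] by simp
  moreover have "(LINT x|lborel. h x * g x) = (LINT x|lborel. h x * \<psi> x - (k / m) * (h x * bump x))"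
   by (rule lint_cong) (auto simp: g_def algebra_simps)
  moreover have "\<dots> = (LINT x|lborel. h x * \<psi> x) - (k / m) * (LINT x|lborel. h x * bump x)"
   using h1 h2 by simp
  ultimately have "(LINT x|lborel. h x * \<psi> x) = c * k" using m by (simp add: c_def)
  moreover have "(LINT x|lborel. (h x - c) * \<psi> x) = (LINT x|lborel. h x * \<psi> x - c * \<psi> x)"
   by (rule lint_cong) (auto simp: algebra_simps)
  moreover have "\<dots> = (LINT x|lborel. h x * \<psi> x) - c * k"
   using h1 test_function_integrable(1)[OF \<psi>] by (simp add: k_def)
  ultimately show "(LINT x|lborel. (h x - c) * \<psi> x) = 0" by simp
 qed
 then have "AE x in lborel. h x = c" by eventually_elim simp
 then show ?thesis by (rule exI)
qed

lemma weak_derivative_iff: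
 assumes "AE x in lborel. f x = F x" "AE x in lborel. g x = G x"
  and "F \<in> borel_measurable borel" "G \<in> borel_measurable borel"
 shows "weak_derivative f g \<longleftrightarrow>
  (\<forall>\<phi>. test_function \<phi> --> (LINT x|lborel. F x * deriv \<phi> x) = - (LINT x|lborel. G x * \<phi> x))"
proof -
 have "(\<integral>x. f x * deriv \<phi> x \<partial>lebesgue) = (LINT x|lborel. F x * deriv \<phi> x)"
    "(\<integral>x. g x * \<phi> x \<partial>lebesgue) = (LINT x|lborel. G x * \<phi> x)" if "test_function \<phi>" for \<phi>
 proof -
  note [measurable] = test_function_borel[OF that] assms(3,4)
  have 1: "AE x in lborel. f x * deriv \<phi> x = F x * deriv \<phi> x" using assms(1) by eventually_elim simp
  have 2: "AE x in lborel. g x * \<phi> x = G x * \<phi> x" using assms(2) by eventually_elim simp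
  show "(\<integral>x. f x * deriv \<phi> x \<partial>lebesgue) = (LINT x|lborel. F x * deriv \<phi> x)"
   using lebesgue_integral_cong_AE(1)[OF 1] lebesgue_eq_lborel(1)[of "\<lambda>x. F x * deriv \<phi> x"] by simp
  show "(\<integral>x. g x * \<phi> x \<partial>lebesgue) = (LINT x|lborel. G x * \<phi> x)"
   using lebesgue_integral_cong_AE(1)[OF 2] lebesgue_eq_lborel(1)[of "\<lambda>x. G x * \<phi> x"] by simp
 qed
 then show ?thesis by (simp add: weak_derivative_def)
qed

lemma AE_eq_trans:
 "AE x in M. f x = g x ==> AE x in M. g x = h x ==> AE x in M. f x = h x"
 by (elim AE_mp) auto

text \<open>An element of \<open>H\<^sup>1\<close>, given by its absolutely continuous representative
  \<open>F\<close> and its derivative \<open>G\<close>.\<close>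

definition weak_pair :: "(real => real) => (real => real) => bool" where
 "weak_pair F G \<longleftrightarrow> sq_int F \<and> sq_int G \<and> continuous_on UNIV F \<and>
   (\<forall>a b. a <= b --> F b - F a = (LINT y:{a..b}|lborel. G y))"

text \<open>The function \<open>f\<close> and the antiderivative of \<open>G\<close> have the same weak
  derivative, so they differ by a constant by the lemma of du Bois-Reymond.\<close>

lemma weak_derivative_pair:
 assumes "sq_int F0" "AE x in lborel. f x = F0 x" "sq_int G" "AE x in lborel. g x = G x" "weak_derivative f g"
 shows "\<exists>F. weak_pair F G \<and> (AE x in lborel. f x = F x)"
proof -
 have Gl: "set_integrable lborel {a..b} G" for a b by (rule sq_int_set_integrable[OF assms(3)])
 have Fl: "set_integrable lborel {a..b} F0" for a b by (rule sq_int_set_integrable[OF assms(1)])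
 have Al: "set_integrable lborel {a..b} (antideriv G)" for a b
  by (rule borel_integrable_atLeastAtMost') (use continuous_antideriv[OF Gl] continuous_on_subset in blast)
 have "\<exists>c. AE x in lborel. F0 x - antideriv G x = c"
 proof (rule du_Bois_Reymond)
  show "set_integrable lborel {a..b} (\<lambda>x. F0 x - antideriv G x)" for a b
   by (rule set_integral_diff(1)[OF Fl Al])
  fix \<phi> assume \<phi>: "test_function \<phi>"
  obtain L where L: "L > 0" "!!x. x < - L \<or> L < x ==> \<phi> x = 0" "!!x. x < - L \<or> L < x ==> deriv \<phi> x = 0"
   using test_function_deriv_support[OF \<phi>] by blast
  have "continuous_on {-L..L} (deriv \<phi>)" using test_function_deriv(2)[OF \<phi>] continuous_on_subset by blast
  then have "compact (deriv \<phi> ` {-L..L})" by (intro compact_continuous_image) auto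
  then obtain B where B: "!!x. x \<in> {-L..L} ==> \<bar>deriv \<phi> x\<bar> <= B"
   by (metis bounded_iff compact_imp_bounded image_eqI real_norm_def)
  have "\<bar>deriv \<phi> x\<bar> <= \<bar>B\<bar>" for x
   using B[of x] L(3)[of x] by (cases "x \<in> {-L..L}") auto
  then have "sq_int (deriv \<phi>)"
   using sq_int_bounded_support[OF test_function_borel(2)[OF \<phi>], of "\<bar>B\<bar>" "-L" L] L(3) by blast
  from sq_int_mult[OF assms(1) this] have 1: "integrable lborel (\<lambda>x. F0 x * deriv \<phi> x)" .
  have 2: "integrable lborel (\<lambda>x. antideriv G x * deriv \<phi> x)"
   by (rule integrable_compact_support[of _ "-L" L])
     (use L continuous_antideriv[OF Gl] test_function_deriv(2)[OF \<phi>] in \<open>auto intro!: continuous_intros\<close>)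
  have "(LINT x|lborel. F0 x * deriv \<phi> x) = - (LINT x|lborel. G x * \<phi> x)"
   using weak_derivative_iff[OF assms(2,4) sq_int_measurable(1)[OF assms(1)] sq_int_measurable(1)[OF assms(3)]]
    assms(5) \<phi> by simp
  then show "(LINT x|lborel. (F0 x - antideriv G x) * deriv \<phi> x) = 0"
   using 1 2 antideriv_by_parts[OF Gl \<phi>] by (simp add: left_diff_distrib)
 qed
 then obtain c where c: "AE x in lborel. F0 x - antideriv G x = c" by iprover
 define F where "F = (\<lambda>x. antideriv G x + c)"
 have F0F: "AE x in lborel. F0 x = F x" using c by eventually_elim (simp add: F_def)
 have Fc: "continuous_on UNIV F" unfolding F_def by (intro continuous_intros continuous_antideriv[OF Gl])
 have "sq_int F"
 proof -
  have "AE x in lborel. (F0 x)\<^sup>2 = (F x)\<^sup>2" using F0F by eventually_elim simp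
  then have "integrable lborel (\<lambda>x. (F0 x)\<^sup>2) \<longleftrightarrow> integrable lborel (\<lambda>x. (F x)\<^sup>2)"
   using assms(1) borel_measurable_continuous_onI[OF Fc]
   by (intro integrable_cong_AE) (auto simp: sq_int_def)
  then show ?thesis using assms(1) borel_measurable_continuous_onI[OF Fc] by (simp add: sq_int_def)
 qed
 then have "weak_pair F G"
  using assms(3) Fc antideriv_diff[OF Gl] by (simp add: weak_pair_def F_def)
 moreover have "AE x in lborel. f x = F x" using AE_eq_trans[OF assms(2) F0F] .
 ultimately show ?thesis by iprover
qed

lemma weak_pair_weak_derivative:
 assumes "weak_pair F G" "AE x in lborel. f x = F x" "AE x in lborel. g x = G x"
 shows "weak_derivative f g"
proof -
 have sq: "sq_int F" "sq_int G" using assms(1) by (auto simp: weak_pair_def)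
 have Gl: "set_integrable lborel {a..b} G" for a b by (rule sq_int_set_integrable[OF sq(2)])
 have F: "F x = antideriv G x + F 0" for x
 proof -
  have "F b - F a = antideriv G b - antideriv G a" if "a <= b" for a b
   using assms(1) that antideriv_diff[OF Gl] by (simp add: weak_pair_def)
  moreover have "antideriv G 0 = 0"
   using set_integral_Ioc_Icc[of 0 0 G] by (simp add: antideriv_def set_int_def)
  ultimately show ?thesis by (metis add.commute add_diff_cancel_right' diff_add_cancel diff_zero linear minus_diff_eq)
 qed
 have "(LINT x|lborel. F x * deriv \<phi> x) = - (LINT x|lborel. G x * \<phi> x)" if \<phi>: "test_function \<phi>" for \<phi>
 proof -
  obtain L where L: "L > 0" "!!x. x < - L \<or> L < x ==> \<phi> x = 0" "!!x. x < - L \<or> L < x ==> deriv \<phi> x = 0"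
   using test_function_deriv_support[OF \<phi>] by blast
  have 2: "integrable lborel (\<lambda>x. antideriv G x * deriv \<phi> x)"
   by (rule integrable_compact_support[of _ "-L" L])
     (use L continuous_antideriv[OF Gl] test_function_deriv(2)[OF \<phi>] in \<open>auto intro!: continuous_intros\<close>)
  have "(LINT x|lborel. F x * deriv \<phi> x) = (LINT x|lborel. antideriv G x * deriv \<phi> x + F 0 * deriv \<phi> x)"
   by (rule lint_cong) (auto simp: F[symmetric] distrib_right[symmetric])
  then show ?thesis using antideriv_by_parts[OF Gl \<phi>] test_function_eq_primitive(2)[OF \<phi>]
    test_function_integrable(2)[OF \<phi>] 2 by simp
 qed
 then show ?thesis
  using weak_derivative_iff[OF assms(2,3) sq_int_measurable(1)[OF sq(1)] sq_int_measurable(1)[OF sq(2)]] by simp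
qed

lemma weak_pair_H1:
 assumes "weak_pair F G" "AE x in lborel. f x = F x" shows "f \<in> H1_space"
proof -
 have "f \<in> Lp_space 2" "G \<in> Lp_space 2"
  unfolding Lp_space_2_iff using assms by (auto simp: weak_pair_def)
 moreover have "weak_derivative f G" by (rule weak_pair_weak_derivative[OF assms]) simp
 ultimately show ?thesis by (auto simp: H1_space_def)
qed

lemma H1_weak_pair:
 assumes "f \<in> H1_space" shows "\<exists>F G. weak_pair F G \<and> (AE x in lborel. f x = F x)"
proof -
 obtain g where g: "f \<in> Lp_space 2" "g \<in> Lp_space 2" "weak_derivative f g"
  using assms by (auto simp: H1_space_def)
 obtain F0 where F0: "sq_int F0" "AE x in lborel. f x = F0 x" using g(1) unfolding Lp_space_2_iff by iprover
 obtain G where G: "sq_int G" "AE x in lborel. g x = G x" using g(2) unfolding Lp_space_2_iff by iprover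
 from weak_derivative_pair[OF F0 G g(3)] show ?thesis by iprover
qed

lemma sq_norm_cong_AE:
 assumes "sq_int F" "sq_int G" "AE x in lborel. F x = G x" shows "sq_norm F = sq_norm G"
proof -
 have "AE x in lborel. (F x)\<^sup>2 = (G x)\<^sup>2" using assms(3) by eventually_elim simp
 then show ?thesis unfolding sq_norm_def
  using assms(1,2) by (intro integral_cong_AE) (auto simp: sq_int_def)
qed

text \<open>The weak derivative picked in the norm is almost everywhere equal to \<open>G\<close> by the
  fundamental lemma.\<close>

lemma H1_norm_eq:
 assumes "weak_pair F G" "AE x in lborel. f x = F x"
 shows "H1_norm f = sqrt (sq_norm F + sq_norm G)"
proof -
 have sq: "sq_int F" "sq_int G" using assms(1) by (auto simp: weak_pair_def)
 define g where "g = (SOME g. g \<in> Lp_space 2 \<and> weak_derivative f g)"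
 have "G \<in> Lp_space 2 \<and> weak_derivative f G"
  using weak_pair_weak_derivative[OF assms, of G] sq by (auto simp: Lp_space_2_iff)
 then have g: "g \<in> Lp_space 2 \<and> weak_derivative f g"
  unfolding g_def by (rule someI[of "\<lambda>g. g \<in> Lp_space 2 \<and> weak_derivative f g"])
 obtain G' where G': "sq_int G'" "AE x in lborel. g x = G' x" using g unfolding Lp_space_2_iff by iprover
 have eq: "AE x in lborel. G' x - G x = 0"
 proof (rule fundamental_lemma)
  show "set_integrable lborel {a..b} (\<lambda>x. G' x - G x)" for a b
   by (rule set_integral_diff(1)) (use sq G' sq_int_set_integrable in auto)
  fix \<phi> assume \<phi>: "test_function \<phi>"
  obtain L where L: "L > 0" "!!x. x < - L \<or> L < x ==> \<phi> x = 0"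
   using test_function_deriv_support[OF \<phi>] by blast
  have "continuous_on {-L..L} \<phi>" using test_function_deriv(3)[OF \<phi>] continuous_on_subset by blast
  then have "compact (\<phi> ` {-L..L})" by (intro compact_continuous_image) auto
  then obtain B where B: "!!x. x \<in> {-L..L} ==> \<bar>\<phi> x\<bar> <= B"
   by (metis bounded_iff compact_imp_bounded image_eqI real_norm_def)
  have "\<bar>\<phi> x\<bar> <= \<bar>B\<bar>" for x
   using B[of x] L(2)[of x] by (cases "x \<in> {-L..L}") auto
  then have "sq_int \<phi>"
   using sq_int_bounded_support[OF test_function_borel(1)[OF \<phi>], of "\<bar>B\<bar>" "-L" L] L(2) by blast
  then have i: "integrable lborel (\<lambda>x. G' x * \<phi> x)" "integrable lborel (\<lambda>x. G x * \<phi> x)"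
   using sq_int_mult[OF G'(1)] sq_int_mult[OF sq(2)] by blast+
  have "weak_derivative f g" "weak_derivative f G" using g weak_pair_weak_derivative[OF assms, of G] by auto
  then have "(LINT x|lborel. G' x * \<phi> x) = (LINT x|lborel. G x * \<phi> x)"
   using weak_derivative_iff[OF assms(2) G'(2) sq_int_measurable(1)[OF sq(1)] sq_int_measurable(1)[OF G'(1)]]
    weak_derivative_iff[OF assms(2) _ sq_int_measurable(1)[OF sq(1)] sq_int_measurable(1)[OF sq(2)], of G] \<phi>
   by simp
  then show "(LINT x|lborel. (G' x - G x) * \<phi> x) = 0" using i by (simp add: left_diff_distrib)
 qed
 then have "AE x in lborel. G' x = G x" by eventually_elim simp
 then have "sq_norm G' = sq_norm G" using sq_norm_cong_AE[OF G'(1) sq(2)] by simp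
 moreover have "Lp_norm 2 g = sqrt (sq_norm G')" by (rule Lp_norm_2_eq[OF G'])
 moreover have "Lp_norm 2 f = sqrt (sq_norm F)" by (rule Lp_norm_2_eq[OF sq(1) assms(2)])
 ultimately show ?thesis by (simp add: H1_norm_def g_def[symmetric] sq_norm_nonneg)
qed

lemma weak_pair_diff:
 assumes "weak_pair F G" "weak_pair F' G'" shows "weak_pair (\<lambda>x. F x - F' x) (\<lambda>x. G x - G' x)"
 unfolding weak_pair_def
proof (intro conjI allI impI)
 fix a b :: real assume ab: "a <= b"
 have "(LINT y:{a..b}|lborel. G y - G' y) = (LINT y:{a..b}|lborel. G y) - (LINT y:{a..b}|lborel. G' y)"
  by (rule set_integral_diff(2)) (use assms in \<open>auto simp: weak_pair_def intro: sq_int_set_integrable\<close>)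
 moreover have "F b - F a = (LINT y:{a..b}|lborel. G y)" "F' b - F' a = (LINT y:{a..b}|lborel. G' y)"
  using assms ab by (auto simp: weak_pair_def)
 ultimately show "F b - F' b - (F a - F' a) = (LINT y:{a..b}|lborel. G y - G' y)"
  by linarith
qed (use assms in \<open>auto simp: weak_pair_def intro!: sq_int_diff continuous_intros\<close>)

text \<open>The Sobolev embedding: compare the value at a point with the mean over the next unit
  interval.\<close>

lemma weak_pair_sup_bound:
 assumes "weak_pair F G" shows "(F x)\<^sup>2 <= 2 * (sq_norm F + sq_norm G)"
proof -
 have sq: "sq_int F" "sq_int G" using assms by (auto simp: weak_pair_def)
 have *: "(F x)\<^sup>2 - 2 * sq_norm G <= 2 * (F y)\<^sup>2" if "y \<in> {x..x+1}" for y
 proof -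
  have "(F y - F x)\<^sup>2 <= (y - x) * sq_norm G"
   using set_integral_square_le[OF sq(2), of x y] assms that by (simp add: weak_pair_def)
  also have "\<dots> <= 1 * sq_norm G" using that by (intro mult_right_mono sq_norm_nonneg) auto
  finally have "(F y - F x)\<^sup>2 <= sq_norm G" by simp
  moreover have "(F x)\<^sup>2 <= 2 * (F y)\<^sup>2 + 2 * (F y - F x)\<^sup>2"
   using zero_le_power2[of "2 * F y - F x"] by (simp add: power2_eq_square algebra_simps)
  ultimately show ?thesis by simp
 qed
 have "(F x)\<^sup>2 - 2 * sq_norm G = (LINT y|lborel. indicator {x..x+1} y * ((F x)\<^sup>2 - 2 * sq_norm G))"
  by simp
 also have "\<dots> <= (LINT y|lborel. 2 * (F y)\<^sup>2)"
 proof (rule integral_mono)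
  show "integrable lborel (\<lambda>y. indicator {x..x+1} y * ((F x)\<^sup>2 - 2 * sq_norm G))"
   by (auto intro!: integrable_mult_left integrable_real_indicator simp: emeasure_lborel_Icc_eq)
  show "integrable lborel (\<lambda>y. 2 * (F y)\<^sup>2)" using sq by (simp add: sq_int_def)
  show "indicator {x..x+1} y * ((F x)\<^sup>2 - 2 * sq_norm G) <= 2 * (F y)\<^sup>2" for y
   using *[of y] by (cases "y \<in> {x..x+1}") auto
 qed
 also have "\<dots> = 2 * sq_norm F" by (simp add: sq_norm_def)
 finally show ?thesis by simp
qed

section \<open>Curves in the space of square integrable functions\<close>

lemma continuous_compact_bounded:
 fixes f :: "'a::topological_space => real"
 assumes "compact K" "continuous_on K f" shows "\<exists>B\<ge>0. \<forall>x\<in>K. \<bar>f x\<bar> <= B"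
proof -
 have "bounded (f ` K)" by (rule compact_imp_bounded[OF compact_continuous_image[OF assms(2,1)]])
 then obtain B where "\<forall>y\<in>f ` K. norm y <= B" unfolding bounded_iff by blast
 then show ?thesis by (intro exI[of _ "\<bar>B\<bar>"]) (auto intro: order_trans)
qed

lemma clamp_le: "0 <= (N::real) ==> \<bar>max (- N) (min N y)\<bar> <= \<bar>y\<bar>" "0 <= N ==> \<bar>max (- N) (min N y)\<bar> <= N"
 by (auto simp: max_def min_def abs_if)

definition cutoff :: "real => real => real" where "cutoff N x = max 0 (min 1 (N + 1 - \<bar>x\<bar>))"

lemma cutoff_simps:
 "0 <= cutoff N x" "cutoff N x <= 1" "\<bar>x\<bar> <= N ==> cutoff N x = 1" "N + 1 <= \<bar>x\<bar> ==> cutoff N x = 0"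
 by (auto simp: cutoff_def)

lemma continuous_cutoff: "continuous_on UNIV (cutoff N)"
 unfolding cutoff_def by (intro continuous_intros)

lemma sq_norm_tendsto_0:
 fixes f :: "nat => real => real"
 assumes "!!n. f n \<in> borel_measurable borel" "AE x in lborel. (\<lambda>n. f n x) \<longlonglongrightarrow> 0"
  and "!!n x. (f n x)\<^sup>2 <= w x" "integrable lborel w"
 shows "(\<lambda>n. sq_norm (f n)) \<longlonglongrightarrow> 0"
proof -
 have "(\<lambda>n. LINT x|lborel. (f n x)\<^sup>2) \<longlonglongrightarrow> (LINT (x::real)|lborel. (0::real))"
 proof (rule integral_dominated_convergence[where w=w])
  show "AE x in lborel. (\<lambda>n. (f n x)\<^sup>2) \<longlonglongrightarrow> 0"
   using assms(2) by eventually_elim (auto intro: tendsto_eq_intros)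
 qed (use assms in auto)
 then show ?thesis by (simp add: sq_norm_def)
qed

text \<open>Truncate \<open>g\<close> to a bounded function of bounded support, then truncate in the same way
  continuous functions that converge to \<open>g\<close> almost everywhere; both limits are dominated.\<close>

lemma sq_int_dense_continuous:
 assumes g: "sq_int g" and e: "e > 0"
 shows "\<exists>G L. continuous_on UNIV G \<and> (\<forall>x. x < - L \<or> L < x --> G x = 0) \<and> sq_norm (\<lambda>x. g x - G x) < e"
proof -
 have [measurable]: "g \<in> borel_measurable borel" using g by (simp add: sq_int_def)
 define gN where "gN = (\<lambda>(n::nat) x. max (- real n) (min (real n) (g x)) * cutoff n x)"
 have [measurable]: "cutoff N \<in> borel_measurable borel" for N
  by (rule borel_measurable_continuous_onI[OF continuous_cutoff])
 have gN_m[measurable]: "gN n \<in> borel_measurable borel" for n unfolding gN_def by measurable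
 have gN_le: "\<bar>gN n x\<bar> <= \<bar>g x\<bar>" "\<bar>gN n x\<bar> <= n" for n x
 proof -
  have c: "\<bar>cutoff n x\<bar> <= 1" using cutoff_simps[of n x] by simp
  show "\<bar>gN n x\<bar> <= \<bar>g x\<bar>" unfolding gN_def abs_mult
   using mult_mono[OF clamp_le(1)[of "real n" "g x"] c] by simp
  show "\<bar>gN n x\<bar> <= n" unfolding gN_def abs_mult
   using mult_mono[OF clamp_le(2)[of "real n" "g x"] c] by simp
 qed
 have lim1: "(\<lambda>n. sq_norm (\<lambda>x. g x - gN n x)) \<longlonglongrightarrow> 0"
 proof (rule sq_norm_tendsto_0[where w = "\<lambda>x. 4 * (g x)\<^sup>2"])
  have "(\<lambda>n. g x - gN n x) \<longlonglongrightarrow> 0" for x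
  proof (rule tendsto_eventually)
   obtain N :: nat where N: "\<bar>x\<bar> + \<bar>g x\<bar> <= N" using real_arch_simple by blast
   have "g x - gN n x = 0" if "n \<ge> N" for n
   proof -
    have "real N <= real n" using that by simp
    then have "\<bar>x\<bar> <= n" "\<bar>g x\<bar> <= n" using N by linarith+
    then show ?thesis by (auto simp: gN_def cutoff_simps)
   qed
   then show "eventually (\<lambda>n. g x - gN n x = 0) sequentially" by (auto simp: eventually_sequentially)
  qed
  then show "AE x in lborel. (\<lambda>n. g x - gN n x) \<longlonglongrightarrow> 0" by simp
  show "(g x - gN n x)\<^sup>2 <= 4 * (g x)\<^sup>2" for n x
  proof -
   have "\<bar>g x - gN n x\<bar> <= 2 * \<bar>g x\<bar>" using gN_le(1)[of n x] by linarith
   then have "\<bar>g x - gN n x\<bar>\<^sup>2 <= (2 * \<bar>g x\<bar>)\<^sup>2" by (intro power_mono) auto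
   then show ?thesis by (simp add: power_mult_distrib)
  qed
  show "integrable lborel (\<lambda>x. 4 * (g x)\<^sup>2)" using g by (simp add: sq_int_def)
 qed measurable
 then obtain n where n: "sq_norm (\<lambda>x. g x - gN n x) < e / 4"
  using order_tendstoD(2)[OF lim1, of "e/4"] e by (auto simp: eventually_sequentially)
 have "g \<in> borel_measurable lebesgue" by (rule lebesgue_eq_lborel(3)) measurable
 then have "g measurable_on UNIV" by (simp add: lebesgue_measurable_imp_measurable_on)
 then obtain N h where Nh: "negligible N" "!!k. continuous_on UNIV (h k)" "!!x. x \<notin> N ==> (\<lambda>k. h k x) \<longlonglongrightarrow> g x"
  by (auto simp: measurable_on_def)
 define G where "G = (\<lambda>(k::nat) x. max (- real n) (min (real n) (h k x)) * cutoff n x)"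
 have Gc: "continuous_on UNIV (G k)" for k
  unfolding G_def by (intro continuous_intros continuous_cutoff Nh)
 have [measurable]: "G k \<in> borel_measurable borel" for k by (rule borel_measurable_continuous_onI[OF Gc])
 have G_le: "\<bar>G k x\<bar> <= n" for k x
 proof -
  have c: "\<bar>cutoff n x\<bar> <= 1" using cutoff_simps[of n x] by simp
  show "\<bar>G k x\<bar> <= n" unfolding G_def abs_mult
   using mult_mono[OF clamp_le(2)[of "real n" "h k x"] c] by simp
 qed
 have supp: "gN n x = 0" "G k x = 0" if "x < - real (n + 1) \<or> real (n + 1) < x" for k x
  using cutoff_simps(4)[of n x] that by (auto simp: gN_def G_def)
 have lim2: "(\<lambda>k. sq_norm (\<lambda>x. gN n x - G k x)) \<longlonglongrightarrow> 0"
 proof (rule sq_norm_tendsto_0[where w = "\<lambda>x. indicator {- real (n+1)..real (n+1)} x * (2 * real n)\<^sup>2"])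
  have "AE x in lborel. x \<notin> N"
  proof -
   have "N \<in> null_sets lebesgue" using Nh(1) by (simp add: negligible_iff_null_sets)
   then have "AE x in lebesgue. x \<notin> N" by (rule AE_not_in)
   then show ?thesis by (simp only: AE_completion_iff)
  qed
  then show "AE x in lborel. (\<lambda>k. gN n x - G k x) \<longlonglongrightarrow> 0"
  proof eventually_elim
   case (elim x)
   have "(\<lambda>k. gN n x - G k x) \<longlonglongrightarrow> gN n x - max (- real n) (min (real n) (g x)) * cutoff n x"
    unfolding G_def by (intro tendsto_intros Nh(3) elim)
   then show ?case by (simp add: gN_def)
  qed
  show "(gN n x - G k x)\<^sup>2 <= indicator {- real (n+1)..real (n+1)} x * (2 * real n)\<^sup>2" for k x
  proof (cases "x \<in> {- real (n+1)..real (n+1)}")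
   case True
   have "\<bar>gN n x - G k x\<bar> <= 2 * real n" using gN_le(2)[of n x] G_le[of k x] by linarith
   then have "\<bar>gN n x - G k x\<bar>\<^sup>2 <= (2 * real n)\<^sup>2" by (intro power_mono) auto
   then show ?thesis using True by simp
  next
   case False
   then show ?thesis using supp(1)[of x] supp(2)[of x k] by auto
  qed
  show "integrable lborel (\<lambda>x. indicator {- real (n+1)..real (n+1)} x * (2 * real n)\<^sup>2)"
   by (auto intro!: integrable_mult_left integrable_real_indicator simp: emeasure_lborel_Icc_eq)
 qed measurable
 then obtain k where k: "sq_norm (\<lambda>x. gN n x - G k x) < e / 4"
  using order_tendstoD(2)[OF lim2, of "e/4"] e by (auto simp: eventually_sequentially)
 have sqN: "sq_int (gN n)" "sq_int (G k)"
  by (rule sq_int_bounded_support[where C="real n" and a="- real (n+1)" and b="real (n+1)"];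
    use gN_le G_le supp in auto)+
 have "sq_norm (\<lambda>x. g x - G k x) = sq_norm (\<lambda>x. (g x - gN n x) + (gN n x - G k x))" by simp
 also have "\<dots> <= 2 * sq_norm (\<lambda>x. g x - gN n x) + 2 * sq_norm (\<lambda>x. gN n x - G k x)"
  by (rule sq_norm_add_le[OF sq_int_diff[OF g sqN(1)] sq_int_diff[OF sqN]])
 also have "\<dots> < e" using n k by simp
 finally have "sq_norm (\<lambda>x. g x - G k x) < e" .
 moreover have "\<forall>x. x < - real (n+1) \<or> real (n+1) < x --> G k x = 0" using supp(2) by blast
 ultimately show ?thesis using Gc[of k] by blast
qed

lemma sq_norm_shift: "sq_norm (\<lambda>x. g (x + t)) = sq_norm g"
 using lborel_integral_real_affine[where c=1 and f="\<lambda>x. (g x)\<^sup>2" and t=t] by (simp add: sq_norm_def add.commute)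

lemma sq_int_shift:
 assumes "sq_int g" shows "sq_int (\<lambda>x. g (x + t))"
proof -
 have [measurable]: "g \<in> borel_measurable borel" using assms by (simp add: sq_int_def)
 have "integrable lborel (\<lambda>x. (g (t + 1 * x))\<^sup>2)"
  using lborel_integrable_real_affine[where f="\<lambda>x. (g x)\<^sup>2" and c=1 and t=t] assms by (simp add: sq_int_def)
 then show ?thesis by (simp add: sq_int_def add.commute)
qed

text \<open>The functions \<open>G t\<close> are fixed Borel functions, not classes; the property is continuity
  of the curve in the norm of \<open>L\<^sup>2\<close>.\<close>

definition L2cont :: "real set => (real => real => real) => bool" where
 "L2cont S G \<longleftrightarrow> (\<forall>t\<in>S. sq_int (G t) \<and> ((\<lambda>s. sq_norm (\<lambda>x. G s x - G t x)) \<longlongrightarrow> 0) (at t within S))"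

lemma L2cont_add:
 assumes "L2cont S F" "L2cont S G" shows "L2cont S (\<lambda>t x. F t x + G t x)"
 unfolding L2cont_def
proof (intro ballI conjI)
 fix t assume t: "t \<in> S"
 have F: "sq_int (F t)" "((\<lambda>s. sq_norm (\<lambda>x. F s x - F t x)) \<longlongrightarrow> 0) (at t within S)"
  and G: "sq_int (G t)" "((\<lambda>s. sq_norm (\<lambda>x. G s x - G t x)) \<longlongrightarrow> 0) (at t within S)"
  using assms t by (auto simp: L2cont_def)
 show "sq_int (\<lambda>x. F t x + G t x)" by (rule sq_int_add[OF F(1) G(1)])
 show "((\<lambda>s. sq_norm (\<lambda>x. F s x + G s x - (F t x + G t x))) \<longlongrightarrow> 0) (at t within S)"
 proof (rule tendsto_sandwich[where f="\<lambda>_. 0" and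
   h="\<lambda>s. 2 * sq_norm (\<lambda>x. F s x - F t x) + 2 * sq_norm (\<lambda>x. G s x - G t x)"])
  show "((\<lambda>s. 2 * sq_norm (\<lambda>x. F s x - F t x) + 2 * sq_norm (\<lambda>x. G s x - G t x)) \<longlongrightarrow> 0) (at t within S)"
   using tendsto_add[OF tendsto_mult_left[OF F(2), of 2] tendsto_mult_left[OF G(2), of 2]] by simp
  show "eventually (\<lambda>s. sq_norm (\<lambda>x. F s x + G s x - (F t x + G t x))
   <= 2 * sq_norm (\<lambda>x. F s x - F t x) + 2 * sq_norm (\<lambda>x. G s x - G t x)) (at t within S)"
   unfolding eventually_at_filter
  proof (intro always_eventually allI impI)
   fix s assume "s \<in> S"
   then have "sq_int (F s)" "sq_int (G s)" using assms by (auto simp: L2cont_def)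
   then have "sq_norm (\<lambda>x. (F s x - F t x) + (G s x - G t x))
    <= 2 * sq_norm (\<lambda>x. F s x - F t x) + 2 * sq_norm (\<lambda>x. G s x - G t x)"
    by (intro sq_norm_add_le sq_int_diff F G)
   then show "sq_norm (\<lambda>x. F s x + G s x - (F t x + G t x))
    <= 2 * sq_norm (\<lambda>x. F s x - F t x) + 2 * sq_norm (\<lambda>x. G s x - G t x)"
    by (simp add: algebra_simps)
  qed
 qed (auto simp: sq_norm_nonneg)
qed

lemma L2cont_mult:
 assumes "L2cont S F" "continuous_on S c" shows "L2cont S (\<lambda>t x. c t * F t x)"
 unfolding L2cont_def
proof (intro ballI conjI)
 fix t assume t: "t \<in> S"
 have F: "sq_int (F t)" "((\<lambda>s. sq_norm (\<lambda>x. F s x - F t x)) \<longlongrightarrow> 0) (at t within S)"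
  using assms t by (auto simp: L2cont_def)
 have c: "(c \<longlongrightarrow> c t) (at t within S)" using assms(2) t by (simp add: continuous_on_def)
 show "sq_int (\<lambda>x. c t * F t x)" by (rule sq_int_cmult[OF F(1)])
 show "((\<lambda>s. sq_norm (\<lambda>x. c s * F s x - c t * F t x)) \<longlongrightarrow> 0) (at t within S)"
 proof (rule tendsto_sandwich[where f="\<lambda>_. 0" and
   h="\<lambda>s. 2 * ((c s)\<^sup>2 * sq_norm (\<lambda>x. F s x - F t x)) + 2 * ((c s - c t)\<^sup>2 * sq_norm (F t))"])
  show "((\<lambda>s. 2 * ((c s)\<^sup>2 * sq_norm (\<lambda>x. F s x - F t x)) + 2 * ((c s - c t)\<^sup>2 * sq_norm (F t))) \<longlongrightarrow> 0) (at t within S)"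
   using F(2) c by (auto intro!: tendsto_eq_intros)
  show "eventually (\<lambda>s. sq_norm (\<lambda>x. c s * F s x - c t * F t x)
   <= 2 * ((c s)\<^sup>2 * sq_norm (\<lambda>x. F s x - F t x)) + 2 * ((c s - c t)\<^sup>2 * sq_norm (F t))) (at t within S)"
   unfolding eventually_at_filter
  proof (intro always_eventually allI impI)
   fix s assume "s \<in> S"
   then have Fs: "sq_int (F s)" using assms by (auto simp: L2cont_def)
   have "sq_norm (\<lambda>x. c s * (F s x - F t x) + (c s - c t) * F t x)
    <= 2 * sq_norm (\<lambda>x. c s * (F s x - F t x)) + 2 * sq_norm (\<lambda>x. (c s - c t) * F t x)"
    by (intro sq_norm_add_le sq_int_cmult sq_int_diff Fs F)
   moreover have "(\<lambda>x. c s * (F s x - F t x) + (c s - c t) * F t x) = (\<lambda>x. c s * F s x - c t * F t x)"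
    by (auto simp: fun_eq_iff algebra_simps)
   ultimately show "sq_norm (\<lambda>x. c s * F s x - c t * F t x)
   <= 2 * ((c s)\<^sup>2 * sq_norm (\<lambda>x. F s x - F t x)) + 2 * ((c s - c t)\<^sup>2 * sq_norm (F t))"
    by (simp only: sq_norm_cmult)
  qed
 qed (auto simp: sq_norm_nonneg)
qed

lemma L2cont_continuous_support:
 assumes c: "continuous_on UNIV (\<lambda>p. G (fst p) (snd p))"
  and supp: "!!t x. x < - (R + \<bar>t\<bar>) \<or> R + \<bar>t\<bar> < x ==> G t x = 0"
 shows "L2cont S G"
 unfolding L2cont_def
proof (intro ballI conjI)
 fix t assume t: "t \<in> S"
 define L where "L = \<bar>R\<bar> + \<bar>t\<bar> + 1"
 have cs: "continuous_on UNIV (G s)" for s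
  using continuous_on_compose2[OF c continuous_on_Pair[OF continuous_on_const continuous_on_id]] by simp
 have m: "G s \<in> borel_measurable borel" for s by (rule borel_measurable_continuous_onI[OF cs])
 have "\<exists>B\<ge>0. \<forall>p\<in>{t-1..t+1} \<times> {-L..L}. \<bar>G (fst p) (snd p)\<bar> <= B"
  by (rule continuous_compact_bounded[OF compact_Times continuous_on_subset[OF c]]) auto
 then obtain B where B: "!!s x. s \<in> {t-1..t+1} ==> x \<in> {-L..L} ==> \<bar>G s x\<bar> <= B" by force
 have z: "G s x = 0" if "s \<in> {t-1..t+1}" "x < - L \<or> L < x" for s x
  by (rule supp) (use that in \<open>auto simp: L_def abs_if split: if_splits\<close>)
 have B': "\<bar>G s x\<bar> <= \<bar>B\<bar>" if "s \<in> {t-1..t+1}" for s x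
  using B[OF that, of x] z[OF that, of x] by (cases "x \<in> {-L..L}") auto
 show "sq_int (G t)" by (rule sq_int_bounded_support[OF m, of _ "\<bar>B\<bar>" "-L" L]) (use B' z in auto)
 have "((\<lambda>s. sq_norm (\<lambda>x. G s x - G t x)) \<longlongrightarrow> sq_norm (\<lambda>x. G t x - G t x)) (at t within {t-1..t+1})"
  unfolding sq_norm_def
 proof (rule tendsto_integral_dominated[where w = "\<lambda>x. indicator {-L..L} x * (2 * \<bar>B\<bar>)\<^sup>2"])
  show "(\<lambda>x. (G s x - G t x)\<^sup>2) \<in> borel_measurable lborel" for s using m[of s] m[of t] by measurable
  have "((\<lambda>s. (G s x - G t x)\<^sup>2) \<longlongrightarrow> (G t x - G t x)\<^sup>2) (at t within {t-1..t+1})" for x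
  proof -
   have "continuous_on UNIV (\<lambda>s. G s x)"
    using continuous_on_compose2[OF c continuous_on_Pair[OF continuous_on_id continuous_on_const]] by simp
   then have "((\<lambda>s. G s x) \<longlongrightarrow> G t x) (at t within {t-1..t+1})"
    by (meson UNIV_I continuous_on_def tendsto_within_subset top_greatest)
   then show ?thesis by (intro tendsto_intros)
  qed
  then show "AE x in lborel. ((\<lambda>s. (G s x - G t x)\<^sup>2) \<longlongrightarrow> (G t x - G t x)\<^sup>2) (at t within {t-1..t+1})" by simp
  show "\<bar>(G s x - G t x)\<^sup>2\<bar> <= indicator {-L..L} x * (2 * \<bar>B\<bar>)\<^sup>2" if "s \<in> {t-1..t+1}" for s x
  proof (cases "x \<in> {-L..L}")
   case True
   have "\<bar>G s x - G t x\<bar> <= 2 * \<bar>B\<bar>" using B'[OF that, of x] B'[of t x] by simp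
   then have "\<bar>G s x - G t x\<bar>\<^sup>2 <= (2 * \<bar>B\<bar>)\<^sup>2" by (intro power_mono) auto
   then show ?thesis using True by simp
  next
   case False
   then show ?thesis using z[OF that, of x] z[of t x] by auto
  qed
  show "integrable lborel (\<lambda>x. indicator {-L..L} x * (2 * \<bar>B\<bar>)\<^sup>2)"
   by (auto intro!: integrable_mult_left integrable_real_indicator simp: emeasure_lborel_Icc_eq)
 qed
 then have "((\<lambda>s. sq_norm (\<lambda>x. G s x - G t x)) \<longlongrightarrow> 0) (at t within {t-1..t+1})"
  by (simp add: sq_norm_def)
 then have "((\<lambda>s. sq_norm (\<lambda>x. G s x - G t x)) \<longlongrightarrow> 0) (at t)"
  by (simp add: at_within_interior[of t "{t-1..t+1}"])
 then show "((\<lambda>s. sq_norm (\<lambda>x. G s x - G t x)) \<longlongrightarrow> 0) (at t within S)"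
  using tendsto_within_subset by blast
qed

text \<open>Translation is continuous in \<open>L\<^sup>2\<close>: this is clear for continuous functions of
  bounded support, and these are dense.\<close>

lemma L2cont_shift:
 assumes g: "sq_int g" and c: "c = 1 \<or> c = - 1" shows "L2cont S (\<lambda>t x. g (x + c * t))"
 unfolding L2cont_def
proof (intro ballI conjI)
 fix t assume t: "t \<in> S"
 show "sq_int (\<lambda>x. g (x + c * t))" by (rule sq_int_shift[OF g])
 show "((\<lambda>s. sq_norm (\<lambda>x. g (x + c * s) - g (x + c * t))) \<longlongrightarrow> 0) (at t within S)"
 proof (rule tendstoI)
  fix e :: real assume e: "e > 0"
  then obtain G L where G: "continuous_on UNIV G" "!!x. x < - L \<or> L < x ==> G x = 0"
    "sq_norm (\<lambda>x. g x - G x) < e / 16"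
   using sq_int_dense_continuous[OF g, of "e/16"] by auto
  have Gm: "G \<in> borel_measurable borel" by (rule borel_measurable_continuous_onI[OF G(1)])
  have "\<exists>B\<ge>0. \<forall>x\<in>{-L..L}. \<bar>G x\<bar> <= B"
   by (rule continuous_compact_bounded[OF _ continuous_on_subset[OF G(1)]]) auto
  then obtain B where B: "!!x. x \<in> {-L..L} ==> \<bar>G x\<bar> <= B" by blast
  have "\<bar>G x\<bar> <= \<bar>B\<bar>" for x using B[of x] G(2)[of x] by (cases "x \<in> {-L..L}") auto
  then have sG: "sq_int G" by (rule sq_int_bounded_support[OF Gm]) (rule G(2))
  have "L2cont UNIV (\<lambda>t x. G (x + c * t))"
  proof (rule L2cont_continuous_support)
   show "continuous_on UNIV (\<lambda>p. G (snd p + c * fst p))"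
    by (rule continuous_on_compose2[OF G(1)]) (auto intro!: continuous_intros)
   show "G (x + c * t) = 0" if "x < - (L + \<bar>t\<bar>) \<or> L + \<bar>t\<bar> < x" for t x
    by (rule G(2)) (use that c in \<open>auto simp: abs_if split: if_splits\<close>)
  qed
  then have "((\<lambda>s. sq_norm (\<lambda>x. G (x + c * s) - G (x + c * t))) \<longlongrightarrow> 0) (at t)" by (simp add: L2cont_def)
  then have "eventually (\<lambda>s. sq_norm (\<lambda>x. G (x + c * s) - G (x + c * t)) < e / 16) (at t)"
   using e by (intro order_tendstoD) auto
  then have "eventually (\<lambda>s. sq_norm (\<lambda>x. G (x + c * s) - G (x + c * t)) < e / 16) (at t within S)"
   by (rule filter_leD[OF at_le, rotated]) simp
  then show "eventually (\<lambda>s. dist (sq_norm (\<lambda>x. g (x + c * s) - g (x + c * t))) 0 < e) (at t within S)"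
  proof eventually_elim
   case (elim s)
   have d: "sq_int (\<lambda>x. g (x + r) - G (x + r))" "sq_norm (\<lambda>x. g (x + r) - G (x + r)) < e / 16" for r
    using sq_int_shift[OF sq_int_diff[OF g sG]] sq_norm_shift[of "\<lambda>x. g x - G x" r] G(3) by auto
   have dd: "sq_int (\<lambda>x. G (x + r) - G (x + r'))" for r r'
    by (intro sq_int_diff sq_int_shift[OF sG])
   have neg: "sq_int (\<lambda>x. (-1) * (g (x + c * t) - G (x + c * t)))" by (rule sq_int_cmult[OF d(1)])
   have "sq_norm (\<lambda>x. g (x + c * s) - g (x + c * t)) = sq_norm (\<lambda>x. (g (x + c * s) - G (x + c * s)) +
     ((G (x + c * s) - G (x + c * t)) + (-1) * (g (x + c * t) - G (x + c * t))))"
    by (rule arg_cong[where f=sq_norm]) auto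
   also have "\<dots> <= 2 * sq_norm (\<lambda>x. g (x + c * s) - G (x + c * s)) +
     2 * sq_norm (\<lambda>x. (G (x + c * s) - G (x + c * t)) + (-1) * (g (x + c * t) - G (x + c * t)))"
    by (intro sq_norm_add_le sq_int_add d dd neg)
   also have "\<dots> <= 2 * sq_norm (\<lambda>x. g (x + c * s) - G (x + c * s)) +
     2 * (2 * sq_norm (\<lambda>x. G (x + c * s) - G (x + c * t)) + 2 * sq_norm (\<lambda>x. (-1) * (g (x + c * t) - G (x + c * t))))"
    by (intro add_mono mult_left_mono sq_norm_add_le d dd neg) auto
   also have "\<dots> = 2 * sq_norm (\<lambda>x. g (x + c * s) - G (x + c * s)) +
     2 * (2 * sq_norm (\<lambda>x. G (x + c * s) - G (x + c * t)) + 2 * sq_norm (\<lambda>x. g (x + c * t) - G (x + c * t)))"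
    unfolding sq_norm_cmult by simp
   also have "\<dots> <= 2 * (e / 16) + 2 * (2 * (e / 16) + 2 * (e / 16))"
    by (rule add_mono[OF mult_left_mono[OF less_imp_le[OF d(2)]] mult_left_mono[OF
      add_mono[OF mult_left_mono[OF less_imp_le[OF elim]] mult_left_mono[OF less_imp_le[OF d(2)]]]]]) simp_all
   also have "\<dots> < e" using e by simp
   finally have "sq_norm (\<lambda>x. g (x + c * s) - g (x + c * t)) < e" .
   then show ?case by (simp add: dist_real_def sq_norm_nonneg)
  qed
 qed
qed

lemma set_integral_square_nn:
 fixes \<phi> :: "real => real"
 assumes i: "set_integrable lborel {a..b} \<phi>" and ab: "a < b"
 shows "ennreal ((LINT r:{a..b}|lborel. \<phi> r)\<^sup>2)
  <= ennreal (b - a) * (\<integral>\<^sup>+r. ennreal ((\<phi> r)\<^sup>2) * indicator {a..b} r \<partial>lborel)"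
proof -
 let ?f = "\<lambda>r. indicator {a..b} r *\<^sub>R \<phi> r"
 have fm: "?f \<in> borel_measurable borel" using i by (auto simp: set_integrable_def)
 have nn: "(\<integral>\<^sup>+r. ennreal ((\<phi> r)\<^sup>2) * indicator {a..b} r \<partial>lborel) = (\<integral>\<^sup>+r. ennreal ((?f r)\<^sup>2) \<partial>lborel)"
  by (rule nn_integral_cong) (auto simp: indicator_def)
 have m2: "(\<lambda>r. (?f r)\<^sup>2) \<in> borel_measurable lborel" using fm by measurable
 show ?thesis
 proof (cases "integrable lborel (\<lambda>r. (?f r)\<^sup>2)")
  case True
  then have sf: "sq_int ?f" using fm by (simp add: sq_int_def)
  have "(LINT r:{a..b}|lborel. \<phi> r) = (LINT r:{a..b}|lborel. ?f r)"
   unfolding set_int_def by (rule lint_cong) (auto simp: indicator_def)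
  then have "(LINT r:{a..b}|lborel. \<phi> r)\<^sup>2 <= (b - a) * sq_norm ?f"
   using set_integral_square_le[OF sf, of a b] ab by simp
  then have "ennreal ((LINT r:{a..b}|lborel. \<phi> r)\<^sup>2) <= ennreal ((b - a) * sq_norm ?f)"
   by (rule ennreal_leI)
  also have "\<dots> = ennreal (b - a) * ennreal (sq_norm ?f)" using ab by (simp add: ennreal_mult sq_norm_nonneg)
  also have "ennreal (sq_norm ?f) = (\<integral>\<^sup>+r. ennreal ((?f r)\<^sup>2) \<partial>lborel)"
   unfolding sq_norm_def by (rule nn_integral_eq_integral[symmetric, OF True]) simp
  finally show ?thesis by (simp only: nn)
 next
  case False
  have "(\<integral>\<^sup>+r. ennreal ((?f r)\<^sup>2) \<partial>lborel) = \<infinity>"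
  proof (rule ccontr)
   assume "(\<integral>\<^sup>+r. ennreal ((?f r)\<^sup>2) \<partial>lborel) \<noteq> \<infinity>"
   then have "integrable lborel (\<lambda>r. (?f r)\<^sup>2)"
    by (intro integrableI_bounded[OF m2]) (simp add: less_top)
   then show False using False by simp
  qed
  then show ?thesis using ab unfolding nn by (simp add: ennreal_mult_top)
 qed
qed

text \<open>Minkowski's integral inequality in the form needed for difference quotients in time.\<close>

lemma sq_norm_average_le:
 assumes ab: "a < b" and W: "(\<lambda>(r, x). W r x) \<in> borel_measurable plane"
  and int: "!!x. set_integrable lborel {a..b} (\<lambda>r. W r x)"
  and bd: "!!r. r \<in> {a..b} ==> sq_int (W r) \<and> sq_norm (W r) <= e"
 shows "sq_int (\<lambda>x. (LINT r:{a..b}|lborel. W r x) / (b - a))"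
  and "sq_norm (\<lambda>x. (LINT r:{a..b}|lborel. W r x) / (b - a)) <= e"
proof -
 note [measurable] = W
 define I where "I = (\<lambda>x. LINT r:{a..b}|lborel. W r x)"
 have e: "e \<ge> 0" using bd[of a] sq_norm_nonneg[of "W a"] ab by auto
 have Im[measurable]: "I \<in> borel_measurable borel"
 proof -
  have "(\<lambda>x. LINT r|lborel. indicator {a..b} r *\<^sub>R W r x) \<in> borel_measurable lborel"
   by measurable
  then show ?thesis by (simp add: I_def set_int_def)
 qed
 have "(\<integral>\<^sup>+x. ennreal ((I x)\<^sup>2) \<partial>lborel)
  <= (\<integral>\<^sup>+x. ennreal (b - a) * (\<integral>\<^sup>+r. ennreal ((W r x)\<^sup>2) * indicator {a..b} r \<partial>lborel) \<partial>lborel)"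
  unfolding I_def by (intro nn_integral_mono set_integral_square_nn int ab)
 also have "\<dots> = ennreal (b - a) * (\<integral>\<^sup>+x. \<integral>\<^sup>+r. ennreal ((W r x)\<^sup>2) * indicator {a..b} r \<partial>lborel \<partial>lborel)"
  by (rule nn_integral_cmult) measurable
 also have "(\<integral>\<^sup>+x. \<integral>\<^sup>+r. ennreal ((W r x)\<^sup>2) * indicator {a..b} r \<partial>lborel \<partial>lborel)
  = (\<integral>\<^sup>+r. \<integral>\<^sup>+x. ennreal ((W r x)\<^sup>2) * indicator {a..b} r \<partial>lborel \<partial>lborel)"
  by (rule lborel_pair.Fubini') measurable
 also have "\<dots> <= (\<integral>\<^sup>+r. ennreal e * indicator {a..b} r \<partial>lborel)"
 proof (rule nn_integral_mono)
  fix r :: real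
  show "(\<integral>\<^sup>+x. ennreal ((W r x)\<^sup>2) * indicator {a..b} r \<partial>lborel) <= ennreal e * indicator {a..b} r"
  proof (cases "r \<in> {a..b}")
   case True
   have "(\<integral>\<^sup>+x. ennreal ((W r x)\<^sup>2) \<partial>lborel) = ennreal (sq_norm (W r))"
    unfolding sq_norm_def
    by (rule nn_integral_eq_integral) (use bd[OF True] in \<open>auto simp: sq_int_def\<close>)
   then show ?thesis using bd[OF True] True by (simp add: ennreal_leI)
  qed simp
 qed
 also have "\<dots> = ennreal e * ennreal (b - a)" using ab by (simp add: nn_integral_cmult_indicator)
 finally have "(\<integral>\<^sup>+x. ennreal ((I x)\<^sup>2) \<partial>lborel) <= ennreal (b - a) * (ennreal e * ennreal (b - a))"
  by (simp add: mult_left_mono)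
 also have "\<dots> = ennreal ((b - a)\<^sup>2 * e)"
  using ab e by (simp add: ennreal_mult[symmetric] power2_eq_square mult_ac)
 finally have bound: "(\<integral>\<^sup>+x. ennreal ((I x)\<^sup>2) \<partial>lborel) <= ennreal ((b - a)\<^sup>2 * e)" .
 have I2: "integrable lborel (\<lambda>x. (I x)\<^sup>2)"
 proof (rule integrableI_bounded)
  have "(\<integral>\<^sup>+x. ennreal (norm ((I x)\<^sup>2)) \<partial>lborel) <= ennreal ((b - a)\<^sup>2 * e)" using bound by simp
  then show "(\<integral>\<^sup>+x. ennreal (norm ((I x)\<^sup>2)) \<partial>lborel) < \<infinity>"
   by (rule order_le_less_trans) simp
 qed measurable
 then have sI: "sq_int I" using Im by (simp add: sq_int_def)
 have "ennreal (sq_norm I) <= ennreal ((b - a)\<^sup>2 * e)"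
  using bound nn_integral_eq_integral[OF I2] by (simp add: sq_norm_def)
 then have "sq_norm I <= (b - a)\<^sup>2 * e" using e by (simp add: ennreal_le_iff)
 then have "(1 / (b - a))\<^sup>2 * sq_norm I <= (1 / (b - a))\<^sup>2 * ((b - a)\<^sup>2 * e)"
  by (intro mult_left_mono) auto
 also have "\<dots> = e" using ab by (simp add: power_divide)
 finally have "sq_norm (\<lambda>x. (1 / (b - a)) * I x) <= e" by (simp only: sq_norm_cmult)
 moreover have eq: "(\<lambda>x. (LINT r:{a..b}|lborel. W r x) / (b - a)) = (\<lambda>x. (1 / (b - a)) * I x)"
  by (simp add: I_def)
 ultimately show "sq_norm (\<lambda>x. (LINT r:{a..b}|lborel. W r x) / (b - a)) <= e" by (simp only: eq)
 show "sq_int (\<lambda>x. (LINT r:{a..b}|lborel. W r x) / (b - a))" unfolding eq by (rule sq_int_cmult[OF sI])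
qed

section \<open>Energy curves\<close>

definition time_primitive :: "real set => (real => real => real) => (real => real => real) => bool" where
 "time_primitive S u ut \<longleftrightarrow> (\<lambda>(r, x). ut r x) \<in> borel_measurable plane \<and>
   (\<forall>a\<in>S. \<forall>b\<in>S. \<forall>x. a <= b --> set_integrable lborel {a..b} (\<lambda>r. ut r x) \<and>
    u b x - u a x = (LINT r:{a..b}|lborel. ut r x))"

text \<open>A pointwise description of a curve in \<open>C(S, H\<^sup>1) \<inter> C\<^sup>1(S,
  L\<^sup>2)\<close>: the time derivative \<open>ut\<close> enters through its integral for every fixed
  \<open>x\<close>. Such curves are closed under sums, and translates, cone convolutions and Duhamel integrals are
  of this kind.\<close>

definition energy_curve :: "real set => (real => real => real) => bool" where
 "energy_curve S u \<longleftrightarrow> (\<exists>ux ut. L2cont S u \<and> L2cont S ux \<and> L2cont S ut \<and>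
   (\<forall>t\<in>S. weak_pair (u t) (ux t)) \<and> time_primitive S u ut)"

lemma weak_pair_add:
 assumes "weak_pair F G" "weak_pair F' G'" shows "weak_pair (\<lambda>x. F x + F' x) (\<lambda>x. G x + G' x)"
 unfolding weak_pair_def
proof (intro conjI allI impI)
 fix a b :: real assume ab: "a <= b"
 have "(LINT y:{a..b}|lborel. G y + G' y) = (LINT y:{a..b}|lborel. G y) + (LINT y:{a..b}|lborel. G' y)"
  by (rule set_integral_add(2)) (use assms in \<open>auto simp: weak_pair_def intro: sq_int_set_integrable\<close>)
 moreover have "F b - F a = (LINT y:{a..b}|lborel. G y)" "F' b - F' a = (LINT y:{a..b}|lborel. G' y)"
  using assms ab by (auto simp: weak_pair_def)
 ultimately show "F b + F' b - (F a + F' a) = (LINT y:{a..b}|lborel. G y + G' y)"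
  by linarith
qed (use assms in \<open>auto simp: weak_pair_def intro!: sq_int_add continuous_intros\<close>)

lemma time_primitive_add:
 assumes "time_primitive S u ut" "time_primitive S v vt"
 shows "time_primitive S (\<lambda>t x. u t x + v t x) (\<lambda>t x. ut t x + vt t x)"
 unfolding time_primitive_def
proof (intro conjI ballI allI impI)
 have "(\<lambda>p. (case p of (r, x) => ut r x) + (case p of (r, x) => vt r x)) \<in> borel_measurable plane"
  using assms by (intro borel_measurable_add) (auto simp: time_primitive_def)
 then show "(\<lambda>(r, x). ut r x + vt r x) \<in> borel_measurable plane" by (simp add: case_prod_beta')
 fix a b x assume ab: "a \<in> S" "b \<in> S" "a <= b"
 have 1: "set_integrable lborel {a..b} (\<lambda>r. ut r x)" "u b x - u a x = (LINT r:{a..b}|lborel. ut r x)"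
  and 2: "set_integrable lborel {a..b} (\<lambda>r. vt r x)" "v b x - v a x = (LINT r:{a..b}|lborel. vt r x)"
  using assms ab by (auto simp: time_primitive_def)
 show "set_integrable lborel {a..b} (\<lambda>r. ut r x + vt r x)" by (rule set_integral_add(1)[OF 1(1) 2(1)])
 show "u b x + v b x - (u a x + v a x) = (LINT r:{a..b}|lborel. ut r x + vt r x)"
  using set_integral_add(2)[OF 1(1) 2(1)] 1(2) 2(2) by linarith
qed

lemma energy_curve_add:
 assumes "energy_curve S u" "energy_curve S v" shows "energy_curve S (\<lambda>t x. u t x + v t x)"
proof -
 obtain ux ut where u: "L2cont S u" "L2cont S ux" "L2cont S ut" "!!t. t \<in> S ==> weak_pair (u t) (ux t)" "time_primitive S u ut"
  using assms(1) by (auto simp: energy_curve_def)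
 obtain vx vt where v: "L2cont S v" "L2cont S vx" "L2cont S vt" "!!t. t \<in> S ==> weak_pair (v t) (vx t)" "time_primitive S v vt"
  using assms(2) by (auto simp: energy_curve_def)
 have "\<forall>t\<in>S. weak_pair (\<lambda>x. u t x + v t x) (\<lambda>x. ux t x + vx t x)"
  using weak_pair_add[OF u(4) v(4)] by blast
 then show ?thesis
  unfolding energy_curve_def
  using L2cont_add[OF u(1) v(1)] L2cont_add[OF u(2) v(2)] L2cont_add[OF u(3) v(3)] time_primitive_add[OF u(5) v(5)]
  by blast
qed

lemma energy_curve_C0:
 assumes "energy_curve S u" and ae: "!!t. t \<in> S ==> AE x in lborel. w t x = u t x"
 shows "C0_curve S H1_space H1_norm w"
proof -
 obtain ux ut where u: "L2cont S u" "L2cont S ux" "!!t. t \<in> S ==> weak_pair (u t) (ux t)"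
  using assms(1) by (auto simp: energy_curve_def)
 show ?thesis unfolding C0_curve_def
 proof (intro ballI conjI)
  fix t assume t: "t \<in> S"
  show "w t \<in> H1_space" by (rule weak_pair_H1[OF u(3)[OF t] ae[OF t]])
  have eq: "H1_norm (\<lambda>x. w s x - w t x) = sqrt (sq_norm (\<lambda>x. u s x - u t x) + sq_norm (\<lambda>x. ux s x - ux t x))"
   if s: "s \<in> S" for s
  proof (rule H1_norm_eq[OF weak_pair_diff[OF u(3)[OF s] u(3)[OF t]]])
   show "AE x in lborel. w s x - w t x = u s x - u t x"
    using ae[OF s] ae[OF t] by eventually_elim simp
  qed
  have "((\<lambda>s. sqrt (sq_norm (\<lambda>x. u s x - u t x) + sq_norm (\<lambda>x. ux s x - ux t x))) \<longlongrightarrow> sqrt (0 + 0)) (at t within S)"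
   using u(1,2) t by (intro tendsto_intros) (auto simp: L2cont_def)
  then have "((\<lambda>s. sqrt (sq_norm (\<lambda>x. u s x - u t x) + sq_norm (\<lambda>x. ux s x - ux t x))) \<longlongrightarrow> 0) (at t within S)"
   by simp
  then show "((\<lambda>s. H1_norm (\<lambda>x. w s x - w t x)) \<longlongrightarrow> 0) (at t within S)"
   by (rule Lim_transform_eventually) (use eq in \<open>auto simp: eventually_at_filter intro!: always_eventually\<close>)
 qed
qed

text \<open>The difference quotient minus the derivative is the time average of \<open>ut r - ut t\<close>,
  which is small in \<open>L\<^sup>2\<close> by Minkowski and continuity.\<close>

lemma energy_curve_C1:
 assumes "energy_curve S u" and ae: "!!t. t \<in> S ==> AE x in lborel. w t x = u t x"
  and S: "!!a b. a \<in> S ==> b \<in> S ==> {a..b} \<subseteq> S"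
 shows "C1_curve S (Lp_space 2) (Lp_norm 2) w"
proof -
 obtain ux ut where u: "L2cont S u" "L2cont S ut" "!!t. t \<in> S ==> weak_pair (u t) (ux t)" "time_primitive S u ut"
  using assms(1) by (auto simp: energy_curve_def)
 have utm: "(\<lambda>(r, x). ut r x) \<in> borel_measurable plane" using u(4) by (simp add: time_primitive_def)
 have usq: "sq_int (u t)" "sq_int (ut t)" if "t \<in> S" for t using u that by (auto simp: L2cont_def)
 have C0: "C0_curve S (Lp_space 2) (Lp_norm 2) ut"
  unfolding C0_curve_def
 proof (intro ballI conjI)
  fix t assume t: "t \<in> S"
  show "ut t \<in> Lp_space 2" using usq[OF t] by (auto simp: Lp_space_2_iff)
  have "((\<lambda>s. sqrt (sq_norm (\<lambda>x. ut s x - ut t x))) \<longlongrightarrow> sqrt 0) (at t within S)"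
   using u(2) t by (intro tendsto_intros) (auto simp: L2cont_def)
  then have "((\<lambda>s. sqrt (sq_norm (\<lambda>x. ut s x - ut t x))) \<longlongrightarrow> 0) (at t within S)" by simp
  then show "((\<lambda>s. Lp_norm 2 (\<lambda>x. ut s x - ut t x)) \<longlongrightarrow> 0) (at t within S)"
  proof (rule Lim_transform_eventually)
   have "Lp_norm 2 (\<lambda>x. ut s x - ut t x) = sqrt (sq_norm (\<lambda>x. ut s x - ut t x))" if "s \<in> S" for s
    by (rule Lp_norm_2_eq[OF sq_int_diff[OF usq(2)[OF that] usq(2)[OF t]]]) simp
   then show "\<forall>\<^sub>F s in at t within S. sqrt (sq_norm (\<lambda>x. ut s x - ut t x)) = Lp_norm 2 (\<lambda>x. ut s x - ut t x)"
    by (auto simp: eventually_at_filter intro!: always_eventually)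
  qed
 qed
 have q: "Lp_norm 2 (\<lambda>x. (w s x - w t x) / (s - t) - ut t x) <= sqrt e"
  if st: "s \<in> S" "t \<in> S" "s \<noteq> t" and e: "!!r. r \<in> {min s t..max s t} ==> sq_norm (\<lambda>x. ut r x - ut t x) <= e" for s t e
 proof -
  let ?a = "min s t" and ?b = "max s t"
  have ab: "?a < ?b" "?a \<in> S" "?b \<in> S" using st by (auto simp: min_def max_def)
  define W where "W = (\<lambda>r x. ut r x - ut t x)"
  have int: "set_integrable lborel {?a..?b} (\<lambda>r. ut r x)" "u ?b x - u ?a x = (LINT r:{?a..?b}|lborel. ut r x)" for x
   using u(4) ab unfolding time_primitive_def by (meson less_imp_le)+
  have ci: "set_integrable lborel {?a..?b} (\<lambda>r. c)" for c :: real
   by (simp add: set_integrable_def emeasure_lborel_Icc_eq)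
  have cI: "(LINT r:{?a..?b}|lborel. c) = (?b - ?a) * c" for c :: real
   using ab(1) by (simp add: set_int_def)
  have Wint: "set_integrable lborel {?a..?b} (\<lambda>r. W r x)" for x
   unfolding W_def by (rule set_integral_diff(1)[OF int(1) ci])
  have WI: "(LINT r:{?a..?b}|lborel. W r x) / (?b - ?a) = (u s x - u t x) / (s - t) - ut t x" for x
  proof -
   have "(LINT r:{?a..?b}|lborel. W r x) = u ?b x - u ?a x - (?b - ?a) * ut t x"
    unfolding W_def set_integral_diff(2)[OF int(1) ci] cI int(2)[symmetric] by simp
   then have "(LINT r:{?a..?b}|lborel. W r x) / (?b - ?a) = (u ?b x - u ?a x) / (?b - ?a) - ut t x"
    using ab(1) by (simp add: diff_divide_distrib)
   also have "(u ?b x - u ?a x) / (?b - ?a) = (u s x - u t x) / (s - t)"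
   proof (cases "s < t")
    case True
    then have "(u ?b x - u ?a x) / (?b - ?a) = (u t x - u s x) / (t - s)" by simp
    also have "\<dots> = (u s x - u t x) / (s - t)"
     by (metis minus_diff_eq minus_divide_divide)
    finally show ?thesis .
   qed (use st in simp)
   finally show ?thesis .
  qed
  have Wm: "(\<lambda>(r, x). W r x) \<in> borel_measurable plane"
  proof -
   have [measurable]: "ut t \<in> borel_measurable lborel" using sq_int_measurable(1)[OF usq(2)[OF st(2)]] by simp
   have "(\<lambda>p. (case p of (r, x) => ut r x) - ut t (snd p)) \<in> borel_measurable plane"
    using utm by measurable
   then show ?thesis by (simp add: W_def case_prod_beta')
  qed
  have Wb: "sq_int (W r) \<and> sq_norm (W r) <= e" if r: "r \<in> {?a..?b}" for r
  proof -
   have "r \<in> S" using S[OF ab(2,3)] r by blast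
   then show ?thesis using e[OF r] sq_int_diff[OF usq(2) usq(2)[OF st(2)]] by (simp add: W_def)
  qed
  have A: "sq_int (\<lambda>x. (u s x - u t x) / (s - t) - ut t x)" "sq_norm (\<lambda>x. (u s x - u t x) / (s - t) - ut t x) <= e"
   using sq_norm_average_le[OF ab(1) Wm Wint Wb] unfolding WI by auto
  have "AE x in lborel. (w s x - w t x) / (s - t) - ut t x = (u s x - u t x) / (s - t) - ut t x"
   using ae[OF st(1)] ae[OF st(2)] by eventually_elim simp
  from Lp_norm_2_eq[OF A(1) this] show ?thesis using A(2) by simp
 qed
 have "((\<lambda>s. Lp_norm 2 (\<lambda>x. (w s x - w t x) / (s - t) - ut t x)) \<longlongrightarrow> 0) (at t within S)" if t: "t \<in> S" for t
 proof (rule tendstoI)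
  fix e :: real assume e: "e > 0"
  have "((\<lambda>s. sq_norm (\<lambda>x. ut s x - ut t x)) \<longlongrightarrow> 0) (at t within S)" using u(2) t by (simp add: L2cont_def)
  then have "eventually (\<lambda>s. sq_norm (\<lambda>x. ut s x - ut t x) < (e / 2)\<^sup>2) (at t within S)"
   by (rule order_tendstoD) (use e in auto)
  then obtain d where d: "d > 0" "!!s. s \<in> S ==> s \<noteq> t ==> dist s t < d ==> sq_norm (\<lambda>x. ut s x - ut t x) < (e / 2)\<^sup>2"
   unfolding eventually_at by blast
  have "dist (Lp_norm 2 (\<lambda>x. (w s x - w t x) / (s - t) - ut t x)) 0 < e" if s: "s \<in> S" "s \<noteq> t" "dist s t < d" for s
  proof -
   have "Lp_norm 2 (\<lambda>x. (w s x - w t x) / (s - t) - ut t x) <= sqrt ((e / 2)\<^sup>2)"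
   proof (rule q[OF s(1) t s(2)])
    fix r assume r: "r \<in> {min s t..max s t}"
    have rS: "r \<in> S" using S[of "min s t" "max s t"] s(1) t r by (auto simp: min_def max_def split: if_splits)
    show "sq_norm (\<lambda>x. ut r x - ut t x) <= (e / 2)\<^sup>2"
    proof (cases "r = t")
     case True
     then show ?thesis by (simp add: sq_norm_def)
    next
     case False
     have "dist r t < d" using r s(3) by (auto simp: dist_real_def min_def max_def abs_if split: if_splits)
     then show ?thesis using d(2)[OF rS False] by simp
    qed
   qed
   then have "Lp_norm 2 (\<lambda>x. (w s x - w t x) / (s - t) - ut t x) <= e / 2" using e by simp
   moreover have "Lp_norm 2 (\<lambda>x. (w s x - w t x) / (s - t) - ut t x) \<ge> 0" by (simp add: Lp_norm_def)
   ultimately show ?thesis using e by (simp add: dist_real_def)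
  qed
  then show "eventually (\<lambda>s. dist (Lp_norm 2 (\<lambda>x. (w s x - w t x) / (s - t) - ut t x)) 0 < e) (at t within S)"
   unfolding eventually_at using d(1) by blast
 qed
 moreover have "w t \<in> Lp_space 2" if "t \<in> S" for t
  unfolding Lp_space_2_iff using usq(1)[OF that] ae[OF that] by iprover
 ultimately show ?thesis unfolding C1_curve_def using C0 by blast
qed

section \<open>Convolution on the light cone\<close>

text \<open>Only the values of the kernel on the cone \<open>\<bar>x - y\<bar> \<le> t\<close> enter.\<close>

definition conv :: "(real => real => real) => real => (real => real) => real => real" where
 "conv \<kappa> t h x = (LINT y|lborel. (if \<bar>x - y\<bar> <= t then \<kappa> t (x - y) * h y else 0))"

text \<open>Joint continuity in time and space.\<close>

abbreviation jcont :: "(real => real => real) => bool" where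
 "jcont \<kappa> \<equiv> continuous_on UNIV (\<lambda>p. \<kappa> (fst p) (snd p))"

text \<open>A kernel that is continuously differentiable on the whole plane and even in space. The cut-off at
  the cone is not part of the kernel; it produces the boundary terms in the formulas for the derivatives.\<close>

definition cone_kernel :: "(real => real => real) => (real => real => real) => (real => real => real) => bool" where
 "cone_kernel \<kappa> \<kappa>t \<kappa>z \<longleftrightarrow> jcont \<kappa> \<and> jcont \<kappa>t \<and> jcont \<kappa>z \<and>
   (\<forall>t z. ((\<lambda>r. \<kappa> r z) has_field_derivative \<kappa>t t z) (at t)) \<and>
   (\<forall>t z. (\<kappa> t has_field_derivative \<kappa>z t z) (at z)) \<and> (\<forall>t z. \<kappa> t (- z) = \<kappa> t z)"

lemma AE_not_two: "AE y in lborel. y \<noteq> (a::real) \<and> y \<noteq> b"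
 using AE_lborel_singleton[of a] AE_lborel_singleton[of b] by eventually_elim simp

text \<open>For fixed \<open>y\<close> off the two boundary points of the limit interval the integrand is
  continuous at \<open>p0\<close>, so dominated convergence applies.\<close>

lemma isCont_cone_integral:
 fixes p0 :: "'p::metric_space" and \<rho> \<xi> :: "'p => real" and K :: "'p => real => real"
 assumes \<rho>: "isCont \<rho> p0" and \<xi>: "isCont \<xi> p0"
  and K: "!!y. isCont (\<lambda>p. K p y) p0" "!!p. K p \<in> borel_measurable borel"
  and d: "d > 0" and w: "!!p y. dist p p0 < d ==> \<bar>\<xi> p - y\<bar> <= \<rho> p ==> \<bar>K p y\<bar> <= w y"
  "!!y. 0 <= w y" "integrable lborel w"
 shows "isCont (\<lambda>p. LINT y|lborel. (if \<bar>\<xi> p - y\<bar> <= \<rho> p then K p y else 0)) p0"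
proof -
 have "((\<lambda>p. LINT y|lborel. (if \<bar>\<xi> p - y\<bar> <= \<rho> p then K p y else 0)) \<longlongrightarrow>
   (LINT y|lborel. (if \<bar>\<xi> p0 - y\<bar> <= \<rho> p0 then K p0 y else 0))) (at p0 within ball p0 d)"
 proof (rule tendsto_integral_dominated[where w=w])
  show "(\<lambda>y. if \<bar>\<xi> p - y\<bar> <= \<rho> p then K p y else 0) \<in> borel_measurable lborel" for p
   using K(2)[of p] by measurable
  have "((\<lambda>p. if \<bar>\<xi> p - y\<bar> <= \<rho> p then K p y else 0) \<longlongrightarrow> (if \<bar>\<xi> p0 - y\<bar> <= \<rho> p0 then K p0 y else 0)) (at p0 within ball p0 d)"
   if y: "y \<noteq> \<xi> p0 + \<rho> p0 \<and> y \<noteq> \<xi> p0 - \<rho> p0" for y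
  proof -
   have l: "((\<lambda>p. \<rho> p - \<bar>\<xi> p - y\<bar>) \<longlongrightarrow> \<rho> p0 - \<bar>\<xi> p0 - y\<bar>) (at p0)"
    using \<rho> \<xi> by (intro tendsto_intros) (auto simp: isCont_def)
   have "((\<lambda>p. if \<bar>\<xi> p - y\<bar> <= \<rho> p then K p y else 0) \<longlongrightarrow> (if \<bar>\<xi> p0 - y\<bar> <= \<rho> p0 then K p0 y else 0)) (at p0)"
   proof (cases "\<bar>\<xi> p0 - y\<bar> <= \<rho> p0")
    case True
    then have "0 < \<rho> p0 - \<bar>\<xi> p0 - y\<bar>" using y by (auto simp: abs_if split: if_splits)
    from order_tendstoD(1)[OF l this]
    have "eventually (\<lambda>p. K p y = (if \<bar>\<xi> p - y\<bar> <= \<rho> p then K p y else 0)) (at p0)"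
     by eventually_elim auto
    moreover have "((\<lambda>p. K p y) \<longlongrightarrow> K p0 y) (at p0)" using K(1)[of y] by (simp add: isCont_def)
    ultimately show ?thesis using True by (simp add: Lim_transform_eventually)
   next
    case False
    then have "\<rho> p0 - \<bar>\<xi> p0 - y\<bar> < 0" by simp
    from order_tendstoD(2)[OF l this]
    have "eventually (\<lambda>p. (if \<bar>\<xi> p - y\<bar> <= \<rho> p then K p y else 0) = 0) (at p0)"
     by eventually_elim auto
    then show ?thesis using False by (simp add: tendsto_eventually)
   qed
   then show ?thesis by (rule tendsto_within_subset) simp
  qed
  with AE_not_two[of "\<xi> p0 + \<rho> p0" "\<xi> p0 - \<rho> p0"]
  show "AE y in lborel. ((\<lambda>p. if \<bar>\<xi> p - y\<bar> <= \<rho> p then K p y else 0) \<longlongrightarrow> (if \<bar>\<xi> p0 - y\<bar> <= \<rho> p0 then K p0 y else 0)) (at p0 within ball p0 d)"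
   by (rule eventually_mono)
  show "\<bar>if \<bar>\<xi> p - y\<bar> <= \<rho> p then K p y else 0\<bar> <= w y" if "p \<in> ball p0 d" for p y
   using w(1)[of p y] w(2)[of y] that by (auto simp: dist_commute)
 qed (rule w(3))
 then show ?thesis using d by (simp add: isCont_def at_within_open[of p0 "ball p0 d"])
qed

lemma jcont_measurable:
 assumes "jcont \<kappa>" "f \<in> borel_measurable M" "g \<in> borel_measurable M"
 shows "(\<lambda>w. \<kappa> (f w) (g w)) \<in> borel_measurable M"
 by (rule borel_measurable_continuous_Pair[OF assms(2,3,1)])

lemma jcont_bound:
 assumes "jcont \<kappa>"
 shows "\<exists>B\<ge>0. \<forall>t z. \<bar>t\<bar> <= L --> \<bar>z\<bar> <= L --> \<bar>\<kappa> t z\<bar> <= B"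
proof -
 have "\<exists>B\<ge>0. \<forall>p\<in>{-L..L} \<times> {-L..L}. \<bar>\<kappa> (fst p) (snd p)\<bar> <= B"
  by (rule continuous_compact_bounded[OF compact_Times continuous_on_subset[OF assms]]) auto
 then show ?thesis by (force simp: abs_le_iff)
qed

lemma jcont_isCont:
 assumes "jcont \<kappa>" "isCont f p" "isCont g p"
 shows "isCont (\<lambda>p. \<kappa> (f p) (g p)) p"
proof -
 have "isCont (\<lambda>p. \<kappa> (fst p) (snd p)) (f p, g p)" using assms(1) by (simp add: continuous_on_eq_continuous_at)
 moreover have "isCont (\<lambda>p. (f p, g p)) p" using assms(2,3) by (rule continuous_Pair)
 ultimately have "isCont ((\<lambda>p. \<kappa> (fst p) (snd p)) \<circ> (\<lambda>p. (f p, g p))) p"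
  by (rule continuous_at_compose[rotated])
 then show ?thesis by (simp add: comp_def)
qed

lemma jcont_conv:
 assumes \<kappa>: "jcont \<kappa>" and h: "integrable lborel h"
 shows "jcont (\<lambda>t x. conv \<kappa> t h x)"
proof -
 have [measurable]: "h \<in> borel_measurable borel" using h by auto
 have "isCont (\<lambda>p. conv \<kappa> (fst p) h (snd p)) p0" for p0 :: "real \<times> real"
  unfolding conv_def
 proof -
  obtain B where B: "B \<ge> 0" "!!t z. \<bar>t\<bar> <= \<bar>fst p0\<bar> + 1 ==> \<bar>z\<bar> <= \<bar>fst p0\<bar> + 1 ==> \<bar>\<kappa> t z\<bar> <= B"
   using jcont_bound[OF \<kappa>, of "\<bar>fst p0\<bar> + 1"] by blast
  show "isCont (\<lambda>p. LINT y|lborel. (if \<bar>snd p - y\<bar> <= fst p then \<kappa> (fst p) (snd p - y) * h y else 0)) p0"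
  proof (rule isCont_cone_integral[where d=1 and w="\<lambda>y. B * \<bar>h y\<bar>"])
   show "isCont (\<lambda>p. \<kappa> (fst p) (snd p - y) * h y) p0" for y
    by (intro continuous_mult continuous_const jcont_isCont[OF \<kappa>]) (auto intro!: continuous_intros)
   show "(\<lambda>y. \<kappa> (fst p) (snd p - y) * h y) \<in> borel_measurable borel" for p
    by (intro borel_measurable_times jcont_measurable[OF \<kappa>]) measurable
   fix p :: "real \<times> real" and y assume p: "dist p p0 < 1" "\<bar>snd p - y\<bar> <= fst p"
   have "\<bar>fst p\<bar> <= \<bar>fst p0\<bar> + 1" using dist_fst_le[of p p0] p(1) by (simp add: dist_real_def)
   then have "\<bar>\<kappa> (fst p) (snd p - y)\<bar> <= B" using p(2) by (intro B(2)) auto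
   then show "\<bar>\<kappa> (fst p) (snd p - y) * h y\<bar> <= B * \<bar>h y\<bar>" by (simp add: abs_mult mult_right_mono)
  qed (use B(1) h in \<open>auto intro!: continuous_intros\<close>)
 qed
 then show ?thesis by (simp add: continuous_on_eq_continuous_at)
qed

lemma continuous_conv_param:
 assumes \<kappa>: "jcont \<kappa>" and F: "jcont F"
 shows "continuous_on UNIV (\<lambda>p::real \<times> real \<times> real. conv \<kappa> (fst p) (F (fst (snd p))) (snd (snd p)))"
proof -
 have "isCont (\<lambda>p. conv \<kappa> (fst p) (F (fst (snd p))) (snd (snd p))) p0" for p0 :: "real \<times> real \<times> real"
  unfolding conv_def
 proof -
  define L where "L = \<bar>fst p0\<bar> + \<bar>fst (snd p0)\<bar> + \<bar>snd (snd p0)\<bar> + 2"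
  obtain B where B: "B \<ge> 0" "!!t z. \<bar>t\<bar> <= L ==> \<bar>z\<bar> <= L ==> \<bar>\<kappa> t z\<bar> <= B"
   using jcont_bound[OF \<kappa>, of L] by blast
  obtain C where C: "C \<ge> 0" "!!t z. \<bar>t\<bar> <= L ==> \<bar>z\<bar> <= L ==> \<bar>F t z\<bar> <= C"
   using jcont_bound[OF F, of L] by blast
  show "isCont (\<lambda>p. LINT y|lborel. (if \<bar>snd (snd p) - y\<bar> <= fst p
    then \<kappa> (fst p) (snd (snd p) - y) * F (fst (snd p)) y else 0)) p0"
  proof (rule isCont_cone_integral[where d=1 and w="\<lambda>y. indicator {-L..L} y * (B * C)"])
   show "isCont (\<lambda>p. \<kappa> (fst p) (snd (snd p) - y) * F (fst (snd p)) y) p0" for y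
    by (intro continuous_mult jcont_isCont[OF \<kappa>] jcont_isCont[OF F])
      (auto intro!: continuous_intros)
   show "(\<lambda>y. \<kappa> (fst p) (snd (snd p) - y) * F (fst (snd p)) y) \<in> borel_measurable borel" for p
    by (intro borel_measurable_times jcont_measurable[OF \<kappa>] jcont_measurable[OF F]) measurable
   show "integrable lborel (\<lambda>y. indicator {-L..L} y * (B * C))"
    by (auto intro!: integrable_mult_left integrable_real_indicator simp: emeasure_lborel_Icc_eq)
   fix p :: "real \<times> real \<times> real" and y assume p: "dist p p0 < 1" "\<bar>snd (snd p) - y\<bar> <= fst p"
   have d: "\<bar>fst p - fst p0\<bar> < 1" "\<bar>fst (snd p) - fst (snd p0)\<bar> < 1" "\<bar>snd (snd p) - snd (snd p0)\<bar> < 1"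
    using dist_fst_le[of p p0] dist_snd_le[of p p0] dist_fst_le[of "snd p" "snd p0"]
     dist_snd_le[of "snd p" "snd p0"] p(1) by (auto simp: dist_real_def)
   have l: "\<bar>fst p\<bar> <= L" "\<bar>snd (snd p) - y\<bar> <= L" "\<bar>fst (snd p)\<bar> <= L" "\<bar>y\<bar> <= L"
    using d p(2) unfolding L_def by linarith+
   have "\<bar>\<kappa> (fst p) (snd (snd p) - y)\<bar> * \<bar>F (fst (snd p)) y\<bar> <= B * C"
    using B(1) by (intro mult_mono B(2) C(2) l) auto
   then show "\<bar>\<kappa> (fst p) (snd (snd p) - y) * F (fst (snd p)) y\<bar> <= indicator {-L..L} y * (B * C)"
    using l(4) by (simp add: abs_mult abs_le_iff)
  qed (use B(1) C(1) in \<open>auto intro!: continuous_intros\<close>)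
 qed
 then show ?thesis by (simp add: continuous_on_eq_continuous_at)
qed

lemma integrable_mult_bounded:
 assumes "integrable lborel h" "m \<in> borel_measurable borel" "!!y. \<bar>m y\<bar> <= (B::real)"
 shows "integrable lborel (\<lambda>y. m y * h y :: real)"
proof (rule int_bound[of _ "\<lambda>y. B * h y"])
 have [measurable]: "h \<in> borel_measurable borel" "m \<in> borel_measurable borel" using assms by auto
 show "(\<lambda>y. m y * h y) \<in> borel_measurable lborel" by measurable
 have "\<bar>m y * h y\<bar> <= \<bar>B * h y\<bar>" for y
  using assms(3)[of y] by (simp add: abs_mult mult_right_mono)
 then show "AE y in lborel. norm (m y * h y) <= norm (B * h y)" by simp
qed (use assms in auto)

lemma set_integral_shift:
 fixes h :: "real => real"
 shows "(LINT y:{a + t<..b + t}|lborel. h y) = (LINT x:{a..b}|lborel. h (x + t))"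
  "(LINT y:{a + t..<b + t}|lborel. h y) = (LINT x:{a..b}|lborel. h (x + t))"
proof -
 have *: "(LINT y:{a + t..b + t}|lborel. h y) = (LINT x:{a..b}|lborel. h (x + t))"
  unfolding set_int_def
  by (subst lborel_integral_real_affine[where c=1 and t=t])
    (auto intro!: lint_cong simp: indicator_def add.commute)
 show "(LINT y:{a + t<..b + t}|lborel. h y) = (LINT x:{a..b}|lborel. h (x + t))"
  using * set_integral_Ioc_Icc by simp
 have "(LINT y:{a + t..<b + t}|lborel. h y) = (LINT y:{a + t..b + t}|lborel. h y)"
  by (rule set_integral_discrete_difference[where X="{b + t}"]) auto
 then show "(LINT y:{a + t..<b + t}|lborel. h y) = (LINT x:{a..b}|lborel. h (x + t))" using * by simp
qed

lemma set_integrable_shift: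
 fixes h :: "real => real"
 assumes "integrable lborel h" "c = 1 \<or> c = - 1" shows "set_integrable lborel A' (\<lambda>x. h (x + c * t)) \<or> A' \<notin> sets borel"
  "integrable lborel (\<lambda>x. h (x + t))" "integrable lborel (\<lambda>r. h (x + c * r))"
proof -
 show i: "integrable lborel (\<lambda>x. h (x + t))" for t
  using lborel_integrable_real_affine[OF assms(1), of 1 t] by (simp add: add.commute)
 show "set_integrable lborel A' (\<lambda>x. h (x + c * t)) \<or> A' \<notin> sets borel"
  using set_integrable_of_integrable[OF i] by blast
 show "integrable lborel (\<lambda>r. h (x + c * r))"
  using lborel_integrable_real_affine[OF assms(1), of c x] assms(2) by auto
qed

lemma set_integral_FTC:
 fixes F f :: "real => real"
 assumes "a <= b" "!!x. (F has_field_derivative f x) (at x)" "continuous_on UNIV f"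
 shows "(LINT x:{a..b}|lborel. f x) = F b - F a"
proof -
 have "(LINT x|lborel. f x * indicator {a..b} x) = F b - F a"
  by (rule integral_FTC_Icc_real) (use assms in \<open>auto simp: continuous_on_eq_continuous_at\<close>)
 then show ?thesis by (simp add: set_int_def mult.commute)
qed

text \<open>The kernel cut off at the cone is a continuous function plus two jumps.\<close>

lemma cone_kernel_space_increment:
 assumes k: "cone_kernel \<kappa> \<kappa>t \<kappa>z" and t: "0 <= t" and ab: "a <= b"
 shows "(if \<bar>b - y\<bar> <= t then \<kappa> t (b - y) else 0) - (if \<bar>a - y\<bar> <= t then \<kappa> t (a - y) else 0)
  = \<kappa> t t * indicator {a + t<..b + t} y - \<kappa> t t * indicator {a - t..<b - t} y
   + (LINT x:{a..b}|lborel. (if \<bar>x - y\<bar> <= t then \<kappa>z t (x - y) else 0))"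
proof -
 define cl where "cl = (\<lambda>z. max (- t) (min t z))"
 have ev: "\<kappa> t (- t) = \<kappa> t t" using k by (simp add: cone_kernel_def)
 have kz: "(if \<bar>z\<bar> <= t then \<kappa> t z else 0) = \<kappa> t (cl z) - \<kappa> t t + \<kappa> t t * ((if - t <= z then 1 else 0) - (if t < z then 1 else 0))" for z
  using t ev by (auto simp: cl_def max_def min_def abs_if)
 have "(LINT x:{a..b}|lborel. (if \<bar>x - y\<bar> <= t then \<kappa>z t (x - y) else 0)) = \<kappa> t (cl (b - y)) - \<kappa> t (cl (a - y))"
 proof -
  have eq: "(LINT x:{a..b}|lborel. (if \<bar>x - y\<bar> <= t then \<kappa>z t (x - y) else 0)) = (LINT x:{max a (y - t)..min b (y + t)}|lborel. \<kappa>z t (x - y))"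
   unfolding set_int_def
   by (rule lint_cong) (auto simp: indicator_def abs_if)
  show ?thesis
  proof (cases "max a (y - t) <= min b (y + t)")
   case True
   have "(LINT x:{max a (y - t)..min b (y + t)}|lborel. \<kappa>z t (x - y)) = \<kappa> t (min b (y + t) - y) - \<kappa> t (max a (y - t) - y)"
   proof (rule set_integral_FTC[OF True])
    fix x
    have "((\<lambda>z. \<kappa> t z) has_field_derivative \<kappa>z t (x - y)) (at (x - y))" using k by (simp add: cone_kernel_def)
    moreover have "((\<lambda>x. x - y) has_field_derivative 1) (at x)" by (auto intro!: derivative_eq_intros)
    ultimately have "((\<lambda>x. \<kappa> t (x - y)) has_field_derivative \<kappa>z t (x - y) * 1) (at x)" by (rule DERIV_chain2)
    then show "((\<lambda>x. \<kappa> t (x - y)) has_field_derivative \<kappa>z t (x - y)) (at x)" by simp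
   next
    have kc: "jcont \<kappa>z" using k by (simp add: cone_kernel_def)
    show "continuous_on UNIV (\<lambda>x. \<kappa>z t (x - y))"
     by (rule continuous_at_imp_continuous_on) (auto intro!: jcont_isCont[OF kc] continuous_intros)
   qed
   also have "min b (y + t) - y = cl (b - y)" using True t by (auto simp: cl_def max_def min_def split: if_splits)
   also have "max a (y - t) - y = cl (a - y)" using True t by (auto simp: cl_def max_def min_def split: if_splits)
   finally show ?thesis using eq by simp
  next
   case False
   then have "{max a (y - t)..min b (y + t)} = {}" by auto
   then have "(LINT x:{max a (y - t)..min b (y + t)}|lborel. \<kappa>z t (x - y)) = 0"
    by (simp only: set_int_def) simp
   moreover have "cl (b - y) = cl (a - y)" using False t ab by (auto simp: cl_def max_def min_def split: if_splits)
   ultimately show ?thesis using eq by simp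
  qed
 qed
 moreover have "indicator {a + t<..b + t} y - indicator {a - t..<b - t} y
   = ((if - t <= b - y then 1 else 0) - (if t < b - y then 1 else 0))
    - ((if - t <= a - y then 1 else 0) - (if t < a - y then 1 else (0::real)))"
  using ab t by (auto simp: indicator_def)
 then have "\<kappa> t t * indicator {a + t<..b + t} y - \<kappa> t t * indicator {a - t..<b - t} y
   = \<kappa> t t * ((if - t <= b - y then 1 else 0) - (if t < b - y then 1 else 0))
    - \<kappa> t t * ((if - t <= a - y then 1 else 0) - (if t < a - y then 1 else (0::real)))"
  by (simp only: right_diff_distrib[symmetric])
 ultimately show ?thesis unfolding kz[of "b - y"] kz[of "a - y"] by linarith
qed

text \<open>The common measure theory behind the two increment formulas.\<close>

lemma kernel_Fubini:
 fixes h :: "real => real" and k :: "real => real => real"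
 assumes h: "integrable lborel h" and m: "(\<lambda>(r, y). indicator {a..b} r * k r y * h y) \<in> borel_measurable plane"
  and C: "!!r y. r \<in> {a..b} ==> \<bar>k r y\<bar> <= (C::real)"
 shows "set_integrable lborel {a..b} (\<lambda>r. LINT y|lborel. k r y * h y)"
  "integrable lborel (\<lambda>y. (LINT r:{a..b}|lborel. k r y) * h y)"
  "(LINT y|lborel. (LINT r:{a..b}|lborel. k r y) * h y) = (LINT r:{a..b}|lborel. LINT y|lborel. k r y * h y)"
proof -
 have i: "integrable plane (\<lambda>(r, y). indicator {a..b} r * k r y * h y)"
 proof (rule integrable_pair_bound[OF m, where g="indicator {a..b}" and h="\<lambda>y. C * \<bar>h y\<bar>"])
  show "\<bar>indicator {a..b} r * k r y * h y\<bar> <= indicator {a..b} r * (C * \<bar>h y\<bar>)" for r y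
   using C[of r y] by (cases "r \<in> {a..b}") (auto simp: abs_mult mult_right_mono)
 qed (use h in \<open>auto simp: emeasure_lborel_Icc_eq\<close>)
 show "set_integrable lborel {a..b} (\<lambda>r. LINT y|lborel. k r y * h y)"
  using lborel_pair.integrable_fst'[OF i] by (simp add: set_integrable_def mult.assoc)
 show "integrable lborel (\<lambda>y. (LINT r:{a..b}|lborel. k r y) * h y)"
  using lborel_pair.integrable_snd[OF i] by (simp add: set_int_def)
 have "(LINT r|lborel. indicator {a..b} r * k r y * h y) = (LINT r:{a..b}|lborel. k r y) * h y" for y
  by (simp add: set_int_def)
 moreover have "(LINT y|lborel. indicator {a..b} r * k r y * h y) = indicator {a..b} r *\<^sub>R (LINT y|lborel. k r y * h y)" for r
  by (simp add: mult.assoc)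
 ultimately show "(LINT y|lborel. (LINT r:{a..b}|lborel. k r y) * h y) = (LINT r:{a..b}|lborel. LINT y|lborel. k r y * h y)"
  using lborel_pair.Fubini_integral[OF i] by (simp add: set_int_def)
qed

text \<open>The two jumps at the cone give the translates of \<open>h\<close>, which makes the convolution of an
  integrable function absolutely continuous in \<open>x\<close>.\<close>

lemma conv_space_increment:
 assumes k: "cone_kernel \<kappa> \<kappa>t \<kappa>z" and h: "integrable lborel h" and t: "0 <= t" and ab: "a <= b"
 shows "conv \<kappa> t h b - conv \<kappa> t h a
  = (LINT x:{a..b}|lborel. \<kappa> t t * (h (x + t) - h (x - t)) + conv \<kappa>z t h x)"
proof -
 have c: "jcont \<kappa>" "jcont \<kappa>z" using k by (auto simp: cone_kernel_def)
 have [measurable]: "h \<in> borel_measurable borel" using h by auto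
 obtain B where B: "B \<ge> 0" "!!s z. \<bar>s\<bar> <= t ==> \<bar>z\<bar> <= t ==> \<bar>\<kappa> s z\<bar> <= B"
  using jcont_bound[OF c(1), of t] by blast
 obtain C where C: "C \<ge> 0" "!!s z. \<bar>s\<bar> <= t ==> \<bar>z\<bar> <= t ==> \<bar>\<kappa>z s z\<bar> <= C"
  using jcont_bound[OF c(2), of t] by blast
 define k1 where "k1 = (\<lambda>x y. if \<bar>x - y\<bar> <= t then \<kappa> t (x - y) else 0)"
 define k2 where "k2 = (\<lambda>x y. if \<bar>x - y\<bar> <= t then \<kappa>z t (x - y) else 0)"
 have [measurable]: "(\<lambda>y. \<kappa> t (x - y)) \<in> borel_measurable borel" for x
  by (rule jcont_measurable[OF c(1)]) measurable
 have k1m: "k1 x \<in> borel_measurable borel" for x unfolding k1_def by measurable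
 have k1b: "\<bar>k1 x y\<bar> <= B" for x y using B t by (auto simp: k1_def)
 have k1i: "integrable lborel (\<lambda>y. k1 x y * h y)" for x by (rule integrable_mult_bounded[OF h k1m k1b])
 have cv: "conv \<kappa> t h x = (LINT y|lborel. k1 x y * h y)" for x
  unfolding conv_def k1_def by (rule lint_cong) auto
 have [measurable]: "(\<lambda>p. \<kappa>z t (fst p - snd p)) \<in> borel_measurable plane"
  by (rule jcont_measurable[OF c(2)]) measurable
 have k2m: "(\<lambda>(x, y). indicator {a..b} x * k2 x y * h y) \<in> borel_measurable plane"
  unfolding k2_def case_prod_beta' by measurable
 have k2b: "\<bar>k2 r y\<bar> <= C" if "r \<in> {a..b}" for r y using C t by (auto simp: k2_def)
 have cz: "conv \<kappa>z t h x = (LINT y|lborel. k2 x y * h y)" for x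
  unfolding conv_def k2_def by (rule lint_cong) auto
 note iz = kernel_Fubini(1)[OF h k2m k2b, folded cz] and i3 = kernel_Fubini(2)[OF h k2m k2b] and fub = kernel_Fubini(3)[OF h k2m k2b, folded cz]
 have sh: "set_integrable lborel {a..b} (\<lambda>x. h (x + t))" "set_integrable lborel {a..b} (\<lambda>x. h (x - t))"
  using set_integrable_shift(2)[OF h, of 1 t] set_integrable_shift(2)[OF h, of 1 "-t"]
  by (auto intro: set_integrable_of_integrable)
 have ii: "integrable lborel (\<lambda>y. indicator {a + t<..b + t} y *\<^sub>R h y)" "integrable lborel (\<lambda>y. indicator {a - t..<b - t} y *\<^sub>R h y)"
  using set_integrable_of_integrable[OF h, of "{a + t<..b + t}"] set_integrable_of_integrable[OF h, of "{a - t..<b - t}"]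
  by (auto simp: set_integrable_def)
 have "conv \<kappa> t h b - conv \<kappa> t h a = (LINT y|lborel. (k1 b y - k1 a y) * h y)"
  unfolding cv left_diff_distrib using k1i by simp
 also have "\<dots> = (LINT y|lborel. \<kappa> t t * (indicator {a + t<..b + t} y *\<^sub>R h y)
   - \<kappa> t t * (indicator {a - t..<b - t} y *\<^sub>R h y) + (LINT x:{a..b}|lborel. k2 x y) * h y)"
  unfolding k1_def k2_def cone_kernel_space_increment[OF k t ab]
  by (rule lint_cong) (auto simp: algebra_simps)
 also have "\<dots> = \<kappa> t t * (LINT y:{a + t<..b + t}|lborel. h y) - \<kappa> t t * (LINT y:{a - t..<b - t}|lborel. h y)
   + (LINT x:{a..b}|lborel. conv \<kappa>z t h x)"
  using ii i3 fub by (simp add: set_int_def)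
 also have "\<dots> = \<kappa> t t * ((LINT x:{a..b}|lborel. h (x + t)) - (LINT x:{a..b}|lborel. h (x - t)))
   + (LINT x:{a..b}|lborel. conv \<kappa>z t h x)"
  using set_integral_shift(1)[of a t b h] set_integral_shift(2)[of a "-t" b h] by (simp add: algebra_simps)
 also have "\<dots> = (LINT x:{a..b}|lborel. \<kappa> t t * (h (x + t) - h (x - t)) + conv \<kappa>z t h x)"
  using sh iz by (simp add: set_integral_add(2) set_integral_diff(2) set_integral_mult_right set_integrable_mult_right set_integral_diff(1))
 finally show ?thesis .
qed

text \<open>As time grows from \<open>a\<close> to \<open>b\<close>, the point \<open>z\<close> enters the cone
  at time \<open>\<bar>z\<bar>\<close>, with a jump, and from then on the kernel moves by its time
  derivative.\<close>

lemma cone_kernel_time_increment: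
 assumes k: "cone_kernel \<kappa> \<kappa>t \<kappa>z" and a: "0 <= a" and ab: "a <= b"
 shows "(if \<bar>z\<bar> <= b then \<kappa> b z else 0) - (if \<bar>z\<bar> <= a then \<kappa> a z else 0)
  = \<kappa> z z * indicator {a<..b} z + \<kappa> (- z) (- z) * indicator {a<..b} (- z)
   + (LINT r:{a..b}|lborel. (if \<bar>z\<bar> <= r then \<kappa>t r z else 0))"
proof -
 have ev: "\<kappa> t (- z) = \<kappa> t z" for t z using k by (simp add: cone_kernel_def)
 have ft: "(LINT r:{c..b}|lborel. \<kappa>t r z) = \<kappa> b z - \<kappa> c z" if "c <= b" for c
 proof (rule set_integral_FTC[OF that])
  show "((\<lambda>r. \<kappa> r z) has_field_derivative \<kappa>t x z) (at x)" for x using k by (simp add: cone_kernel_def)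
  have kc: "jcont \<kappa>t" using k by (simp add: cone_kernel_def)
  show "continuous_on UNIV (\<lambda>r. \<kappa>t r z)"
   by (rule continuous_at_imp_continuous_on) (auto intro!: jcont_isCont[OF kc] continuous_intros)
 qed
 have eq: "(LINT r:{a..b}|lborel. (if \<bar>z\<bar> <= r then \<kappa>t r z else 0)) = (LINT r:{max a \<bar>z\<bar>..b}|lborel. \<kappa>t r z)"
  unfolding set_int_def by (rule lint_cong) (auto simp: indicator_def)
 consider "\<bar>z\<bar> <= a" | "a < \<bar>z\<bar>" "\<bar>z\<bar> <= b" | "b < \<bar>z\<bar>" by linarith
 then show ?thesis
 proof cases
  case 1
  then show ?thesis using eq ft[of a] ab by (auto simp: indicator_def max_def)
 next
  case 2
  have "\<kappa> \<bar>z\<bar> z = \<kappa> z z * indicator {a<..b} z + \<kappa> (- z) (- z) * indicator {a<..b} (- z)"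
   using 2 a ev[of "-z" z] by (auto simp: indicator_def abs_if split: if_splits)
  then show ?thesis using eq ft[of "\<bar>z\<bar>"] 2 by simp
 next
  case 3
  then have "{max a \<bar>z\<bar>..b} = {}" by auto
  then have "(LINT r:{max a \<bar>z\<bar>..b}|lborel. \<kappa>t r z) = 0" by (simp only: set_int_def) simp
  then show ?thesis using eq 3 ab a by (auto simp: indicator_def abs_if split: if_splits)
 qed
qed

lemma conv_time_increment:
 assumes k: "cone_kernel \<kappa> \<kappa>t \<kappa>z" and h: "integrable lborel h" and a: "0 <= a" and ab: "a <= b"
 shows "conv \<kappa> b h x - conv \<kappa> a h x
  = (LINT r:{a..b}|lborel. \<kappa> r r * (h (x + r) + h (x - r)) + conv \<kappa>t r h x)"
  and "set_integrable lborel {a..b} (\<lambda>r. \<kappa> r r * (h (x + r) + h (x - r)) + conv \<kappa>t r h x)"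
proof -
 have c: "jcont \<kappa>" "jcont \<kappa>t" using k by (auto simp: cone_kernel_def)
 have [measurable]: "h \<in> borel_measurable borel" using h by auto
 obtain B where B: "B \<ge> 0" "!!s z. \<bar>s\<bar> <= b ==> \<bar>z\<bar> <= b ==> \<bar>\<kappa> s z\<bar> <= B"
  using jcont_bound[OF c(1), of b] by blast
 obtain C where C: "C \<ge> 0" "!!s z. \<bar>s\<bar> <= b ==> \<bar>z\<bar> <= b ==> \<bar>\<kappa>t s z\<bar> <= C"
  using jcont_bound[OF c(2), of b] by blast
 define k1 where "k1 = (\<lambda>r y. if \<bar>x - y\<bar> <= r then \<kappa> r (x - y) else 0)"
 define k2 where "k2 = (\<lambda>r y. if \<bar>x - y\<bar> <= r then \<kappa>t r (x - y) else 0)"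
 have [measurable]: "(\<lambda>y. \<kappa> r (x - y)) \<in> borel_measurable borel" for r
  by (rule jcont_measurable[OF c(1)]) measurable
 have [measurable]: "(\<lambda>r. \<kappa> r r) \<in> borel_measurable borel"
  by (rule jcont_measurable[OF c(1)]) measurable
 have k1m: "k1 r \<in> borel_measurable borel" for r unfolding k1_def by measurable
 have k1i: "integrable lborel (\<lambda>y. k1 r y * h y)" if "0 <= r" "r <= b" for r
 proof (rule integrable_mult_bounded[OF h k1m])
  show "\<bar>k1 r y\<bar> <= B" for y using B that by (auto simp: k1_def)
 qed
 have cv: "conv \<kappa> r h x = (LINT y|lborel. k1 r y * h y)" for r
  unfolding conv_def k1_def by (rule lint_cong) auto
 have [measurable]: "(\<lambda>p. \<kappa>t (fst p) (x - snd p)) \<in> borel_measurable plane"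
  by (rule jcont_measurable[OF c(2)]) measurable
 have k2m: "(\<lambda>(r, y). indicator {a..b} r * k2 r y * h y) \<in> borel_measurable plane"
  unfolding k2_def case_prod_beta' by measurable
 have k2b: "\<bar>k2 r y\<bar> <= C" if "r \<in> {a..b}" for r y using C a that by (auto simp: k2_def)
 have cz: "conv \<kappa>t r h x = (LINT y|lborel. k2 r y * h y)" for r
  unfolding conv_def k2_def by (rule lint_cong) auto
 note iz = kernel_Fubini(1)[OF h k2m k2b, folded cz] and i3 = kernel_Fubini(2)[OF h k2m k2b] and fub = kernel_Fubini(3)[OF h k2m k2b, folded cz]
 have bb: "\<bar>indicator {a<..b} r * \<kappa> r r\<bar> <= B" for r
  using B a by (cases "r \<in> {a<..b}") auto
 have bb': "\<bar>indicator {a..b} r * \<kappa> r r\<bar> <= B" for r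
  using B a by (cases "r \<in> {a..b}") auto
 have hp: "integrable lborel (\<lambda>r. h (x + r))" "integrable lborel (\<lambda>r. h (x - r))"
  using set_integrable_shift(3)[OF h, of 1 x] set_integrable_shift(3)[OF h, of "-1" x] by auto
 have sp: "set_integrable lborel {a..b} (\<lambda>r. \<kappa> r r * h (x + r))" "set_integrable lborel {a..b} (\<lambda>r. \<kappa> r r * h (x - r))"
  using integrable_mult_bounded[OF hp(1) _ bb'] integrable_mult_bounded[OF hp(2) _ bb']
  by (auto simp: set_integrable_def mult.assoc)
 have 1: "(LINT y|lborel. \<kappa> (y - x) (y - x) * indicator {a<..b} (y - x) * h y) = (LINT r:{a..b}|lborel. \<kappa> r r * h (x + r))"
  unfolding set_integral_Ioc_Icc[symmetric] unfolding set_int_def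
  by (subst lborel_integral_real_affine[where c=1 and t=x])
    (auto intro!: lint_cong simp: mult_ac)
 have 2: "(LINT y|lborel. \<kappa> (x - y) (x - y) * indicator {a<..b} (x - y) * h y) = (LINT r:{a..b}|lborel. \<kappa> r r * h (x - r))"
  unfolding set_integral_Ioc_Icc[symmetric] unfolding set_int_def
  by (subst lborel_integral_real_affine[where c="-1" and t=x])
    (auto intro!: lint_cong simp: mult_ac)
 have [measurable]: "(\<lambda>y. \<kappa> (x - y) (x - y)) \<in> borel_measurable borel" "(\<lambda>y. \<kappa> (y - x) (y - x)) \<in> borel_measurable borel"
  by (rule jcont_measurable[OF c(1)]; measurable)+
 have i1: "integrable lborel (\<lambda>y. \<kappa> (y - x) (y - x) * indicator {a<..b} (y - x) * h y)"
  by (rule integrable_mult_bounded[OF h, where B=B]) (use bb[of "_ - x"] in \<open>auto simp: mult.commute\<close>)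
 have i2: "integrable lborel (\<lambda>y. \<kappa> (x - y) (x - y) * indicator {a<..b} (x - y) * h y)"
  by (rule integrable_mult_bounded[OF h, where B=B]) (use bb[of "x - _"] in \<open>auto simp: mult.commute\<close>)
 have "conv \<kappa> b h x - conv \<kappa> a h x = (LINT y|lborel. (k1 b y - k1 a y) * h y)"
  unfolding cv left_diff_distrib using k1i[of b] k1i[of a] a ab by simp
 also have "\<dots> = (LINT y|lborel. \<kappa> (x - y) (x - y) * indicator {a<..b} (x - y) * h y
   + \<kappa> (y - x) (y - x) * indicator {a<..b} (y - x) * h y + (LINT r:{a..b}|lborel. k2 r y) * h y)"
  unfolding k1_def k2_def cone_kernel_time_increment[OF k a ab]
  by (rule lint_cong) (auto simp: algebra_simps)
 also have "\<dots> = (LINT r:{a..b}|lborel. \<kappa> r r * h (x - r)) + (LINT r:{a..b}|lborel. \<kappa> r r * h (x + r))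
   + (LINT r:{a..b}|lborel. conv \<kappa>t r h x)"
  using i1 i2 i3 fub 1 2 by simp
 also have "\<dots> = (LINT r:{a..b}|lborel. \<kappa> r r * h (x - r) + \<kappa> r r * h (x + r) + conv \<kappa>t r h x)"
  using sp iz by (simp add: set_integral_add)
 finally show "conv \<kappa> b h x - conv \<kappa> a h x
  = (LINT r:{a..b}|lborel. \<kappa> r r * (h (x + r) + h (x - r)) + conv \<kappa>t r h x)"
  by (simp add: algebra_simps)
 show "set_integrable lborel {a..b} (\<lambda>r. \<kappa> r r * (h (x + r) + h (x - r)) + conv \<kappa>t r h x)"
  using set_integral_add(1)[OF set_integral_add(1)[OF sp] iz] by (simp add: algebra_simps)
qed

section \<open>The Duhamel integral\<close>

definition duh :: "(real => real => real) => (real => real => real) => real => real => real" where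
 "duh \<kappa> F t x = (LINT s:{0..t}|lborel. conv \<kappa> (t - s) (F s) x)"

definition supported :: "real => (real => real) => bool" where
 "supported R h \<longleftrightarrow> (\<forall>y. y < - R \<or> R < y --> h y = 0)"

text \<open>A forcing term with finite speed of propagation. The bound uses \<open>\<bar>s\<bar>\<close> to be
  meaningful for all real \<open>s\<close>.\<close>

definition source :: "real => (real => real => real) => bool" where
 "source R F \<longleftrightarrow> jcont F \<and> (\<forall>s. supported (R + \<bar>s\<bar>) (F s))"

lemma jcont_slice:
 assumes "jcont F" shows "continuous_on UNIV (F s)" "continuous_on UNIV (\<lambda>s. F s x)"
  "F s \<in> borel_measurable borel" "(\<lambda>s. F s x) \<in> borel_measurable borel"
proof -
 show 1: "continuous_on UNIV (F s)" "continuous_on UNIV (\<lambda>s. F s x)"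
  by (rule continuous_at_imp_continuous_on; auto intro!: jcont_isCont[OF assms] continuous_intros)+
 show "F s \<in> borel_measurable borel" "(\<lambda>s. F s x) \<in> borel_measurable borel"
  using 1 by (auto intro: borel_measurable_continuous_onI)
qed

lemma source_integrable: "source R F ==> integrable lborel (F s)"
 by (rule integrable_compact_support[where a="-(R + \<bar>s\<bar>)" and b="R + \<bar>s\<bar>"])
   (auto simp: source_def supported_def jcont_slice(1))

lemma conv_eq_0:
 assumes "!!y. \<bar>x - y\<bar> <= t ==> h y = 0" shows "conv \<kappa> t h x = 0"
proof -
 have "(\<lambda>y. if \<bar>x - y\<bar> <= t then \<kappa> t (x - y) * h y else 0) = (\<lambda>y. 0)" using assms by auto
 then show ?thesis unfolding conv_def by simp
qed

lemma supported_conv: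
 assumes "supported R h" shows "supported (R + \<bar>t\<bar>) (conv \<kappa> t h)"
 unfolding supported_def
proof (intro allI impI conv_eq_0)
 fix x y assume "x < - (R + \<bar>t\<bar>) \<or> R + \<bar>t\<bar> < x" "\<bar>x - y\<bar> <= t"
 then have "y < - R \<or> R < y" by (auto simp: abs_if split: if_splits)
 then show "h y = 0" using assms by (auto simp: supported_def)
qed

lemma set_integral_eq_0: "(!!s. s \<in> A ==> c s = (0::real)) ==> (LINT s:A|lborel. c s) = 0"
proof -
 assume "!!s. s \<in> A ==> c s = 0"
 then have "(\<lambda>s. indicator A s *\<^sub>R c s) = (\<lambda>s. 0)" by (auto simp: indicator_def)
 then show ?thesis by (simp add: set_int_def)
qed

lemma conv_source_eq_0:
 assumes F: "!!s. supported (R + \<bar>s\<bar>) (F s)" and x: "x < - (R + \<bar>t\<bar>) \<or> R + \<bar>t\<bar> < x" and s: "s \<in> {0..t}"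
 shows "conv \<kappa> (t - s) (F s) x = 0"
 using supported_conv[OF F, of s "t - s" \<kappa>] x s by (auto simp: supported_def)

lemma supported_duh:
 assumes F: "!!s. supported (R + \<bar>s\<bar>) (F s)" shows "supported (R + \<bar>t\<bar>) (duh \<kappa> F t)"
 unfolding supported_def duh_def
 by (intro allI impI set_integral_eq_0 conv_source_eq_0[OF F])

text \<open>The interval \<open>[0, t]\<close> is the cone over the point \<open>t / 2\<close> of radius
  \<open>t / 2\<close>, so the continuity of cone integrals applies.\<close>

lemma jcont_time_integral:
 assumes c: "continuous_on UNIV (c :: real \<times> real \<times> real => real)"
 shows "jcont (\<lambda>t x. LINT s:{0..t}|lborel. c (t - s, s, x))"
proof -
 have cc: "isCont c p" for p using c continuous_on_eq_continuous_at[of UNIV c] by blast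
 have "isCont (\<lambda>p. LINT s:{0..fst p}|lborel. c (fst p - s, s, snd p)) p0" for p0 :: "real \<times> real"
 proof -
  define L where "L = \<bar>fst p0\<bar> + \<bar>snd p0\<bar> + 1"
  have "\<exists>B\<ge>0. \<forall>q\<in>{-L..L} \<times> {-L..L} \<times> {-L..L}. \<bar>c q\<bar> <= B"
   by (rule continuous_compact_bounded[OF compact_Times[OF _ compact_Times] continuous_on_subset[OF c]]) auto
  then obtain B where B: "B \<ge> 0" "!!q. q \<in> {-L..L} \<times> {-L..L} \<times> {-L..L} ==> \<bar>c q\<bar> <= B" by blast
  have "isCont (\<lambda>p. LINT s|lborel. (if \<bar>fst p / 2 - s\<bar> <= fst p / 2 then c (fst p - s, s, snd p) else 0)) p0"
  proof (rule isCont_cone_integral[where d=1 and w="\<lambda>s. indicator {-L..L} s * B"])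
   show "isCont (\<lambda>p. c (fst p - s, s, snd p)) p0" for s
    by (rule isCont_o2[OF _ cc]) (auto intro!: continuous_intros)
   show "(\<lambda>s. c (fst p - s, s, snd p)) \<in> borel_measurable borel" for p
   proof (rule borel_measurable_continuous_onI[OF continuous_at_imp_continuous_on])
    show "\<forall>s\<in>UNIV. isCont (\<lambda>s. c (fst p - s, s, snd p)) s"
     by (intro ballI isCont_o2[OF _ cc]) (auto intro!: continuous_intros)
   qed
   show "integrable lborel (\<lambda>s. indicator {-L..L} s * B)"
    by (auto intro!: integrable_mult_left integrable_real_indicator simp: emeasure_lborel_Icc_eq)
   fix p :: "real \<times> real" and s assume p: "dist p p0 < 1" "\<bar>fst p / 2 - s\<bar> <= fst p / 2"
   have d: "\<bar>fst p - fst p0\<bar> < 1" "\<bar>snd p - snd p0\<bar> < 1"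
    using dist_fst_le[of p p0] dist_snd_le[of p p0] p(1) by (auto simp: dist_real_def)
   have s: "0 <= s" "s <= fst p" using p(2) by (auto simp: abs_if split: if_splits)
   have m: "fst p - s \<in> {-L..L}" "s \<in> {-L..L}" "snd p \<in> {-L..L}"
    using s d unfolding L_def by auto
   then have "\<bar>c (fst p - s, s, snd p)\<bar> <= B" by (intro B(2)) auto
   then show "\<bar>c (fst p - s, s, snd p)\<bar> <= indicator {-L..L} s * B" using m(2) by simp
  qed (use B(1) in \<open>auto intro!: continuous_intros\<close>)
  moreover have "(LINT s:{0..fst p}|lborel. c (fst p - s, s, snd p))
    = (LINT s|lborel. (if \<bar>fst p / 2 - s\<bar> <= fst p / 2 then c (fst p - s, s, snd p) else 0))" for p :: "real \<times> real"
  proof -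
   have "s \<in> {0..fst p} \<longleftrightarrow> \<bar>fst p / 2 - s\<bar> <= fst p / 2" for s
    by (auto simp: abs_if split: if_splits)
   then show ?thesis unfolding set_int_def
    by (intro lint_cong) (auto simp: indicator_def)
  qed
  ultimately show ?thesis by simp
 qed
 then show ?thesis by (simp add: continuous_on_eq_continuous_at)
qed

lemma jcont_duh:
 assumes "jcont \<kappa>" "jcont F" shows "jcont (duh \<kappa> F)"
 using jcont_time_integral[OF continuous_conv_param[OF assms]]
 by (simp add: duh_def[abs_def])

lemma continuous_cone_derivative:
 assumes \<kappa>: "jcont \<kappa>" "jcont \<kappa>'" and F: "jcont F"
 shows "continuous_on UNIV (\<lambda>p::real\<times>real\<times>real. \<kappa> (fst p) (fst p) *
   (F (fst (snd p)) (snd (snd p) + fst p) + \<sigma> * F (fst (snd p)) (snd (snd p) - fst p))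
   + conv \<kappa>' (fst p) (F (fst (snd p))) (snd (snd p)))"
proof -
 have "isCont (\<lambda>p::real\<times>real\<times>real. \<kappa> (fst p) (fst p) *
   (F (fst (snd p)) (snd (snd p) + fst p) + \<sigma> * F (fst (snd p)) (snd (snd p) - fst p))
   + conv \<kappa>' (fst p) (F (fst (snd p))) (snd (snd p))) p" for p
 proof (intro continuous_add continuous_mult continuous_const jcont_isCont[OF \<kappa>(1)] jcont_isCont[OF F])
  show "isCont (\<lambda>p::real\<times>real\<times>real. conv \<kappa>' (fst p) (F (fst (snd p))) (snd (snd p))) p"
   using continuous_conv_param[OF \<kappa>(2) F] continuous_on_eq_continuous_at[OF open_UNIV] by blast
 qed (auto intro!: continuous_intros)
 then show ?thesis by (simp add: continuous_on_eq_continuous_at)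
qed

lemma jcont_pair_measurable:
 "jcont G ==> (\<lambda>(r, x). G r x) \<in> borel_measurable plane"
 unfolding case_prod_beta' by (rule jcont_measurable) auto

lemma continuous_set_integrable:
 fixes f :: "real => real"
 assumes "continuous_on UNIV f" shows "set_integrable lborel {a..b} f"
 by (rule borel_integrable_atLeastAtMost') (use assms continuous_on_subset in blast)

lemma Fubini_rectangle:
 assumes G: "jcont G"
 shows "(LINT s:{a..b}|lborel. LINT x:{c..d}|lborel. G s x) = (LINT x:{c..d}|lborel. LINT s:{a..b}|lborel. G s x)"
  "set_integrable lborel {a..b} (\<lambda>s. LINT x:{c..d}|lborel. G s x)"
proof -
 define L where "L = \<bar>a\<bar> + \<bar>b\<bar> + \<bar>c\<bar> + \<bar>d\<bar>"
 obtain B where B: "B \<ge> 0" "!!t z. \<bar>t\<bar> <= L ==> \<bar>z\<bar> <= L ==> \<bar>G t z\<bar> <= B"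
  using jcont_bound[OF G, of L] by blast
 have [measurable]: "(\<lambda>p. G (fst p) (snd p)) \<in> borel_measurable plane"
  by (rule jcont_measurable[OF G]) auto
 have m: "(\<lambda>(s, x). indicator {a..b} s * indicator {c..d} x * G s x) \<in> borel_measurable plane"
  unfolding case_prod_beta' by measurable
 have i: "integrable plane (\<lambda>(s, x). indicator {a..b} s * indicator {c..d} x * G s x)"
 proof (rule integrable_pair_bound[OF m, where g="\<lambda>s. indicator {a..b} s" and h="\<lambda>x. indicator {c..d} x * B"])
  show "\<bar>indicator {a..b} s * indicator {c..d} x * G s x\<bar> <= indicator {a..b} s * (indicator {c..d} x * B)" for s x
  proof (cases "s \<in> {a..b} \<and> x \<in> {c..d}")
   case True
   then have "\<bar>G s x\<bar> <= B" by (intro B(2)) (auto simp: L_def)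
   then show ?thesis using True by simp
  qed (auto simp: indicator_def)
 qed (auto intro!: integrable_mult_left integrable_real_indicator simp: emeasure_lborel_Icc_eq)
 have 1: "(LINT x|lborel. indicator {a..b} s * indicator {c..d} x * G s x) = indicator {a..b} s *\<^sub>R (LINT x:{c..d}|lborel. G s x)" for s
  by (simp add: set_int_def mult.assoc)
 show "set_integrable lborel {a..b} (\<lambda>s. LINT x:{c..d}|lborel. G s x)"
  using lborel_pair.integrable_fst'[OF i] 1 by (simp add: set_integrable_def)
 have "(LINT s|lborel. indicator {a..b} s * indicator {c..d} x * G s x) = indicator {c..d} x *\<^sub>R (LINT s:{a..b}|lborel. G s x)" for x
 proof -
  have "(LINT s|lborel. indicator {a..b} s * indicator {c..d} x * G s x) = (LINT s|lborel. indicator {c..d} x * (indicator {a..b} s * G s x))"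
   by (rule lint_cong) (auto simp: mult_ac)
  then show ?thesis by (simp add: set_int_def)
 qed
 with 1 show "(LINT s:{a..b}|lborel. LINT x:{c..d}|lborel. G s x) = (LINT x:{c..d}|lborel. LINT s:{a..b}|lborel. G s x)"
  using lborel_pair.Fubini_integral[OF i] by (simp add: set_int_def)
qed

lemma Fubini_triangle:
 assumes G: "jcont G"
 shows "(LINT s:{0..t}|lborel. LINT \<tau>:{s..t}|lborel. G s \<tau>) = (LINT \<tau>:{0..t}|lborel. LINT s:{0..\<tau>}|lborel. G s \<tau>)"
proof -
 obtain B where B: "B \<ge> 0" "!!s z. \<bar>s\<bar> <= \<bar>t\<bar> ==> \<bar>z\<bar> <= \<bar>t\<bar> ==> \<bar>G s z\<bar> <= B"
  using jcont_bound[OF G, of "\<bar>t\<bar>"] by blast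
 have [measurable]: "(\<lambda>p. G (fst p) (snd p)) \<in> borel_measurable plane"
  by (rule jcont_measurable[OF G]) auto
 let ?f = "\<lambda>s \<tau>. if 0 <= s \<and> s <= \<tau> \<and> \<tau> <= t then G s \<tau> else 0"
 have m: "(\<lambda>(s, \<tau>). ?f s \<tau>) \<in> borel_measurable plane"
  unfolding case_prod_beta' by measurable
 have i: "integrable plane (\<lambda>(s, \<tau>). ?f s \<tau>)"
 proof (rule integrable_pair_bound[OF m, where g="\<lambda>s. indicator {0..t} s" and h="\<lambda>x. indicator {0..t} x * B"])
  show "\<bar>?f s x\<bar> <= indicator {0..t} s * (indicator {0..t} x * B)" for s x
  proof (cases "0 <= s \<and> s <= x \<and> x <= t")
   case True
   then have "\<bar>G s x\<bar> <= B" by (intro B(2)) auto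
   then show ?thesis using True by simp
  next
   case False
   then have "?f s x = 0" by auto
   then show ?thesis using B(1) by (simp del: if_not_P)
  qed
 qed (auto intro!: integrable_mult_left integrable_real_indicator simp: emeasure_lborel_Icc_eq)
 have 1: "(LINT \<tau>|lborel. ?f s \<tau>) = indicator {0..t} s *\<^sub>R (LINT \<tau>:{s..t}|lborel. G s \<tau>)" for s
 proof (cases "s \<in> {0..t}")
  case True
  then show ?thesis unfolding set_int_def
   by (auto intro!: lint_cong simp: indicator_def)
 next
  case False
  then have "?f s = (\<lambda>\<tau>. 0)" by auto
  then have "(LINT \<tau>|lborel. ?f s \<tau>) = (LINT \<tau>::real|lborel. 0)" by (rule arg_cong)
  then show ?thesis using False by simp
 qed
 have 2: "(LINT s|lborel. ?f s \<tau>) = indicator {0..t} \<tau> *\<^sub>R (LINT s:{0..\<tau>}|lborel. G s \<tau>)" for \<tau>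
 proof (cases "\<tau> \<in> {0..t}")
  case True
  then show ?thesis unfolding set_int_def
   by (auto intro!: lint_cong simp: indicator_def)
 next
  case False
  then have "(\<lambda>s. ?f s \<tau>) = (\<lambda>\<tau>. 0)" by auto
  then have "(LINT s|lborel. ?f s \<tau>) = (LINT \<tau>::real|lborel. 0)" by (rule arg_cong)
  then show ?thesis using False by simp
 qed
 show ?thesis
  using lborel_pair.Fubini_integral[OF i] unfolding 1 2 by (simp add: set_int_def)
qed

lemma conv_0: "conv \<kappa> 0 h x = 0"
proof -
 have "conv \<kappa> 0 h x = (LINT (y::real)|lborel. (0::real))"
  unfolding conv_def by (rule integral_discrete_difference[where X="{x}"]) auto
 then show ?thesis by simp
qed

text \<open>The derivatives of the Duhamel integral come from the increment formulas for \<open>conv\<close>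
  after interchanging integrals, over a rectangle for the space increment and over a triangle for the time
  increment.\<close>

lemma energy_curve_duh:
 assumes k: "cone_kernel \<kappa> \<kappa>t \<kappa>z" and F: "source R F" and S: "S \<subseteq> {0..}"
 shows "energy_curve S (duh \<kappa> F)"
proof -
 have c: "jcont \<kappa>" "jcont \<kappa>t" "jcont \<kappa>z"
  using k by (auto simp: cone_kernel_def)
 have Fc: "jcont F" and Fs: "!!s. supported (R + \<bar>s\<bar>) (F s)" using F by (auto simp: source_def)
 note Fi = source_integrable[OF F]
 define cx where "cx = (\<lambda>p::real\<times>real\<times>real. \<kappa> (fst p) (fst p) *
   (F (fst (snd p)) (snd (snd p) + fst p) + (-1) * F (fst (snd p)) (snd (snd p) - fst p))
   + conv \<kappa>z (fst p) (F (fst (snd p))) (snd (snd p)))"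
 define ct where "ct = (\<lambda>p::real\<times>real\<times>real. \<kappa> (fst p) (fst p) *
   (F (fst (snd p)) (snd (snd p) + fst p) + 1 * F (fst (snd p)) (snd (snd p) - fst p))
   + conv \<kappa>t (fst p) (F (fst (snd p))) (snd (snd p)))"
 have cxc: "continuous_on UNIV cx" unfolding cx_def by (rule continuous_cone_derivative[OF c(1) c(3) Fc])
 have ctc: "continuous_on UNIV ct" unfolding ct_def by (rule continuous_cone_derivative[OF c(1) c(2) Fc])
 define Dx where "Dx = (\<lambda>t x. LINT s:{0..t}|lborel. cx (t - s, s, x))"
 define Dt where "Dt = (\<lambda>t x. LINT s:{0..t}|lborel. ct (t - s, s, x))"
 have cz: "cx (t - s, s, x) = 0" "ct (t - s, s, x) = 0"
  if x: "x < - (R + \<bar>t\<bar>) \<or> R + \<bar>t\<bar> < x" and s: "s \<in> {0..t}" for t s x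
 proof -
  have "F s (x + (t - s)) = 0" "F s (x - (t - s)) = 0"
   using Fs[of s] x s by (auto simp: supported_def)
  then show "cx (t - s, s, x) = 0" "ct (t - s, s, x) = 0"
   using conv_source_eq_0[OF Fs x s] by (auto simp: cx_def ct_def)
 qed
 have L: "L2cont S (duh \<kappa> F)" "L2cont S Dx" "L2cont S Dt"
 proof -
  show "L2cont S (duh \<kappa> F)"
   by (rule L2cont_continuous_support[OF jcont_duh[OF c(1) Fc], of R])
     (use supported_duh[OF Fs] in \<open>auto simp: supported_def\<close>)
  show "L2cont S Dx" unfolding Dx_def
   by (rule L2cont_continuous_support[OF jcont_time_integral[OF cxc], of R])
     (intro set_integral_eq_0 cz(1))
  show "L2cont S Dt" unfolding Dt_def
   by (rule L2cont_continuous_support[OF jcont_time_integral[OF ctc], of R])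
     (intro set_integral_eq_0 cz(2))
 qed
 have comp: "continuous_on UNIV (\<lambda>w. C (f w, g w, h w))"
  if "continuous_on UNIV C" "continuous_on UNIV f" "continuous_on UNIV g" "continuous_on UNIV h"
  for C :: "real \<times> real \<times> real => real" and f g h :: "'z::topological_space => real"
  by (rule continuous_on_compose2[OF that(1)]) (auto intro!: continuous_on_Pair that(2-))
 have sx: "duh \<kappa> F t b - duh \<kappa> F t a = (LINT x:{a..b}|lborel. Dx t x)" if ab: "a <= b" for t a b
 proof -
  have ci: "set_integrable lborel {0..t} (\<lambda>s. conv \<kappa> (t - s) (F s) x)" for x
   using continuous_set_integrable[OF comp[OF continuous_conv_param[OF c(1) Fc], of "\<lambda>s. t - s" "\<lambda>s. s" "\<lambda>s. x"]]
   by (simp add: continuous_intros)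
  have "duh \<kappa> F t b - duh \<kappa> F t a = (LINT s:{0..t}|lborel. conv \<kappa> (t - s) (F s) b - conv \<kappa> (t - s) (F s) a)"
   unfolding duh_def by (rule set_integral_diff(2)[OF ci ci, symmetric])
  also have "\<dots> = (LINT s:{0..t}|lborel. LINT x:{a..b}|lborel. cx (t - s, s, x))"
  proof (rule set_lebesgue_integral_cong)
   show "\<forall>s. s \<in> {0..t} --> conv \<kappa> (t - s) (F s) b - conv \<kappa> (t - s) (F s) a = (LINT x:{a..b}|lborel. cx (t - s, s, x))"
    using conv_space_increment[OF k Fi _ ab] by (auto simp: cx_def)
  qed simp
  also have "\<dots> = (LINT x:{a..b}|lborel. Dx t x)" unfolding Dx_def
   by (rule Fubini_rectangle(1)) (intro comp[OF cxc] continuous_intros)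
  finally show ?thesis .
 qed
 have wp: "weak_pair (duh \<kappa> F t) (Dx t)" if "t \<in> S" for t
  using L(1,2) that sx jcont_slice(1)[OF jcont_duh[OF c(1) Fc]]
  by (simp add: weak_pair_def L2cont_def)
 have D0: "duh \<kappa> F t x = (LINT \<tau>:{0..t}|lborel. Dt \<tau> x)" for t x
 proof -
  have "duh \<kappa> F t x = (LINT s:{0..t}|lborel. LINT \<tau>:{s..t}|lborel. ct (\<tau> - s, s, x))"
   unfolding duh_def
  proof (rule set_lebesgue_integral_cong)
   show "\<forall>s. s \<in> {0..t} --> conv \<kappa> (t - s) (F s) x = (LINT \<tau>:{s..t}|lborel. ct (\<tau> - s, s, x))"
   proof (intro allI impI)
    fix s assume s: "s \<in> {0..t}"
    have "conv \<kappa> (t - s) (F s) x = (LINT r:{0..t - s}|lborel. ct (r, s, x))"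
     using conv_time_increment(1)[OF k Fi, of 0 "t - s" s x] s by (simp add: conv_0 ct_def)
    also have "\<dots> = (LINT \<tau>:{s + (- s)<..t + (- s)}|lborel. ct (\<tau>, s, x))"
     using set_integral_Ioc_Icc[of 0 "t - s"] by simp
    also have "\<dots> = (LINT \<tau>:{s..t}|lborel. ct (\<tau> - s, s, x))"
     by (subst set_integral_shift(1)) simp
    finally show "conv \<kappa> (t - s) (F s) x = (LINT \<tau>:{s..t}|lborel. ct (\<tau> - s, s, x))" .
   qed
  qed simp
  also have "\<dots> = (LINT \<tau>:{0..t}|lborel. Dt \<tau> x)" unfolding Dt_def
   by (rule Fubini_triangle) (intro comp[OF ctc] continuous_intros)
  finally show ?thesis .
 qed
 have Dtc: "jcont Dt" unfolding Dt_def by (rule jcont_time_integral[OF ctc])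
 have "time_primitive S (duh \<kappa> F) Dt"
  unfolding time_primitive_def
 proof (intro conjI ballI allI impI)
  show "(\<lambda>(r, x). Dt r x) \<in> borel_measurable plane" by (rule jcont_pair_measurable[OF Dtc])
  fix a b x assume ab: "a \<in> S" "b \<in> S" "a <= b"
  have int: "set_integrable lborel {c..d} (\<lambda>r. Dt r x)" for c d
   by (rule continuous_set_integrable[OF jcont_slice(2)[OF Dtc]])
  show "set_integrable lborel {a..b} (\<lambda>r. Dt r x)" by (rule int)
  have e: "{0..b} = {0..a} \<union> {a<..b}" using ab S by auto
  have "(LINT \<tau>:{0..b}|lborel. Dt \<tau> x) = (LINT \<tau>:{0..a}|lborel. Dt \<tau> x) + (LINT \<tau>:{a<..b}|lborel. Dt \<tau> x)"
   unfolding e by (rule set_integral_Un) (auto intro: int set_integrable_subset[OF int[of a b]])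
  then show "duh \<kappa> F b x - duh \<kappa> F a x = (LINT r:{a..b}|lborel. Dt r x)"
   by (simp add: D0 set_integral_Ioc_Icc)
 qed
 then show ?thesis unfolding energy_curve_def using L wp by blast
qed

lemma sq_int_supported_integrable: "sq_int h ==> supported R h ==> integrable lborel h"
 by (rule sq_int_integrable_support[where a="-R" and b=R]) (auto simp: supported_def)

lemma energy_curve_conv:
 assumes k: "cone_kernel \<kappa> \<kappa>t \<kappa>z" and h: "sq_int h" "supported R h" and S: "S \<subseteq> {0..}"
 shows "energy_curve S (\<lambda>t. conv \<kappa> t h)"
proof -
 have c: "jcont \<kappa>" "jcont \<kappa>t" "jcont \<kappa>z"
  using k by (auto simp: cone_kernel_def)
 note hi = sq_int_supported_integrable[OF h]
 have [measurable]: "h \<in> borel_measurable borel" using h by (simp add: sq_int_def)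
 have L: "L2cont S (\<lambda>t. conv \<kappa>' t h)" if "jcont \<kappa>'" for \<kappa>'
  by (rule L2cont_continuous_support[OF jcont_conv[OF that hi], of R])
    (use supported_conv[OF h(2)] in \<open>auto simp: supported_def\<close>)
 have kc: "continuous_on S (\<lambda>t. \<kappa> t t)"
  by (rule continuous_at_imp_continuous_on) (auto intro!: jcont_isCont[OF c(1)])
 define ux where "ux = (\<lambda>t x. \<kappa> t t * (h (x + t) - h (x - t)) + conv \<kappa>z t h x)"
 define ut where "ut = (\<lambda>t x. \<kappa> t t * (h (x + t) + h (x - t)) + conv \<kappa>t t h x)"
 have sh: "L2cont S (\<lambda>t x. h (x + t))" "L2cont S (\<lambda>t x. h (x - t))"
  using L2cont_shift[OF h(1), of 1 S] L2cont_shift[OF h(1), of "-1" S] by simp_all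
 have Lx: "L2cont S ux"
  using L2cont_add[OF L2cont_mult[OF L2cont_add[OF sh(1) L2cont_mult[OF sh(2), of "\<lambda>_. -1"]] kc] L[OF c(3)]]
  by (simp add: ux_def)
 have Lt: "L2cont S ut"
  using L2cont_add[OF L2cont_mult[OF L2cont_add[OF sh] kc] L[OF c(2)]] by (simp add: ut_def)
 have wp: "weak_pair (conv \<kappa> t h) (ux t)" if t: "t \<in> S" for t
  using L[OF c(1)] Lx t conv_space_increment[OF k hi, of t] S jcont_slice(1)[OF jcont_conv[OF c(1) hi]]
  by (auto simp: weak_pair_def L2cont_def ux_def)
 have "time_primitive S (\<lambda>t. conv \<kappa> t h) ut"
  unfolding time_primitive_def
 proof (intro conjI ballI allI impI)
  have [measurable]: "(\<lambda>p. conv \<kappa>t (fst p) h (snd p)) \<in> borel_measurable plane"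
   by (rule jcont_measurable[OF jcont_conv[OF c(2) hi]]) auto
  have [measurable]: "(\<lambda>p. \<kappa> (fst p) (fst p)) \<in> borel_measurable plane"
   by (rule jcont_measurable[OF c(1)]) auto
  show "(\<lambda>(r, x). ut r x) \<in> borel_measurable plane"
   unfolding ut_def case_prod_beta' by measurable
  fix a b x assume ab: "a \<in> S" "b \<in> S" "a <= b"
  then have "0 <= a" using S by auto
  then show "set_integrable lborel {a..b} (\<lambda>r. ut r x)" "conv \<kappa> b h x - conv \<kappa> a h x = (LINT r:{a..b}|lborel. ut r x)"
   unfolding ut_def using conv_time_increment[OF k hi, of a b x] ab(3) by auto
 qed
 then show ?thesis unfolding energy_curve_def using L[OF c(1)] Lx Lt wp by blast
qed

lemma energy_curve_shift:
 assumes f: "weak_pair f f'" and s: "supported R f'" and c: "c = 1 \<or> c = - 1"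
 shows "energy_curve S (\<lambda>t x. f (x + c * t))"
proof -
 have sq: "sq_int f" "sq_int f'" using f by (auto simp: weak_pair_def)
 have fi: "integrable lborel f'" by (rule sq_int_supported_integrable[OF sq(2) s])
 have [measurable]: "f' \<in> borel_measurable borel" using sq by (simp add: sq_int_def)
 have fd: "f b - f a = (LINT y:{a..b}|lborel. f' y)" if "a <= b" for a b using f that by (simp add: weak_pair_def)
 have wp: "weak_pair (\<lambda>x. f (x + d)) (\<lambda>x. f' (x + d))" for d
  unfolding weak_pair_def
 proof (intro conjI allI impI)
  show "continuous_on UNIV (\<lambda>x. f (x + d))"
   by (rule continuous_on_compose2[of UNIV f]) (use f in \<open>auto simp: weak_pair_def intro!: continuous_intros\<close>)
  show "f (b + d) - f (a + d) = (LINT y:{a..b}|lborel. f' (y + d))" if "a <= b" for a b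
   using fd[of "a + d" "b + d"] that set_integral_shift(1)[of a d b f'] by (simp add: set_integral_Ioc_Icc)
 qed (auto intro: sq_int_shift sq)
 have tp: "time_primitive S (\<lambda>t x. f (x + c * t)) (\<lambda>t x. c * f' (x + c * t))"
  unfolding time_primitive_def
 proof (intro conjI ballI allI impI)
  show "(\<lambda>(r, x). c * f' (x + c * r)) \<in> borel_measurable plane"
   unfolding case_prod_beta' by measurable
  fix a b x :: real assume ab: "a <= b"
  have "integrable lborel (\<lambda>r. c * f' (x + c * r))" using set_integrable_shift(3)[OF fi c] by simp
  then show "set_integrable lborel {a..b} (\<lambda>r. c * f' (x + c * r))" by (auto intro: set_integrable_of_integrable)
  show "f (x + c * b) - f (x + c * a) = (LINT r:{a..b}|lborel. c * f' (x + c * r))"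
  proof (cases "c = 1")
   case True
   then show ?thesis
    using fd[of "x + a" "x + b"] ab set_integral_shift(1)[of a x b f'] by (simp add: set_integral_Ioc_Icc add.commute)
  next
   case False
   then have c1: "c = -1" using c by simp
   have "f (x - a) - f (x - b) = (LINT y:{x - b..x - a}|lborel. f' y)" using fd ab by simp
   also have "\<dots> = (LINT r:{a..b}|lborel. f' (x - r))"
    unfolding set_int_def
    by (subst lborel_integral_real_affine[where c="-1" and t=x])
      (auto intro!: lint_cong simp: indicator_def)
   finally show ?thesis using c1 by (simp add: set_int_def)
  qed
 qed
 have "\<forall>t\<in>S. weak_pair (\<lambda>x. f (x + c * t)) (\<lambda>x. f' (x + c * t))" using wp by blast
 moreover have "L2cont S (\<lambda>t x. c * f' (x + c * t))"
  using L2cont_mult[OF L2cont_shift[OF sq(2) c], of S "\<lambda>_. c"] by simp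
 ultimately show ?thesis unfolding energy_curve_def
  using L2cont_shift[OF sq(1) c, of S] L2cont_shift[OF sq(2) c, of S] tp by blast
qed

text \<open>The product rule for an absolutely continuous function, needed for the factor \<open>exp (- t /
  2)\<close> of the damped propagator.\<close>

lemma product_primitive:
 fixes U g m m' :: "real => real"
 assumes ab: "a <= b" and g: "set_integrable lborel {a..b} g"
  and U: "!!r. r \<in> {a..b} ==> U r - U a = (LINT \<rho>:{a..r}|lborel. g \<rho>)"
  and m: "!!r. (m has_field_derivative m' r) (at r)" and m': "continuous_on UNIV m'"
 shows "set_integrable lborel {a..b} (\<lambda>r. m' r * U r + m r * g r)"
  "m b * U b - m a * U a = (LINT r:{a..b}|lborel. m' r * U r + m r * g r)"
proof -
 define G where "G = (\<lambda>\<rho>. indicator {a..b} \<rho> * g \<rho>)"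
 have Gi: "integrable lborel G" using g by (simp add: set_integrable_def G_def)
 then have [measurable]: "G \<in> borel_measurable borel" by auto
 have mc: "continuous_on UNIV m" by (rule continuous_at_imp_continuous_on) (use m DERIV_isCont in blast)
 obtain B where B: "B \<ge> 0" "\<forall>r\<in>{a..b}. \<bar>m r\<bar> <= B"
  using continuous_compact_bounded[of "{a..b}" m] continuous_on_subset[OF mc] by auto
 obtain C where C: "C \<ge> 0" "\<forall>r\<in>{a..b}. \<bar>m' r\<bar> <= C"
  using continuous_compact_bounded[of "{a..b}" m'] continuous_on_subset[OF m'] by auto
 note [measurable] = borel_measurable_continuous_onI[OF mc] borel_measurable_continuous_onI[OF m']
 let ?f = "\<lambda>r \<rho>. if a <= \<rho> \<and> \<rho> <= r \<and> r <= b then m' r * G \<rho> else 0"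
 have fm: "(\<lambda>(r, \<rho>). ?f r \<rho>) \<in> borel_measurable plane" unfolding case_prod_beta' by measurable
 have fi: "integrable plane (\<lambda>(r, \<rho>). ?f r \<rho>)"
 proof (rule integrable_pair_bound[OF fm, where g="\<lambda>r. indicator {a..b} r * C" and h="\<lambda>\<rho>. \<bar>G \<rho>\<bar>"])
  show "\<bar>?f r \<rho>\<bar> <= indicator {a..b} r * C * \<bar>G \<rho>\<bar>" for r \<rho>
   using C by (auto simp: abs_mult mult_right_mono)
 qed (use Gi in \<open>auto intro!: integrable_mult_left integrable_real_indicator simp: emeasure_lborel_Icc_eq\<close>)
 have 1: "(LINT \<rho>|lborel. ?f r \<rho>) = indicator {a..b} r *\<^sub>R (m' r * (U r - U a))" for r
 proof (cases "r \<in> {a..b}")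
  case True
  have "(LINT \<rho>|lborel. ?f r \<rho>) = (LINT \<rho>|lborel. m' r * (indicator {a..r} \<rho> *\<^sub>R g \<rho>))"
   by (rule lint_cong) (use True in \<open>auto simp: G_def\<close>)
  then show ?thesis using U[OF True] True by (simp add: set_int_def)
 next
  case False
  then have "?f r = (\<lambda>\<tau>. 0)" by (auto simp: fun_eq_iff)
  then have "(LINT \<tau>|lborel. ?f r \<tau>) = (LINT \<tau>::real|lborel. 0)" by (rule arg_cong)
  then show ?thesis using False by simp
 qed
 have 2: "(LINT r|lborel. ?f r \<rho>) = indicator {a..b} \<rho> *\<^sub>R ((m b - m \<rho>) * g \<rho>)" for \<rho>
 proof (cases "\<rho> \<in> {a..b}")
  case True
  have "(LINT r|lborel. ?f r \<rho>) = (LINT r|lborel. (indicator {\<rho>..b} r *\<^sub>R m' r) * g \<rho>)"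
   by (rule lint_cong) (use True in \<open>auto simp: G_def\<close>)
  also have "\<dots> = (LINT r:{\<rho>..b}|lborel. m' r) * g \<rho>" by (simp add: set_int_def)
  also have "(LINT r:{\<rho>..b}|lborel. m' r) = m b - m \<rho>" by (rule set_integral_FTC) (use True m m' in auto)
  finally show ?thesis using True by simp
 next
  case False
  then have "(\<lambda>r. ?f r \<rho>) = (\<lambda>\<tau>. 0)" by (auto simp: fun_eq_iff)
  then have "(LINT r|lborel. ?f r \<rho>) = (LINT \<tau>::real|lborel. 0)" by (rule arg_cong)
  then show ?thesis using False by simp
 qed
 have i1: "set_integrable lborel {a..b} (\<lambda>r. m' r * (U r - U a))"
  using lborel_pair.integrable_fst'[OF fi] by (simp add: set_integrable_def 1)
 have im': "set_integrable lborel {a..b} m'" by (rule continuous_set_integrable[OF m'])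
 have i2: "set_integrable lborel {a..b} (\<lambda>r. m r * g r)"
 proof -
  have "integrable lborel (\<lambda>r. (indicator {a..b} r * m r) * G r)"
   by (rule integrable_mult_bounded[OF Gi, where B=B]) (use B in \<open>auto simp: indicator_def\<close>)
  moreover have "(\<lambda>r. (indicator {a..b} r * m r) * G r) = (\<lambda>r. indicator {a..b} r *\<^sub>R (m r * g r))"
   by (auto simp: G_def indicator_def fun_eq_iff)
  ultimately show ?thesis by (simp add: set_integrable_def)
 qed
 have eq: "m' r * U r + m r * g r = (m' r * (U r - U a) + m' r * U a) + m r * g r" for r
  by (simp add: algebra_simps)
 show "set_integrable lborel {a..b} (\<lambda>r. m' r * U r + m r * g r)"
  unfolding eq by (intro set_integral_add(1) i1 i2 set_integrable_mult_left) (use im' in auto)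
 have fub: "(LINT r:{a..b}|lborel. m' r * (U r - U a)) = (LINT \<rho>:{a..b}|lborel. (m b - m \<rho>) * g \<rho>)"
  using lborel_pair.Fubini_integral[OF fi] unfolding 1 2 by (simp add: set_int_def)
 have "(LINT r:{a..b}|lborel. m' r * U r + m r * g r)
   = (LINT r:{a..b}|lborel. m' r * (U r - U a)) + (LINT r:{a..b}|lborel. m' r * U a) + (LINT r:{a..b}|lborel. m r * g r)"
  unfolding eq using i1 i2 set_integrable_mult_left[of "U a" lborel "{a..b}" m'] im'
  by (simp add: set_integral_add)
 also have "(LINT r:{a..b}|lborel. m' r * U a) = (m b - m a) * U a"
  using set_integral_FTC[OF ab m m'] by (simp add: set_int_def mult.assoc[symmetric])
 also have "(LINT r:{a..b}|lborel. m' r * (U r - U a)) = (LINT \<rho>:{a..b}|lborel. m b * g \<rho> - m \<rho> * g \<rho>)"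
  unfolding fub by (simp add: algebra_simps)
 also have "\<dots> = m b * (U b - U a) - (LINT \<rho>:{a..b}|lborel. m \<rho> * g \<rho>)"
  using set_integrable_mult_right[of "m b" lborel "{a..b}" g] g i2 U[of b] ab by (simp add: set_integral_diff(2))
 finally show "m b * U b - m a * U a = (LINT r:{a..b}|lborel. m' r * U r + m r * g r)"
  by (simp add: algebra_simps)
qed

lemma energy_curve_mult:
 assumes u: "energy_curve S u" and um: "jcont u"
  and S: "!!a b. a \<in> S ==> b \<in> S ==> {a..b} \<subseteq> S"
  and m: "!!r. (m has_field_derivative m' r) (at r)" and m': "continuous_on UNIV m'"
 shows "energy_curve S (\<lambda>t x. m t * u t x)"
proof -
 obtain ux ut where e: "L2cont S u" "L2cont S ux" "L2cont S ut" "!!t. t \<in> S ==> weak_pair (u t) (ux t)" "time_primitive S u ut"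
  using u by (auto simp: energy_curve_def)
 have mc: "continuous_on UNIV m" by (rule continuous_at_imp_continuous_on) (use m DERIV_isCont in blast)
 have mS: "continuous_on S m" "continuous_on S m'" using mc m' continuous_on_subset by blast+
 have wp: "weak_pair (\<lambda>x. m t * u t x) (\<lambda>x. m t * ux t x)" if "t \<in> S" for t
  using e(4)[OF that] by (auto simp: weak_pair_def right_diff_distrib[symmetric] set_int_def
    mult.left_commute intro: sq_int_cmult continuous_intros)
 have tp: "time_primitive S (\<lambda>t x. m t * u t x) (\<lambda>t x. m' t * u t x + m t * ut t x)"
  unfolding time_primitive_def
 proof (intro conjI ballI allI impI)
  have [measurable]: "(\<lambda>(r, x). ut r x) \<in> borel_measurable plane" using e(5) by (simp add: time_primitive_def)
  note [measurable] = jcont_pair_measurable[OF um]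
   borel_measurable_continuous_onI[OF mc] borel_measurable_continuous_onI[OF m']
  show "(\<lambda>(r, x). m' r * u r x + m r * ut r x) \<in> borel_measurable plane"
   by measurable
  fix a b x assume ab: "a \<in> S" "b \<in> S" "a <= b"
  have g: "set_integrable lborel {a..b} (\<lambda>r. ut r x)" using e(5) ab by (auto simp: time_primitive_def)
  have U: "u r x - u a x = (LINT \<rho>:{a..r}|lborel. ut \<rho> x)" if "r \<in> {a..b}" for r
   using e(5) ab that S[OF ab(1,2)] unfolding time_primitive_def by (meson atLeastAtMost_iff subsetD)
  show "set_integrable lborel {a..b} (\<lambda>r. m' r * u r x + m r * ut r x)"
   "m b * u b x - m a * u a x = (LINT r:{a..b}|lborel. m' r * u r x + m r * ut r x)"
   using product_primitive[OF ab(3) g, of "\<lambda>r. u r x" m m'] U m m' by auto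
 qed
 have L: "L2cont S (\<lambda>t x. m t * u t x)" "L2cont S (\<lambda>t x. m t * ux t x)" "L2cont S (\<lambda>t x. m' t * u t x + m t * ut t x)"
  by (intro L2cont_mult L2cont_add e mS)+
 show ?thesis unfolding energy_curve_def using L wp tp by blast
qed

section \<open>The kernels of the two propagators\<close>

text \<open>The Bessel functions \<open>I\<^sub>0\<close> and \<open>I\<^sub>1\<close> as entire functions of
  the squared argument: \<open>I\<^sub>j(sqrt \<zeta> / 2) = (sqrt \<zeta> / 4)\<^sup>j bk j \<zeta>\<close>. In
  this form the kernels are smooth across the light cone.\<close>

definition bk :: "nat => real => real" where
 "bk j \<zeta> = (\<Sum>k. 1 / (16 ^ k * fact k * fact (k + j)) * \<zeta> ^ k)"

lemma bk_summable: "summable (\<lambda>k. 1 / (16 ^ k * fact k * fact (k + j)) * \<zeta> ^ k :: real)"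
proof (rule summable_comparison_test')
 show "summable (\<lambda>k. inverse (fact k) * \<bar>\<zeta>\<bar> ^ k)" by (rule summable_exp)
 fix k :: nat
 have "(1::real) * fact k * 1 <= 16 ^ k * fact k * fact (k + j)"
  by (intro mult_mono) auto
 then have "1 / (16 ^ k * fact k * fact (k + j)) <= inverse (fact k :: real)"
  by (simp add: divide_inverse le_imp_inverse_le del: mult_1 inverse_mult_distrib)
 then have "1 / (16 ^ k * fact k * fact (k + j)) * \<bar>\<zeta>\<bar> ^ k <= inverse (fact k) * \<bar>\<zeta>\<bar> ^ k"
  by (rule mult_right_mono) simp
 then show "norm (1 / (16 ^ k * fact k * fact (k + j)) * \<zeta> ^ k) <= inverse (fact k) * \<bar>\<zeta>\<bar> ^ k"
  by (simp add: power_abs)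
qed

lemma bk_deriv: "(bk j has_field_derivative bk (Suc j) \<zeta> / 16) (at \<zeta>)"
proof -
 define c where "c = (\<lambda>j k. 1 / (16 ^ k * fact k * fact (k + j)) :: real)"
 have bk: "bk j = (\<lambda>x. \<Sum>k. c j k * x ^ k)" for j by (simp only: bk_def[abs_def] c_def)
 have s: "summable (\<lambda>k. c j k * x ^ k)" for j x unfolding c_def by (rule bk_summable)
 have dk: "diffs (c j) k = c (Suc j) k / 16" for k
 proof -
  have n: "real k + 1 \<noteq> 0" by linarith
  have "diffs (c j) k = (real k + 1) * (1 / (16 * 16 ^ k * ((real k + 1) * fact k) * fact (k + Suc j)))"
   by (simp add: diffs_def add.commute c_def)
  also have "\<dots> = (1 / (16 ^ k * fact k * fact (k + Suc j))) / 16" using n by simp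
  finally show ?thesis unfolding c_def .
 qed
 have "((\<lambda>x. \<Sum>k. c j k * x ^ k) has_field_derivative (\<Sum>k. diffs (c j) k * \<zeta> ^ k)) (at \<zeta>)"
  by (rule termdiffs_strong_converges_everywhere[OF s])
 moreover have "(\<Sum>k. diffs (c j) k * \<zeta> ^ k) = (\<Sum>k. c (Suc j) k * \<zeta> ^ k / 16)"
  unfolding dk by simp
 moreover have "(\<Sum>k. c (Suc j) k * \<zeta> ^ k / 16) = (\<Sum>k. c (Suc j) k * \<zeta> ^ k) / 16"
  by (rule suminf_divide[OF s])
 ultimately show ?thesis by (simp only: bk)
qed

lemma continuous_bk: "continuous_on UNIV (bk j)"
 by (rule continuous_at_imp_continuous_on) (use DERIV_isCont[OF bk_deriv] in blast)

lemma bk_nonneg: "0 <= \<zeta> ==> 0 <= bk j \<zeta>"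
 unfolding bk_def by (rule suminf_nonneg[OF bk_summable]) auto

lemma bk_mono: "0 <= \<zeta> ==> \<zeta> <= \<xi> ==> bk j \<zeta> <= bk j \<xi>"
 unfolding bk_def by (rule suminf_le[OF _ bk_summable bk_summable]) (auto intro!: divide_right_mono power_mono)

lemma cone_kernel_radial:
 assumes m: "!!r. (m has_field_derivative m' r) (at r)" "continuous_on UNIV m'"
  and \<phi>: "!!\<zeta>. (\<phi> has_field_derivative \<phi>' \<zeta>) (at \<zeta>)" "continuous_on UNIV \<phi>'"
 shows "cone_kernel (\<lambda>t z. m t * \<phi> (t\<^sup>2 - z\<^sup>2))
  (\<lambda>t z. m' t * \<phi> (t\<^sup>2 - z\<^sup>2) + m t * (\<phi>' (t\<^sup>2 - z\<^sup>2) * (2 * t)))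
  (\<lambda>t z. m t * (\<phi>' (t\<^sup>2 - z\<^sup>2) * (- 2 * z)))"
proof -
 have c: "isCont m r" "isCont m' r" "isCont \<phi> r" "isCont \<phi>' r" for r
  using m \<phi> DERIV_isCont continuous_on_eq_continuous_at[OF open_UNIV] by blast+
 have cc: "isCont (\<lambda>p. f (g p)) p" if "!!r. isCont f r" "isCont g p" for f :: "real => real" and g :: "real \<times> real => real" and p
  by (rule isCont_o2[OF that(2) that(1)])
 have 1: "jcont (\<lambda>t z. m t * \<phi> (t\<^sup>2 - z\<^sup>2))"
  by (rule continuous_at_imp_continuous_on) (auto intro!: continuous_intros cc[of m] cc[of \<phi>] c)
 have 2: "jcont (\<lambda>t z. m' t * \<phi> (t\<^sup>2 - z\<^sup>2) + m t * (\<phi>' (t\<^sup>2 - z\<^sup>2) * (2 * t)))"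
  by (rule continuous_at_imp_continuous_on) (auto intro!: continuous_intros cc[of m] cc[of m'] cc[of \<phi>] cc[of \<phi>'] c)
 have 3: "jcont (\<lambda>t z. m t * (\<phi>' (t\<^sup>2 - z\<^sup>2) * (- 2 * z)))"
  by (rule continuous_at_imp_continuous_on) (auto intro!: continuous_intros cc[of m] cc[of \<phi>'] c)
 have 4: "((\<lambda>r. m r * \<phi> (r\<^sup>2 - z\<^sup>2)) has_field_derivative m' t * \<phi> (t\<^sup>2 - z\<^sup>2) + m t * (\<phi>' (t\<^sup>2 - z\<^sup>2) * (2 * t))) (at t)" for t z
 proof -
  have "((\<lambda>r. r\<^sup>2 - z\<^sup>2) has_field_derivative 2 * t) (at t)" by (auto intro!: derivative_eq_intros)
  from DERIV_mult[OF m(1) DERIV_chain2[OF \<phi>(1) this]] show ?thesis by (simp add: algebra_simps)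
 qed
 have 5: "((\<lambda>z. m t * \<phi> (t\<^sup>2 - z\<^sup>2)) has_field_derivative m t * (\<phi>' (t\<^sup>2 - z\<^sup>2) * (- 2 * z))) (at z)" for t z
 proof -
  have "((\<lambda>z. t\<^sup>2 - z\<^sup>2) has_field_derivative - 2 * z) (at z)" by (auto intro!: derivative_eq_intros)
  from DERIV_cmult[OF DERIV_chain2[OF \<phi>(1) this], of "m t"] show ?thesis .
 qed
 show ?thesis unfolding cone_kernel_def using 1 2 3 4 5 by auto
qed

lemma cone_kernel_add:
 assumes "cone_kernel \<kappa> \<kappa>t \<kappa>z" "cone_kernel \<mu> \<mu>t \<mu>z"
 shows "cone_kernel (\<lambda>t z. \<kappa> t z + \<mu> t z) (\<lambda>t z. \<kappa>t t z + \<mu>t t z) (\<lambda>t z. \<kappa>z t z + \<mu>z t z)"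
 using assms unfolding cone_kernel_def by (auto intro: continuous_on_add DERIV_add)

definition ker_w :: "real => real => real" where "ker_w t z = 1 / 2"

text \<open>The kernel that acts on the initial velocity in the damped equation.\<close>

definition ker_d :: "real => real => real" where
 "ker_d t z = exp (- t / 2) / 2 * bk 0 (t\<^sup>2 - z\<^sup>2)"

text \<open>The kernel that acts on the initial value in the damped equation, next to the translates of the
  value itself.\<close>

definition ker_f :: "real => real => real" where
 "ker_f t z = exp (- t / 2) / 4 * bk 0 (t\<^sup>2 - z\<^sup>2) + t * exp (- t / 2) / 16 * bk 1 (t\<^sup>2 - z\<^sup>2)"

lemma cone_kernel_w: "cone_kernel ker_w (\<lambda>t z. 0) (\<lambda>t z. 0)"
 unfolding cone_kernel_def ker_w_def by (auto intro!: derivative_eq_intros)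

lemma continuous_bk': "continuous_on UNIV (\<lambda>\<zeta>. bk j \<zeta> / 16)"
 using continuous_bk by (intro continuous_intros) auto

lemma cone_kernel_d: "\<exists>\<kappa>t \<kappa>z. cone_kernel ker_d \<kappa>t \<kappa>z"
proof -
 have 1: "((\<lambda>t. exp (- t / 2) / 2) has_field_derivative - exp (- r / 2) / 4) (at (r::real))" for r
  by (auto intro!: derivative_eq_intros)
 have c: "continuous_on UNIV (\<lambda>r::real. - exp (- r / 2) / 4)" by (intro continuous_intros) auto
 from cone_kernel_radial[OF 1 c bk_deriv[of 0] continuous_bk'] show ?thesis
  unfolding ker_d_def[abs_def] by blast
qed

lemma cone_kernel_f: "\<exists>\<kappa>t \<kappa>z. cone_kernel ker_f \<kappa>t \<kappa>z"
proof -
 have 1: "((\<lambda>t. exp (- t / 2) / 4) has_field_derivative - exp (- r / 2) / 8) (at (r::real))" for r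
  by (auto intro!: derivative_eq_intros)
 have 2: "((\<lambda>t. t * exp (- t / 2) / 16) has_field_derivative (exp (- r / 2) / 16 - r * exp (- r / 2) / 32)) (at (r::real))" for r
  by (auto intro!: derivative_eq_intros simp: field_simps)
 have c: "continuous_on UNIV (\<lambda>r::real. - exp (- r / 2) / 8)" "continuous_on UNIV (\<lambda>r::real. exp (- r / 2) / 16 - r * exp (- r / 2) / 32)"
  by (intro continuous_intros; auto)+
 from cone_kernel_add[OF cone_kernel_radial[OF 1 c(1) bk_deriv[of 0] continuous_bk'] cone_kernel_radial[OF 2 c(2) bk_deriv[of 1] continuous_bk']]
 show ?thesis unfolding ker_f_def[abs_def] by blast
qed

lemma jcont_kernels:
 "jcont ker_w" "jcont ker_d" "jcont ker_f"
 using cone_kernel_w cone_kernel_d cone_kernel_f by (auto simp: cone_kernel_def)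

lemma cone_square: "\<bar>z\<bar> <= t ==> 0 <= t\<^sup>2 - z\<^sup>2" for t z :: real
 by (simp add: abs_le_square_iff[symmetric])

lemma ker_nonneg:
 assumes "\<bar>z\<bar> <= t" shows "0 <= ker_w t z" "0 <= ker_d t z" "0 <= ker_f t z"
 using assms bk_nonneg[OF cone_square[OF assms]] by (auto simp: ker_w_def ker_d_def ker_f_def)

section \<open>Masses of the kernels\<close>

text \<open>The recursion in \<open>k\<close> comes from integrating the derivative of \<open>z (t\<^sup>2 -
  z\<^sup>2) ^ Suc k\<close>, which vanishes at both ends of the cone.\<close>

lemma integral_cone_power:
 fixes t :: real
 assumes t: "0 <= t"
 shows "(LINT z:{-t..t}|lborel. (t\<^sup>2 - z\<^sup>2) ^ k) = 2 * t ^ (2 * k + 1) * 4 ^ k * (fact k)\<^sup>2 / fact (2 * k + 1)"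
proof (induction k)
 case 0
 show ?case using t by (simp add: set_int_def)
next
 case (Suc k)
 let ?J = "\<lambda>k. (LINT z:{-t..t}|lborel. (t\<^sup>2 - z\<^sup>2) ^ k)"
 have i: "set_integrable lborel {-t..t} (\<lambda>z. c * (t\<^sup>2 - z\<^sup>2) ^ k)" for c k
  by (rule continuous_set_integrable) (intro continuous_intros)
 have "(LINT z:{-t..t}|lborel. (2 * real k + 3) * (t\<^sup>2 - z\<^sup>2) ^ Suc k - (2 * (real k + 1) * t\<^sup>2) * (t\<^sup>2 - z\<^sup>2) ^ k)
  = t * (t\<^sup>2 - t\<^sup>2) ^ Suc k - (- t) * (t\<^sup>2 - (- t)\<^sup>2) ^ Suc k"
 proof (rule set_integral_FTC)
  show "((\<lambda>z. z * (t\<^sup>2 - z\<^sup>2) ^ Suc k) has_field_derivative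
   (2 * real k + 3) * (t\<^sup>2 - z\<^sup>2) ^ Suc k - (2 * (real k + 1) * t\<^sup>2) * (t\<^sup>2 - z\<^sup>2) ^ k) (at z)" for z
  proof -
   have "((\<lambda>z. t\<^sup>2 - z\<^sup>2) has_field_derivative - 2 * z) (at z)" by (auto intro!: derivative_eq_intros)
   from DERIV_mult[OF DERIV_ident DERIV_power[OF this, of "Suc k"]]
   have "((\<lambda>z. z * (t\<^sup>2 - z\<^sup>2) ^ Suc k) has_field_derivative
    1 * (t\<^sup>2 - z\<^sup>2) ^ Suc k + real (Suc k) * (- 2 * z * (t\<^sup>2 - z\<^sup>2) ^ k) * z) (at z)" by simp
   moreover have "1 * (t\<^sup>2 - z\<^sup>2) ^ Suc k + real (Suc k) * (- 2 * z * (t\<^sup>2 - z\<^sup>2) ^ k) * z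
    = (2 * real k + 3) * (t\<^sup>2 - z\<^sup>2) ^ Suc k - (2 * (real k + 1) * t\<^sup>2) * (t\<^sup>2 - z\<^sup>2) ^ k"
    by (simp add: algebra_simps power2_eq_square)
   ultimately show ?thesis by simp
  qed
  show "continuous_on UNIV (\<lambda>z. (2 * real k + 3) * (t\<^sup>2 - z\<^sup>2) ^ Suc k - (2 * (real k + 1) * t\<^sup>2) * (t\<^sup>2 - z\<^sup>2) ^ k)"
   by (intro continuous_intros)
 qed (use t in simp)
 then have "(2 * real k + 3) * ?J (Suc k) = (2 * (real k + 1) * t\<^sup>2) * ?J k"
  using i by (simp add: set_integral_diff(2) del: power_Suc)
 then have "?J (Suc k) = (2 * (real k + 1) * t\<^sup>2) * ?J k / (2 * real k + 3)"
  by (simp add: field_simps)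
 also have "\<dots> = (2 * (real k + 1) * t\<^sup>2) * (2 * t ^ (2 * k + 1) * 4 ^ k * (fact k)\<^sup>2 / fact (2 * k + 1)) / (2 * real k + 3)"
  by (simp only: Suc.IH)
 also have "\<dots> = 2 * t ^ (2 * Suc k + 1) * 4 ^ Suc k * (fact (Suc k))\<^sup>2 / fact (2 * Suc k + 1)"
 proof -
  have f: "fact (2 * Suc k + 1) = (2 * real k + 3) * (2 * (real k + 1)) * fact (2 * k + 1)"
   by (simp add: algebra_simps)
  have p: "t ^ (2 * Suc k + 1) = t ^ (2 * k + 1) * t\<^sup>2" by (simp add: power2_eq_square)
  have g: "(fact (Suc k) :: real)\<^sup>2 = (real k + 1)\<^sup>2 * (fact k)\<^sup>2"
   by (simp add: power_mult_distrib add.commute)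
  have n: "2 * real k + 3 \<noteq> 0" "real k + 1 \<noteq> 0" by linarith+
  show ?thesis unfolding f p g using n
   by (simp add: divide_simps) (simp add: power2_eq_square algebra_simps)
 qed
 finally show ?case .
qed

lemma integral_cone_bk:
 assumes t: "0 <= t"
 shows "(\<lambda>k. 2 * t ^ (2 * k + 1) * 4 ^ k * (fact k)\<^sup>2 / (fact (2 * k + 1) * 16 ^ k * fact k * fact (k + j)))
   sums (LINT z:{-t..t}|lborel. bk j (t\<^sup>2 - z\<^sup>2))"
proof -
 let ?c = "\<lambda>k. 1 / (16 ^ k * fact k * fact (k + j)) :: real"
 let ?f = "\<lambda>k z. indicator {-t..t} z * (?c k * (t\<^sup>2 - z\<^sup>2) ^ k)"
 have i: "integrable lborel (?f k)" for k
  using continuous_set_integrable[of "\<lambda>z. ?c k * (t\<^sup>2 - z\<^sup>2) ^ k" "-t" t]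
  by (simp add: set_integrable_def continuous_intros)
 have nn: "norm (?f k z) = ?f k z" for k z
 proof (cases "z \<in> {-t..t}")
  case True
  then have "0 <= t\<^sup>2 - z\<^sup>2" by (intro cone_square) auto
  then show ?thesis using True by simp
 qed simp
 have I: "(LINT z|lborel. ?f k z) = 2 * t ^ (2 * k + 1) * 4 ^ k * (fact k)\<^sup>2 / (fact (2 * k + 1) * 16 ^ k * fact k * fact (k + j))" for k
 proof -
  have "(LINT z|lborel. ?f k z) = (LINT z|lborel. ?c k * (indicator {-t..t} z * (t\<^sup>2 - z\<^sup>2) ^ k))"
   by (rule lint_cong) auto
  also have "\<dots> = ?c k * (LINT z:{-t..t}|lborel. (t\<^sup>2 - z\<^sup>2) ^ k)"
   by (simp only: integral_mult_right_zero set_int_def real_scaleR_def)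
  finally show ?thesis unfolding integral_cone_power[OF t] by simp
 qed
 have "(\<lambda>k. LINT z|lborel. ?f k z) sums (LINT z|lborel. (\<Sum>k. ?f k z))"
 proof (rule sums_integral[OF i])
  have "summable (\<lambda>k. norm (?f k z))" for z
   unfolding nn using bk_summable[of j "t\<^sup>2 - z\<^sup>2"] by (intro summable_mult) simp
  then show "AE z in lborel. summable (\<lambda>k. norm (?f k z))" by simp
  show "summable (\<lambda>k. LINT z|lborel. norm (?f k z))"
  proof (rule summable_comparison_test')
   show "summable (\<lambda>k. 2 * t * (?c k * (t\<^sup>2) ^ k))" by (intro summable_mult bk_summable)
   fix k
   have "(LINT z|lborel. ?f k z) <= (LINT z|lborel. indicator {-t..t} z * (?c k * (t\<^sup>2) ^ k))"
   proof (rule integral_mono[OF i])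
    show "integrable lborel (\<lambda>z. indicator {-t..t} z * (?c k * (t\<^sup>2) ^ k))"
     by (intro integrable_mult_left integrable_real_indicator) (auto simp: emeasure_lborel_Icc_eq)
    show "?f k z <= indicator {-t..t} z * (?c k * (t\<^sup>2) ^ k)" for z
    proof (cases "z \<in> {-t..t}")
     case True
     then have "0 <= t\<^sup>2 - z\<^sup>2" by (intro cone_square) auto
     then have "(t\<^sup>2 - z\<^sup>2) ^ k <= (t\<^sup>2) ^ k" by (intro power_mono) auto
     then show ?thesis using True by (simp add: divide_right_mono)
    qed simp
   qed
   also have "\<dots> = 2 * t * (?c k * (t\<^sup>2) ^ k)" using t by simp
   finally have "(LINT z|lborel. ?f k z) <= 2 * t * (?c k * (t\<^sup>2) ^ k)" .
   moreover have "0 <= (LINT z|lborel. ?f k z)"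
    by (rule integral_nonneg_AE) (use nn in \<open>metis (no_types, lifting) AE_I2 norm_ge_zero\<close>)
   ultimately show "norm (LINT z|lborel. norm (?f k z)) <= 2 * t * (?c k * (t\<^sup>2) ^ k)"
    unfolding nn by simp
  qed
 qed
 moreover have "(\<Sum>k. ?f k z) = indicator {-t..t} z *\<^sub>R bk j (t\<^sup>2 - z\<^sup>2)" for z
  unfolding bk_def using suminf_mult[OF bk_summable[of j "t\<^sup>2 - z\<^sup>2"], of "indicator {-t..t} z"] by simp
 ultimately show ?thesis unfolding I set_int_def by simp
qed

lemma sums_sinh: "(\<lambda>k. x ^ (2 * k + 1) / fact (2 * k + 1)) sums sinh (x::real)"
proof -
 have *: "(\<lambda>n. if even n then 0 else x ^ n /\<^sub>R fact n) sums sinh x" by (rule sinh_converges)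
 have "strict_mono (\<lambda>k::nat. 2 * k + 1)" by (auto simp: strict_mono_def)
 moreover have "(if even n then 0 else x ^ n /\<^sub>R fact n) = 0" if "n \<notin> range (\<lambda>k::nat. 2 * k + 1)" for n
  using that by (auto elim!: oddE)
 ultimately have "(\<lambda>k. if even (2 * k + 1) then 0 else x ^ (2 * k + 1) /\<^sub>R fact (2 * k + 1)) sums sinh x"
  using sums_mono_reindex[of "\<lambda>k::nat. 2 * k + 1" "\<lambda>n. if even n then 0 else x ^ n /\<^sub>R fact n" "sinh x"] * by blast
 then show ?thesis by (simp add: divide_inverse mult.commute)
qed

lemma sums_cosh: "(\<lambda>k. x ^ (2 * k) / fact (2 * k)) sums cosh (x::real)"
proof -
 have *: "(\<lambda>n. if even n then x ^ n /\<^sub>R fact n else 0) sums cosh x" by (rule cosh_converges)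
 have "strict_mono (\<lambda>k::nat. 2 * k)" by (auto simp: strict_mono_def)
 moreover have "(if even n then x ^ n /\<^sub>R fact n else 0) = 0" if "n \<notin> range (\<lambda>k::nat. 2 * k)" for n
  using that by (auto elim!: evenE)
 ultimately have "(\<lambda>k. if even (2 * k) then x ^ (2 * k) /\<^sub>R fact (2 * k) else 0) sums cosh x"
  using sums_mono_reindex[of "\<lambda>k::nat. 2 * k" "\<lambda>n. if even n then x ^ n /\<^sub>R fact n else 0" "cosh x"] * by blast
 then show ?thesis by (simp add: divide_inverse mult.commute)
qed

lemma integral_cone_bk0:
 assumes t: "0 <= t" shows "(LINT z:{-t..t}|lborel. bk 0 (t\<^sup>2 - z\<^sup>2)) = 4 * sinh (t / 2)"
proof -
 have "2 * t ^ (2 * k + 1) * 4 ^ k * (fact k)\<^sup>2 / (fact (2 * k + 1) * 16 ^ k * fact k * fact (k + 0))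
   = 4 * ((t / 2) ^ (2 * k + 1) / fact (2 * k + 1))" for k
 proof -
  have "(16::real) ^ k = 4 ^ k * 4 ^ k" by (simp flip: power_mult_distrib)
  moreover have "(2::real) ^ (2 * k + 1) = 2 * 4 ^ k" by (simp add: power_mult)
  ultimately show ?thesis by (simp add: power_divide power2_eq_square divide_simps)
 qed
 then have "(\<lambda>k. 4 * ((t / 2) ^ (2 * k + 1) / fact (2 * k + 1))) sums (LINT z:{-t..t}|lborel. bk 0 (t\<^sup>2 - z\<^sup>2))"
  using integral_cone_bk[OF t, of 0] by simp
 moreover have "(\<lambda>k. 4 * ((t / 2) ^ (2 * k + 1) / fact (2 * k + 1))) sums (4 * sinh (t / 2))"
  by (rule sums_mult[OF sums_sinh])
 ultimately show ?thesis by (rule sums_unique2)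
qed

lemma integral_cone_bk1:
 assumes t: "0 <= t" shows "t / 8 * (LINT z:{-t..t}|lborel. bk 1 (t\<^sup>2 - z\<^sup>2)) = 2 * (cosh (t / 2) - 1)"
proof -
 have "t / 8 * (2 * t ^ (2 * k + 1) * 4 ^ k * (fact k)\<^sup>2 / (fact (2 * k + 1) * 16 ^ k * fact k * fact (k + 1)))
   = 2 * ((t / 2) ^ (2 * Suc k) / fact (2 * Suc k))" for k
 proof -
  have "(16::real) ^ k = 4 ^ k * 4 ^ k" by (simp flip: power_mult_distrib)
  moreover have "(2::real) ^ (2 * Suc k) = 4 * 4 ^ k" by (simp add: power_mult)
  moreover have "fact (2 * Suc k) = 2 * (real k + 1) * fact (2 * k + 1)" by (simp add: algebra_simps)
  moreover have "fact (k + 1) = (real k + 1) * fact k" by (simp add: add.commute)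
  moreover have "real k + 1 \<noteq> 0" by linarith
  moreover have "t ^ (2 * Suc k) = t * t ^ (2 * k + 1)" by simp
  ultimately show ?thesis by (simp only: power_divide power2_eq_square) (simp add: divide_simps)
 qed
 then have "(\<lambda>k. 2 * ((t / 2) ^ (2 * Suc k) / fact (2 * Suc k))) sums (t / 8 * (LINT z:{-t..t}|lborel. bk 1 (t\<^sup>2 - z\<^sup>2)))"
  using sums_mult[OF integral_cone_bk[OF t, of 1], of "t / 8"] by simp
 moreover have "(\<lambda>k. (t / 2) ^ (2 * Suc k) / fact (2 * Suc k)) sums (cosh (t / 2) - 1)"
  using sums_cosh[of "t / 2"] by (subst sums_Suc_iff) simp
 then have "(\<lambda>k. 2 * ((t / 2) ^ (2 * Suc k) / fact (2 * Suc k))) sums (2 * (cosh (t / 2) - 1))"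
  by (rule sums_mult)
 ultimately show ?thesis by (rule sums_unique2)
qed

definition mass :: "(real => real => real) => real => real" where
 "mass \<kappa> t = (LINT z:{-t..t}|lborel. \<kappa> t z)"

lemma mass_w: "0 <= t ==> mass ker_w t = t"
 by (simp add: mass_def ker_w_def set_int_def)

text \<open>The sum of the term-wise integrals is a hyperbolic sine.\<close>

lemma mass_d: assumes t: "0 <= t" shows "mass ker_d t = 1 - exp (- t)"
proof -
 have "mass ker_d t = exp (- t / 2) / 2 * (4 * sinh (t / 2))"
  unfolding mass_def ker_d_def integral_cone_bk0[OF t, symmetric] by (simp add: set_int_def mult.left_commute)
 also have "\<dots> = exp (- t / 2) * exp (t / 2) - exp (- t / 2) * exp (- t / 2)"
  by (simp add: sinh_def algebra_simps)
 also have "\<dots> = 1 - exp (- t)" by (simp add: exp_add[symmetric])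
 finally show ?thesis .
qed

lemma mass_f: assumes t: "0 <= t" shows "mass ker_f t = 1 - exp (- t / 2)"
proof -
 have i: "set_integrable lborel {-t..t} (\<lambda>z. bk j (t\<^sup>2 - z\<^sup>2))" for j
 proof (rule continuous_set_integrable)
  show "continuous_on UNIV (\<lambda>z. bk j (t\<^sup>2 - z\<^sup>2))"
   by (rule continuous_on_compose2[OF continuous_bk]) (auto intro!: continuous_intros)
 qed
 have "mass ker_f t = exp (- t / 2) / 4 * (LINT z:{-t..t}|lborel. bk 0 (t\<^sup>2 - z\<^sup>2))
   + t * exp (- t / 2) / 16 * (LINT z:{-t..t}|lborel. bk 1 (t\<^sup>2 - z\<^sup>2))"
  unfolding mass_def ker_f_def using i by (simp add: set_integral_add(2))
 also have "\<dots> = exp (- t / 2) / 4 * (LINT z:{-t..t}|lborel. bk 0 (t\<^sup>2 - z\<^sup>2))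
   + exp (- t / 2) / 2 * (t / 8 * (LINT z:{-t..t}|lborel. bk 1 (t\<^sup>2 - z\<^sup>2)))" by simp
 also have "\<dots> = exp (- t / 2) * (sinh (t / 2) + cosh (t / 2)) - exp (- t / 2)"
  unfolding integral_cone_bk0[OF t] integral_cone_bk1[OF t] by (simp add: algebra_simps)
 also have "sinh (t / 2) + cosh (t / 2) = exp (t / 2)" by (rule sinh_plus_cosh)
 also have "exp (- t / 2) * exp (t / 2) = 1" by (simp add: exp_add[symmetric])
 finally show ?thesis .
qed

section \<open>Decay of the kernels\<close>

lemma central_binomial_bound: "(2 * real k + 1) * (fact (2 * k))\<^sup>2 <= 16 ^ k * fact k ^ 4"
proof (induction k)
 case (Suc k)
 let ?a = "real k + 1"
 have f: "fact (2 * Suc k) = (2 * ?a) * ((2 * real k + 1) * fact (2 * k))" by (simp add: algebra_simps)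
 have g: "fact (Suc k) = ?a * (fact k :: real)" by (simp add: add.commute)
 have "(2 * real (Suc k) + 1) * (fact (2 * Suc k))\<^sup>2
  = (2 * real k + 3) * (2 * real k + 1) * (4 * ?a\<^sup>2) * ((2 * real k + 1) * (fact (2 * k))\<^sup>2)"
  unfolding f by (simp add: power2_eq_square algebra_simps)
 also have "\<dots> <= (4 * ?a\<^sup>2) * (4 * ?a\<^sup>2) * (16 ^ k * fact k ^ 4)"
 proof -
  have "(2 * real k + 3) * (2 * real k + 1) <= 4 * ?a\<^sup>2" by (simp add: power2_eq_square algebra_simps)
  then show ?thesis by (intro mult_mono[OF mult_right_mono Suc.IH]) auto
 qed
 also have "\<dots> = 16 ^ Suc k * fact (Suc k) ^ 4" unfolding g by (simp add: power_mult_distrib power2_eq_square power4_eq_xxxx)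
 finally show ?case .
qed simp

text \<open>The central binomial coefficient is at most \<open>4\<^sup>k / sqrt (2 k + 1)\<close>, which bounds
  the left side by a geometric mean of reciprocals of consecutive factorials; the parameter \<open>c\<close>
  weights the arithmetic-geometric mean inequality.\<close>

lemma bk0_term_bound:
 assumes l: "c > (0::real)"
 shows "1 / (4 ^ k * (fact k)\<^sup>2) <= (c / fact (2 * k + 1) + 1 / (c * fact (2 * k))) / 2"
proof -
 define n where "n = 2 * real k + 1"
 have n: "n > 0" unfolding n_def by linarith
 have "(sqrt n * fact (2 * k))\<^sup>2 <= (4 ^ k * (fact k)\<^sup>2)\<^sup>2"
 proof -
  have "(sqrt n * fact (2 * k))\<^sup>2 = n * (fact (2 * k))\<^sup>2" using n by (simp add: power_mult_distrib)
  moreover have "((4::real) ^ k * (fact k)\<^sup>2)\<^sup>2 = 16 ^ k * fact k ^ 4"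
  proof -
   have "((4::real) ^ k)\<^sup>2 = 16 ^ k" by (simp add: power2_eq_square flip: power_mult_distrib)
   then show ?thesis by (simp add: power_mult_distrib flip: power_mult)
  qed
  ultimately show ?thesis using central_binomial_bound[of k] by (simp add: n_def)
 qed
 then have "sqrt n * fact (2 * k) <= 4 ^ k * (fact k)\<^sup>2" by (rule power2_le_imp_le) simp
 then have "1 / (4 ^ k * (fact k)\<^sup>2) <= 1 / (sqrt n * fact (2 * k))"
  by (intro divide_left_mono) (use n in auto)
 also have "\<dots> <= (c / n + 1 / c) / 2 * (1 / fact (2 * k))"
 proof -
  have "0 <= (c - sqrt n)\<^sup>2" by simp
  then have "2 * c * sqrt n <= c\<^sup>2 + n" using n by (simp add: power2_diff)
  then have "2 * c * sqrt n / (2 * c * n) <= (c\<^sup>2 + n) / (2 * c * n)" using l n by (intro divide_right_mono) auto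
  moreover have "2 * c * sqrt n / (2 * c * n) = 1 / sqrt n"
  proof -
   have "2 * c * sqrt n / (2 * c * n) = sqrt n / n" using l by simp
   also have "\<dots> = 1 / sqrt n"
   proof -
    define r where "r = sqrt n"
    have r: "r > 0" "r * r = n" using n by (auto simp: r_def)
    then have "r / n = 1 / r" by (simp flip: r(2))
    then show ?thesis by (simp add: r_def)
   qed
   finally show ?thesis .
  qed
  moreover have "(c\<^sup>2 + n) / (2 * c * n) = (c / n + 1 / c) / 2"
  proof -
   have "(c\<^sup>2 + n) / (2 * c * n) = c\<^sup>2 / (2 * c * n) + n / (2 * c * n)" by (rule add_divide_distrib)
   moreover have "c\<^sup>2 / (2 * c * n) = c / n / 2" using l n by (simp add: power2_eq_square)
   moreover have "n / (2 * c * n) = 1 / c / 2" using l n by simp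
   ultimately show ?thesis by simp
  qed
  ultimately have "1 / sqrt n <= (c / n + 1 / c) / 2" by simp
  then have "1 / sqrt n * (1 / fact (2 * k)) <= (c / n + 1 / c) / 2 * (1 / fact (2 * k))"
   by (intro mult_right_mono) auto
  then show ?thesis by simp
 qed
 also have "\<dots> = (c / fact (2 * k + 1) + 1 / (c * fact (2 * k))) / 2"
 proof -
  have "fact (2 * k + 1) = n * fact (2 * k)" by (simp add: n_def algebra_simps)
  then show ?thesis by (simp add: add_divide_distrib)
 qed
 finally show ?thesis .
qed

lemma bk0_sums: "(\<lambda>k. z ^ (2 * k) / (4 ^ k * (fact k)\<^sup>2)) sums bk 0 ((2 * z)\<^sup>2)"
proof -
 have "(\<lambda>k. 1 / (16 ^ k * fact k * fact (k + 0)) * ((2 * z)\<^sup>2) ^ k) sums bk 0 ((2 * z)\<^sup>2)"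
  unfolding bk_def by (rule summable_sums[OF bk_summable])
 moreover have "1 / (16 ^ k * fact k * fact (k + 0)) * ((2 * z)\<^sup>2) ^ k = z ^ (2 * k) / (4 ^ k * (fact k)\<^sup>2)" for k
 proof -
  have "(16::real) ^ k = 4 ^ k * 4 ^ k" by (simp flip: power_mult_distrib)
  moreover have "((2 * z)\<^sup>2) ^ k = 4 ^ k * z ^ (2 * k)" by (simp add: power_mult_distrib power_mult)
  ultimately show ?thesis by (simp add: power2_eq_square)
 qed
 ultimately show ?thesis by simp
qed

text \<open>Summation of the previous bound gives hyperbolic functions; the weight \<open>c\<close> is chosen to
  balance them. This is the growth \<open>exp z / sqrt z\<close> of \<open>I\<^sub>0\<close> at infinity.\<close>

lemma bk0_bound_sqrt:
 assumes z: "z > 0" shows "bk 0 ((2 * z)\<^sup>2) <= exp z / (2 * sqrt z)"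
proof -
 have s: "sqrt z > 0" using z by simp
 have "bk 0 ((2 * z)\<^sup>2) <= (sqrt z / z * sinh z + 1 / sqrt z * cosh z) / 2"
 proof (rule sums_le[OF _ bk0_sums])
  show "(\<lambda>k. (sqrt z / z * (z ^ (2 * k + 1) / fact (2 * k + 1)) + 1 / sqrt z * (z ^ (2 * k) / fact (2 * k))) / 2)
   sums ((sqrt z / z * sinh z + 1 / sqrt z * cosh z) / 2)"
   by (intro sums_divide sums_add sums_mult sums_sinh sums_cosh)
  fix k
  have "z ^ (2 * k) * (1 / (4 ^ k * (fact k)\<^sup>2)) <= z ^ (2 * k) * ((sqrt z / fact (2 * k + 1) + 1 / (sqrt z * fact (2 * k))) / 2)"
   by (intro mult_left_mono bk0_term_bound[OF s]) (use z in auto)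
  also have "\<dots> = (sqrt z / z * (z ^ (2 * k + 1) / fact (2 * k + 1)) + 1 / sqrt z * (z ^ (2 * k) / fact (2 * k))) / 2"
   using z by (simp add: algebra_simps)
  finally show "z ^ (2 * k) / (4 ^ k * (fact k)\<^sup>2) <= (sqrt z / z * (z ^ (2 * k + 1) / fact (2 * k + 1)) + 1 / sqrt z * (z ^ (2 * k) / fact (2 * k))) / 2"
   by simp
 qed
 also have "sqrt z / z = 1 / sqrt z" using z real_sqrt_mult_self[of z] by (simp add: field_simps)
 also have "(1 / sqrt z * sinh z + 1 / sqrt z * cosh z) / 2 = (sinh z + cosh z) / (2 * sqrt z)"
  by (simp add: add_divide_distrib)
 also have "sinh z + cosh z = exp z" by (rule sinh_plus_cosh)
 finally show ?thesis .
qed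

lemma bk0_bound_exp:
 assumes z: "z \<ge> 0" shows "bk 0 ((2 * z)\<^sup>2) <= exp z"
proof -
 have "bk 0 ((2 * z)\<^sup>2) <= cosh z"
 proof (rule sums_le[OF _ bk0_sums sums_cosh])
  fix k
  have "(1::real) * (fact (2 * k))\<^sup>2 <= (2 * real k + 1) * (fact (2 * k))\<^sup>2" by (intro mult_right_mono) auto
  also have "\<dots> <= 16 ^ k * fact k ^ 4" by (rule central_binomial_bound)
  also have "\<dots> = ((4::real) ^ k * (fact k)\<^sup>2)\<^sup>2"
  proof -
   have "((4::real) ^ k)\<^sup>2 = 16 ^ k" by (simp add: power2_eq_square flip: power_mult_distrib)
   then show ?thesis by (simp add: power_mult_distrib flip: power_mult)
  qed
  finally have "(fact (2 * k))\<^sup>2 <= ((4::real) ^ k * (fact k)\<^sup>2)\<^sup>2" by simp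
  then have "fact (2 * k) <= (4::real) ^ k * (fact k)\<^sup>2" by (rule power2_le_imp_le) simp
  then show "z ^ (2 * k) / (4 ^ k * (fact k)\<^sup>2) <= z ^ (2 * k) / fact (2 * k)"
   by (intro divide_left_mono) (use z in auto)
 qed
 also have "\<dots> <= exp z" using z by (simp add: cosh_def)
 finally show ?thesis .
qed

lemma damped_decay:
 assumes t: "t \<ge> 0" shows "exp (- t / 2) * bk 0 (t\<^sup>2) <= 2 / sqrt (1 + t)"
proof (cases "t <= 1")
 case True
 have "exp (- t / 2) * bk 0 (t\<^sup>2) <= exp (- t / 2) * exp (t / 2)"
  using bk0_bound_exp[of "t / 2"] t by (intro mult_left_mono) auto
 also have "\<dots> = 1" by (simp add: exp_add[symmetric])
 also have "1 <= 2 / sqrt (1 + t)"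
 proof -
  have "sqrt (1 + t) <= sqrt 4" using True by (intro real_sqrt_le_mono) auto
  then show ?thesis using t by (simp add: field_simps)
 qed
 finally show ?thesis .
next
 case False
 have "exp (- t / 2) * bk 0 (t\<^sup>2) <= exp (- t / 2) * (exp (t / 2) / (2 * sqrt (t / 2)))"
  using bk0_bound_sqrt[of "t / 2"] False by (intro mult_left_mono) auto
 also have "\<dots> = 1 / (2 * sqrt (t / 2))" by (simp add: exp_add[symmetric])
 also have "\<dots> <= 2 / sqrt (1 + t)"
 proof -
  have "sqrt (1 + t) <= sqrt (16 * (t / 2))" using False by (intro real_sqrt_le_mono) auto
  also have "\<dots> = 4 * sqrt (t / 2)" by (simp only: real_sqrt_mult) simp
  finally have le: "sqrt (1 + t) <= 4 * sqrt (t / 2)" .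
  have "2 / (4 * sqrt (t / 2)) <= 2 / sqrt (1 + t)" using le False by (intro divide_left_mono) auto
  then show ?thesis by simp
 qed
 finally show ?thesis .
qed

text \<open>This is \<open>I\<^sub>1 \<le> I\<^sub>0\<close>: with \<open>a\<^sub>k = z\<^sup>k / k!\<close> the
  two series are \<open>\<Sum> a\<^sub>k a\<^sub>k\<^sub>+\<^sub>1\<close> and \<open>\<Sum>
  a\<^sub>k\<^sup>2\<close>.\<close>

lemma bk1_le_bk0:
 assumes t: "t \<ge> 0" shows "t / 4 * bk 1 (t\<^sup>2) <= bk 0 (t\<^sup>2)"
proof -
 define z where "z = t / 4"
 have z: "z \<ge> 0" "t = 4 * z" using t by (auto simp: z_def)
 define a where "a = (\<lambda>k::nat. z ^ k / fact k)"
 have a0: "a k \<ge> 0" for k using z by (simp add: a_def)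
 have s0: "(\<lambda>k. (a k)\<^sup>2) sums bk 0 (t\<^sup>2)"
 proof -
  have "(\<lambda>k. 1 / (16 ^ k * fact k * fact (k + 0)) * (t\<^sup>2) ^ k) sums bk 0 (t\<^sup>2)"
   unfolding bk_def by (rule summable_sums[OF bk_summable])
  moreover have "1 / (16 ^ k * fact k * fact (k + 0)) * (t\<^sup>2) ^ k = (a k)\<^sup>2" for k
   by (simp add: a_def z(2) power_mult_distrib power_divide power2_eq_square)
  ultimately show ?thesis by simp
 qed
 have s1: "(\<lambda>k. a k * a (Suc k)) sums (z * bk 1 (t\<^sup>2))"
 proof -
  have "(\<lambda>k. z * (1 / (16 ^ k * fact k * fact (k + 1)) * (t\<^sup>2) ^ k)) sums (z * bk 1 (t\<^sup>2))"
   unfolding bk_def by (rule sums_mult[OF summable_sums[OF bk_summable]])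
  moreover have "z * (1 / (16 ^ k * fact k * fact (k + 1)) * (t\<^sup>2) ^ k) = a k * a (Suc k)" for k
   by (simp add: a_def z(2) power_mult_distrib power_divide power2_eq_square)
  ultimately show ?thesis by simp
 qed
 have s2: "(\<lambda>k. ((a k)\<^sup>2 + (a (Suc k))\<^sup>2) / 2) sums ((bk 0 (t\<^sup>2) + (bk 0 (t\<^sup>2) - (a 0)\<^sup>2)) / 2)"
 proof (intro sums_divide sums_add s0)
  show "(\<lambda>k. (a (Suc k))\<^sup>2) sums (bk 0 (t\<^sup>2) - (a 0)\<^sup>2)"
   using s0 sums_Suc_iff[of "\<lambda>k. (a k)\<^sup>2" "bk 0 (t\<^sup>2) - (a 0)\<^sup>2"] by simp
 qed
 have "z * bk 1 (t\<^sup>2) <= (bk 0 (t\<^sup>2) + (bk 0 (t\<^sup>2) - (a 0)\<^sup>2)) / 2"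
 proof (rule sums_le[OF _ s1 s2])
  show "a k * a (Suc k) <= ((a k)\<^sup>2 + (a (Suc k))\<^sup>2) / 2" for k
   using sum_squares_bound[of "a k" "a (Suc k)"] by simp
 qed
 also have "\<dots> <= bk 0 (t\<^sup>2)" by simp
 finally show ?thesis by (simp add: z_def)
qed

text \<open>The series are increasing in \<open>t\<^sup>2 - z\<^sup>2\<close>, so the kernels are largest on the
  axis \<open>z = 0\<close>.\<close>

lemma ker_d_f_decay:
 assumes z: "\<bar>z\<bar> <= t" shows "ker_d t z <= 1 / sqrt (1 + t)" "ker_f t z <= 1 / sqrt (1 + t)"
proof -
 have t: "t \<ge> 0" using z by linarith
 have b: "bk j (t\<^sup>2 - z\<^sup>2) <= bk j (t\<^sup>2)" for j by (rule bk_mono[OF cone_square[OF z]]) simp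
 have "ker_d t z <= exp (- t / 2) / 2 * bk 0 (t\<^sup>2)" unfolding ker_d_def by (intro mult_left_mono b) auto
 then show "ker_d t z <= 1 / sqrt (1 + t)" using damped_decay[OF t] by simp
 have "ker_f t z <= exp (- t / 2) / 4 * bk 0 (t\<^sup>2) + t * exp (- t / 2) / 16 * bk 1 (t\<^sup>2)"
  unfolding ker_f_def using t by (intro add_mono mult_left_mono b) auto
 also have "\<dots> = exp (- t / 2) / 4 * (bk 0 (t\<^sup>2) + t / 4 * bk 1 (t\<^sup>2))" by (simp add: algebra_simps)
 also have "\<dots> <= exp (- t / 2) / 4 * (bk 0 (t\<^sup>2) + bk 0 (t\<^sup>2))"
  by (intro mult_left_mono add_mono bk1_le_bk0[OF t]) auto
 also have "\<dots> = exp (- t / 2) * bk 0 (t\<^sup>2) / 2" by simp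
 also have "\<dots> <= 2 / sqrt (1 + t) / 2" by (intro divide_right_mono damped_decay[OF t]) simp
 finally show "ker_f t z <= 1 / sqrt (1 + t)" by simp
qed

section \<open>The propagators as cone convolutions\<close>

lemma bessel_I0: "bessel_I 0 (sqrt \<zeta> / 2) = bk 0 \<zeta>" if "\<zeta> \<ge> 0"
proof -
 have "(sqrt \<zeta> / 2 / 2) ^ (2 * k + 0) / (fact k * fact (k + 0)) = 1 / (16 ^ k * fact k * fact (k + 0)) * \<zeta> ^ k" for k
 proof -
  have "(sqrt \<zeta> / 2 / 2) ^ (2 * k) = ((sqrt \<zeta> / 4)\<^sup>2) ^ k" by (simp add: power_mult)
  also have "\<dots> = \<zeta> ^ k / 16 ^ k" using that by (simp add: power_divide)
  finally show ?thesis by simp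
 qed
 then show ?thesis unfolding bessel_I_def bk_def by simp
qed

lemma bessel_I1: "1 / (2 * sqrt \<zeta>) * bessel_I 1 (sqrt \<zeta> / 2) = bk 1 \<zeta> / 8" if "\<zeta> > 0"
proof -
 have "(sqrt \<zeta> / 2 / 2) ^ (2 * k + 1) / (fact k * fact (k + 1)) = sqrt \<zeta> / 4 * (1 / (16 ^ k * fact k * fact (k + 1)) * \<zeta> ^ k)" for k
 proof -
  have "(sqrt \<zeta> / 2 / 2) ^ (2 * k + 1) = ((sqrt \<zeta> / 4)\<^sup>2) ^ k * (sqrt \<zeta> / 4)" by (simp add: power_mult)
  also have "((sqrt \<zeta> / 4)\<^sup>2) ^ k = \<zeta> ^ k / 16 ^ k" using that by (simp add: power_divide)
  finally show ?thesis by (simp add: mult_ac)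
 qed
 then have eq: "bessel_I 1 (sqrt \<zeta> / 2) = sqrt \<zeta> / 4 * bk 1 \<zeta>"
  unfolding bessel_I_def bk_def using suminf_mult[OF bk_summable[of 1 \<zeta>], of "sqrt \<zeta> / 4"] by simp
 show ?thesis unfolding eq using that by simp
qed

lemma conv_integrable:
 assumes \<kappa>: "jcont \<kappa>" and h: "integrable lborel h"
 shows "integrable lborel (\<lambda>y. if \<bar>x - y\<bar> <= t then \<kappa> t (x - y) * h y else 0)"
proof -
 obtain B where B: "B \<ge> 0" "!!s z. \<bar>s\<bar> <= \<bar>t\<bar> ==> \<bar>z\<bar> <= \<bar>t\<bar> ==> \<bar>\<kappa> s z\<bar> <= B"
  using jcont_bound[OF \<kappa>, of "\<bar>t\<bar>"] by blast
 have [measurable]: "(\<lambda>y. \<kappa> t (x - y)) \<in> borel_measurable borel"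
  by (rule jcont_measurable[OF \<kappa>]) measurable
 have "integrable lborel (\<lambda>y. (if \<bar>x - y\<bar> <= t then \<kappa> t (x - y) else 0) * h y)"
  by (rule integrable_mult_bounded[OF h, where B=B]) (use B in auto)
 then show ?thesis by (rule Bochner_Integration.integrable_cong[THEN iffD1, rotated 2]) auto
qed

lemma lebesgue_set_integral_cone:
 fixes x t :: real
 assumes "!!y. \<bar>x - y\<bar> < t ==> G y = H y" and m: "(\<lambda>y. if \<bar>x - y\<bar> <= t then H y else 0) \<in> borel_measurable borel"
 shows "(LINT y:{x - t..x + t}|lebesgue. G y) = (LINT y|lborel. (if \<bar>x - y\<bar> <= t then H y else (0::real)))"
proof -
 have "(LINT y:{x - t..x + t}|lebesgue. G y) = (LINT y|lebesgue. (if \<bar>x - y\<bar> <= t then H y else 0))"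
  unfolding set_int_def
 proof (rule integral_discrete_difference[where X="{x - t, x + t}"])
  show "indicator {x - t..x + t} y *\<^sub>R G y = (if \<bar>x - y\<bar> <= t then H y else 0)" if "y \<notin> {x - t, x + t}" for y
  proof -
   have "y \<in> {x - t..x + t} \<longleftrightarrow> \<bar>x - y\<bar> <= t" by (auto simp: abs_if split: if_splits)
   moreover have "\<bar>x - y\<bar> \<noteq> t" using that by auto
   ultimately show ?thesis using assms(1)[of y] by (auto simp: indicator_def)
  qed
 qed auto
 also have "\<dots> = (LINT y|lborel. (if \<bar>x - y\<bar> <= t then H y else 0))" by (rule lebesgue_eq_lborel(1)[OF m])
 finally show ?thesis .
qed

lemma wave_prop_eq:
 assumes g: "integrable lborel g"
 shows "wave_prop t f g x = (f (x + t) + f (x - t)) / 2 + conv ker_w t g x"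
proof -
 have [measurable]: "g \<in> borel_measurable borel" using g by auto
 have "(LINT y:{x - t..x + t}|lebesgue. g y) = (LINT y|lborel. (if \<bar>x - y\<bar> <= t then g y else 0))"
  by (rule lebesgue_set_integral_cone) (simp, measurable)
 moreover have "conv ker_w t g x = (LINT y|lborel. 1 / 2 * (if \<bar>x - y\<bar> <= t then g y else 0))"
  unfolding conv_def ker_w_def by (rule lint_cong) auto
 ultimately show ?thesis by (simp add: wave_prop_def)
qed

text \<open>The solution of the free damped equation with data \<open>(f, g)\<close>, defined at every
  point.\<close>

definition damped_free :: "(real => real) => (real => real) => real => real => real" where
 "damped_free f g t x = exp (- t / 2) / 2 * (f (x + t) + f (x - t)) + conv ker_f t f x + conv ker_d t g x"

definition wave_free :: "(real => real) => (real => real) => real => real => real" where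
 "wave_free f g t x = (f (x + t) + f (x - t)) / 2 + conv ker_w t g x"

lemma damped_wave_prop_eq:
 assumes f: "integrable lborel f" and g: "integrable lborel g"
 shows "damped_wave_prop t f g x = damped_free f g t x"
proof -
 have [measurable]: "g \<in> borel_measurable borel" "f \<in> borel_measurable borel" using f g by auto
 have [measurable]: "(\<lambda>y. ker_f t (x - y)) \<in> borel_measurable borel" "(\<lambda>y. ker_d t (x - y)) \<in> borel_measurable borel"
  by (rule jcont_measurable[OF jcont_kernels(3)]; measurable)
    (rule jcont_measurable[OF jcont_kernels(2)]; measurable)
 let ?E = "exp (- t / 2)"
 let ?H = "\<lambda>y. 2 / ?E * (ker_f t (x - y) * f y + ker_d t (x - y) * g y)"
 have "(LINT y:{x - t..x + t}|lebesgue. (let \<rho> = sqrt (t\<^sup>2 - (x - y)\<^sup>2)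
      in bessel_I 0 (\<rho> / 2) * (g y + f y / 2) + t / (2 * \<rho>) * bessel_I 1 (\<rho> / 2) * f y))
   = (LINT y|lborel. (if \<bar>x - y\<bar> <= t then ?H y else 0))"
 proof (rule lebesgue_set_integral_cone)
  fix y assume y: "\<bar>x - y\<bar> < t"
  let ?\<zeta> = "t\<^sup>2 - (x - y)\<^sup>2"
  have \<zeta>: "?\<zeta> > 0"
  proof -
   have "\<bar>x - y\<bar>\<^sup>2 < t\<^sup>2" using y by (intro power_strict_mono) auto
   then show ?thesis by simp
  qed
  have I1: "t / (2 * sqrt ?\<zeta>) * bessel_I 1 (sqrt ?\<zeta> / 2) = t / 8 * bk 1 ?\<zeta>"
  proof -
   have "t / (2 * sqrt ?\<zeta>) * bessel_I 1 (sqrt ?\<zeta> / 2) = t * (1 / (2 * sqrt ?\<zeta>) * bessel_I 1 (sqrt ?\<zeta> / 2))" by simp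
   then show ?thesis unfolding bessel_I1[OF \<zeta>] by simp
  qed
  have "?H y = bk 0 ?\<zeta> * (g y + f y / 2) + t / 8 * bk 1 ?\<zeta> * f y"
   unfolding ker_f_def ker_d_def by (simp add: field_simps)
  then show "(let \<rho> = sqrt ?\<zeta> in bessel_I 0 (\<rho> / 2) * (g y + f y / 2) + t / (2 * \<rho>) * bessel_I 1 (\<rho> / 2) * f y) = ?H y"
   unfolding Let_def I1 bessel_I0[OF less_imp_le[OF \<zeta>]] by simp
 qed measurable
 also have "\<dots> = (LINT y|lborel. 2 / ?E * ((if \<bar>x - y\<bar> <= t then ker_f t (x - y) * f y else 0)
   + (if \<bar>x - y\<bar> <= t then ker_d t (x - y) * g y else 0)))"
  by (rule lint_cong) auto
 also have "\<dots> = 2 / ?E * (conv ker_f t f x + conv ker_d t g x)"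
  unfolding conv_def integral_mult_right_zero
  using conv_integrable[OF jcont_kernels(3) f] conv_integrable[OF jcont_kernels(2) g]
  by (subst Bochner_Integration.integral_add) auto
 finally show ?thesis
  unfolding damped_wave_prop_def damped_free_def by (simp add: field_simps)
qed

section \<open>Bounds for cone convolutions and Duhamel integrals\<close>

lemma integral_abs_le:
 fixes f g :: "'a => real"
 assumes "integrable M f" "integrable M g" "!!x. \<bar>f x\<bar> <= g x"
 shows "\<bar>LINT x|M. f x\<bar> <= (LINT x|M. g x)"
 by (rule order_trans[OF integral_abs_bound integral_mono]) (use assms in auto)

lemma cone_kernel_slice:
 assumes \<kappa>: "jcont \<kappa>"
 shows "integrable lborel (\<lambda>z. if \<bar>z\<bar> <= t then \<kappa> t z else 0)"
  "(LINT z|lborel. (if \<bar>z\<bar> <= t then \<kappa> t z else 0)) = mass \<kappa> t"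
proof -
 have *: "(\<lambda>z. if \<bar>z\<bar> <= t then \<kappa> t z else 0) = (\<lambda>z. indicator {-t..t} z *\<^sub>R \<kappa> t z)"
  by (auto simp: indicator_def abs_le_iff fun_eq_iff)
 show "integrable lborel (\<lambda>z. if \<bar>z\<bar> <= t then \<kappa> t z else 0)"
  using continuous_set_integrable[OF jcont_slice(1)[OF \<kappa>], of "-t" t t] unfolding * by (simp add: set_integrable_def)
 show "(LINT z|lborel. (if \<bar>z\<bar> <= t then \<kappa> t z else 0)) = mass \<kappa> t"
  unfolding * by (simp add: mass_def set_int_def)
qed

lemma conv_integrable_locally:
 assumes \<kappa>: "jcont \<kappa>" and h: "h \<in> borel_measurable borel" and b: "!!y. \<bar>x - y\<bar> <= t ==> \<bar>h y\<bar> <= b"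
 shows "integrable lborel (\<lambda>y. if \<bar>x - y\<bar> <= t then \<kappa> t (x - y) * h y else 0)"
proof (rule int_bound)
 note [measurable] = h
 have [measurable]: "(\<lambda>y. \<kappa> t (x - y)) \<in> borel_measurable borel"
  by (rule jcont_measurable[OF \<kappa>]) measurable
 have "integrable lborel (\<lambda>y. if \<bar>x + (- 1) * y\<bar> <= t then \<kappa> t (x + (- 1) * y) else 0)"
  by (rule lborel_integrable_real_affine[OF cone_kernel_slice(1)[OF \<kappa>]]) simp
 then have "integrable lborel (\<lambda>y. if \<bar>x - y\<bar> <= t then \<kappa> t (x - y) else 0)" by (simp cong: if_cong)
 then show "integrable lborel (\<lambda>y. b * (if \<bar>x - y\<bar> <= t then \<kappa> t (x - y) else 0))"
  by (rule integrable_mult_right)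
 show "(\<lambda>y. if \<bar>x - y\<bar> <= t then \<kappa> t (x - y) * h y else 0) \<in> borel_measurable lborel" by measurable
 have "\<bar>if \<bar>x - y\<bar> <= t then \<kappa> t (x - y) * h y else 0\<bar> <= \<bar>b * (if \<bar>x - y\<bar> <= t then \<kappa> t (x - y) else 0)\<bar>" for y
 proof (cases "\<bar>x - y\<bar> <= t")
  case True
  have "\<bar>h y\<bar> <= \<bar>b\<bar>" using b[OF True] by simp
  from mult_left_mono[OF this, of "\<bar>\<kappa> t (x - y)\<bar>"] show ?thesis using True by (simp add: abs_mult mult.commute)
 qed simp
 then show "AE y in lborel. norm (if \<bar>x - y\<bar> <= t then \<kappa> t (x - y) * h y else 0)
   <= norm (b * (if \<bar>x - y\<bar> <= t then \<kappa> t (x - y) else 0))" by simp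
qed

lemma conv_sup_bound:
 assumes \<kappa>: "jcont \<kappa>" and pos: "!!z. \<bar>z\<bar> <= t ==> 0 <= \<kappa> t z"
  and h: "h \<in> borel_measurable borel" and b: "!!y. \<bar>x - y\<bar> <= t ==> \<bar>h y\<bar> <= b"
 shows "\<bar>conv \<kappa> t h x\<bar> <= mass \<kappa> t * b"
proof -
 let ?k = "\<lambda>z. if \<bar>z\<bar> <= t then \<kappa> t z else 0"
 have i: "integrable lborel (\<lambda>y. ?k (x + (- 1) * y))"
  by (rule lborel_integrable_real_affine[OF cone_kernel_slice(1)[OF \<kappa>]]) simp
 have I: "(LINT y|lborel. ?k (x + (- 1) * y)) = mass \<kappa> t"
  using lborel_integral_real_affine[where c="-1" and t=x and f="?k"] cone_kernel_slice(2)[OF \<kappa>, of t] by simp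
 have "\<bar>conv \<kappa> t h x\<bar> <= (LINT y|lborel. ?k (x + (- 1) * y) * b)"
  unfolding conv_def
 proof (rule integral_abs_le)
  show "integrable lborel (\<lambda>y. if \<bar>x - y\<bar> <= t then \<kappa> t (x - y) * h y else 0)"
   by (rule conv_integrable_locally[OF \<kappa> h b])
  show "integrable lborel (\<lambda>y. ?k (x + (- 1) * y) * b)" using i by simp
  fix y show "abs (if \<bar>x - y\<bar> <= t then \<kappa> t (x - y) * h y else 0) <= ?k (x + (- 1) * y) * b"
   using pos[of "x - y"] b[of y] by (simp add: abs_mult mult_left_mono)
 qed
 then show ?thesis using I by simp
qed

text \<open>Integrating in space multiplies by the mass of the kernel.\<close>

lemma conv_integral:
 assumes \<kappa>: "jcont \<kappa>" and h: "integrable lborel h"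
 shows "(LINT x|lborel. conv \<kappa> t h x) = mass \<kappa> t * (LINT y|lborel. h y)"
  "integrable lborel (conv \<kappa> t h)"
proof -
 let ?k = "\<lambda>z. if \<bar>z\<bar> <= t then \<kappa> t z else 0"
 note ki = cone_kernel_slice(1)[OF \<kappa>, of t]
 have [measurable]: "h \<in> borel_measurable borel" "?k \<in> borel_measurable borel" using h ki by auto
 have ksi: "integrable lborel (\<lambda>x. ?k (x - y))" for y
  using lborel_integrable_real_affine[OF ki, of 1 "-y"] by (simp cong: if_cong)
 have ksI: "(LINT x|lborel. g (x - y)) = (LINT x|lborel. g x)" for g :: "real => real" and y
  using lborel_integral_real_affine[where c=1 and t="-y" and f=g] by (simp add: add.commute)
 have int: "integrable plane (\<lambda>(y, x). ?k (x - y) * h y)"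
 proof (rule lborel_pair.Fubini_integrable)
  show "(\<lambda>(y, x). ?k (x - y) * h y) \<in> borel_measurable plane"
  proof -
   have "(\<lambda>p. ?k (snd p - fst p) * h (fst p)) \<in> borel_measurable plane"
    by (intro borel_measurable_times measurable_compose[of "\<lambda>p. snd p - fst p" _ borel ?k]) measurable
   then show ?thesis by (simp add: case_prod_beta')
  qed
  have "(LINT x|lborel. norm (case (y, x) of (y, x) => ?k (x - y) * h y)) = (LINT z|lborel. \<bar>?k z\<bar>) * \<bar>h y\<bar>" for y
   using ksI[of "\<lambda>z. \<bar>?k z\<bar>" y] by (simp add: abs_mult)
  then show "integrable lborel (\<lambda>y. LINT x|lborel. norm (case (y, x) of (y, x) => ?k (x - y) * h y))"
   using h by simp
  show "AE y in lborel. integrable lborel (\<lambda>x. case (y, x) of (y, x) => ?k (x - y) * h y)"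
   using ksi by simp
 qed
 have cv: "conv \<kappa> t h x = (LINT y|lborel. ?k (x - y) * h y)" for x
  unfolding conv_def by (rule lint_cong) auto
 show "integrable lborel (conv \<kappa> t h)"
  using lborel_pair.integrable_snd[OF int] by (simp add: cv[abs_def])
 have "(LINT x|lborel. conv \<kappa> t h x) = (LINT y|lborel. LINT x|lborel. ?k (x - y) * h y)"
  unfolding cv by (rule lborel_pair.Fubini_integral[OF int])
 also have "\<dots> = (LINT y|lborel. mass \<kappa> t * h y)"
  using ksI[of ?k] cone_kernel_slice(2)[OF \<kappa>, of t] by simp
 finally show "(LINT x|lborel. conv \<kappa> t h x) = mass \<kappa> t * (LINT y|lborel. h y)" by simp
qed

lemma conv_abs_le:
 assumes \<kappa>: "jcont \<kappa>" and pos: "!!z. \<bar>z\<bar> <= t ==> 0 <= \<kappa> t z" and h: "integrable lborel h"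
 shows "\<bar>conv \<kappa> t h x\<bar> <= conv \<kappa> t (\<lambda>y. \<bar>h y\<bar>) x"
proof -
 show ?thesis
  unfolding conv_def
  by (rule integral_abs_le)
    (use conv_integrable[OF \<kappa> h] conv_integrable[OF \<kappa> integrable_abs[OF h]] pos in \<open>auto simp: abs_mult\<close>)
qed

lemma conv_pointwise_bound:
 assumes \<kappa>: "jcont \<kappa>" and pos: "!!z. \<bar>z\<bar> <= t ==> 0 <= \<kappa> t z" and h: "integrable lborel h"
  and M: "!!z. \<bar>z\<bar> <= t ==> \<kappa> t z <= M" "0 <= M"
 shows "\<bar>conv \<kappa> t h x\<bar> <= M * (LINT y|lborel. \<bar>h y\<bar>)"
proof -
 have "\<bar>conv \<kappa> t h x\<bar> <= conv \<kappa> t (\<lambda>y. \<bar>h y\<bar>) x" by (rule conv_abs_le[OF \<kappa> pos h])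
 also have "\<dots> <= (LINT y|lborel. M * \<bar>h y\<bar>)"
  unfolding conv_def
  by (rule integral_mono[OF conv_integrable[OF \<kappa> integrable_abs[OF h]]]) (use h M in \<open>auto simp: mult_right_mono\<close>)
 finally show ?thesis by simp
qed

lemma conv_diff:
 assumes \<kappa>: "jcont \<kappa>" and "continuous_on UNIV h" "continuous_on UNIV k"
 shows "conv \<kappa> t h x - conv \<kappa> t k x = conv \<kappa> t (\<lambda>y. h y - k y) x"
proof -
 have i: "integrable lborel (\<lambda>y. if \<bar>x - y\<bar> <= t then \<kappa> t (x - y) * h y else 0)" if h: "continuous_on UNIV h" for h
 proof -
  obtain B where "B \<ge> 0" "\<forall>y\<in>{x - t..x + t}. \<bar>h y\<bar> <= B"
   using continuous_compact_bounded[of "{x - t..x + t}" h] continuous_on_subset[OF h] by auto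
  then show ?thesis
   by (intro conv_integrable_locally[OF \<kappa> borel_measurable_continuous_onI[OF h], of x t B]) (auto simp: abs_le_iff)
 qed
 have "conv \<kappa> t h x - conv \<kappa> t k x = (LINT y|lborel. (if \<bar>x - y\<bar> <= t then \<kappa> t (x - y) * h y else 0) - (if \<bar>x - y\<bar> <= t then \<kappa> t (x - y) * k y else 0))"
  unfolding conv_def by (rule Bochner_Integration.integral_diff[symmetric]) (intro i assms)+
 also have "\<dots> = conv \<kappa> t (\<lambda>y. h y - k y) x"
  unfolding conv_def by (rule lint_cong) (auto simp: algebra_simps)
 finally show ?thesis .
qed

lemma duh_integrand_continuous:
 assumes \<kappa>: "jcont \<kappa>" and F: "jcont F"
 shows "jcont (\<lambda>s x. conv \<kappa> (t - s) (F s) x)"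
proof -
 have "continuous_on UNIV (\<lambda>p::real\<times>real. (t - fst p, fst p, snd p))" by (intro continuous_intros)
 from continuous_on_compose2[OF continuous_conv_param[OF \<kappa> F] this] show ?thesis by simp
qed

lemma duh_integrand_integrable:
 assumes \<kappa>: "jcont \<kappa>" and F: "jcont F"
 shows "set_integrable lborel {0..t} (\<lambda>s. conv \<kappa> (t - s) (F s) x)"
 by (rule continuous_set_integrable[OF jcont_slice(2)[OF duh_integrand_continuous[OF assms]]])

lemma duh_diff:
 assumes \<kappa>: "jcont \<kappa>" and F: "jcont F" "jcont G"
 shows "duh \<kappa> F t x - duh \<kappa> G t x = duh \<kappa> (\<lambda>s y. F s y - G s y) t x"
proof -
 have "duh \<kappa> F t x - duh \<kappa> G t x = (LINT s:{0..t}|lborel. conv \<kappa> (t - s) (F s) x - conv \<kappa> (t - s) (G s) x)"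
  unfolding duh_def using duh_integrand_integrable[OF \<kappa>] F by (simp add: set_integral_diff(2))
 also have "\<dots> = duh \<kappa> (\<lambda>s y. F s y - G s y) t x"
  unfolding duh_def using conv_diff[OF \<kappa> jcont_slice(1)[OF F(1)] jcont_slice(1)[OF F(2)]] by simp
 finally show ?thesis .
qed

lemma duh_abs_le:
 assumes \<kappa>: "jcont \<kappa>" and F: "jcont F"
  and b: "!!s. s \<in> {0..t} ==> \<bar>conv \<kappa> (t - s) (F s) x\<bar> <= c s" and c: "set_integrable lborel {0..t} c"
 shows "\<bar>duh \<kappa> F t x\<bar> <= (LINT s:{0..t}|lborel. c s)"
proof -
 have "abs (LINT s|lborel. indicator {0..t} s *\<^sub>R conv \<kappa> (t - s) (F s) x) <= (LINT s|lborel. indicator {0..t} s *\<^sub>R c s)"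
  by (rule integral_abs_le)
    (use duh_integrand_integrable[OF \<kappa> F] c b in \<open>auto simp: set_integrable_def indicator_def\<close>)
 then show ?thesis by (simp add: duh_def set_int_def)
qed

text \<open>The bound behind the contraction: in a norm weighted by an exponential in time, the Duhamel operator
  gains a factor that is inversely proportional to the rate.\<close>

lemma duh_exponential_bound:
 assumes \<kappa>: "jcont \<kappa>" and pos: "!!t z. \<bar>z\<bar> <= t ==> 0 <= \<kappa> t z"
  and F: "jcont F" and t: "0 <= t" and l: "l > 0" and D: "D \<ge> 0"
  and m: "!!r. 0 <= r ==> r <= t ==> mass \<kappa> r <= M"
  and b: "!!s y. 0 <= s ==> s <= t ==> \<bar>x - y\<bar> <= t - s ==> \<bar>F s y\<bar> <= D * exp (l * s)"
 shows "\<bar>duh \<kappa> F t x\<bar> <= M * D / l * exp (l * t)"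
proof -
 have "mass \<kappa> 0 = 0" unfolding mass_def using set_integral_Ioc_Icc[of 0 0 "\<kappa> 0"] by (simp add: set_int_def)
 then have M: "M \<ge> 0" using m[of 0] t by simp
 have "\<bar>duh \<kappa> F t x\<bar> <= (LINT s:{0..t}|lborel. M * (D * exp (l * s)))"
 proof (rule duh_abs_le[OF \<kappa> F])
  fix s assume s: "s \<in> {0..t}"
  have "\<bar>conv \<kappa> (t - s) (F s) x\<bar> <= mass \<kappa> (t - s) * (D * exp (l * s))"
   by (rule conv_sup_bound[OF \<kappa> pos jcont_slice(3)[OF F]]) (use s b in auto)
  also have "\<dots> <= M * (D * exp (l * s))" using s D by (intro mult_right_mono m) auto
  finally show "\<bar>conv \<kappa> (t - s) (F s) x\<bar> <= M * (D * exp (l * s))" .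
 next
  show "set_integrable lborel {0..t} (\<lambda>s. M * (D * exp (l * s)))"
   by (rule continuous_set_integrable) (intro continuous_intros)
 qed
 also have "\<dots> = M * D / l * exp (l * t) - M * D / l * exp (l * 0)"
 proof (rule set_integral_FTC[OF t])
  show "((\<lambda>s. M * D / l * exp (l * s)) has_field_derivative M * (D * exp (l * s))) (at s)" for s
   using l by (auto intro!: derivative_eq_intros)
 qed (intro continuous_intros)
 also have "\<dots> <= M * D / l * exp (l * t)" using M D l by simp
 finally show ?thesis .
qed

lemma set_integral_support:
 fixes h :: "real => real"
 assumes "!!x. x < - L \<or> L < x ==> h x = 0" shows "(LINT x:{-L..L}|lborel. h x) = (LINT x|lborel. h x)"
 unfolding set_int_def
 by (rule lint_cong) (use assms in \<open>force simp: indicator_def\<close>)+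

lemma duh_integral:
 assumes \<kappa>: "jcont \<kappa>" and F: "source R F" and t: "0 <= t"
 shows "(LINT x|lborel. duh \<kappa> F t x) = (LINT s:{0..t}|lborel. mass \<kappa> (t - s) * (LINT y|lborel. F s y))"
proof -
 have Fc: "jcont F" and Fs: "!!s. supported (R + \<bar>s\<bar>) (F s)" using F by (auto simp: source_def)
 let ?L = "R + \<bar>t\<bar>"
 have "(LINT x|lborel. duh \<kappa> F t x) = (LINT x:{-?L..?L}|lborel. duh \<kappa> F t x)"
  by (rule set_integral_support[symmetric]) (use supported_duh[OF Fs, of t \<kappa>] in \<open>auto simp: supported_def\<close>)
 also have "\<dots> = (LINT s:{0..t}|lborel. LINT x:{-?L..?L}|lborel. conv \<kappa> (t - s) (F s) x)"
  unfolding duh_def by (rule Fubini_rectangle(1)[OF duh_integrand_continuous[OF \<kappa> Fc], symmetric])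
 also have "\<dots> = (LINT s:{0..t}|lborel. mass \<kappa> (t - s) * (LINT y|lborel. F s y))"
 proof (rule set_lebesgue_integral_cong)
  show "\<forall>s. s \<in> {0..t} --> (LINT x:{-?L..?L}|lborel. conv \<kappa> (t - s) (F s) x) = mass \<kappa> (t - s) * (LINT y|lborel. F s y)"
  proof (intro allI impI)
   fix s assume s: "s \<in> {0..t}"
   have "(LINT x:{-?L..?L}|lborel. conv \<kappa> (t - s) (F s) x) = (LINT x|lborel. conv \<kappa> (t - s) (F s) x)"
    by (rule set_integral_support) (rule conv_source_eq_0[OF Fs _ s])
   then show "(LINT x:{-?L..?L}|lborel. conv \<kappa> (t - s) (F s) x) = mass \<kappa> (t - s) * (LINT y|lborel. F s y)"
    using conv_integral(1)[OF \<kappa> source_integrable[OF F]] by simp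
  qed
 qed simp
 finally show ?thesis .
qed

section \<open>The integral equations and their uniqueness\<close>

lemma powr_lipschitz:
 fixes p M a b :: real
 assumes p: "p > 1" and a: "\<bar>a\<bar> <= M" and b: "\<bar>b\<bar> <= M"
 shows "\<bar>\<bar>a\<bar> powr p - \<bar>b\<bar> powr p\<bar> <= p * M powr (p - 1) * \<bar>a - b\<bar>"
proof -
 have *: "\<bar>y powr p - x powr p\<bar> <= p * M powr (p - 1) * \<bar>y - x\<bar>" if xy: "0 <= x" "x < y" "y <= M" for x y :: real
 proof -
  have d: "((\<lambda>z. z powr p) has_real_derivative p * z powr (p - 1)) (at z)" if "z > 0" for z
   using that by (rule has_real_derivative_powr)
  obtain l z where lz: "x < z" "z < y" "((\<lambda>z. z powr p) has_real_derivative l) (at z)" "y powr p - x powr p = (y - x) * l"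
  proof (rule MVT[OF xy(2), of "\<lambda>z. z powr p", THEN exE])
   show "continuous_on {x..y} (\<lambda>z. z powr p)"
    by (intro continuous_on_powr' continuous_intros) (use xy p in auto)
   show "(\<lambda>z. z powr p) differentiable (at z)" if "x < z" "z < y" for z
    using d[of z] that xy real_differentiable_def by auto
  qed (use that in blast)
  have "l = p * z powr (p - 1)" using DERIV_unique[OF lz(3) d[of z]] lz(1) xy by auto
  moreover have "z powr (p - 1) <= M powr (p - 1)" using lz xy p by (intro powr_mono2) auto
  ultimately have "0 <= l" "l <= p * M powr (p - 1)" using p by (auto intro: mult_left_mono)
  then show ?thesis unfolding lz(4) using xy by (simp add: abs_mult mult.commute mult_left_mono)
 qed
 have M: "\<bar>\<bar>a\<bar> - \<bar>b\<bar>\<bar> <= \<bar>a - b\<bar>" by (rule abs_triangle_ineq3)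
 have "\<bar>\<bar>a\<bar> powr p - \<bar>b\<bar> powr p\<bar> <= p * M powr (p - 1) * \<bar>\<bar>a\<bar> - \<bar>b\<bar>\<bar>"
 proof (cases "\<bar>a\<bar> < \<bar>b\<bar>")
  case True
  then show ?thesis using *[of "\<bar>a\<bar>" "\<bar>b\<bar>"] b by (simp add: abs_minus_commute)
 next
  case False
  then show ?thesis using *[of "\<bar>b\<bar>" "\<bar>a\<bar>"] a by (cases "\<bar>a\<bar> = \<bar>b\<bar>") auto
 qed
 also have "\<dots> <= p * M powr (p - 1) * \<bar>a - b\<bar>" using M p by (intro mult_left_mono) auto
 finally show ?thesis .
qed

lemma jcont_powr:
 assumes "jcont v" "p > 0" shows "jcont (\<lambda>s y. \<bar>v s y\<bar> powr p)"
 by (intro continuous_on_powr' continuous_intros assms) (use assms in auto)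

text \<open>The two integral equations for continuous representatives on \<open>[0, T]\<close>. They are
  required almost everywhere, as for mild solutions, and the free parts are arbitrary.\<close>

definition sol :: "real => real => real => (real => real => real) => (real => real => real) =>
  (real => real => real) => (real => real => real) => bool" where
 "sol p q T ul vl u v \<longleftrightarrow> jcont u \<and> jcont v \<and>
   (\<forall>t\<in>{0..T}. AE x in lborel. u t x = ul t x + duh ker_d (\<lambda>s y. \<bar>v s y\<bar> powr p) t x) \<and>
   (\<forall>t\<in>{0..T}. AE x in lborel. v t x = vl t x + duh ker_w (\<lambda>s y. \<bar>u s y\<bar> powr q) t x)"

lemma AE_open_bound:
 fixes f :: "real => real"
 assumes f: "continuous_on UNIV f" and A: "open A" and ae: "AE x in lborel. x \<in> A --> f x <= c" and x: "x \<in> A"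
 shows "f x <= c"
proof (rule ccontr)
 assume "\<not> f x <= c"
 define U where "U = A \<inter> f -` {c<..}"
 have U: "open U" "x \<in> U" using A f x \<open>\<not> f x <= c\<close> by (auto simp: U_def open_vimage intro!: open_Int)
 then obtain e where e: "e > 0" "ball x e \<subseteq> U" using open_contains_ball by blast
 have "AE y in lborel. y \<notin> ball x e"
  using ae by eventually_elim (use e(2) in \<open>auto simp: U_def\<close>)
 then have "emeasure lborel (ball x e) = 0" by (subst (asm) AE_iff_measurable[of "ball x e"]) auto
 moreover have "ball x e = {x - e<..<x + e}" by (auto simp: dist_real_def abs_less_iff)
 ultimately show False using e by simp
qed

lemma mass_d_le: "0 <= r ==> mass ker_d r <= 1" using mass_d by simp

text \<open>The weight \<open>exp (2 K L t)\<close> makes the Duhamel operator composed with a power a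
  contraction by one half. Only the backward cone of \<open>(t, x)\<close> enters.\<close>

lemma duh_power_lipschitz:
 assumes \<kappa>: "jcont \<kappa>" "!!t z. \<bar>z\<bar> <= t ==> 0 <= \<kappa> t z" "!!r. 0 <= r ==> r <= T ==> mass \<kappa> r <= K"
  and z: "jcont z" "jcont z'" and bz: "!!t x. \<bar>z t x\<bar> <= M" "!!t x. \<bar>z' t x\<bar> <= M"
  and r: "r > 1" "r * M powr (r - 1) <= L" and L: "L > 0" and K: "K > 0" and t: "t \<in> {0..T}"
  and D: "D \<ge> 0" "!!s y. 0 <= s ==> s <= t ==> \<bar>x - y\<bar> <= t - s ==> \<bar>z s y - z' s y\<bar> <= D * exp (2 * K * L * s)"
 shows "\<bar>duh \<kappa> (\<lambda>s y. \<bar>z s y\<bar> powr r) t x - duh \<kappa> (\<lambda>s y. \<bar>z' s y\<bar> powr r) t x\<bar> <= (D / 2) * exp (2 * K * L * t)"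
proof -
 have pc: "jcont (\<lambda>s y. \<bar>z s y\<bar> powr r)" "jcont (\<lambda>s y. \<bar>z' s y\<bar> powr r)"
  using r z by (auto intro!: jcont_powr)
 have l: "2 * K * L > 0" using K L by simp
 have "\<bar>duh \<kappa> (\<lambda>s y. \<bar>z s y\<bar> powr r - \<bar>z' s y\<bar> powr r) t x\<bar> <= K * (L * D) / (2 * K * L) * exp (2 * K * L * t)"
 proof (rule duh_exponential_bound[OF \<kappa>(1,2) _ _ l])
  show "jcont (\<lambda>s y. \<bar>z s y\<bar> powr r - \<bar>z' s y\<bar> powr r)" by (intro continuous_intros pc)
  fix s y assume s: "0 <= s" "s <= t" "\<bar>x - y\<bar> <= t - s"
  have "\<bar>\<bar>z s y\<bar> powr r - \<bar>z' s y\<bar> powr r\<bar> <= r * M powr (r - 1) * \<bar>z s y - z' s y\<bar>"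
   by (rule powr_lipschitz[OF r(1) bz])
  also have "\<dots> <= L * (D * exp (2 * K * L * s))"
   using L D(2)[OF s] by (intro mult_mono r(2)) auto
  finally show "\<bar>\<bar>z s y\<bar> powr r - \<bar>z' s y\<bar> powr r\<bar> <= L * D * exp (2 * K * L * s)" by simp
 qed (use t D L \<kappa>(3) in auto)
 also have "K * (L * D) / (2 * K * L) = D / 2" using K L by (simp add: field_simps)
 finally show ?thesis unfolding duh_diff[OF \<kappa>(1) pc] .
qed

text \<open>Uniqueness on a family of open sets that contains its backward cones; this gives both global
  uniqueness and finite speed of propagation.\<close>

lemma sol_unique_on:
 assumes pq: "p > 1" "q > 1" and T: "T \<ge> 0"
  and s1: "sol p q T ul vl u v" and s2: "sol p q T ul' vl' u' v'"
  and bd: "!!t x. \<bar>u t x\<bar> <= M" "!!t x. \<bar>v t x\<bar> <= M" "!!t x. \<bar>u' t x\<bar> <= M" "!!t x. \<bar>v' t x\<bar> <= M"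
  and A: "!!t. open (A t)" "!!s t x y. 0 <= s ==> s <= t ==> x \<in> A t ==> \<bar>x - y\<bar> <= t - s ==> y \<in> A s"
  and lin: "!!t. t \<in> {0..T} ==> AE x in lborel. x \<in> A t --> ul t x = ul' t x"
   "!!t. t \<in> {0..T} ==> AE x in lborel. x \<in> A t --> vl t x = vl' t x"
  and t: "t \<in> {0..T}" and x: "x \<in> A t"
 shows "u t x = u' t x" "v t x = v' t x"
proof -
 have uc: "jcont u" "jcont v" "jcont u'" "jcont v'"
  using s1 s2 by (auto simp: sol_def)
 define L where "L = p * M powr (p - 1) + q * M powr (q - 1) + 1"
 have L: "L > 0" "p * M powr (p - 1) <= L" "q * M powr (q - 1) <= L"
  unfolding L_def using pq by (auto intro: add_nonneg_pos add_nonneg_nonneg)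
 define K where "K = 1 + T"
 define l where "l = 2 * K * L"
 have l: "l > 0" "K > 0" unfolding l_def K_def using T L by auto
 have M: "M \<ge> 0" using bd(1)[of 0 0] by linarith
 have step: "\<bar>w t x - w' t x\<bar> <= (D / 2) * exp (l * t)"
  if w: "jcont w" "jcont w'" and z: "jcont z" "jcont z'"
   and \<kappa>: "jcont \<kappa>" "!!t z. \<bar>z\<bar> <= t ==> 0 <= \<kappa> t z" "!!r. 0 <= r ==> r <= T ==> mass \<kappa> r <= K"
   and r: "r > 1" "r * M powr (r - 1) <= L" and bz: "!!t x. \<bar>z t x\<bar> <= M" "!!t x. \<bar>z' t x\<bar> <= M"
   and eq: "AE x in lborel. w t x = wl t x + duh \<kappa> (\<lambda>s y. \<bar>z s y\<bar> powr r) t x"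
    "AE x in lborel. w' t x = wl' t x + duh \<kappa> (\<lambda>s y. \<bar>z' s y\<bar> powr r) t x"
   and wl: "AE x in lborel. x \<in> A t --> wl t x = wl' t x"
   and D: "D \<ge> 0" "!!s y. s \<in> {0..T} ==> y \<in> A s ==> \<bar>z s y - z' s y\<bar> <= D * exp (l * s)"
   and t: "t \<in> {0..T}" and x: "x \<in> A t"
  for w w' z z' \<kappa> r wl wl' D t x
 proof -
  have db: "\<bar>duh \<kappa> (\<lambda>s y. \<bar>z s y\<bar> powr r) t x - duh \<kappa> (\<lambda>s y. \<bar>z' s y\<bar> powr r) t x\<bar> <= (D / 2) * exp (l * t)"
   if x: "x \<in> A t" for x
   unfolding l_def
   by (rule duh_power_lipschitz[OF \<kappa> z bz r L(1) l(2) t D(1)])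
     (use D(2) A(2)[OF _ _ x] t in \<open>auto simp: l_def\<close>)
  have "AE x in lborel. x \<in> A t --> \<bar>w t x - w' t x\<bar> <= (D / 2) * exp (l * t)"
   using eq(1) eq(2) wl
  proof eventually_elim
   case (elim x)
   then show ?case using db[of x] by auto
  qed
  then show ?thesis
   by (rule AE_open_bound[OF _ A(1) _ x, rotated])
     (intro continuous_intros jcont_slice(1)[OF w(1)] jcont_slice(1)[OF w(2)])
 qed
 have mK: "mass ker_d r <= K" if "0 <= r" "r <= T" for r
  using mass_d_le[OF that(1)] T unfolding K_def by linarith
 have main: "\<forall>t\<in>{0..T}. \<forall>x\<in>A t. \<bar>u t x - u' t x\<bar> <= (2 * M / 2 ^ n) * exp (l * t) \<and> \<bar>v t x - v' t x\<bar> <= (2 * M / 2 ^ n) * exp (l * t)" for n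
 proof (induction n)
  case 0
  show ?case
  proof (intro ballI)
   fix t x assume t: "t \<in> {0..T}"
   have "1 <= exp (l * t)" using t l by simp
   then have e: "2 * M <= 2 * M * exp (l * t)" using mult_left_mono[of 1 "exp (l * t)" "2 * M"] M by simp
   have "\<bar>u t x - u' t x\<bar> <= 2 * M" "\<bar>v t x - v' t x\<bar> <= 2 * M"
    using bd(1)[of t x] bd(3)[of t x] bd(2)[of t x] bd(4)[of t x] by linarith+
   then show "\<bar>u t x - u' t x\<bar> <= (2 * M / 2 ^ 0) * exp (l * t) \<and> \<bar>v t x - v' t x\<bar> <= (2 * M / 2 ^ 0) * exp (l * t)"
    using e by simp
  qed
 next
  case (Suc n)
  let ?D = "2 * M / 2 ^ n"
  have D: "?D \<ge> 0" using M by simp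
  have half: "2 * M / 2 ^ Suc n = ?D / 2" by simp
  show ?case
   unfolding half
  proof (intro ballI conjI)
   fix t x assume t: "t \<in> {0..T}" and x: "x \<in> A t"
   show "\<bar>u t x - u' t x\<bar> <= (?D / 2) * exp (l * t)"
    by (rule step[where w=u and w'=u' and z=v and z'=v' and \<kappa>=ker_d and r=p and wl=ul and wl'=ul',
       OF uc(1,3) uc(2,4) jcont_kernels(2) ker_nonneg(2) mK pq(1) L(2) bd(2,4) _ _ lin(1)[OF t] D _ t x])
      (use s1 s2 t Suc.IH in \<open>auto simp: sol_def\<close>)
   show "\<bar>v t x - v' t x\<bar> <= (?D / 2) * exp (l * t)"
    by (rule step[where w=v and w'=v' and z=u and z'=u' and \<kappa>=ker_w and r=q and wl=vl and wl'=vl',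
       OF uc(2,4) uc(1,3) jcont_kernels(1) ker_nonneg(1) _ pq(2) L(3) bd(1,3) _ _ lin(2)[OF t] D _ t x])
      (use s1 s2 t Suc.IH in \<open>auto simp: sol_def K_def mass_w\<close>)
  qed
 qed
 have lim: "(\<lambda>n. (2 * M / 2 ^ n) * exp (l * t)) \<longlonglongrightarrow> 0"
 proof -
  have "(\<lambda>n. (2 * M * exp (l * t)) * (1 / 2) ^ n) \<longlonglongrightarrow> (2 * M * exp (l * t)) * 0"
   by (intro tendsto_intros LIMSEQ_realpow_zero) auto
  then show ?thesis by (simp add: power_divide mult.commute mult.left_commute)
 qed
 have "\<bar>u t x - u' t x\<bar> <= 0" "\<bar>v t x - v' t x\<bar> <= 0"
  by (rule LIMSEQ_le_const[OF lim]; use main t x in blast)+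
 then show "u t x = u' t x" "v t x = v' t x" by auto
qed

text \<open>By the Sobolev embedding the continuous representatives depend continuously on \<open>t\<close> in
  the supremum norm. Freezing time outside \<open>[0, T]\<close> makes the representative bounded and continuous
  on the whole plane.\<close>

lemma C0_curve_representative:
 assumes C: "C0_curve S H1_space H1_norm u" and T: "0 <= T" "{0..T} \<subseteq> S"
 shows "\<exists>w M. jcont w \<and> (\<forall>t x. \<bar>w t x\<bar> <= M) \<and> (\<forall>t. w t = w (max 0 (min T t)))
  \<and> (\<forall>t\<in>{0..T}. AE x in lborel. u t x = w t x)"
proof -
 have "\<forall>t\<in>{0..T}. \<exists>F. (\<exists>G. weak_pair F G) \<and> (AE x in lborel. u t x = F x)"
 proof
  fix t assume "t \<in> {0..T}"
  then have "u t \<in> H1_space" using C T by (auto simp: C0_curve_def)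
  from H1_weak_pair[OF this] show "\<exists>F. (\<exists>G. weak_pair F G) \<and> (AE x in lborel. u t x = F x)" by iprover
 qed
 from bchoice[OF this] obtain w where w: "!!t. t \<in> {0..T} ==> \<exists>G. weak_pair (w t) G"
   "!!t. t \<in> {0..T} ==> AE x in lborel. u t x = w t x" by blast
 define N where "N = (\<lambda>s t. sqrt 2 * H1_norm (\<lambda>x. u s x - u t x))"
 have N: "\<bar>w s x - w t x\<bar> <= N s t" if s: "s \<in> {0..T}" and t: "t \<in> {0..T}" for s t x
 proof -
  obtain G G' where G: "weak_pair (w s) G" "weak_pair (w t) G'" using w(1) s t by blast
  have "AE x in lborel. u s x - u t x = w s x - w t x"
   using w(2)[OF s] w(2)[OF t] by eventually_elim simp
  from H1_norm_eq[OF weak_pair_diff[OF G] this] weak_pair_sup_bound[OF weak_pair_diff[OF G], of x]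
  have "(w s x - w t x)\<^sup>2 <= (N s t)\<^sup>2" by (simp add: N_def power_mult_distrib sq_norm_nonneg)
  moreover have "N s t \<ge> 0" using H1_norm_eq[OF weak_pair_diff[OF G] \<open>AE x in lborel. u s x - u t x = w s x - w t x\<close>]
   by (simp add: N_def sq_norm_nonneg)
  ultimately show ?thesis by (simp add: abs_le_square_iff[symmetric])
 qed
 have Nlim: "\<exists>d>0. \<forall>s\<in>{0..T}. \<bar>s - t\<bar> < d --> (\<forall>x. \<bar>w s x - w t x\<bar> < e)" if t: "t \<in> {0..T}" and e: "e > 0" for t e
 proof -
  have "((\<lambda>s. H1_norm (\<lambda>x. u s x - u t x)) \<longlongrightarrow> 0) (at t within S)" using C T t by (auto simp: C0_curve_def)
  then have "((\<lambda>s. N s t) \<longlongrightarrow> sqrt 2 * 0) (at t within S)" unfolding N_def by (intro tendsto_intros)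
  then have "eventually (\<lambda>s. N s t < e) (at t within S)" by (rule order_tendstoD) (use e in simp)
  then obtain d where d: "d > 0" "!!s. s \<in> S ==> s \<noteq> t ==> dist s t < d ==> N s t < e"
   unfolding eventually_at by blast
  show ?thesis
  proof (intro exI[of _ d] conjI ballI impI allI d(1))
   fix s x assume s: "s \<in> {0..T}" "\<bar>s - t\<bar> < d"
   show "\<bar>w s x - w t x\<bar> < e"
   proof (cases "s = t")
    case False
    then have "N s t < e" using d(2)[of s] s T by (auto simp: dist_real_def)
    then show ?thesis using N[OF s(1) t, of x] by linarith
   qed (use e in simp)
  qed
 qed
 define c where "c = (\<lambda>t. max 0 (min T t))"
 have cT: "c t \<in> {0..T}" for t using T by (auto simp: c_def)
 have cl: "\<bar>c s - c t\<bar> <= \<bar>s - t\<bar>" for s t by (auto simp: c_def max_def min_def abs_if)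
 have ce: "c t = t" if "t \<in> {0..T}" for t using that by (auto simp: c_def)
 define W where "W = (\<lambda>t x. w (c t) x)"
 have wc: "continuous_on UNIV (w t)" if "t \<in> {0..T}" for t using w(1)[OF that] by (auto simp: weak_pair_def)
 have Wc: "jcont W"
 proof (rule continuous_at_imp_continuous_on, rule ballI)
  fix p :: "real \<times> real"
  show "isCont (\<lambda>p. W (fst p) (snd p)) p"
   unfolding continuous_at_eps_delta
  proof (intro allI impI)
   fix e :: real assume e: "e > 0"
   obtain d1 where d1: "d1 > 0" "\<forall>s\<in>{0..T}. \<bar>s - c (fst p)\<bar> < d1 --> (\<forall>x. \<bar>w s x - w (c (fst p)) x\<bar> < e / 2)"
    using Nlim[OF cT, of "e / 2" "fst p"] e by auto
   have "isCont (w (c (fst p))) (snd p)" using wc[OF cT] by (simp add: continuous_on_eq_continuous_at)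
   then obtain d2 where d2: "d2 > 0" "!!x. dist x (snd p) < d2 ==> dist (w (c (fst p)) x) (w (c (fst p)) (snd p)) < e / 2"
    unfolding continuous_at_eps_delta using e by (meson half_gt_zero)
   show "\<exists>d>0. \<forall>q. dist q p < d --> dist (W (fst q) (snd q)) (W (fst p) (snd p)) < e"
   proof (intro exI[of _ "min d1 d2"] conjI allI impI)
    fix q :: "real \<times> real" assume q: "dist q p < min d1 d2"
    have "\<bar>fst q - fst p\<bar> < d1" "dist (snd q) (snd p) < d2"
     using dist_fst_le[of q p] dist_snd_le[of q p] q by (auto simp: dist_real_def)
    then have "\<bar>w (c (fst q)) (snd q) - w (c (fst p)) (snd q)\<bar> < e / 2"
     "dist (w (c (fst p)) (snd q)) (w (c (fst p)) (snd p)) < e / 2"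
     using d1(2) cT[of "fst q"] cl[of "fst q" "fst p"] d2(2) by auto
    then show "dist (W (fst q) (snd q)) (W (fst p) (snd p)) < e" unfolding W_def dist_real_def by linarith
   qed (use d1 d2 in auto)
  qed
 qed
 have wb: "\<exists>B. \<forall>x. \<bar>w t x\<bar> <= B" if t: "t \<in> {0..T}" for t
 proof -
  obtain G where G: "weak_pair (w t) G" using w(1)[OF t] by blast
  have "\<bar>w t x\<bar> <= sqrt (2 * (sq_norm (w t) + sq_norm G))" for x
   using weak_pair_sup_bound[OF G, of x] real_sqrt_le_mono[of "(w t x)\<^sup>2"] by fastforce
  then show ?thesis by blast
 qed
 define m where "m = (\<lambda>t. SUP x. \<bar>w t x\<bar>)"
 have ms: "m t = (SUP x. \<bar>w t x\<bar>)" for t by (simp add: m_def)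
 have mb: "\<bar>w t x\<bar> <= m t" if "t \<in> {0..T}" for t x
  unfolding m_def by (rule cSUP_upper) (use wb[OF that] in \<open>auto simp: bdd_above_def\<close>)
 have "continuous_on {0..T} m"
  unfolding continuous_on_iff
 proof (intro ballI allI impI)
  fix t e :: real assume t: "t \<in> {0..T}" and e: "e > 0"
  obtain d where d: "d > 0" "\<forall>s\<in>{0..T}. \<bar>s - t\<bar> < d --> (\<forall>x. \<bar>w s x - w t x\<bar> < e / 2)"
   using Nlim[OF t, of "e / 2"] e by auto
  show "\<exists>d>0. \<forall>s\<in>{0..T}. dist s t < d --> dist (m s) (m t) < e"
  proof (intro exI[of _ d] conjI ballI impI d(1))
   fix s assume s: "s \<in> {0..T}" "dist s t < d"
   have *: "\<bar>w s x - w t x\<bar> < e / 2" for x using d(2) s by (auto simp: dist_real_def)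
   have "m s <= m t + e / 2"
    unfolding ms[of s] 
   proof (rule cSUP_least)
    fix x show "\<bar>w s x\<bar> <= m t + e / 2" using *[of x] mb[OF t, of x] by linarith
   qed simp
   moreover have "m t <= m s + e / 2"
    unfolding ms[of t]
   proof (rule cSUP_least)
    fix x show "\<bar>w t x\<bar> <= m s + e / 2" using *[of x] mb[OF s(1), of x] by linarith
   qed simp
   ultimately show "dist (m s) (m t) < e" using e by (simp add: dist_real_def abs_if)
  qed
 qed
 then obtain B where B: "\<forall>t\<in>{0..T}. \<bar>m t\<bar> <= B" using continuous_compact_bounded[of "{0..T}" m] by auto
 have "\<bar>W t x\<bar> <= B" for t x
  using mb[OF cT, of t x] B cT[of t] unfolding W_def by (meson abs_ge_self order_trans)
 moreover have "\<forall>t\<in>{0..T}. AE x in lborel. u t x = W t x"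
 proof
  fix t assume t: "t \<in> {0..T}"
  show "AE x in lborel. u t x = W t x" using w(2)[OF t] by (simp add: W_def ce[OF t])
 qed
 moreover have "c (max 0 (min T t)) = c t" for t unfolding c_def using T by (auto simp: max_def min_def)
 then have "W t = W (max 0 (min T t))" for t by (simp add: W_def)
 ultimately show ?thesis using Wc by (intro exI[of _ W] exI[of _ B] conjI allI) assumption+
qed

section \<open>From mild solutions to integral equations and back\<close>

text \<open>Lindelof's theorem replaces the union of all open null sets of \<open>f\<close> by a countable
  one.\<close>

lemma ess_supp_AE:
 assumes "ess_supp f \<subseteq> {-R..R}" shows "AE x in lborel. x \<notin> {-R..R} --> f x = 0"
proof -
 define \<U> where "\<U> = {U :: real set. open U \<and> (AE x in lebesgue. x \<in> U --> f x = 0)}"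
 have "!!S. S \<in> \<U> ==> open S" by (auto simp: \<U>_def)
 then obtain \<V> where V: "\<V> \<subseteq> \<U>" "countable \<V>" "\<Union>\<V> = \<Union>\<U>" by (rule Lindelof)
 have "AE x in lborel. \<forall>U\<in>\<V>. x \<in> U --> f x = 0"
 proof (rule AE_ball_countable[OF V(2), THEN iffD2], rule ballI)
  fix U assume "U \<in> \<V>"
  then have "AE x in lebesgue. x \<in> U --> f x = 0" using V(1) by (auto simp: \<U>_def)
  then show "AE x in lborel. x \<in> U --> f x = 0" by (simp only: AE_completion_iff)
 qed
 then show ?thesis
 proof eventually_elim
  case (elim x)
  have "x \<in> \<Union>\<U>" if "x \<notin> {-R..R}" using assms that unfolding ess_supp_def \<U>_def by blast
  then show ?case using elim V(3) by blast
 qed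
qed

text \<open>Representatives of one data pair: the initial value \<open>f\<close> with derivative
  \<open>f'\<close> and the initial velocity \<open>g\<close>, all vanishing off \<open>[-R, R]\<close>.\<close>

definition free_data :: "real => (real => real) => (real => real) => (real => real) => bool" where
 "free_data R f f' g \<longleftrightarrow> weak_pair f f' \<and> supported R f \<and> supported R f' \<and> sq_int g \<and> supported R g"

lemma sq_int_truncate:
 assumes "sq_int g" shows "sq_int (\<lambda>x. indicator {-R..R} x * g x)"
proof -
 have [measurable]: "g \<in> borel_measurable borel" using assms by (simp add: sq_int_def)
 have "integrable lborel (\<lambda>x. (indicator {-R..R} x * g x)\<^sup>2)"
 proof (rule int_bound)
  show "integrable lborel (\<lambda>x. (g x)\<^sup>2)" using assms by (simp add: sq_int_def)
  show "AE x in lborel. norm ((indicator {-R..R} x * g x)\<^sup>2) <= norm ((g x)\<^sup>2)"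
   by (auto simp: indicator_def)
 qed measurable
 then show ?thesis by (simp add: sq_int_def)
qed

lemma free_data_exists:
 assumes f0: "f0 \<in> H1_space" and g0: "g0 \<in> Lp_space 2" and s: "ess_supp f0 \<union> ess_supp g0 \<subseteq> {-R..R}"
 shows "\<exists>f f' g. free_data R f f' g \<and> (AE x in lborel. f0 x = f x) \<and> (AE x in lborel. g0 x = g x)"
proof -
 obtain F G where FG: "weak_pair F G" "AE x in lborel. f0 x = F x" using H1_weak_pair[OF f0] by iprover
 obtain k where k: "sq_int k" "AE x in lborel. g0 x = k x" using g0 unfolding Lp_space_2_iff by iprover
 define G' where "G' = (\<lambda>x. indicator {-R..R} x * G x)"
 define g where "g = (\<lambda>x. indicator {-R..R} x * k x)"
 have sq: "sq_int F" "sq_int G" and Fc: "continuous_on UNIV F" using FG by (auto simp: weak_pair_def)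
 have sG: "supported R G'" "supported R g" by (auto simp: supported_def G'_def g_def indicator_def)
 have sqg: "sq_int G'" "sq_int g" unfolding G'_def g_def by (rule sq_int_truncate sq(2) k(1))+
 have "AE x in lborel. x \<notin> {-R..R} --> f0 x = 0" by (rule ess_supp_AE) (use s in blast)
 with FG(2) have "AE x in lborel. x \<in> - {-R..R} --> \<bar>F x\<bar> <= 0" by eventually_elim auto
 then have F0: "F x = 0" if "x \<notin> {-R..R}" for x
  using AE_open_bound[of "\<lambda>x. \<bar>F x\<bar>" "- {-R..R}" 0 x] that Fc by (auto intro: continuous_intros)
 (* By continuity F also vanishes at the end points, so cutting off its derivative
  there does not change the increments of F. *)
 have FR: "F (-R) = 0 \<and> F R = 0"
 proof -
  have "\<bar>F x\<bar> <= 0" if "x = R \<or> x = -R" for x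
  proof (rule ccontr)
   assume "\<not> \<bar>F x\<bar> <= 0"
   have "isCont F x" using Fc by (simp add: continuous_on_eq_continuous_at)
   moreover have "\<bar>F x\<bar> > 0" using \<open>\<not> \<bar>F x\<bar> <= 0\<close> by simp
   ultimately obtain d where d: "d > 0" "!!y. dist y x < d ==> dist (F y) (F x) < \<bar>F x\<bar>"
    unfolding continuous_at_eps_delta by blast
   define y where "y = (if x = R then (if R \<ge> 0 then R + d / 2 else R) else (if R \<ge> 0 then - R - d / 2 else - R))"
   have "y \<notin> {-R..R}" "dist y x < d" using that d(1) by (auto simp: y_def dist_real_def)
   then show False using d(2)[of y] F0[of y] by (simp add: dist_real_def)
  qed
  then show ?thesis by fastforce
 qed
 have GG: "(LINT y:{a..b}|lborel. G' y) = (LINT y:{max a (-R)..min b R}|lborel. G y)" for a b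
  unfolding set_int_def G'_def by (rule lint_cong) (auto simp: indicator_def)
 have d: "F b - F a = (LINT y:{a..b}|lborel. G' y)" if ab: "a <= b" for a b
 proof (cases "max a (-R) <= min b R")
  case True
  have "F (min b R) = F b" using F0[of b] FR True ab by (cases "b = R") (auto simp: min_def)
  moreover have "F (max a (-R)) = F a" using F0[of a] FR True ab by (cases "a = - R") (auto simp: max_def)
  ultimately show ?thesis using FG(1) True unfolding GG weak_pair_def by metis
 next
  case False
  then have "F a = 0" "F b = 0" using F0[of a] F0[of b] FR ab by (auto simp: max_def min_def split: if_splits)
  moreover have "{max a (-R)..min b R} = {}" using False by auto
  then have "(LINT y:{max a (-R)..min b R}|lborel. G y) = 0" by (simp only: set_int_def) simp
  ultimately show ?thesis unfolding GG by simp
 qed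
 have "weak_pair F G'" unfolding weak_pair_def using sq sqg Fc d by blast
 moreover have "supported R F" using F0 by (auto simp: supported_def)
 moreover have "AE x in lborel. g0 x = g x"
 proof -
  have "AE x in lborel. x \<notin> {-R..R} --> g0 x = 0" by (rule ess_supp_AE) (use s in blast)
  with k(2) show ?thesis by eventually_elim (auto simp: g_def indicator_def)
 qed
 ultimately have "free_data R F G' g \<and> (AE x in lborel. f0 x = F x) \<and> (AE x in lborel. g0 x = g x)"
  using sG sqg FG(2) by (simp add: free_data_def)
 then show ?thesis by iprover
qed

lemma free_dataD:
 assumes "free_data R f f' g"
 shows "integrable lborel f" "integrable lborel g" "continuous_on UNIV f" "sq_int f" "sq_int g"
  "supported R f" "supported R g" "supported R f'" "weak_pair f f'"
 using assms sq_int_supported_integrable by (auto simp: free_data_def weak_pair_def)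

lemma AE_lborel_shift:
 assumes "AE x in lborel. P (x::real)" shows "AE x in lborel. P (x + t)"
proof -
 obtain N where N: "{x. \<not> P x} \<subseteq> N" "N \<in> null_sets lborel" using assms by (auto simp: eventually_ae_filter)
 have [measurable]: "N \<in> sets borel" using N(2) by auto
 have "(\<integral>\<^sup>+x. indicator N (t + 1 * x) \<partial>lborel) = (\<integral>\<^sup>+x. indicator N x \<partial>lborel)"
  using nn_integral_real_affine[of "indicator N" 1 t] by simp
 also have "\<dots> = 0" using N(2) by (simp add: null_setsD1)
 finally have "AE x in lborel. indicator N (t + 1 * x) = (0::ennreal)"
  by (subst (asm) nn_integral_0_iff_AE) auto
 then show ?thesis
 proof eventually_elim
  case (elim x)
  then have "t + x \<notin> N" by (auto simp: indicator_def split: if_splits)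
  then show ?case using N(1) by (auto simp: add.commute)
 qed
qed

lemma damped_wave_prop_cong:
 assumes f: "AE x in lborel. f0 x = f x" and g: "AE x in lborel. g0 x = g x"
 shows "AE x in lborel. damped_wave_prop t f0 g0 x = damped_wave_prop t f g x"
proof -
 have I: "(LINT y:{x - t..x + t}|lebesgue.
      (let \<rho> = sqrt (t\<^sup>2 - (x - y)\<^sup>2)
      in bessel_I 0 (\<rho> / 2) * (g0 y + f0 y / 2) + t / (2 * \<rho>) * bessel_I 1 (\<rho> / 2) * f0 y))
  = (LINT y:{x - t..x + t}|lebesgue.
      (let \<rho> = sqrt (t\<^sup>2 - (x - y)\<^sup>2)
      in bessel_I 0 (\<rho> / 2) * (g y + f y / 2) + t / (2 * \<rho>) * bessel_I 1 (\<rho> / 2) * f y))" for x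
  unfolding set_int_def
  by (rule lebesgue_integral_cong_AE(1)) (use f g in \<open>eventually_elim, simp\<close>)
 show ?thesis using AE_lborel_shift[OF f, of t] AE_lborel_shift[OF f, of "-t"]
 proof eventually_elim
  case (elim x)
  then show ?case unfolding damped_wave_prop_def I by simp
 qed
qed

lemma wave_prop_cong:
 assumes f: "AE x in lborel. f0 x = f x" and g: "AE x in lborel. g0 x = g x"
 shows "AE x in lborel. wave_prop t f0 g0 x = wave_prop t f g x"
proof -
 have I: "(LINT y:{x - t..x + t}|lebesgue. g0 y) = (LINT y:{x - t..x + t}|lebesgue. g y)" for x
  unfolding set_int_def
  by (rule lebesgue_integral_cong_AE(1)) (use g in \<open>eventually_elim, simp\<close>)
 show ?thesis using AE_lborel_shift[OF f, of t] AE_lborel_shift[OF f, of "-t"]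
 proof eventually_elim
  case (elim x)
  then show ?case unfolding wave_prop_def I by simp
 qed
qed

lemma integrable_localize:
 fixes g :: "real => real"
 assumes "continuous_on UNIV g" shows "integrable lborel (\<lambda>y. indicator {a..b} y * g y)"
 using continuous_set_integrable[OF assms, of a b] by (simp add: set_integrable_def)

lemma conv_localize: "conv \<kappa> t (\<lambda>y. indicator {x - t..x + t} y * g y) x = conv \<kappa> t g x"
proof -
 have "y \<in> {x - t..x + t} \<longleftrightarrow> \<bar>x - y\<bar> <= t" for y :: real by (auto simp: abs_if split: if_splits)
 then show ?thesis unfolding conv_def by (intro lint_cong) (auto simp: indicator_def)
qed

text \<open>With initial value zero the propagators are integrals, so they do not see null sets at any point
  \<open>x\<close>.\<close>

lemma propagators_cong:
 assumes g: "AE y in lborel. y \<in> {x - t..x + t} --> g y = g' y"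
 shows "damped_wave_prop t (\<lambda>y. 0) g x = damped_wave_prop t (\<lambda>y. 0) g' x"
  "wave_prop t (\<lambda>y. 0) g x = wave_prop t (\<lambda>y. 0) g' x"
proof -
 have "(LINT y:{x - t..x + t}|lebesgue.
      (let \<rho> = sqrt (t\<^sup>2 - (x - y)\<^sup>2)
      in bessel_I 0 (\<rho> / 2) * (g y + 0 / 2) + t / (2 * \<rho>) * bessel_I 1 (\<rho> / 2) * 0))
  = (LINT y:{x - t..x + t}|lebesgue.
      (let \<rho> = sqrt (t\<^sup>2 - (x - y)\<^sup>2)
      in bessel_I 0 (\<rho> / 2) * (g' y + 0 / 2) + t / (2 * \<rho>) * bessel_I 1 (\<rho> / 2) * 0))"
  unfolding set_int_def
  by (rule lebesgue_integral_cong_AE(1)) (use g in \<open>eventually_elim, auto simp: indicator_def\<close>)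
 then show "damped_wave_prop t (\<lambda>y. 0) g x = damped_wave_prop t (\<lambda>y. 0) g' x"
  unfolding damped_wave_prop_def by simp
 have "(LINT y:{x - t..x + t}|lebesgue. g y) = (LINT y:{x - t..x + t}|lebesgue. g' y)"
  unfolding set_int_def
  by (rule lebesgue_integral_cong_AE(1)) (use g in \<open>eventually_elim, auto simp: indicator_def\<close>)
 then show "wave_prop t (\<lambda>y. 0) g x = wave_prop t (\<lambda>y. 0) g' x" unfolding wave_prop_def by simp
qed

abbreviation damped_duhamel :: "real => (real => real => real) => real => real => real" where
 "damped_duhamel p v t x \<equiv> LINT s:{0..t}|lebesgue. damped_wave_prop (t - s) (\<lambda>y. 0) (\<lambda>y. \<bar>v s y\<bar> powr p) x"

abbreviation wave_duhamel :: "real => (real => real => real) => real => real => real" where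
 "wave_duhamel q u t x \<equiv> LINT s:{0..t}|lebesgue. wave_prop (t - s) (\<lambda>y. 0) (\<lambda>y. \<bar>u s y\<bar> powr q) x"

lemma propagators_source:
 assumes g0: "AE y in lborel. g0 y = g y" and g: "continuous_on UNIV g"
 shows "damped_wave_prop t (\<lambda>y. 0) g0 x = conv ker_d t g x" "wave_prop t (\<lambda>y. 0) g0 x = conv ker_w t g x"
proof -
 let ?g = "\<lambda>y. indicator {x - t..x + t} y * g y"
 note gi = integrable_localize[OF g, of "x - t" "x + t"]
 have ae: "AE y in lborel. y \<in> {x - t..x + t} --> g0 y = ?g y" using g0 by eventually_elim simp
 have 0: "conv \<kappa> t (\<lambda>y. 0) x = 0" for \<kappa> by (rule conv_eq_0) simp
 have "damped_wave_prop t (\<lambda>y. 0) g0 x = damped_wave_prop t (\<lambda>y. 0) ?g x" by (rule propagators_cong(1)[OF ae])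
 also have "\<dots> = damped_free (\<lambda>y. 0) ?g t x" by (rule damped_wave_prop_eq[OF _ gi]) simp
 also have "\<dots> = conv ker_d t g x" by (simp add: damped_free_def 0 conv_localize)
 finally show "damped_wave_prop t (\<lambda>y. 0) g0 x = conv ker_d t g x" .
 have "wave_prop t (\<lambda>y. 0) g0 x = wave_prop t (\<lambda>y. 0) ?g x" by (rule propagators_cong(2)[OF ae])
 also have "\<dots> = conv ker_w t ?g x" unfolding wave_prop_eq[OF gi] by simp
 finally show "wave_prop t (\<lambda>y. 0) g0 x = conv ker_w t g x" by (simp add: conv_localize)
qed

lemma duhamel_eq:
 assumes V: "jcont V" and p: "p > 0"
  and v: "!!s. s \<in> {0..t} ==> AE y in lborel. v s y = V s y"
 shows "damped_duhamel p v t x = duh ker_d (\<lambda>s y. \<bar>V s y\<bar> powr p) t x"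
  "wave_duhamel p v t x = duh ker_w (\<lambda>s y. \<bar>V s y\<bar> powr p) t x"
proof -
 note Vp = jcont_powr[OF V p]
 have ae: "AE y in lborel. \<bar>v s y\<bar> powr p = \<bar>V s y\<bar> powr p" if "s \<in> {0..t}" for s
  using v[OF that] by eventually_elim simp
 have leb: "(LINT s:{0..t}|lebesgue. c s) = (LINT s:{0..t}|lborel. c s)" if "set_integrable lborel {0..t} c" for c :: "real => real"
  unfolding set_int_def
  by (rule lebesgue_eq_lborel(1)) (use that in \<open>auto simp: set_integrable_def\<close>)
 have "damped_duhamel p v t x
  = (LINT s:{0..t}|lebesgue. conv ker_d (t - s) (\<lambda>y. \<bar>V s y\<bar> powr p) x)"
  by (rule set_lebesgue_integral_cong) (use propagators_source(1)[OF ae jcont_slice(1)[OF Vp]] in auto)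
 then show "damped_duhamel p v t x = duh ker_d (\<lambda>s y. \<bar>V s y\<bar> powr p) t x"
  unfolding duh_def using leb[OF duh_integrand_integrable[OF jcont_kernels(2) Vp]] by simp
 have "wave_duhamel p v t x
  = (LINT s:{0..t}|lebesgue. conv ker_w (t - s) (\<lambda>y. \<bar>V s y\<bar> powr p) x)"
  by (rule set_lebesgue_integral_cong) (use propagators_source(2)[OF ae jcont_slice(1)[OF Vp]] in auto)
 then show "wave_duhamel p v t x = duh ker_w (\<lambda>s y. \<bar>V s y\<bar> powr p) t x"
  unfolding duh_def using leb[OF duh_integrand_integrable[OF jcont_kernels(1) Vp]] by simp
qed

text \<open>The data of both equations together with representatives \<open>f, g, h, k\<close> as above. Scaling the data
  by \<open>\<epsilon>\<close> gives another instance with the same \<open>p\<close>, \<open>q\<close> and \<open>R\<close>.\<close>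

locale profiles =
 fixes p q R :: real and u0 u1 v0 v1 f f' g h h' k :: "real => real"
 assumes p: "p > 1" and q: "q > 1" and R: "R > 0"
  and fd: "free_data R f f' g" and hd: "free_data R h h' k"
  and aef: "AE x in lborel. u0 x = f x" and aeg: "AE x in lborel. u1 x = g x"
  and aeh: "AE x in lborel. v0 x = h x" and aek: "AE x in lborel. v1 x = k x"
begin

abbreviation "ul \<equiv> damped_free f g"
abbreviation "vl \<equiv> wave_free h k"

lemma linear_parts:
 "AE x in lborel. damped_wave_prop t u0 u1 x = ul t x" "AE x in lborel. wave_prop t v0 v1 x = vl t x"
proof -
 show "AE x in lborel. damped_wave_prop t u0 u1 x = ul t x"
  using damped_wave_prop_cong[OF aef aeg, of t]
  by eventually_elim (simp add: damped_wave_prop_eq[OF free_dataD(1,2)[OF fd]])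
 show "AE x in lborel. wave_prop t v0 v1 x = vl t x"
  using wave_prop_cong[OF aeh aek, of t]
  by eventually_elim (simp add: wave_prop_eq[OF free_dataD(2)[OF hd]] wave_free_def)
qed

lemma linear_support: "0 <= t ==> supported (R + t) (ul t)" "0 <= t ==> supported (R + t) (vl t)"
proof -
 assume t: "0 <= t"
 have c: "conv \<kappa> t e x = 0" if "supported R e" "x < - (R + t) \<or> R + t < x" for \<kappa> e x
  using supported_conv[OF that(1), of t \<kappa>] that(2) t by (auto simp: supported_def)
 have s: "e (x + t) = 0" "e (x - t) = 0" if "supported R e" "x < - (R + t) \<or> R + t < x" for e :: "real => real" and x
  using that t R by (auto simp: supported_def)
 show "supported (R + t) (ul t)" unfolding supported_def[of "R + t"] damped_free_def
  using s[OF free_dataD(6)[OF fd]] c[OF free_dataD(6)[OF fd]] c[OF free_dataD(7)[OF fd]] by auto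
 show "supported (R + t) (vl t)" unfolding supported_def[of "R + t"] wave_free_def
  using s[OF free_dataD(6)[OF hd]] c[OF free_dataD(7)[OF hd]] by auto
qed

text \<open>The representatives of a mild solution solve the integral equations, since changing the nonlinearity
  on a null set does not change a cone convolution.\<close>

lemma mild_to_sol:
 assumes "Nakao_mild_solution p q u0 u1 v0 v1 T u v" and T0: "0 <= T0" "ereal T0 < T"
 shows "\<exists>U V M. sol p q T0 ul vl U V \<and> (\<forall>t x. \<bar>U t x\<bar> <= M \<and> \<bar>V t x\<bar> <= M) \<and>
  (\<forall>t. U t = U (max 0 (min T0 t)) \<and> V t = V (max 0 (min T0 t))) \<and>
  (\<forall>t\<in>{0..T0}. (AE x in lborel. u t x = U t x) \<and> (AE x in lborel. v t x = V t x))"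
proof -
 let ?S = "{t. 0 <= t \<and> ereal t < T}"
 have S: "{0..T0} \<subseteq> ?S"
 proof
  fix t assume "t \<in> {0..T0}"
  then have "0 <= t" "ereal t <= ereal T0" by auto
  then show "t \<in> ?S" using le_less_trans[OF _ T0(2)] by blast
 qed
 have m: "C0_curve ?S H1_space H1_norm u" "C0_curve ?S H1_space H1_norm v"
  "!!t. t \<in> ?S ==> AE x in lebesgue. u t x = damped_wave_prop t u0 u1 x +
       damped_duhamel p v t x"
  "!!t. t \<in> ?S ==> AE x in lebesgue. v t x = wave_prop t v0 v1 x +
       wave_duhamel q u t x"
  using assms(1) unfolding Nakao_mild_solution_def Let_def by blast+
 obtain U M1 where U: "jcont U" "!!t x. \<bar>U t x\<bar> <= M1" "!!t. U t = U (max 0 (min T0 t))"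
  "!!t. t \<in> {0..T0} ==> AE x in lborel. u t x = U t x"
  using C0_curve_representative[OF m(1) T0(1) S] by blast
 obtain V M2 where V: "jcont V" "!!t x. \<bar>V t x\<bar> <= M2" "!!t. V t = V (max 0 (min T0 t))"
  "!!t. t \<in> {0..T0} ==> AE x in lborel. v t x = V t x"
  using C0_curve_representative[OF m(2) T0(1) S] by blast
 have "sol p q T0 ul vl U V"
  unfolding sol_def
 proof (intro conjI ballI U(1) V(1))
  fix t assume t: "t \<in> {0..T0}"
  have tS: "t \<in> ?S" using t S by blast
  have "AE x in lborel. u t x = damped_wave_prop t u0 u1 x +
       damped_duhamel p v t x"
   using m(3)[OF tS] by (simp only: AE_completion_iff)
  then have "AE x in lborel. u t x = damped_wave_prop t u0 u1 x + duh ker_d (\<lambda>s y. \<bar>V s y\<bar> powr p) t x"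
   using duhamel_eq(1)[OF V(1), of p t v] V(4) t p by simp
  with U(4)[OF t] linear_parts(1)[of t]
  show "AE x in lborel. U t x = ul t x + duh ker_d (\<lambda>s y. \<bar>V s y\<bar> powr p) t x"
   by eventually_elim simp
  have "AE x in lborel. v t x = wave_prop t v0 v1 x +
       wave_duhamel q u t x"
   using m(4)[OF tS] by (simp only: AE_completion_iff)
  then have "AE x in lborel. v t x = wave_prop t v0 v1 x + duh ker_w (\<lambda>s y. \<bar>U s y\<bar> powr q) t x"
   using duhamel_eq(2)[OF U(1), of q t u] U(4) t q by simp
  with V(4)[OF t] linear_parts(2)[of t]
  show "AE x in lborel. V t x = vl t x + duh ker_w (\<lambda>s y. \<bar>U s y\<bar> powr q) t x"
   by eventually_elim simp
 qed
 note sol = this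
 show ?thesis
 proof (rule exI[of _ U], rule exI[of _ V], rule exI[of _ "max M1 M2"], intro conjI allI ballI)
  show "sol p q T0 ul vl U V" by (rule sol)
  show "\<bar>U t x\<bar> <= max M1 M2" "\<bar>V t x\<bar> <= max M1 M2" for t x
   using U(2)[of t x] V(2)[of t x] by linarith+
  show "AE x in lborel. u t x = U t x" "AE x in lborel. v t x = V t x" if "t \<in> {0..T0}" for t
   by (rule U(4)[OF that], rule V(4)[OF that])
 qed (rule U(3) V(3))+
qed

text \<open>Comparison with the zero solution on the complement of the cone over \<open>[-R, R]\<close>.\<close>

lemma sol_supported:
 assumes s: "sol p q T0 ul vl U V" and b: "!!t x. \<bar>U t x\<bar> <= M \<and> \<bar>V t x\<bar> <= M" and T0: "0 <= T0" and t: "t \<in> {0..T0}"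
 shows "supported (R + t) (U t)" "supported (R + t) (V t)"
proof -
 have d0: "duh \<kappa> (\<lambda>s y. 0) t x = 0" for \<kappa> t x
  unfolding duh_def by (intro set_integral_eq_0 conv_eq_0) simp
 have z: "sol p q T0 (\<lambda>t x. 0) (\<lambda>t x. 0) (\<lambda>t x. 0) (\<lambda>t x. 0)"
  using p q by (simp add: sol_def d0)
 define A where "A = (\<lambda>t. {x::real. x < - (R + t) \<or> R + t < x})"
 have A: "open (A t)" for t
 proof -
  have "A t = {..< - (R + t)} \<union> {R + t<..}" by (auto simp: A_def)
  then show ?thesis by (simp only:) (intro open_Un open_lessThan open_greaterThan)
 qed
 have A2: "y \<in> A s" if "0 <= s" "s <= t" "x \<in> A t" "\<bar>x - y\<bar> <= t - s" for s t x y
  using that by (auto simp: A_def)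
 have M: "M \<ge> 0" using b[of 0 0] by linarith
 have eq: "U t x = 0 \<and> V t x = 0" if x: "x \<in> A t" for x
 proof -
  have 1: "AE x in lborel. x \<in> A t --> ul t x = 0" "AE x in lborel. x \<in> A t --> vl t x = 0" if "t \<in> {0..T0}" for t
   using linear_support[of t] that by (auto simp: supported_def A_def)
  show ?thesis
   using sol_unique_on[OF p q T0 s z, of M A t x] b M A A2 1 t x by auto
 qed
 show "supported (R + t) (U t)" "supported (R + t) (V t)"
  unfolding supported_def[of "R + t"] using eq by (auto simp: A_def)
qed

lemma clamped_source:
 assumes s: "sol p q T0 ul vl U V" and b: "!!t x. \<bar>U t x\<bar> <= M \<and> \<bar>V t x\<bar> <= M" and T0: "0 <= T0"
  and c: "!!t. U t = U (max 0 (min T0 t)) \<and> V t = V (max 0 (min T0 t))" and r: "r > 0"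
 shows "source R (\<lambda>s y. \<bar>U s y\<bar> powr r)" "source R (\<lambda>s y. \<bar>V s y\<bar> powr r)" "source R U" "source R V"
proof -
 have jc: "jcont U" "jcont V" using s by (auto simp: sol_def)
 have su: "supported (R + \<bar>t\<bar>) (U t) \<and> supported (R + \<bar>t\<bar>) (V t)" for t
 proof -
  let ?c = "max 0 (min T0 t)"
  have "?c \<in> {0..T0}" "?c <= \<bar>t\<bar>" using T0 by auto
  then have "supported (R + ?c) (U ?c)" "supported (R + ?c) (V ?c)" using sol_supported[OF s b T0] by auto
  then have "supported (R + \<bar>t\<bar>) (U ?c)" "supported (R + \<bar>t\<bar>) (V ?c)"
   using \<open>?c <= \<bar>t\<bar>\<close> unfolding supported_def by force+
  then show ?thesis using c[of t] by simp
 qed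
 show "source R (\<lambda>s y. \<bar>U s y\<bar> powr r)" "source R (\<lambda>s y. \<bar>V s y\<bar> powr r)" "source R U" "source R V"
  unfolding source_def using jcont_powr[OF jc(1) r] jcont_powr[OF jc(2) r] jc su
  by (auto simp: supported_def)
qed

lemma energy_curve_linear:
 assumes S: "S \<subseteq> {0..}" "!!a b. a \<in> S ==> b \<in> S ==> {a..b} \<subseteq> S"
 shows "energy_curve S ul" "energy_curve S vl"
proof -
 have sh: "energy_curve S (\<lambda>t x. m t * e (x + c * t))"
  if e: "weak_pair e e'" "supported R e'" and c: "c = 1 \<or> c = -1"
   and m: "!!r. (m has_field_derivative m' r) (at r)" "continuous_on UNIV m'" for e e' c m m'
 proof (rule energy_curve_mult[OF energy_curve_shift[OF e c] _ S(2) m])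
  show "jcont (\<lambda>t x. e (x + c * t))"
   by (rule continuous_on_compose2[of UNIV e]) (use e in \<open>auto simp: weak_pair_def intro!: continuous_intros\<close>)
 qed
 have e: "((\<lambda>t. exp (- t / 2) / 2) has_field_derivative - exp (- r / 2) / 4) (at (r::real))" for r
  by (auto intro!: derivative_eq_intros)
 have ec: "continuous_on UNIV (\<lambda>r::real. - exp (- r / 2) / 4)" by (intro continuous_intros) auto
 obtain dt dz where kd: "cone_kernel ker_d dt dz" using cone_kernel_d by blast
 obtain ft fz where kf: "cone_kernel ker_f ft fz" using cone_kernel_f by blast
 have "energy_curve S (\<lambda>t x. (exp (- t / 2) / 2 * f (x + 1 * t) + exp (- t / 2) / 2 * f (x + (-1) * t)) + (conv ker_f t f x + conv ker_d t g x))"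
  by (intro energy_curve_add sh[OF free_dataD(9,8)[OF fd] _ e ec] energy_curve_conv[OF kf free_dataD(4,6)[OF fd] S(1)]
    energy_curve_conv[OF kd free_dataD(5,7)[OF fd] S(1)]) auto
 moreover have "ul = (\<lambda>t x. (exp (- t / 2) / 2 * f (x + 1 * t) + exp (- t / 2) / 2 * f (x + (-1) * t)) + (conv ker_f t f x + conv ker_d t g x))"
  by (simp add: damped_free_def fun_eq_iff distrib_left)
 ultimately show "energy_curve S ul" by simp
 have h: "((\<lambda>t. 1 / 2) has_field_derivative 0) (at (r::real))" for r by simp
 have "energy_curve S (\<lambda>t x. (1 / 2 * h (x + 1 * t) + 1 / 2 * h (x + (-1) * t)) + conv ker_w t k x)"
  by (intro energy_curve_add sh[OF free_dataD(9,8)[OF hd] _ h] energy_curve_conv[OF cone_kernel_w free_dataD(5,7)[OF hd] S(1)]) auto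
 then show "energy_curve S vl" by (simp add: wave_free_def[abs_def] add_divide_distrib)
qed

text \<open>The right sides of the integral equations are energy curves.\<close>

lemma sol_to_mild:
 assumes s: "sol p q T0 ul vl U V" and T0: "0 < T0"
  and src: "source R (\<lambda>s y. \<bar>U s y\<bar> powr q)" "source R (\<lambda>s y. \<bar>V s y\<bar> powr p)"
 shows "Nakao_mild_solution p q u0 u1 v0 v1 (ereal T0) U V"
proof -
 let ?S = "{t. 0 <= t \<and> ereal t < ereal T0}"
 have S: "?S \<subseteq> {0..}" "!!a b. a \<in> ?S ==> b \<in> ?S ==> {a..b} \<subseteq> ?S" by auto
 have jc: "jcont U" "jcont V" using s by (auto simp: sol_def)
 obtain dt dz where kd: "cone_kernel ker_d dt dz" using cone_kernel_d by blast
 have eU: "energy_curve ?S (\<lambda>t x. ul t x + duh ker_d (\<lambda>s y. \<bar>V s y\<bar> powr p) t x)"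
  by (rule energy_curve_add[OF energy_curve_linear(1)[OF S] energy_curve_duh[OF kd src(2) S(1)]])
 have eV: "energy_curve ?S (\<lambda>t x. vl t x + duh ker_w (\<lambda>s y. \<bar>U s y\<bar> powr q) t x)"
  by (rule energy_curve_add[OF energy_curve_linear(2)[OF S] energy_curve_duh[OF cone_kernel_w src(1) S(1)]])
 have aU: "AE x in lborel. U t x = ul t x + duh ker_d (\<lambda>s y. \<bar>V s y\<bar> powr p) t x"
  and aV: "AE x in lborel. V t x = vl t x + duh ker_w (\<lambda>s y. \<bar>U s y\<bar> powr q) t x" if "t \<in> ?S" for t
  using s that by (auto simp: sol_def)
 have mU: "AE x in lebesgue. U t x = damped_wave_prop t u0 u1 x +
       damped_duhamel p V t x" if "t \<in> ?S" for t
 proof -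
  have "AE x in lborel. U t x = damped_wave_prop t u0 u1 x + duh ker_d (\<lambda>s y. \<bar>V s y\<bar> powr p) t x"
   using aU[OF that] linear_parts(1)[of t] by eventually_elim simp
  then show ?thesis using duhamel_eq(1)[OF jc(2), of p t V] p by (simp add: AE_completion)
 qed
 have mV: "AE x in lebesgue. V t x = wave_prop t v0 v1 x +
       wave_duhamel q U t x" if "t \<in> ?S" for t
 proof -
  have "AE x in lborel. V t x = wave_prop t v0 v1 x + duh ker_w (\<lambda>s y. \<bar>U s y\<bar> powr q) t x"
   using aV[OF that] linear_parts(2)[of t] by eventually_elim simp
  then show ?thesis using duhamel_eq(2)[OF jc(1), of q t U] q by (simp add: AE_completion)
 qed
 show ?thesis
  unfolding Nakao_mild_solution_def Let_def
  using T0 energy_curve_C0[OF eU aU] energy_curve_C1[OF eU aU S(2)] energy_curve_C0[OF eV aV] energy_curve_C1[OF eV aV S(2)]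
   mU mV by auto
qed

end

section \<open>Blow-up of spatial averages\<close>

lemma powr_MVT:
 fixes x y r :: real
 assumes r: "r > 1" and xy: "0 <= x" "x < y"
 shows "\<exists>z. x < z \<and> z < y \<and> y powr r - x powr r = (y - x) * (r * z powr (r - 1))"
proof -
 have d: "((\<lambda>z. z powr r) has_real_derivative r * z powr (r - 1)) (at z)" if "z > 0" for z
  using that by (rule has_real_derivative_powr)
 have "\<exists>l z. x < z \<and> z < y \<and> ((\<lambda>z. z powr r) has_real_derivative l) (at z) \<and> y powr r - x powr r = (y - x) * l"
 proof (rule MVT[OF xy(2)])
  show "continuous_on {x..y} (\<lambda>z. z powr r)"
   by (intro continuous_on_powr' continuous_intros) (use xy r in auto)
  show "(\<lambda>z. z powr r) differentiable (at z)" if "x < z" "z < y" for z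
   using d[of z] that xy real_differentiable_def by auto
 qed
 then obtain l z where lz: "x < z" "z < y" "((\<lambda>z. z powr r) has_real_derivative l) (at z)" "y powr r - x powr r = (y - x) * l"
  by blast
 have "l = r * z powr (r - 1)" using DERIV_unique[OF lz(3) d[of z]] lz(1) xy by auto
 then show ?thesis using lz by blast
qed

lemma powr_tangent:
 fixes a x r :: real
 assumes r: "r > 1" and a: "a > 0" and x: "x \<ge> 0"
 shows "a powr r + r * a powr (r - 1) * (x - a) <= x powr r"
proof -
 consider "x = a" | "a < x" | "x < a" by linarith
 then show ?thesis
 proof cases
  case 2
  then obtain z where z: "a < z" "x powr r - a powr r = (x - a) * (r * z powr (r - 1))"
   using powr_MVT[OF r, of a x] a by auto
  have "(x - a) * (r * a powr (r - 1)) <= (x - a) * (r * z powr (r - 1))"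
   using 2 z r a by (intro mult_left_mono powr_mono2) auto
  then show ?thesis using z(2) by (simp add: mult.commute mult.left_commute)
 next
  case 3
  then obtain z where z: "x < z" "z < a" "a powr r - x powr r = (a - x) * (r * z powr (r - 1))"
   using powr_MVT[OF r x, of a] by auto
  have "(a - x) * (r * z powr (r - 1)) <= (a - x) * (r * a powr (r - 1))"
   using 3 z r a x by (intro mult_left_mono powr_mono2) auto
  then have "a powr r - (a - x) * (r * a powr (r - 1)) <= x powr r" using z(3) by linarith
  moreover have "r * a powr (r - 1) * (x - a) = - ((a - x) * (r * a powr (r - 1)))" by (simp add: algebra_simps)
  ultimately show ?thesis by linarith
 qed simp
qed

text \<open>Jensen's inequality on \<open>[-L, L]\<close>: integrate the tangent of the power at the mean of
  \<open>\<bar>w\<bar>\<close>.\<close>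

lemma mean_power_le:
 fixes w :: "real => real"
 assumes r: "r > 1" and w: "continuous_on UNIV w" and s: "supported L w" and L: "L > 0"
 shows "\<bar>LINT x|lborel. w x\<bar> powr r * (2 * L) powr (1 - r) <= (LINT x|lborel. \<bar>w x\<bar> powr r)"
proof (cases "(LINT x|lborel. w x) = 0")
 case True
 then show ?thesis using r by simp
next
 case False
 define I where "I = \<bar>LINT x|lborel. w x\<bar>"
 (* The mean over [-L, L], where the tangent is taken. *)
 define a where "a = I / (2 * L)"
 have a: "a > 0" using False L by (simp add: a_def I_def)
 have c: "continuous_on UNIV (\<lambda>x. \<bar>w x\<bar> powr r)"
  by (intro continuous_on_powr' continuous_intros w) (use r in auto)
 have i1: "set_integrable lborel {-L..L} (\<lambda>x. \<bar>w x\<bar>)" "set_integrable lborel {-L..L} (\<lambda>x. \<bar>w x\<bar> powr r)"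
  by (intro continuous_set_integrable c continuous_on_rabs w)+
 have I1: "I <= (LINT x:{-L..L}|lborel. \<bar>w x\<bar>)"
 proof -
  have "I <= (LINT x|lborel. \<bar>w x\<bar>)" unfolding I_def by (rule integral_abs_bound)
  also have "\<dots> = (LINT x:{-L..L}|lborel. \<bar>w x\<bar>)"
   by (rule set_integral_support[symmetric]) (use s in \<open>auto simp: supported_def\<close>)
  finally show ?thesis .
 qed
 have ci: "set_integrable lborel {-L..L} (\<lambda>x. c)" for c :: real by (rule continuous_set_integrable) simp
 have cI: "(LINT x:{-L..L}|lborel. c) = 2 * L * c" for c :: real using L by (simp add: set_int_def)
 have "I powr r * (2 * L) powr (1 - r) = 2 * L * a powr r"
 proof -
  have "a powr r = I powr r / (2 * L) powr r" unfolding a_def using L by (simp add: powr_divide I_def)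
  moreover have "(2 * L) powr (1 - r) = 2 * L / (2 * L) powr r" using L by (simp add: powr_diff)
  ultimately show ?thesis by simp
 qed
 also have "\<dots> <= 2 * L * (a powr r - r * a powr (r - 1) * a) + r * a powr (r - 1) * (LINT x:{-L..L}|lborel. \<bar>w x\<bar>)"
 proof -
  have "2 * L * (r * a powr (r - 1) * a) = r * a powr (r - 1) * I" using L by (simp add: a_def)
  also have "\<dots> <= r * a powr (r - 1) * (LINT x:{-L..L}|lborel. \<bar>w x\<bar>)" using r by (intro mult_left_mono I1) auto
  finally show ?thesis by (simp add: right_diff_distrib)
 qed
 also have "\<dots> = (LINT x:{-L..L}|lborel. (a powr r - r * a powr (r - 1) * a) + r * a powr (r - 1) * \<bar>w x\<bar>)"
  using set_integrable_mult_right[OF i1(1), of "r * a powr (r - 1)"] ci by (simp add: set_integral_add(2) cI)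
 also have "\<dots> <= (LINT x:{-L..L}|lborel. \<bar>w x\<bar> powr r)"
 proof (rule set_integral_mono)
  show "set_integrable lborel {-L..L} (\<lambda>x. (a powr r - r * a powr (r - 1) * a) + r * a powr (r - 1) * \<bar>w x\<bar>)"
   by (intro set_integral_add(1) ci set_integrable_mult_right i1)
  show "(a powr r - r * a powr (r - 1) * a) + r * a powr (r - 1) * \<bar>w x\<bar> <= \<bar>w x\<bar> powr r" for x
   using powr_tangent[OF r a, of "\<bar>w x\<bar>"] by (simp add: algebra_simps)
 qed (rule i1)
 also have "\<dots> = (LINT x|lborel. \<bar>w x\<bar> powr r)"
  by (rule set_integral_support) (use s in \<open>auto simp: supported_def\<close>)
 finally show ?thesis by (simp add: I_def)
qed

lemma duh_integral_lower_bound: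
 assumes \<kappa>: "jcont \<kappa>" and pos: "!!r. 0 <= r ==> 0 <= mass \<kappa> r"
  and F: "source R F" and Fp: "!!s y. 0 <= F s y" and ab: "0 <= a" "a <= b" "b <= t"
  and c: "!!s. s \<in> {a..b} ==> c <= mass \<kappa> (t - s) * (LINT y|lborel. F s y)"
 shows "c * (b - a) <= (LINT x|lborel. duh \<kappa> F t x)"
proof -
 have Fc: "jcont F" and Fs: "!!s. supported (R + \<bar>s\<bar>) (F s)" using F by (auto simp: source_def)
 let ?L = "R + \<bar>t\<bar>" and ?m = "\<lambda>s. mass \<kappa> (t - s) * (LINT y|lborel. F s y)"
 have eq: "?m s = (LINT x:{-?L..?L}|lborel. conv \<kappa> (t - s) (F s) x)" if s: "s \<in> {0..t}" for s
 proof -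
  have "(LINT x:{-?L..?L}|lborel. conv \<kappa> (t - s) (F s) x) = (LINT x|lborel. conv \<kappa> (t - s) (F s) x)"
   by (rule set_integral_support) (rule conv_source_eq_0[OF Fs _ s])
  then show ?thesis using conv_integral(1)[OF \<kappa> source_integrable[OF F]] by simp
 qed
 have "set_integrable lborel {0..t} (\<lambda>s. LINT x:{-?L..?L}|lborel. conv \<kappa> (t - s) (F s) x)"
  by (rule Fubini_rectangle(2)[OF duh_integrand_continuous[OF \<kappa> Fc]])
 then have i: "set_integrable lborel {0..t} ?m"
  using eq by (subst set_integrable_cong[OF refl refl]) auto
 have "c * (b - a) = (LINT s|lborel. indicator {a..b} s * c)" using ab by simp
 also have "\<dots> <= (LINT s|lborel. indicator {0..t} s *\<^sub>R ?m s)"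
 proof (rule integral_mono)
  show "integrable lborel (\<lambda>s. indicator {a..b} s * c)"
   by (intro integrable_mult_left integrable_real_indicator) (auto simp: emeasure_lborel_Icc_eq)
  show "integrable lborel (\<lambda>s. indicator {0..t} s *\<^sub>R ?m s)" using i by (simp add: set_integrable_def)
  show "indicator {a..b} s * c <= indicator {0..t} s *\<^sub>R ?m s" for s
  proof (cases "s \<in> {a..b}")
   case True
   then show ?thesis using c[OF True] ab by simp
  next
   case False
   have "0 <= ?m s" if "s \<in> {0..t}" using that by (intro mult_nonneg_nonneg pos integral_nonneg_AE) (auto simp: Fp)
   then show ?thesis using False by (cases "s \<in> {0..t}") auto
  qed
 qed
 also have "\<dots> = (LINT x|lborel. duh \<kappa> F t x)"
  using duh_integral[OF \<kappa> F] ab by (simp add: set_int_def)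
 finally show ?thesis .
qed

text \<open>The constant collects the loss from the support, at most \<open>10 \<tau>\<close> wide on the
  window, and from \<open>1 - exp (- \<delta>) \<ge> \<delta> / 2\<close>.\<close>

definition blowup_const :: "real => real => real" where
 "blowup_const p q = (10 powr (1 - p) / 2) powr q * 10 powr (1 - q) / 4"

text \<open>The window \<open>[\<sigma>, \<sigma> + 4 \<delta> \<tau>]\<close> is cut into four pieces of equal
  length. The bound on \<open>n\<close> over the first piece gives a constant lower bound for \<open>m\<close>
  after the second, and \<open>m\<close> on the third piece gives the new bound for \<open>n\<close> after the
  fourth.\<close>

lemma blowup_step:
 fixes m n :: "real => real"
 assumes p: "p > 1" and q: "q > 1" and \<tau>: "\<tau> \<ge> 1" "0 < R" "R <= \<tau>"
  and m: "!!a b t c. \<tau> <= a ==> a <= b ==> b <= t ==> t <= 4 * \<tau> ==>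
    (!!s. s \<in> {a..b} ==> c <= (1 - exp (- (t - s))) * (\<bar>n s\<bar> powr p * (2 * (R + s)) powr (1 - p))) ==> c * (b - a) <= m t"
  and n: "!!a b t c. \<tau> <= a ==> a <= b ==> b <= t ==> t <= 4 * \<tau> ==>
    (!!s. s \<in> {a..b} ==> c <= (t - s) * (\<bar>m s\<bar> powr q * (2 * (R + s)) powr (1 - q))) ==> c * (b - a) <= n t"
  and \<sigma>: "\<tau> <= \<sigma>" and \<delta>: "0 < \<delta>" "\<delta> <= 1" "\<sigma> + 4 * \<delta> * \<tau> <= 4 * \<tau>" and A: "A > 0"
  and nA: "!!t. \<sigma> <= t ==> t <= 4 * \<tau> ==> A * t <= n t"
  and t: "\<sigma> + 4 * \<delta> * \<tau> <= t" "t <= 4 * \<tau>"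
 shows "blowup_const p q * \<delta> powr (2 * q + 2) * \<tau> powr (q + 2) * A powr (p * q) * t <= n t"
proof -
 have \<delta>\<tau>: "\<delta> * \<tau> > 0" using \<delta>(1) \<tau>(1) by simp
 have len: "(10 * \<tau>) powr (1 - r) <= (2 * (R + s)) powr (1 - r)" if "r > 1" "\<tau> <= s" "s <= 4 * \<tau>" for r s
 proof -
  have "0 < 2 * (R + s)" "2 * (R + s) <= 10 * \<tau>" using that \<tau> by auto
  then show ?thesis using that by (intro powr_mono2') auto
 qed
 define c1 where "c1 = 10 powr (1 - p) / 2 * \<delta>\<^sup>2 * A powr p * \<tau>\<^sup>2"
 have c1: "c1 > 0" unfolding c1_def using \<delta>(1) A \<tau>(1) by simp
 have e: "\<delta> / 2 <= 1 - exp (- x)" if "\<delta> <= x" for x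
 proof -
  have "exp (- x) <= exp (- \<delta>)" using that by simp
  also have "exp (- \<delta>) = 1 / exp \<delta>" by (simp add: exp_minus divide_inverse)
  also have "\<dots> <= 1 / (1 + \<delta>)" using \<delta>(1) exp_ge_add_one_self[of \<delta>] by (intro divide_left_mono) auto
  also have "\<dots> <= 1 - \<delta> / 2"
  proof -
   have "1 <= (1 - \<delta> / 2) * (1 + \<delta>)" using \<delta> by (simp add: algebra_simps)
   then show ?thesis using \<delta>(1) by (simp add: field_simps)
  qed
  finally show ?thesis by simp
 qed
 have mb: "c1 <= m r" if r: "\<sigma> + 2 * \<delta> * \<tau> <= r" "r <= 4 * \<tau>" for r
 proof -
  have "(\<delta> / 2 * ((A * \<tau>) powr p * (10 * \<tau>) powr (1 - p))) * (\<sigma> + \<delta> * \<tau> - \<sigma>) <= m r"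
  proof (rule m)
   fix s assume s: "s \<in> {\<sigma>..\<sigma> + \<delta> * \<tau>}"
   have s4: "\<tau> <= s" "s <= 4 * \<tau>" using s \<sigma> r \<delta>\<tau> by auto
   have "A * \<tau> <= A * s" using A s4 by simp
   also have "\<dots> <= n s" using nA[of s] s s4 by simp
   finally have ns: "A * \<tau> <= \<bar>n s\<bar>" by linarith
   have "\<delta> * 1 <= \<delta> * \<tau>" using \<delta> \<tau> by (intro mult_left_mono) auto
   then have "\<delta> <= r - s" using s r by simp
   then show "\<delta> / 2 * ((A * \<tau>) powr p * (10 * \<tau>) powr (1 - p)) <= (1 - exp (- (r - s))) * (\<bar>n s\<bar> powr p * (2 * (R + s)) powr (1 - p))"
    using \<delta>(1) e[of "r - s"] A \<tau> p ns s4 by (intro mult_mono len powr_mono2) auto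
  qed (use \<sigma> \<delta>\<tau> r in auto)
  also have "(\<delta> / 2 * ((A * \<tau>) powr p * (10 * \<tau>) powr (1 - p))) * (\<sigma> + \<delta> * \<tau> - \<sigma>) = c1"
  proof -
   have "(A * \<tau>) powr p * (10 * \<tau>) powr (1 - p) = A powr p * 10 powr (1 - p) * (\<tau> powr p * \<tau> powr (1 - p))"
    using A \<tau> by (simp add: powr_mult)
   also have "\<tau> powr p * \<tau> powr (1 - p) = \<tau>" using \<tau> by (simp add: powr_add[symmetric])
   finally show ?thesis unfolding c1_def by (simp add: power2_eq_square)
  qed
  finally show ?thesis .
 qed
 have "(\<delta> * \<tau> * (c1 powr q * (10 * \<tau>) powr (1 - q))) * ((\<sigma> + 3 * \<delta> * \<tau>) - (\<sigma> + 2 * \<delta> * \<tau>)) <= n t"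
 proof (rule n)
  fix s assume s: "s \<in> {\<sigma> + 2 * \<delta> * \<tau>..\<sigma> + 3 * \<delta> * \<tau>}"
  have s4: "\<tau> <= s" "s <= 4 * \<tau>" using s \<sigma> t \<delta>\<tau> by auto
  have "c1 <= \<bar>m s\<bar>" using mb[of s] s s4 by auto
  moreover have "\<delta> * \<tau> <= t - s" using s t by auto
  ultimately show "\<delta> * \<tau> * (c1 powr q * (10 * \<tau>) powr (1 - q)) <= (t - s) * (\<bar>m s\<bar> powr q * (2 * (R + s)) powr (1 - q))"
   using \<delta>\<tau> q s4 c1 by (intro mult_mono len powr_mono2) auto
 qed (use \<sigma> \<delta>\<tau> t in auto)
 then have nt: "(\<delta> * \<tau>)\<^sup>2 * (c1 powr q * (10 * \<tau>) powr (1 - q)) <= n t"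
  by (simp add: power2_eq_square mult_ac)
 have "c1 powr q = (10 powr (1 - p) / 2) powr q * (\<delta> powr (2 * q) * A powr (p * q) * \<tau> powr (2 * q))"
 proof -
  have "(\<delta>\<^sup>2) powr q = \<delta> powr (2 * q)" "(\<tau>\<^sup>2) powr q = \<tau> powr (2 * q)"
   using \<delta>(1) \<tau>(1) by (simp_all add: powr_powr flip: powr_numeral)
  moreover have "c1 powr q = (10 powr (1 - p) / 2) powr q * (\<delta>\<^sup>2) powr q * (A powr p) powr q * (\<tau>\<^sup>2) powr q"
   unfolding c1_def by (simp only: powr_mult)
  ultimately show ?thesis by (simp add: powr_powr)
 qed
 moreover have "(10 * \<tau>) powr (1 - q) = 10 powr (1 - q) * \<tau> powr (1 - q)" using \<tau> by (simp add: powr_mult)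
 moreover have "(\<delta> * \<tau>)\<^sup>2 = \<delta> powr 2 * \<tau> powr 2" using \<delta>(1) \<tau>(1) by (simp add: power_mult_distrib)
 ultimately have "(\<delta> * \<tau>)\<^sup>2 * (c1 powr q * (10 * \<tau>) powr (1 - q))
  = 4 * blowup_const p q * (\<delta> powr 2 * \<delta> powr (2 * q)) * (\<tau> powr 2 * \<tau> powr (2 * q) * \<tau> powr (1 - q)) * A powr (p * q)"
  by (simp add: blowup_const_def mult_ac)
 also have "\<delta> powr 2 * \<delta> powr (2 * q) = \<delta> powr (2 * q + 2)" by (simp add: powr_add[symmetric] add.commute del: powr_numeral)
 also have "\<tau> powr 2 * \<tau> powr (2 * q) * \<tau> powr (1 - q) = \<tau> powr ((q + 2) + 1)"
  by (simp add: powr_add[symmetric] del: powr_numeral)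
 also have "\<tau> powr ((q + 2) + 1) = \<tau> powr (q + 2) * \<tau>" using \<tau> by (simp only: powr_add) simp
 finally have eq: "(\<delta> * \<tau>)\<^sup>2 * (c1 powr q * (10 * \<tau>) powr (1 - q))
  = blowup_const p q * \<delta> powr (2 * q + 2) * \<tau> powr (q + 2) * A powr (p * q) * (4 * \<tau>)" by (simp only: mult_ac)
 have "blowup_const p q * \<delta> powr (2 * q + 2) * \<tau> powr (q + 2) * A powr (p * q) * t
  <= blowup_const p q * \<delta> powr (2 * q + 2) * \<tau> powr (q + 2) * A powr (p * q) * (4 * \<tau>)"
  using t by (intro mult_left_mono) (auto simp: blowup_const_def)
 then show ?thesis using eq nt by simp
qed

text \<open>With \<open>\<delta> = 2\<^sup>-\<^sup>k / 4\<close> in the step of index \<open>k\<close> the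
  windows start at \<open>3 \<tau> - 2 \<tau> 2\<^sup>-\<^sup>k\<close> and never pass \<open>3 \<tau>\<close>.
  The number \<open>\<gamma>\<close> solves \<open>\<gamma> powr (p q - 1) = 2 powr (2 q + 2)\<close>: multiplying
  the constant by \<open>\<gamma>\<close> in every step compensates the loss from halving \<open>\<delta>\<close>.
  If the claim failed, \<open>n (4 \<tau>)\<close> would exceed every \<open>A \<gamma>\<^sup>k 4
  \<tau>\<close>.\<close>

lemma blowup_iteration:
 fixes m n :: "real => real"
 assumes p: "p > 1" and q: "q > 1" and \<tau>: "\<tau> \<ge> 1" "0 < R" "R <= \<tau>"
  and m: "!!a b t c. \<tau> <= a ==> a <= b ==> b <= t ==> t <= 4 * \<tau> ==>
    (!!s. s \<in> {a..b} ==> c <= (1 - exp (- (t - s))) * (\<bar>n s\<bar> powr p * (2 * (R + s)) powr (1 - p))) ==> c * (b - a) <= m t"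
  and n: "!!a b t c. \<tau> <= a ==> a <= b ==> b <= t ==> t <= 4 * \<tau> ==>
    (!!s. s \<in> {a..b} ==> c <= (t - s) * (\<bar>m s\<bar> powr q * (2 * (R + s)) powr (1 - q))) ==> c * (b - a) <= n t"
  and A: "A > 0" and nA: "!!t. \<tau> <= t ==> t <= 4 * \<tau> ==> A * t <= n t"
 shows "blowup_const p q * \<tau> powr (q + 2) * A powr (p * q - 1) < 2 powr ((2 * q + 2) / (p * q - 1)) * 4 powr (2 * q + 2)"
proof (rule ccontr)
 define e where "e = 2 * q + 2"
 define \<gamma> where "\<gamma> = 2 powr (e / (p * q - 1))"
 assume "\<not> ?thesis"
 then have big: "\<gamma> * 4 powr e <= blowup_const p q * \<tau> powr (q + 2) * A powr (p * q - 1)" by (simp add: e_def \<gamma>_def)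
 have pq: "p * q > 1" using p q by (metis less_1_mult)
 have e: "e > 0" using q by (simp add: e_def)
 have \<gamma>: "\<gamma> > 1" unfolding \<gamma>_def using powr_less_mono[of 0 "e / (p * q - 1)" 2] e pq by simp
 have \<gamma>e: "\<gamma> powr (p * q - 1) = 2 powr e" unfolding \<gamma>_def using pq by (simp add: powr_powr)
 have main: "\<forall>t. 3 * \<tau> - 2 * \<tau> * (1 / 2) ^ k <= t --> t <= 4 * \<tau> --> A * \<gamma> ^ k * t <= n t" for k
 proof (induction k)
  case 0
  show ?case using nA by simp
 next
  case (Suc k)
  let ?\<sigma> = "3 * \<tau> - 2 * \<tau> * (1 / 2) ^ k" and ?\<delta> = "(1 / 2) ^ k / 4 :: real"
  have h: "(1 / 2 :: real) ^ k <= 1" "(1 / 2 :: real) ^ k > 0" by (auto simp: power_le_one)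
  have s: "3 * \<tau> - 2 * \<tau> * (1 / 2) ^ Suc k = ?\<sigma> + 4 * ?\<delta> * \<tau>" by (simp add: algebra_simps)
  have "A * \<gamma> ^ Suc k * t <= n t" if t: "?\<sigma> + 4 * ?\<delta> * \<tau> <= t" "t <= 4 * \<tau>" for t
  proof -
   have "blowup_const p q * ?\<delta> powr e * \<tau> powr (q + 2) * (A * \<gamma> ^ k) powr (p * q) * t <= n t"
    unfolding e_def
   proof (rule blowup_step[where R=R and m=m and n=n and t=t and \<sigma>="?\<sigma>" and \<delta>="?\<delta>", OF p q \<tau>])
    show "c * (b - a) <= m t" if "\<tau> <= a" "a <= b" "b <= t" "t <= 4 * \<tau>"
     "!!s. s \<in> {a..b} ==> c <= (1 - exp (- (t - s))) * (\<bar>n s\<bar> powr p * (2 * (R + s)) powr (1 - p))" for a b t c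
     by (rule m[OF that])
    show "c * (b - a) <= n t" if "\<tau> <= a" "a <= b" "b <= t" "t <= 4 * \<tau>"
     "!!s. s \<in> {a..b} ==> c <= (t - s) * (\<bar>m s\<bar> powr q * (2 * (R + s)) powr (1 - q))" for a b t c
     by (rule n[OF that])
    show "?\<sigma> + 4 * ?\<delta> * \<tau> <= t" "t <= 4 * \<tau>" by (rule t)+
    have "2 * \<tau> * (1 / 2) ^ k <= 2 * \<tau> * 1" using h \<tau> by (intro mult_left_mono) auto
    then show "\<tau> <= ?\<sigma>" by simp
    have "\<tau> * (1 / 2) ^ k > 0" using h \<tau> by simp
    then show "?\<sigma> + 4 * ?\<delta> * \<tau> <= 4 * \<tau>" using \<tau> by (simp add: algebra_simps)
    show "A * \<gamma> ^ k > 0" using A \<gamma> by simp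
    show "A * \<gamma> ^ k * t <= n t" if "?\<sigma> <= t" "t <= 4 * \<tau>" for t using Suc.IH that by blast
    show "0 < ?\<delta>" "?\<delta> <= 1" using h by auto
   qed
   moreover have "A * \<gamma> ^ Suc k <= blowup_const p q * ?\<delta> powr e * \<tau> powr (q + 2) * (A * \<gamma> ^ k) powr (p * q)"
   proof -
    have \<gamma>k: "\<gamma> ^ k = \<gamma> powr k" using \<gamma> by (simp add: powr_realpow)
    have d: "?\<delta> powr e = 2 powr (- (real k * e)) / 4 powr e"
    proof -
     have k: "(1 / 2 :: real) ^ k = 2 powr (- real k)"
      unfolding powr_minus_divide powr_realpow[OF zero_less_numeral] power_one_over ..
     show ?thesis unfolding k powr_divide powr_powr by simp
    qed
    have "(A * \<gamma> ^ k) powr (p * q) = (A * \<gamma> ^ k) powr ((p * q - 1) + 1)" by simp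
    also have "\<dots> = (A * \<gamma> ^ k) powr (p * q - 1) * (A * \<gamma> ^ k)" using A \<gamma> by (simp only: powr_add) simp
    also have "(A * \<gamma> ^ k) powr (p * q - 1) = A powr (p * q - 1) * 2 powr (real k * e)"
    proof -
     have "(\<gamma> ^ k) powr (p * q - 1) = (\<gamma> powr (p * q - 1)) powr k" unfolding \<gamma>k by (simp add: powr_powr mult.commute)
     also have "\<dots> = 2 powr (real k * e)" unfolding \<gamma>e by (simp add: powr_powr mult.commute)
     finally show ?thesis using A \<gamma> by (simp add: powr_mult)
    qed
    finally have Ak: "(A * \<gamma> ^ k) powr (p * q) = A powr (p * q - 1) * 2 powr (real k * e) * (A * \<gamma> ^ k)" .
    have "blowup_const p q * ?\<delta> powr e * \<tau> powr (q + 2) * (A * \<gamma> ^ k) powr (p * q)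
     = (blowup_const p q * \<tau> powr (q + 2) * A powr (p * q - 1)) / 4 powr e * (2 powr (- (real k * e)) * 2 powr (real k * e)) * (A * \<gamma> ^ k)"
     unfolding d Ak by simp
    also have "(2 powr (- (real k * e)) * 2 powr (real k * e) :: real) = 1" by (simp add: powr_add[symmetric])
    finally have eq: "blowup_const p q * ?\<delta> powr e * \<tau> powr (q + 2) * (A * \<gamma> ^ k) powr (p * q)
     = (blowup_const p q * \<tau> powr (q + 2) * A powr (p * q - 1)) / 4 powr e * (A * \<gamma> ^ k)" by simp
    have "\<gamma> <= (blowup_const p q * \<tau> powr (q + 2) * A powr (p * q - 1)) / 4 powr e"
     using big by (simp add: pos_le_divide_eq)
    then have "\<gamma> * (A * \<gamma> ^ k) <= (blowup_const p q * \<tau> powr (q + 2) * A powr (p * q - 1)) / 4 powr e * (A * \<gamma> ^ k)"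
     using A \<gamma> by (intro mult_right_mono) auto
    then show ?thesis unfolding eq by (simp add: mult_ac)
   qed
   then have "A * \<gamma> ^ Suc k * t <= blowup_const p q * ?\<delta> powr e * \<tau> powr (q + 2) * (A * \<gamma> ^ k) powr (p * q) * t"
   proof (rule mult_right_mono)
    have "2 * \<tau> * (1 / 2) ^ k <= 2 * \<tau> * 1" using h \<tau> by (intro mult_left_mono) auto
    moreover have "0 <= 4 * ?\<delta> * \<tau>" using \<tau> h by simp
    ultimately show "0 <= t" using t \<tau> by linarith
   qed
   ultimately show ?thesis by linarith
  qed
  then show ?case unfolding s by blast
 qed
 have "A * \<gamma> ^ k * (4 * \<tau>) <= n (4 * \<tau>)" for k
 proof -
  have "2 * \<tau> * (1 / 2 :: real) ^ k \<ge> 0" using \<tau> by simp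
  then have "3 * \<tau> - 2 * \<tau> * (1 / 2) ^ k <= 4 * \<tau>" using \<tau> by linarith
  then show ?thesis using main[of k, THEN spec, of "4 * \<tau>"] by simp
 qed
 then have "\<gamma> ^ k <= n (4 * \<tau>) / (A * (4 * \<tau>))" for k
  using A \<tau> by (simp add: pos_le_divide_eq mult_ac)
 moreover obtain k where "n (4 * \<tau>) / (A * (4 * \<tau>)) < \<gamma> ^ k" using real_arch_pow[OF \<gamma>] by blast
 ultimately show False using not_le by blast
qed

lemma integral_shift:
 fixes e :: "real => real"
 assumes "integrable lborel e"
 shows "integrable lborel (\<lambda>x. e (x + c))" "(LINT x|lborel. e (x + c)) = (LINT x|lborel. e x)"
 using lborel_integrable_real_affine[OF assms, of 1 c] lborel_integral_real_affine[where c=1 and t=c and f=e]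
 by (simp_all add: add.commute)

lemma damped_free_integral:
 assumes f: "integrable lborel f" and g: "integrable lborel g" and t: "0 <= t"
 shows "integrable lborel (damped_free f g t)"
  "(LINT x|lborel. damped_free f g t x) = (LINT x|lborel. f x) + (1 - exp (- t)) * (LINT x|lborel. g x)"
proof -
 note f1 = integral_shift[OF f, of t] integral_shift[OF f, of "-t"]
 note cf = conv_integral[OF jcont_kernels(3) f, of t] and cd = conv_integral[OF jcont_kernels(2) g, of t]
 show "integrable lborel (damped_free f g t)" unfolding damped_free_def using f1 cf cd by simp
 have "(LINT x|lborel. damped_free f g t x) = exp (- t / 2) / 2 * (2 * (LINT x|lborel. f x)) + mass ker_f t * (LINT x|lborel. f x) + mass ker_d t * (LINT x|lborel. g x)"
  unfolding damped_free_def using f1 cf cd by simp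
 then show "(LINT x|lborel. damped_free f g t x) = (LINT x|lborel. f x) + (1 - exp (- t)) * (LINT x|lborel. g x)"
  unfolding mass_f[OF t] mass_d[OF t] by (simp add: algebra_simps)
qed

lemma wave_free_integral:
 assumes f: "integrable lborel f" and g: "integrable lborel g" and t: "0 <= t"
 shows "integrable lborel (wave_free f g t)"
  "(LINT x|lborel. wave_free f g t x) = (LINT x|lborel. f x) + t * (LINT x|lborel. g x)"
proof -
 note f1 = integral_shift[OF f, of t] integral_shift[OF f, of "-t"]
 note cw = conv_integral[OF jcont_kernels(1) g, of t]
 show "integrable lborel (wave_free f g t)" unfolding wave_free_def using f1 cw by simp
 show "(LINT x|lborel. wave_free f g t x) = (LINT x|lborel. f x) + t * (LINT x|lborel. g x)"
  unfolding wave_free_def using f1 cw mass_w[OF t] by simp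
qed

context profiles
begin

lemmas integral_linear =
 damped_free_integral[OF free_dataD(1,2)[OF fd]] wave_free_integral[OF free_dataD(1,2)[OF hd]]

lemma solution_averages:
 assumes s: "sol p q T0 ul vl U V" and b: "!!t x. \<bar>U t x\<bar> <= M \<and> \<bar>V t x\<bar> <= M" and T0: "0 <= T0"
  and c: "!!t. U t = U (max 0 (min T0 t)) \<and> V t = V (max 0 (min T0 t))" and t: "t \<in> {0..T0}"
 shows "(LINT x|lborel. U t x) = (LINT x|lborel. ul t x) + (LINT x|lborel. duh ker_d (\<lambda>s y. \<bar>V s y\<bar> powr p) t x)"
  "(LINT x|lborel. V t x) = (LINT x|lborel. vl t x) + (LINT x|lborel. duh ker_w (\<lambda>s y. \<bar>U s y\<bar> powr q) t x)"
proof -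
 have jc: "jcont U" "jcont V" using s by (auto simp: sol_def)
 have t0: "0 <= t" using t by simp
 have src: "source R (\<lambda>s y. \<bar>V s y\<bar> powr p)" "source R (\<lambda>s y. \<bar>U s y\<bar> powr q)"
  using clamped_source(2)[OF s b T0 c, of p] clamped_source(1)[OF s b T0 c, of q] p q by auto
 have di: "integrable lborel (duh \<kappa> F t)" if F: "source R F" and \<kappa>: "jcont \<kappa>" for F \<kappa>
  by (rule integrable_compact_support[where a="-(R + \<bar>t\<bar>)" and b="R + \<bar>t\<bar>"])
    (use F supported_duh[of R F t \<kappa>] jcont_slice(1)[OF jcont_duh[OF \<kappa>]] in
     \<open>auto simp: source_def supported_def\<close>)
 have m: "U t \<in> borel_measurable lborel" "V t \<in> borel_measurable lborel"
  using jcont_slice(3)[OF jc(1)] jcont_slice(3)[OF jc(2)] by auto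
 have i: "integrable lborel (\<lambda>x. ul t x + duh ker_d (\<lambda>s y. \<bar>V s y\<bar> powr p) t x)"
  "integrable lborel (\<lambda>x. vl t x + duh ker_w (\<lambda>s y. \<bar>U s y\<bar> powr q) t x)"
  using integral_linear(1,3)[OF t0] di[OF src(1) jcont_kernels(2)] di[OF src(2) jcont_kernels(1)]
  by auto
 have e1: "AE x in lborel. U t x = ul t x + duh ker_d (\<lambda>s y. \<bar>V s y\<bar> powr p) t x"
  and e2: "AE x in lborel. V t x = vl t x + duh ker_w (\<lambda>s y. \<bar>U s y\<bar> powr q) t x"
  using s t by (auto simp: sol_def)
 show "(LINT x|lborel. U t x) = (LINT x|lborel. ul t x) + (LINT x|lborel. duh ker_d (\<lambda>s y. \<bar>V s y\<bar> powr p) t x)"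
  using integral_cong_AE[OF m(1) borel_measurable_integrable[OF i(1)] e1] integral_linear(1)[OF t0]
   di[OF src(1) jcont_kernels(2)] by simp
 show "(LINT x|lborel. V t x) = (LINT x|lborel. vl t x) + (LINT x|lborel. duh ker_w (\<lambda>s y. \<bar>U s y\<bar> powr q) t x)"
  using integral_cong_AE[OF m(2) borel_measurable_integrable[OF i(2)] e2] integral_linear(3)[OF t0]
   di[OF src(2) jcont_kernels(1)] by simp
qed

text \<open>The spatial integrals of a solution that exists beyond \<open>4 \<tau>\<close> satisfy the
  hypotheses of the iteration.\<close>

lemma lifespan_upper_bound:
 assumes ms: "Nakao_mild_solution p q u0 u1 v0 v1 T u v" and \<tau>: "\<tau> \<ge> 1" "R <= \<tau>" "ereal (4 * \<tau>) < T"
  and ulp: "!!t. \<tau> <= t ==> 0 <= (LINT x|lborel. f x) + (1 - exp (- t)) * (LINT x|lborel. g x)"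
  and A: "A > 0" and vlp: "!!t. \<tau> <= t ==> A * t <= (LINT x|lborel. h x) + t * (LINT x|lborel. k x)"
 shows "blowup_const p q * \<tau> powr (q + 2) * A powr (p * q - 1) < 2 powr ((2 * q + 2) / (p * q - 1)) * 4 powr (2 * q + 2)"
proof -
 define T0 where "T0 = 4 * \<tau>"
 have T0: "0 <= T0" "ereal T0 < T" using \<tau> by (auto simp: T0_def)
 from mild_to_sol[OF ms T0] obtain U V M where UV': "sol p q T0 ul vl U V"
  "\<forall>t x. \<bar>U t x\<bar> <= M \<and> \<bar>V t x\<bar> <= M" "\<forall>t. U t = U (max 0 (min T0 t)) \<and> V t = V (max 0 (min T0 t))"
  by (elim exE conjE) (rule that)
 note UV = UV'(1) UV'(2)[THEN spec, THEN spec] UV'(3)[THEN spec]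
 note av = solution_averages[OF UV(1,2) T0(1) UV(3)]
 have jc: "jcont U" "jcont V" using UV(1) by (auto simp: sol_def)
 have src: "source R (\<lambda>s y. \<bar>V s y\<bar> powr p)" "source R (\<lambda>s y. \<bar>U s y\<bar> powr q)"
  using clamped_source(2)[OF UV(1,2) T0(1) UV(3), of p] clamped_source(1)[OF UV(1,2) T0(1) UV(3), of q] p q by auto
 define m where "m = (\<lambda>t. LINT x|lborel. U t x)"
 define n where "n = (\<lambda>t. LINT x|lborel. V t x)"
 have pos: "0 <= mass ker_d r" "0 <= mass ker_w r" if "0 <= r" for r using that by (auto simp: mass_d mass_w)
 have mn: "(LINT x|lborel. duh ker_d (\<lambda>s y. \<bar>V s y\<bar> powr p) t x) <= m t"
  "(LINT x|lborel. duh ker_w (\<lambda>s y. \<bar>U s y\<bar> powr q) t x) + A * t <= n t" if t: "\<tau> <= t" "t <= 4 * \<tau>" for t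
 proof -
  have t': "t \<in> {0..T0}" "0 <= t" using t \<tau> by (auto simp: T0_def)
  show "(LINT x|lborel. duh ker_d (\<lambda>s y. \<bar>V s y\<bar> powr p) t x) <= m t"
   unfolding m_def av(1)[OF t'(1)] integral_linear(2)[OF t'(2)] using ulp[OF t(1)] by simp
  show "(LINT x|lborel. duh ker_w (\<lambda>s y. \<bar>U s y\<bar> powr q) t x) + A * t <= n t"
   unfolding n_def av(2)[OF t'(1)] integral_linear(4)[OF t'(2)] using vlp[OF t(1)] by simp
 qed
 have mp: "\<bar>n s\<bar> powr p * (2 * (R + s)) powr (1 - p) <= (LINT y|lborel. \<bar>V s y\<bar> powr p)"
  "\<bar>m s\<bar> powr q * (2 * (R + s)) powr (1 - q) <= (LINT y|lborel. \<bar>U s y\<bar> powr q)" if s: "\<tau> <= s" "s <= 4 * \<tau>" for s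
 proof -
  have s': "s \<in> {0..T0}" "R + s > 0" using s \<tau> R by (auto simp: T0_def)
  show "\<bar>n s\<bar> powr p * (2 * (R + s)) powr (1 - p) <= (LINT y|lborel. \<bar>V s y\<bar> powr p)"
   unfolding n_def by (rule mean_power_le[OF p jcont_slice(1)[OF jc(2)] sol_supported(2)[OF UV(1,2) T0(1) s'(1)] s'(2)])
  show "\<bar>m s\<bar> powr q * (2 * (R + s)) powr (1 - q) <= (LINT y|lborel. \<bar>U s y\<bar> powr q)"
   unfolding m_def by (rule mean_power_le[OF q jcont_slice(1)[OF jc(1)] sol_supported(1)[OF UV(1,2) T0(1) s'(1)] s'(2)])
 qed
 show ?thesis
 proof (rule blowup_iteration[where R=R and m=m and n=n, OF p q \<tau>(1) R \<tau>(2)])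
  fix a b t c assume H: "\<tau> <= a" "a <= b" "b <= t" "t <= 4 * \<tau>"
   "!!s. s \<in> {a..b} ==> c <= (1 - exp (- (t - s))) * (\<bar>n s\<bar> powr p * (2 * (R + s)) powr (1 - p))"
  have "c * (b - a) <= (LINT x|lborel. duh ker_d (\<lambda>s y. \<bar>V s y\<bar> powr p) t x)"
  proof (rule duh_integral_lower_bound[OF jcont_kernels(2) pos(1) src(1)])
   fix s assume s: "s \<in> {a..b}"
   have "(1 - exp (- (t - s))) * (\<bar>n s\<bar> powr p * (2 * (R + s)) powr (1 - p)) <= mass ker_d (t - s) * (LINT y|lborel. \<bar>V s y\<bar> powr p)"
    using s H mass_d[of "t - s"] by (intro mult_mono mp) auto
   then show "c <= mass ker_d (t - s) * (LINT y|lborel. \<bar>V s y\<bar> powr p)" using H(5)[OF s] by linarith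
  qed (use H \<tau> in auto)
  then show "c * (b - a) <= m t" using mn(1)[of t] H by linarith
 next
  fix a b t c assume H: "\<tau> <= a" "a <= b" "b <= t" "t <= 4 * \<tau>"
   "!!s. s \<in> {a..b} ==> c <= (t - s) * (\<bar>m s\<bar> powr q * (2 * (R + s)) powr (1 - q))"
  have "c * (b - a) <= (LINT x|lborel. duh ker_w (\<lambda>s y. \<bar>U s y\<bar> powr q) t x)"
  proof (rule duh_integral_lower_bound[OF jcont_kernels(1) pos(2) src(2)])
   fix s assume s: "s \<in> {a..b}"
   have "(t - s) * (\<bar>m s\<bar> powr q * (2 * (R + s)) powr (1 - q)) <= mass ker_w (t - s) * (LINT y|lborel. \<bar>U s y\<bar> powr q)"
    using s H mass_w[of "t - s"] by (intro mult_mono mp) auto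
   then show "c <= mass ker_w (t - s) * (LINT y|lborel. \<bar>U s y\<bar> powr q)" using H(5)[OF s] by linarith
  qed (use H \<tau> in auto)
  moreover have "0 <= A * t" using A H \<tau> by simp
  ultimately show "c * (b - a) <= n t" using mn(2)[of t] H by linarith
 next
  fix t assume t: "\<tau> <= t" "t <= 4 * \<tau>"
  have "0 * (t - t) <= (LINT x|lborel. duh ker_w (\<lambda>s y. \<bar>U s y\<bar> powr q) t x)"
  proof (rule duh_integral_lower_bound[OF jcont_kernels(1) pos(2) src(2)])
   show "0 <= mass ker_w (t - s) * (LINT y|lborel. \<bar>U s y\<bar> powr q)" if "s \<in> {t..t}" for s
    using that by (intro mult_nonneg_nonneg pos integral_nonneg_AE) auto
  qed (use t \<tau> in auto)
  then show "A * t <= n t" using mn(2)[OF t] by simp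
 qed (rule A)
qed

end

section \<open>Existence by Picard iteration\<close>

lemma jcont_clamp:
 assumes "jcont (w :: real => real => real)" shows "jcont (\<lambda>t. w (max 0 (min T t)))"
proof -
 have "continuous_on UNIV (\<lambda>p::real\<times>real. (max 0 (min T (fst p)), snd p))" by (intro continuous_intros)
 from continuous_on_compose2[OF assms this] show ?thesis by simp
qed

text \<open>The hypotheses say that the ball of radius \<open>B\<close> is invariant under the Picard map. The
  iterates are frozen in time outside \<open>[0, T]\<close>, so that they are bounded and continuous on the plane;
  on \<open>[0, T]\<close> this changes nothing, because the Duhamel integral at time \<open>t\<close> only uses
  the past.\<close>

lemma picard_exists:
 assumes pq: "p > 1" "q > 1" and T: "0 <= T" and lin: "jcont ul" "jcont vl"
  and B: "B \<ge> 0"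
  and u_bd: "!!v t x. jcont v ==> (!!t x. \<bar>v t x\<bar> <= B) ==> t \<in> {0..T} ==>
    \<bar>ul t x + duh ker_d (\<lambda>s y. \<bar>v s y\<bar> powr p) t x\<bar> <= M"
  and v_bd: "!!v u t x. jcont v ==> (!!t x. \<bar>v t x\<bar> <= B) ==> jcont u ==>
    (!!s y. s \<in> {0..T} ==> u s y = ul s y + duh ker_d (\<lambda>s y. \<bar>v s y\<bar> powr p) s y) ==> t \<in> {0..T} ==>
    \<bar>vl t x + duh ker_w (\<lambda>s y. \<bar>u s y\<bar> powr q) t x\<bar> <= B"
 shows "\<exists>U V. sol p q T ul vl U V \<and> (\<forall>t x. \<bar>U t x\<bar> <= max M B \<and> \<bar>V t x\<bar> <= max M B) \<and>
  (\<forall>t. U t = U (max 0 (min T t)) \<and> V t = V (max 0 (min T t)))"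
proof -
 let ?c = "\<lambda>t. max 0 (min T t)"
 have c: "?c t \<in> {0..T}" for t using T by auto
 have cc: "?c t = t" if "t \<in> {0..T}" for t using that by auto
 define P where "P = (\<lambda>v t x. ul (?c t) x + duh ker_d (\<lambda>s y. \<bar>v s y\<bar> powr p) (?c t) x)"
 define Q where "Q = (\<lambda>v t x. vl (?c t) x + duh ker_w (\<lambda>s y. \<bar>P v s y\<bar> powr q) (?c t) x)"
 define ok where "ok = (\<lambda>v. jcont v \<and> (\<forall>t x. \<bar>v t x\<bar> <= B))"
 have dj: "jcont (duh \<kappa> (\<lambda>s y. \<bar>w s y\<bar> powr r))"
  if "jcont w" "jcont \<kappa>" "r > 0" for \<kappa> w r
  by (rule jcont_duh[OF that(2) jcont_powr[OF that(1,3)]])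
 have Pc: "jcont (P v)" if "ok v" for v
 proof -
  have v: "jcont v" using that by (simp add: ok_def)
  have "p > 0" using pq by simp
  show ?thesis unfolding P_def
   by (intro continuous_on_add jcont_clamp[OF lin(1)]
    jcont_clamp[OF dj[OF v jcont_kernels(2) \<open>p > 0\<close>]])
 qed
 have Pb: "\<bar>P v t x\<bar> <= M" if "ok v" for v t x
  unfolding P_def by (rule u_bd[OF _ _ c]) (use that in \<open>auto simp: ok_def\<close>)
 have Qok: "ok (Q v)" if v: "ok v" for v
 proof -
  have q0: "q > 0" using pq by simp
  have "jcont (Q v)" unfolding Q_def
   by (intro continuous_on_add jcont_clamp[OF lin(2)]
    jcont_clamp[OF dj[OF Pc[OF v] jcont_kernels(1) q0]])
  moreover have "\<bar>Q v t x\<bar> <= B" for t x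
   unfolding Q_def
  proof (rule v_bd[OF _ _ Pc[OF v] _ c, of v])
   show "P v s y = ul s y + duh ker_d (\<lambda>s y. \<bar>v s y\<bar> powr p) s y" if "s \<in> {0..T}" for s y
    unfolding P_def cc[OF that] ..
  qed (use v in \<open>auto simp: ok_def\<close>)
  ultimately show ?thesis by (simp add: ok_def)
 qed
 define L where "L = p * B powr (p - 1) + q * M powr (q - 1) + 1"
 have L: "L > 0" "p * B powr (p - 1) <= L" "q * M powr (q - 1) <= L"
  unfolding L_def using pq by (auto intro: add_nonneg_pos add_nonneg_nonneg)
 define K where "K = 1 + T"
 have K: "K > 0" using T by (simp add: K_def)
 define l where "l = 2 * K * L"
 have l: "l > 0" using K L by (simp add: l_def)
 have mK: "mass ker_d r <= K" "mass ker_w r <= K" if "0 <= r" "r <= T" for r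
  using mass_d_le[OF that(1)] mass_w[OF that(1)] that T unfolding K_def by linarith+
 have Plip: "\<bar>P v t x - P w t x\<bar> <= (D / 2) * exp (l * t)"
  if v: "ok v" "ok w" and D: "D \<ge> 0" "!!s y. s \<in> {0..T} ==> \<bar>v s y - w s y\<bar> <= D * exp (l * s)" and t: "t \<in> {0..T}" for v w D t x
 proof -
  have "\<bar>duh ker_d (\<lambda>s y. \<bar>v s y\<bar> powr p) t x - duh ker_d (\<lambda>s y. \<bar>w s y\<bar> powr p) t x\<bar> <= (D / 2) * exp (2 * K * L * t)"
   by (rule duh_power_lipschitz[where M=B, OF jcont_kernels(2) ker_nonneg(2) mK(1) _ _ _ _ pq(1) L(2,1) K t D(1)])
    (use v D(2) t in \<open>auto simp: ok_def l_def\<close>)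
  then show ?thesis unfolding P_def cc[OF t] l_def by simp
 qed
 have Qlip: "\<bar>Q v t x - Q w t x\<bar> <= (D / 2) * exp (l * t)"
  if v: "ok v" "ok w" and D: "D \<ge> 0" "!!s y. s \<in> {0..T} ==> \<bar>v s y - w s y\<bar> <= D * exp (l * s)" and t: "t \<in> {0..T}" for v w D t x
 proof -
  have D2: "\<bar>P v s y - P w s y\<bar> <= D * exp (l * s)" if "s \<in> {0..T}" for s y
  proof -
   have "\<bar>P v s y - P w s y\<bar> <= (D / 2) * exp (l * s)" by (rule Plip[OF v D that])
   also have "\<dots> <= D * exp (l * s)" using D(1) by (intro mult_right_mono) auto
   finally show ?thesis .
  qed
  have "\<bar>duh ker_w (\<lambda>s y. \<bar>P v s y\<bar> powr q) t x - duh ker_w (\<lambda>s y. \<bar>P w s y\<bar> powr q) t x\<bar> <= (D / 2) * exp (2 * K * L * t)"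
   by (rule duh_power_lipschitz[where M=M, OF jcont_kernels(1) ker_nonneg(1) mK(2) Pc[OF v(1)] Pc[OF v(2)] Pb[OF v(1)] Pb[OF v(2)]
     pq(2) L(3,1) K t D(1)]) (use D2 t in \<open>auto simp: l_def\<close>)
  then show ?thesis unfolding Q_def cc[OF t] l_def by simp
 qed
 define w where "w = (\<lambda>n. (Q ^^ n) (\<lambda>t x. 0))"
 have w0: "w 0 = (\<lambda>t x. 0)" and wS: "w (Suc n) = Q (w n)" for n by (simp_all add: w_def)
 have wok: "ok (w n)" for n by (induction n) (auto simp: w0 wS Qok, simp add: ok_def B)
 have wc: "w n t = w n (?c t)" for n t
 proof (cases n)
  case (Suc m)
  show ?thesis unfolding Suc wS Q_def cc[OF c] ..
 qed (simp add: w0)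
 have diff: "\<bar>w (Suc n) t x - w n t x\<bar> <= (B / 2 ^ n) * exp (l * t)" if "t \<in> {0..T}" for n t x
  using that
 proof (induction n arbitrary: t x)
  case 0
  have "\<bar>w (Suc 0) t x\<bar> <= B * 1" using wok[of "Suc 0"] by (simp add: ok_def)
  also have "\<dots> <= B * exp (l * t)" using B l 0 by (intro mult_left_mono) auto
  finally show ?case by (simp add: w0)
 next
  case (Suc n)
  have "\<bar>Q (w (Suc n)) t x - Q (w n) t x\<bar> <= (B / 2 ^ n / 2) * exp (l * t)"
   by (rule Qlip[OF wok wok _ Suc.IH Suc.prems]) (use B in auto)
  then show ?case by (simp add: wS)
 qed
 define E where "E = exp (l * T)"
 have Eb: "exp (l * t) <= E" if "t \<in> {0..T}" for t using that l by (simp add: E_def)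
 have diff': "\<bar>w (Suc n) t x - w n t x\<bar> <= B * E * (1 / 2) ^ n" for n t x
 proof -
  have "\<bar>w (Suc n) (?c t) x - w n (?c t) x\<bar> <= (B / 2 ^ n) * exp (l * ?c t)" by (rule diff[OF c])
  also have "\<dots> <= (B / 2 ^ n) * E" using B by (intro mult_left_mono Eb[OF c]) auto
  finally show ?thesis using wc[of "Suc n" t] wc[of n t] by (simp add: power_one_over mult_ac)
 qed
 define V where "V = (\<lambda>t x. suminf (\<lambda>i. w (Suc i) t x - w i t x))"
 have "uniform_limit UNIV (\<lambda>n z. \<Sum>i<n. w (Suc i) (fst z) (snd z) - w i (fst z) (snd z))
   (\<lambda>z. suminf (\<lambda>i. w (Suc i) (fst z) (snd z) - w i (fst z) (snd z))) sequentially"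
 proof (rule Weierstrass_m_test)
  show "norm (w (Suc n) (fst z) (snd z) - w n (fst z) (snd z)) <= B * E * (1 / 2) ^ n" for n z
   using diff' by simp
  show "summable (\<lambda>n. B * E * (1 / 2) ^ n)" by (intro summable_mult summable_geometric) simp
 qed
 moreover have "(\<Sum>i<n. w (Suc i) t x - w i t x) = w n t x" for n t x
  by (subst sum_lessThan_telescope) (simp add: w0)
 ultimately have ulim: "uniform_limit UNIV (\<lambda>n z. w n (fst z) (snd z)) (\<lambda>z. V (fst z) (snd z)) sequentially"
  by (simp add: V_def)
 have Vc: "jcont V"
  by (rule uniform_limit_theorem[OF _ ulim]) (use wok in \<open>auto simp: ok_def\<close>)
 have lim: "(\<lambda>n. w n t x) \<longlonglongrightarrow> V t x" for t x
  using tendsto_uniform_limitI[OF ulim, of "(t, x)"] by simp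
 have Vb: "\<bar>V t x\<bar> <= B" for t x
  by (rule LIMSEQ_le_const2[OF tendsto_rabs[OF lim]]) (use wok in \<open>auto simp: ok_def\<close>)
 have Vok: "ok V" using Vc Vb by (simp add: ok_def)
 have Vcl: "V t = V (?c t)" for t
 proof
  fix x
  have "w n t x = w n (?c t) x" for n by (rule fun_cong[OF wc])
  then show "V t x = V (?c t) x" unfolding V_def by (simp only:)
 qed
 (* Q V and Q (w N) are as close as V and w N, and Q (w N) is the next iterate. *)
 have fix_pt: "V t x = Q V t x" if t: "t \<in> {0..T}" for t x
 proof -
  have small: "\<bar>V t x - Q V t x\<bar> <= e" if e: "e > 0" for e
  proof -
   (* Closeness in the supremum norm costs the factor E in the weighted norm. *)
  define d where "d = e / (1 + E)"
   have E0: "E > 0" by (simp add: E_def)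
   have d: "d > 0" using e E0 by (simp add: d_def)
   obtain N where N: "!!n z. n \<ge> N ==> dist (w n (fst z) (snd z)) (V (fst z) (snd z)) < d"
    using ulim d unfolding uniform_limit_iff eventually_sequentially by fast
   have n: "\<bar>V s y - w n s y\<bar> <= d" if "n \<ge> N" for n s y
    using N[OF that, of "(s, y)"] by (simp add: dist_real_def)
   have "\<bar>Q V t x - Q (w N) t x\<bar> <= (d / 2) * exp (l * t)"
   proof (rule Qlip[OF Vok wok _ _ t])
    fix s y assume s: "s \<in> {0..T}"
    have "d * 1 <= d * exp (l * s)" using d l s by (intro mult_left_mono) auto
    then show "\<bar>V s y - w N s y\<bar> <= d * exp (l * s)" using n[of N s y] by simp
   qed (use d in simp)
   also have "\<dots> <= (d / 2) * E" using d by (intro mult_left_mono Eb t) auto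
   also have "\<dots> <= d * E" using d E0 by simp
   finally have "\<bar>Q V t x - w (Suc N) t x\<bar> <= d * E" by (simp add: wS)
   moreover have "\<bar>V t x - w (Suc N) t x\<bar> <= d" by (rule n) simp
   moreover have "d + d * E = e"
   proof -
    have "d * (1 + E) = e" using E0 by (simp add: d_def)
    then show ?thesis by (simp add: algebra_simps)
   qed
   ultimately show ?thesis by linarith
  qed
  show ?thesis
  proof (rule ccontr)
   assume "V t x \<noteq> Q V t x"
   then have "\<bar>V t x - Q V t x\<bar> / 2 > 0" by simp
   from small[OF this] \<open>V t x \<noteq> Q V t x\<close> show False by simp
  qed
 qed
 have "sol p q T ul vl (P V) V"
  unfolding sol_def
 proof (intro conjI ballI Pc[OF Vok] Vc)
  fix t assume t: "t \<in> {0..T}"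
  show "AE x in lborel. P V t x = ul t x + duh ker_d (\<lambda>s y. \<bar>V s y\<bar> powr p) t x"
   unfolding P_def cc[OF t] by simp
  have "V t x = vl t x + duh ker_w (\<lambda>s y. \<bar>P V s y\<bar> powr q) t x" for x
   using fix_pt[OF t, of x] unfolding Q_def cc[OF t] .
  then show "AE x in lborel. V t x = vl t x + duh ker_w (\<lambda>s y. \<bar>P V s y\<bar> powr q) t x" by simp
 qed
 note sol = this
 show ?thesis
 proof (rule exI[of _ "P V"], rule exI[of _ V], intro conjI allI)
  show "sol p q T ul vl (P V) V" by (rule sol)
  show "\<bar>P V t x\<bar> <= max M B" "\<bar>V t x\<bar> <= max M B" for t x
   using Pb[OF Vok, of t x] Vb[of t x] by linarith+
  show "P V t = P V (?c t)" for t unfolding P_def cc[OF c] ..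
 qed (rule Vcl)
qed

lemma jcont_shift:
 assumes "continuous_on UNIV (f :: real => real)"
 shows "jcont (\<lambda>t x. f (x + t))" "jcont (\<lambda>t x. f (x - t))"
 by (rule continuous_on_compose2[OF assms], intro continuous_intros, simp)+

lemma jcont_damped_free:
 assumes "continuous_on UNIV f" "integrable lborel f" "integrable lborel g"
 shows "jcont (damped_free f g)"
 unfolding damped_free_def[abs_def]
 by (intro continuous_on_add continuous_on_mult jcont_shift jcont_conv jcont_kernels assms)
   (auto intro!: continuous_intros)

lemma jcont_wave_free:
 assumes "continuous_on UNIV f" "integrable lborel g"
 shows "jcont (wave_free f g)"
 unfolding wave_free_def[abs_def]
 by (intro continuous_on_add continuous_on_divide jcont_shift jcont_conv jcont_kernels assms)
   (intro continuous_intros, simp)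

text \<open>The damped free solution is bounded in \<open>L\<^sup>1\<close>, and the decay of the kernels bounds
  its supremum by the \<open>L\<^sup>1\<close> norm of the data; the translates of the value even decay
  exponentially.\<close>

lemma linear_decay:
 assumes f: "integrable lborel f" "!!x. \<bar>f x\<bar> <= b" and g: "integrable lborel g" and t: "0 <= t"
 shows "\<bar>damped_free f g t x\<bar> <= (b + (LINT x|lborel. \<bar>f x\<bar>) + (LINT x|lborel. \<bar>g x\<bar>)) / sqrt (1 + t)"
  "(LINT x|lborel. \<bar>damped_free f g t x\<bar>) <= (LINT x|lborel. \<bar>f x\<bar>) + (LINT x|lborel. \<bar>g x\<bar>)"
  "\<bar>wave_free f g t x\<bar> <= b + (LINT x|lborel. \<bar>g x\<bar>)"
proof -
 have b: "b \<ge> 0" using f(2)[of 0] by linarith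
 have sq: "sqrt (1 + t) > 0" using t by simp
 have cf: "\<bar>conv ker_f t f x\<bar> <= 1 / sqrt (1 + t) * (LINT x|lborel. \<bar>f x\<bar>)"
  by (rule conv_pointwise_bound[OF jcont_kernels(3) ker_nonneg(3) f(1) ker_d_f_decay(2)]) (use sq in auto)
 have cd: "\<bar>conv ker_d t g x\<bar> <= 1 / sqrt (1 + t) * (LINT x|lborel. \<bar>g x\<bar>)"
  by (rule conv_pointwise_bound[OF jcont_kernels(2) ker_nonneg(2) g ker_d_f_decay(1)]) (use sq in auto)
 have cw: "\<bar>conv ker_w t g x\<bar> <= 1 / 2 * (LINT x|lborel. \<bar>g x\<bar>)"
  by (rule conv_pointwise_bound[OF jcont_kernels(1) ker_nonneg(1) g]) (auto simp: ker_w_def)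
 have f2: "\<bar>f (x + t) + f (x - t)\<bar> <= 2 * b" using f(2)[of "x + t"] f(2)[of "x - t"] by linarith
 have e: "exp (- t / 2) <= 1 / sqrt (1 + t)"
 proof -
  have "sqrt (1 + t) <= sqrt (exp t)" using exp_ge_add_one_self[of t] by simp
  also have "\<dots> = exp (t / 2)" by (rule real_sqrt_unique) (simp_all add: power2_eq_square exp_add[symmetric])
  finally have "1 / exp (t / 2) <= 1 / sqrt (1 + t)" using sq by (intro divide_left_mono) auto
  moreover have "exp (- t / 2) = 1 / exp (t / 2)"
   using exp_minus[of "t / 2"] by (simp only: minus_divide_left inverse_eq_divide)
  ultimately show ?thesis by simp
 qed
 have "\<bar>exp (- t / 2) / 2 * (f (x + t) + f (x - t))\<bar> <= (1 / sqrt (1 + t)) / 2 * (2 * b)"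
  unfolding abs_mult using e f2 b t by (intro mult_mono) auto
 also have "\<dots> = b / sqrt (1 + t)" by simp
 finally have ff: "\<bar>exp (- t / 2) / 2 * (f (x + t) + f (x - t))\<bar> <= b / sqrt (1 + t)" .
 show "\<bar>damped_free f g t x\<bar> <= (b + (LINT x|lborel. \<bar>f x\<bar>) + (LINT x|lborel. \<bar>g x\<bar>)) / sqrt (1 + t)"
 proof -
  have "\<bar>damped_free f g t x\<bar> <= b / sqrt (1 + t) + 1 / sqrt (1 + t) * (LINT x|lborel. \<bar>f x\<bar>) + 1 / sqrt (1 + t) * (LINT x|lborel. \<bar>g x\<bar>)"
   using ff cf cd unfolding damped_free_def by linarith
  then show ?thesis by (simp add: add_divide_distrib)
 qed
 show "\<bar>wave_free f g t x\<bar> <= b + (LINT x|lborel. \<bar>g x\<bar>)"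
 proof -
  have "\<bar>(f (x + t) + f (x - t)) / 2\<bar> <= b" using f2 by simp
  moreover have "\<bar>conv ker_w t g x\<bar> <= (LINT x|lborel. \<bar>g x\<bar>)"
   by (rule order_trans[OF cw]) simp
  ultimately show ?thesis unfolding wave_free_def by (intro order_trans[OF abs_triangle_ineq] add_mono)
 qed
 have ai: "integrable lborel (\<lambda>x. \<bar>f x\<bar>)" "integrable lborel (\<lambda>x. \<bar>g x\<bar>)" using f(1) g by auto
 have "(LINT x|lborel. \<bar>damped_free f g t x\<bar>) <= (LINT x|lborel. damped_free (\<lambda>x. \<bar>f x\<bar>) (\<lambda>x. \<bar>g x\<bar>) t x)"
 proof (rule integral_mono)
  fix x
  have "\<bar>f (x + t) + f (x - t)\<bar> <= \<bar>f (x + t)\<bar> + \<bar>f (x - t)\<bar>" by (rule abs_triangle_ineq)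
  then have "\<bar>exp (- t / 2) / 2 * (f (x + t) + f (x - t))\<bar> <= exp (- t / 2) / 2 * (\<bar>f (x + t)\<bar> + \<bar>f (x - t)\<bar>)"
   unfolding abs_mult by (intro mult_mono) auto
  then show "\<bar>damped_free f g t x\<bar> <= damped_free (\<lambda>x. \<bar>f x\<bar>) (\<lambda>x. \<bar>g x\<bar>) t x"
   using conv_abs_le[OF jcont_kernels(3) ker_nonneg(3) f(1), of t x]
    conv_abs_le[OF jcont_kernels(2) ker_nonneg(2) g, of t x] unfolding damped_free_def by linarith
 qed (use damped_free_integral(1)[OF f(1) g t] damped_free_integral(1)[OF ai t] in auto)
 also have "\<dots> = (LINT x|lborel. \<bar>f x\<bar>) + (1 - exp (- t)) * (LINT x|lborel. \<bar>g x\<bar>)" by (rule damped_free_integral(2)[OF ai t])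
 also have "\<dots> <= (LINT x|lborel. \<bar>f x\<bar>) + 1 * (LINT x|lborel. \<bar>g x\<bar>)" by (intro add_mono mult_right_mono) auto
 finally show "(LINT x|lborel. \<bar>damped_free f g t x\<bar>) <= (LINT x|lborel. \<bar>f x\<bar>) + (LINT x|lborel. \<bar>g x\<bar>)" by simp
qed

lemma powr_add_le:
 fixes a b r :: real assumes "0 <= a" "0 <= b" "0 <= r"
 shows "(a + b) powr r <= 2 powr r * a powr r + 2 powr r * b powr r"
proof -
 have "(a + b) powr r <= (2 * max a b) powr r" using assms by (intro powr_mono2) auto
 also have "\<dots> = 2 powr r * max a b powr r" by (rule powr_mult)
 also have "\<dots> <= 2 powr r * (a powr r + b powr r)" by (intro mult_left_mono) (auto simp: max_def)
 finally show ?thesis by (simp add: distrib_left)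
qed

lemma integral_power_one_add:
 fixes a t :: real
 assumes a: "a > 0" and t: "0 <= t"
 shows "set_integrable lborel {0..t} (\<lambda>s. (1 + s) powr (a - 1))" "(LINT s:{0..t}|lborel. (1 + s) powr (a - 1)) <= (1 + t) powr a / a"
proof -
 have c: "continuous_on {0..t} (\<lambda>s. (1 + s) powr (a - 1))" by (intro continuous_on_powr continuous_intros) auto
 show "set_integrable lborel {0..t} (\<lambda>s. (1 + s) powr (a - 1))"
  by (rule borel_integrable_atLeastAtMost'[OF c])
 have "(LINT s:{0..t}|lborel. (1 + s) powr (a - 1)) = (1 + t) powr a / a - (1 + 0) powr a / a"
  unfolding set_int_def real_scaleR_def
 proof (subst mult.commute, rule integral_FTC_Icc_real[OF t])
  show "((\<lambda>s. (1 + s) powr a / a) has_real_derivative (1 + x) powr (a - 1)) (at x)" if "0 <= x" "x <= t" for x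
   using that a by (auto intro!: derivative_eq_intros)
  show "isCont (\<lambda>s. (1 + s) powr (a - 1)) x" if "0 <= x" "x <= t" for x
   using that by (intro continuous_intros) auto
 qed
 also have "\<dots> <= (1 + t) powr a / a" using a by simp
 finally show "(LINT s:{0..t}|lborel. (1 + s) powr (a - 1)) <= (1 + t) powr a / a" .
qed

context profiles
begin

text \<open>Interpolation between the supremum bound and the \<open>L\<^sup>1\<close> bound. The exponent
  \<open>a\<close> replaces \<open>(3 - q) / 2\<close>, which need not be positive.\<close>

lemma power_integral_decay:
 assumes E: "E > 0" and ub: "!!x. \<bar>ul s x\<bar> <= E / sqrt (1 + s)" and ui: "(LINT x|lborel. \<bar>ul s x\<bar>) <= E"
  and a: "- (q - 1) / 2 <= a - 1" and s: "0 <= s"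
 shows "integrable lborel (\<lambda>x. \<bar>ul s x\<bar> powr q)" "(LINT x|lborel. \<bar>ul s x\<bar> powr q) <= E powr q * (1 + s) powr (a - 1)"
proof -
 let ?S = "(E / sqrt (1 + s)) powr (q - 1)"
 have b: "\<bar>ul s x\<bar> powr q <= ?S * \<bar>ul s x\<bar>" for x
 proof (cases "ul s x = 0")
  case False
  have "\<bar>ul s x\<bar> powr q = \<bar>ul s x\<bar> powr ((q - 1) + 1)" by simp
  also have "\<dots> = \<bar>ul s x\<bar> powr (q - 1) * \<bar>ul s x\<bar>" using False by (simp only: powr_add) simp
  also have "\<dots> <= ?S * \<bar>ul s x\<bar>" using q ub by (intro mult_right_mono powr_mono2) auto
  finally show ?thesis .
 qed simp
 have [measurable]: "ul s \<in> borel_measurable borel" using integral_linear(1)[OF s] by auto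
 show i: "integrable lborel (\<lambda>x. \<bar>ul s x\<bar> powr q)"
 proof (rule int_bound)
  show "integrable lborel (\<lambda>x. ?S * \<bar>ul s x\<bar>)" using integral_linear(1)[OF s] by auto
  show "AE x in lborel. norm (\<bar>ul s x\<bar> powr q) <= norm (?S * \<bar>ul s x\<bar>)" using b by simp
 qed measurable
 have "(LINT x|lborel. \<bar>ul s x\<bar> powr q) <= (LINT x|lborel. ?S * \<bar>ul s x\<bar>)"
  by (rule integral_mono[OF i _ b]) (use integral_linear(1)[OF s] in auto)
 also have "\<dots> <= ?S * E" using ui by (simp add: mult_left_mono)
 also have "?S = E powr (q - 1) * (1 + s) powr (- (q - 1) / 2)"
 proof -
  have "(1 + s) powr (- (q - 1) / 2) = 1 / (1 + s) powr ((q - 1) / 2)"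
   using powr_minus_divide[of "1 + s" "(q - 1) / 2"] by (simp only: minus_divide_left)
  moreover have "sqrt (1 + s) powr (q - 1) = (1 + s) powr ((q - 1) / 2)"
   using s by (simp add: powr_powr flip: powr_half_sqrt)
  ultimately show ?thesis by (simp add: powr_divide)
 qed
 also have "E powr (q - 1) * (1 + s) powr (- (q - 1) / 2) * E <= E powr (q - 1) * (1 + s) powr (a - 1) * E"
  using E s a by (intro mult_right_mono mult_left_mono powr_mono) auto
 also have "\<dots> = E powr q * (1 + s) powr (a - 1)"
 proof -
  have "E powr q = E powr ((q - 1) + 1)" by simp
  also have "\<dots> = E powr (q - 1) * E" using E by (simp only: powr_add) simp
  finally show ?thesis by simp
 qed
 finally show "(LINT x|lborel. \<bar>ul s x\<bar> powr q) <= E powr q * (1 + s) powr (a - 1)" .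
qed

text \<open>The inequality for \<open>B\<close> is the invariance of the ball: \<open>E\<close> bounds the free
  solutions, the term with \<open>a\<close> is the contribution of the free part of \<open>u\<close> to
  \<open>v\<close>, and the last term that of its Duhamel part.\<close>

lemma existence_time:
 assumes E: "E > 0" and ub: "!!t x. 0 <= t ==> \<bar>ul t x\<bar> <= E / sqrt (1 + t)"
  and ui: "!!t. 0 <= t ==> (LINT x|lborel. \<bar>ul t x\<bar>) <= E" and vb: "!!t x. 0 <= t ==> \<bar>vl t x\<bar> <= E"
  and a: "a > 0" "- (q - 1) / 2 <= a - 1" and T: "T > 0" and B: "B \<ge> 0"
  and inv: "E + 2 powr q * (E powr q * ((1 + T) powr a / a) + T\<^sup>2 * (T * B powr p) powr q) <= B"
 shows "\<exists>U V. Nakao_mild_solution p q u0 u1 v0 v1 (ereal T) U V"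
proof -
 define W where "W = T * B powr p"
 have W: "W \<ge> 0" using T by (simp add: W_def)
 have db: "\<bar>duh ker_d (\<lambda>s y. \<bar>v s y\<bar> powr p) t x\<bar> <= W"
  if v: "jcont v" "!!t x. \<bar>v t x\<bar> <= B" and t: "t \<in> {0..T}" for v t x
 proof -
  have vc: "jcont (\<lambda>s y. \<bar>v s y\<bar> powr p)" using jcont_powr[OF v(1)] p by simp
  have "\<bar>duh ker_d (\<lambda>s y. \<bar>v s y\<bar> powr p) t x\<bar> <= (LINT s:{0..t}|lborel. B powr p)"
  proof (rule duh_abs_le[OF jcont_kernels(2) vc])
   fix s assume s: "s \<in> {0..t}"
   have "\<bar>conv ker_d (t - s) (\<lambda>y. \<bar>v s y\<bar> powr p) x\<bar> <= mass ker_d (t - s) * B powr p"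
    by (rule conv_sup_bound[OF jcont_kernels(2) ker_nonneg(2) jcont_slice(3)[OF vc]])
      (use v(2) p in \<open>auto intro!: powr_mono2\<close>)
   also have "\<dots> <= 1 * B powr p" using s by (intro mult_right_mono mass_d_le) auto
   finally show "\<bar>conv ker_d (t - s) (\<lambda>y. \<bar>v s y\<bar> powr p) x\<bar> <= B powr p" by simp
  qed (rule continuous_set_integrable, simp)
  also have "\<dots> = t * B powr p" using t by (simp add: set_int_def)
  also have "\<dots> <= W" unfolding W_def using t by (intro mult_right_mono) auto
  finally show ?thesis .
 qed
 have wb: "\<bar>duh ker_w (\<lambda>s y. \<bar>u s y\<bar> powr q) t x\<bar> <= 2 powr q * (E powr q * ((1 + T) powr a / a) + T\<^sup>2 * W powr q)"
  if u: "jcont u" "!!s y. s \<in> {0..T} ==> \<bar>u s y - ul s y\<bar> <= W" and t: "t \<in> {0..T}" for u t x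
 proof -
  have q0: "q > 0" using q by simp
  note uc = jcont_powr[OF u(1) q0]
  have ulc: "jcont ul"
   by (rule jcont_damped_free[OF free_dataD(3,1,2)[OF fd]])
  have ulq: "continuous_on UNIV (\<lambda>y. 2 powr q * \<bar>ul s y\<bar> powr q)" for s
   by (intro continuous_on_mult_left jcont_slice(1)[OF jcont_powr[OF ulc q0]])
  have cb: "\<bar>conv ker_w (t - s) (\<lambda>y. \<bar>u s y\<bar> powr q) x\<bar> <= 2 powr q * E powr q * (1 + s) powr (a - 1) + 2 powr q * T * W powr q"
   if s: "s \<in> {0..t}" for s
  proof -
   have s': "s \<in> {0..T}" "0 <= s" "0 <= t - s" "t - s <= T" using s t by auto
   let ?h = "\<lambda>y. \<bar>u s y\<bar> powr q"
   (* The part of the power that the free solution controls in L1; the rest is bounded. *)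
   let ?h1 = "\<lambda>y. min (?h y) (2 powr q * \<bar>ul s y\<bar> powr q)"
   have hc: "continuous_on UNIV ?h" by (rule jcont_slice(1)[OF uc])
   have h1c: "continuous_on UNIV ?h1" by (intro continuous_on_min hc ulq)
   note pd = power_integral_decay[OF E ub[OF s'(2)] ui[OF s'(2)] a(2) s'(2)]
   have h1i: "integrable lborel ?h1"
   proof (rule int_bound)
    show "integrable lborel (\<lambda>y. 2 powr q * \<bar>ul s y\<bar> powr q)" using pd(1) by simp
    show "?h1 \<in> borel_measurable lborel" unfolding measurable_lborel2 by (rule borel_measurable_continuous_onI[OF h1c])
    show "AE y in lborel. norm (?h1 y) <= norm (2 powr q * \<bar>ul s y\<bar> powr q)" by (rule AE_I2) (simp add: min_def)
   qed
   have "\<bar>conv ker_w (t - s) ?h1 x\<bar> <= 1 / 2 * (LINT y|lborel. \<bar>?h1 y\<bar>)"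
    by (rule conv_pointwise_bound[OF jcont_kernels(1) ker_nonneg(1) h1i]) (auto simp: ker_w_def)
   also have "(LINT y|lborel. \<bar>?h1 y\<bar>) <= (LINT y|lborel. 2 powr q * \<bar>ul s y\<bar> powr q)"
   proof (rule integral_mono[OF integrable_abs[OF h1i]])
    show "integrable lborel (\<lambda>y. 2 powr q * \<bar>ul s y\<bar> powr q)" using pd(1) by simp
    show "\<bar>?h1 y\<bar> <= 2 powr q * \<bar>ul s y\<bar> powr q" for y by (simp add: min_def)
   qed
   also have "(LINT y|lborel. 2 powr q * \<bar>ul s y\<bar> powr q) = 2 powr q * (LINT y|lborel. \<bar>ul s y\<bar> powr q)" by simp
   also have "\<dots> <= 2 powr q * (E powr q * (1 + s) powr (a - 1))"
    by (rule mult_left_mono[OF pd(2)]) simp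
   finally have c1': "\<bar>conv ker_w (t - s) ?h1 x\<bar> <= 1 / 2 * (2 powr q * (E powr q * (1 + s) powr (a - 1)))" by simp
   have "1 / 2 * (2 powr q * (E powr q * (1 + s) powr (a - 1))) <= 1 * (2 powr q * (E powr q * (1 + s) powr (a - 1)))"
    by (rule mult_right_mono) simp_all
   with c1' have c1: "\<bar>conv ker_w (t - s) ?h1 x\<bar> <= 2 powr q * E powr q * (1 + s) powr (a - 1)"
    unfolding mult.assoc mult_1 by (rule order_trans)
   have hd: "\<bar>?h y - ?h1 y\<bar> <= 2 powr q * W powr q" for y
   proof -
    have "\<bar>u s y\<bar> <= \<bar>ul s y\<bar> + W" using u(2)[OF s'(1), of y] by linarith
    then have "?h y <= (\<bar>ul s y\<bar> + W) powr q" using q by (intro powr_mono2) auto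
    also have "\<dots> <= 2 powr q * \<bar>ul s y\<bar> powr q + 2 powr q * W powr q" using q W by (intro powr_add_le) auto
    finally have "?h y <= 2 powr q * \<bar>ul s y\<bar> powr q + 2 powr q * W powr q" .
    moreover have "0 <= 2 powr q * W powr q" by simp
    ultimately show ?thesis by (simp add: min_def)
   qed
   have "\<bar>conv ker_w (t - s) (\<lambda>y. ?h y - ?h1 y) x\<bar> <= mass ker_w (t - s) * (2 powr q * W powr q)"
    by (rule conv_sup_bound[OF jcont_kernels(1) ker_nonneg(1) borel_measurable_continuous_onI hd])
      (assumption | intro continuous_on_diff hc h1c)+
   also have "\<dots> <= T * (2 powr q * W powr q)" using s' by (intro mult_right_mono) (auto simp: mass_w)
   finally have c2: "\<bar>conv ker_w (t - s) (\<lambda>y. ?h y - ?h1 y) x\<bar> <= 2 powr q * T * W powr q" by (simp add: mult_ac)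
   have "conv ker_w (t - s) ?h x = conv ker_w (t - s) ?h1 x + conv ker_w (t - s) (\<lambda>y. ?h y - ?h1 y) x"
    using conv_diff[OF jcont_kernels(1) hc h1c, of "t - s" x] by simp
   then show ?thesis using c1 c2 by linarith
  qed
  have t0: "0 <= t" using t by simp
  note pi = integral_power_one_add[OF a(1) t0]
  have ci: "set_integrable lborel {0..t} (\<lambda>s. c)" for c :: real by (rule continuous_set_integrable) simp
  have pim: "set_integrable lborel {0..t} (\<lambda>s. 2 powr q * E powr q * (1 + s) powr (a - 1))" using pi(1) by simp
  have "\<bar>duh ker_w (\<lambda>s y. \<bar>u s y\<bar> powr q) t x\<bar>
   <= (LINT s:{0..t}|lborel. 2 powr q * E powr q * (1 + s) powr (a - 1) + 2 powr q * T * W powr q)"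
   by (rule duh_abs_le[OF jcont_kernels(1) uc cb]) (assumption | intro set_integral_add(1) pim ci)+
  also have "\<dots> = 2 powr q * E powr q * (LINT s:{0..t}|lborel. (1 + s) powr (a - 1)) + t * (2 powr q * T * W powr q)"
   using t0 by (simp add: set_integral_add(2)[OF pim ci]) (simp add: set_int_def)
  also have "\<dots> <= 2 powr q * E powr q * ((1 + T) powr a / a) + T * (2 powr q * T * W powr q)"
  proof -
   have "(1 + t) powr a / a <= (1 + T) powr a / a" using t a by (intro divide_right_mono powr_mono2) auto
   with pi(2) have "(LINT s:{0..t}|lborel. (1 + s) powr (a - 1)) <= (1 + T) powr a / a" by linarith
   then show ?thesis using t T by (intro add_mono mult_left_mono mult_right_mono) auto
  qed
  also have "\<dots> = 2 powr q * (E powr q * ((1 + T) powr a / a) + T\<^sup>2 * W powr q)" by (simp add: algebra_simps power2_eq_square)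
  finally show ?thesis .
 qed
 have T0: "0 <= T" using T by simp
 have "\<exists>U V. sol p q T ul vl U V \<and> (\<forall>t x. \<bar>U t x\<bar> <= max (E + W) B \<and> \<bar>V t x\<bar> <= max (E + W) B) \<and>
  (\<forall>t. U t = U (max 0 (min T t)) \<and> V t = V (max 0 (min T t)))"
 proof (rule picard_exists[OF p q T0 _ _ B])
  show "jcont ul" by (rule jcont_damped_free[OF free_dataD(3,1,2)[OF fd]])
  show "jcont vl" by (rule jcont_wave_free[OF free_dataD(3,2)[OF hd]])
  show "\<bar>ul t x + duh ker_d (\<lambda>s y. \<bar>v s y\<bar> powr p) t x\<bar> <= E + W"
   if v: "jcont v" "!!t x. \<bar>v t x\<bar> <= B" and t: "t \<in> {0..T}" for v t x
  proof -
   have "\<bar>ul t x\<bar> <= E / sqrt (1 + t)" using ub t by simp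
   also have "\<dots> <= E / 1" using t E by (intro divide_left_mono) auto
   finally show ?thesis using db[OF v t, of x] by linarith
  qed
  show "\<bar>vl t x + duh ker_w (\<lambda>s y. \<bar>u s y\<bar> powr q) t x\<bar> <= B"
   if v: "jcont v" "!!t x. \<bar>v t x\<bar> <= B" and u: "jcont u"
    "!!s y. s \<in> {0..T} ==> u s y = ul s y + duh ker_d (\<lambda>s y. \<bar>v s y\<bar> powr p) s y"
    and t: "t \<in> {0..T}" for v u t x
  proof -
   have "\<bar>u s y - ul s y\<bar> <= W" if "s \<in> {0..T}" for s y using db[OF v that, of y] u(2)[OF that] by simp
   from wb[OF u(1) this t, of x] have "\<bar>duh ker_w (\<lambda>s y. \<bar>u s y\<bar> powr q) t x\<bar> <= B - E"
    using inv unfolding W_def by linarith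
   then show ?thesis using vb[of t x] t by (simp add: abs_le_iff)
  qed
 qed
 then obtain U V where UV': "sol p q T ul vl U V" "\<forall>t x. \<bar>U t x\<bar> <= max (E + W) B \<and> \<bar>V t x\<bar> <= max (E + W) B"
  "\<forall>t. U t = U (max 0 (min T t)) \<and> V t = V (max 0 (min T t))" by (elim exE conjE) (rule that)
 note UV = UV'(1) UV'(2)[THEN spec, THEN spec] UV'(3)[THEN spec]
 have src: "source R (\<lambda>s y. \<bar>U s y\<bar> powr q)" "source R (\<lambda>s y. \<bar>V s y\<bar> powr p)"
  using clamped_source(1)[OF UV(1,2) T0 UV(3), of q] clamped_source(2)[OF UV(1,2) T0 UV(3), of p] p q by auto
 show ?thesis by (intro exI) (rule sol_to_mild[OF UV(1) T src])
qed

end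

section \<open>Gluing and the lifespan\<close>

lemma Lp_norm_cong_AE:
 assumes "AE x in lborel. f x = g x" shows "Lp_norm r f = Lp_norm r g"
proof -
 have "AE x in lborel. \<bar>f x\<bar> powr r = \<bar>g x\<bar> powr r" using assms by eventually_elim simp
 from lebesgue_integral_cong_AE(1)[OF this] show ?thesis by (simp add: Lp_norm_def)
qed

text \<open>The choice in the definition of the norm depends on \<open>f\<close> only through its weak
  derivatives.\<close>

lemma H1_norm_cong_AE:
 assumes "AE x in lborel. f x = g x" shows "H1_norm f = H1_norm g"
proof -
 have "(\<integral>x. f x * deriv \<phi> x \<partial>lebesgue) = (\<integral>x. g x * deriv \<phi> x \<partial>lebesgue)" for \<phi>
  by (rule lebesgue_integral_cong_AE(1)) (use assms in \<open>eventually_elim, simp\<close>)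
 then have "weak_derivative f = weak_derivative g" by (simp add: weak_derivative_def fun_eq_iff)
 then show ?thesis by (simp add: H1_norm_def Lp_norm_cong_AE[OF assms])
qed

lemma Lp_norm_2_diff:
 assumes "f \<in> Lp_space 2" "a \<in> Lp_space 2" "b \<in> Lp_space 2"
 shows "(Lp_norm 2 (\<lambda>x. a x - b x))\<^sup>2 <= 2 * (Lp_norm 2 (\<lambda>x. f x - a x))\<^sup>2 + 2 * (Lp_norm 2 (\<lambda>x. f x - b x))\<^sup>2"
  "Lp_norm 2 (\<lambda>x. a x - b x) = 0 ==> AE x in lborel. a x = b x"
proof -
 obtain F where F: "sq_int F" "AE x in lborel. f x = F x" using assms(1) unfolding Lp_space_2_iff by iprover
 obtain A where A: "sq_int A" "AE x in lborel. a x = A x" using assms(2) unfolding Lp_space_2_iff by iprover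
 obtain B where B: "sq_int B" "AE x in lborel. b x = B x" using assms(3) unfolding Lp_space_2_iff by iprover
 have ab: "AE x in lborel. a x - b x = A x - B x" using A(2) B(2) by eventually_elim simp
 have fa: "AE x in lborel. f x - a x = F x - A x" using A(2) F(2) by eventually_elim simp
 have fb: "AE x in lborel. f x - b x = F x - B x" using B(2) F(2) by eventually_elim simp
 note eq = Lp_norm_2_eq[OF sq_int_diff[OF A(1) B(1)] ab] Lp_norm_2_eq[OF sq_int_diff[OF F(1) A(1)] fa]
  Lp_norm_2_eq[OF sq_int_diff[OF F(1) B(1)] fb]
 have "sq_norm (\<lambda>x. (F x - B x) + (- 1) * (F x - A x)) <= 2 * sq_norm (\<lambda>x. F x - B x) + 2 * sq_norm (\<lambda>x. (- 1) * (F x - A x))"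
  by (rule sq_norm_add_le[OF sq_int_diff[OF F(1) B(1)] sq_int_cmult[OF sq_int_diff[OF F(1) A(1)]]])
 moreover have "sq_norm (\<lambda>x. (- 1) * (F x - A x)) = sq_norm (\<lambda>x. F x - A x)" by (subst sq_norm_cmult) simp
 ultimately show "(Lp_norm 2 (\<lambda>x. a x - b x))\<^sup>2 <= 2 * (Lp_norm 2 (\<lambda>x. f x - a x))\<^sup>2 + 2 * (Lp_norm 2 (\<lambda>x. f x - b x))\<^sup>2"
  unfolding eq by (simp add: sq_norm_nonneg algebra_simps)
 show "AE x in lborel. a x = b x" if "Lp_norm 2 (\<lambda>x. a x - b x) = 0"
 proof -
  have "(LINT x|lborel. (A x - B x)\<^sup>2) = 0" using that unfolding eq by (simp add: sq_norm_nonneg sq_norm_def)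
  then have "AE x in lborel. (A x - B x)\<^sup>2 = 0"
   using sq_int_diff[OF A(1) B(1)] by (subst (asm) integral_nonneg_eq_0_iff_AE) (auto simp: sq_int_def)
  with A(2) B(2) show ?thesis by eventually_elim simp
 qed
qed

lemma L2_quotient:
 assumes "f \<in> Lp_space 2" "g \<in> Lp_space 2" shows "(\<lambda>x. (f x - g x) / c) \<in> Lp_space 2"
proof -
 obtain F where F: "sq_int F" "AE x in lborel. f x = F x" using assms(1) unfolding Lp_space_2_iff by iprover
 obtain G where G: "sq_int G" "AE x in lborel. g x = G x" using assms(2) unfolding Lp_space_2_iff by iprover
 have "AE x in lborel. (f x - g x) / c = inverse c * (F x - G x)"
  using F(2) G(2) by eventually_elim (simp add: field_simps)
 moreover have "sq_int (\<lambda>x. inverse c * (F x - G x))" by (rule sq_int_cmult[OF sq_int_diff[OF F(1) G(1)]])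
 ultimately show ?thesis unfolding Lp_space_2_iff by iprover
qed

text \<open>Both derivatives are limits of the same difference quotients from the right.\<close>

lemma L2_derivative_unique:
 assumes t: "0 <= t" "t < T" "t < T'"
  and U: "!!s. s \<in> {0..<T} ==> U s \<in> Lp_space 2" "w \<in> Lp_space 2" "w' \<in> Lp_space 2"
  and ae: "!!s. 0 <= s ==> s < T ==> s < T' ==> AE x in lborel. U s x = U' s x"
  and d: "((\<lambda>s. Lp_norm 2 (\<lambda>x. (U s x - U t x) / (s - t) - w x)) \<longlongrightarrow> 0) (at t within {0..<T})"
  and d': "((\<lambda>s. Lp_norm 2 (\<lambda>x. (U' s x - U' t x) / (s - t) - w' x)) \<longlongrightarrow> 0) (at t within {0..<T'})"
 shows "AE x in lborel. w x = w' x"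
proof -
 (* On [t, m] both limits can be compared, and t is a limit point of it. *)
 define m where "m = (t + min T T') / 2"
 have m: "t < m" "m < T" "m < T'" using t by (auto simp: m_def)
 have F: "at t within {t..m} = at_right t" by (rule at_within_Icc_at_right[OF m(1)])
 have sub: "{t..m} \<subseteq> {0..<T}" "{t..m} \<subseteq> {0..<T'}" using m t by auto
 have l1: "((\<lambda>s. Lp_norm 2 (\<lambda>x. (U s x - U t x) / (s - t) - w x)) \<longlongrightarrow> 0) (at_right t)"
  using tendsto_within_subset[OF d sub(1)] unfolding F .
 have "((\<lambda>s. Lp_norm 2 (\<lambda>x. (U' s x - U' t x) / (s - t) - w' x)) \<longlongrightarrow> 0) (at t within {t..m})"
  by (rule tendsto_within_subset[OF d' sub(2)])
 then have l2: "((\<lambda>s. Lp_norm 2 (\<lambda>x. (U s x - U t x) / (s - t) - w' x)) \<longlongrightarrow> 0) (at_right t)"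
  unfolding F[symmetric]
 proof (rule Lim_transform_eventually)
  show "\<forall>\<^sub>F s in at t within {t..m}. Lp_norm 2 (\<lambda>x. (U' s x - U' t x) / (s - t) - w' x) = Lp_norm 2 (\<lambda>x. (U s x - U t x) / (s - t) - w' x)"
   unfolding eventually_at_filter
  proof (intro always_eventually allI impI)
   fix s assume "s \<noteq> t" "s \<in> {t..m}"
   then have s: "0 <= s" "s < T" "s < T'" using m t by auto
   show "Lp_norm 2 (\<lambda>x. (U' s x - U' t x) / (s - t) - w' x) = Lp_norm 2 (\<lambda>x. (U s x - U t x) / (s - t) - w' x)"
    by (rule Lp_norm_cong_AE) (use ae[OF s] ae[OF t] in \<open>eventually_elim, simp\<close>)
  qed
 qed
 have "((\<lambda>s. 2 * (Lp_norm 2 (\<lambda>x. (U s x - U t x) / (s - t) - w x))\<^sup>2 + 2 * (Lp_norm 2 (\<lambda>x. (U s x - U t x) / (s - t) - w' x))\<^sup>2)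
   \<longlongrightarrow> 2 * 0\<^sup>2 + 2 * 0\<^sup>2) (at_right t)"
  by (intro tendsto_intros l1 l2)
 then have l: "((\<lambda>s. 2 * (Lp_norm 2 (\<lambda>x. (U s x - U t x) / (s - t) - w x))\<^sup>2 + 2 * (Lp_norm 2 (\<lambda>x. (U s x - U t x) / (s - t) - w' x))\<^sup>2)
   \<longlongrightarrow> 0) (at t within {t..m})" unfolding F by simp
 have "(Lp_norm 2 (\<lambda>x. w x - w' x))\<^sup>2 <= 0"
 proof (rule tendsto_lowerbound[OF l])
  show "\<forall>\<^sub>F s in at t within {t..m}. (Lp_norm 2 (\<lambda>x. w x - w' x))\<^sup>2
   <= 2 * (Lp_norm 2 (\<lambda>x. (U s x - U t x) / (s - t) - w x))\<^sup>2 + 2 * (Lp_norm 2 (\<lambda>x. (U s x - U t x) / (s - t) - w' x))\<^sup>2"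
   unfolding eventually_at_filter
  proof (intro always_eventually allI impI)
   fix s assume "s \<in> {t..m}"
   then have "U s \<in> Lp_space 2" "U t \<in> Lp_space 2" using U(1) m t by auto
   from Lp_norm_2_diff(1)[OF L2_quotient[OF this] U(2,3), of "s - t"]
   show "(Lp_norm 2 (\<lambda>x. w x - w' x))\<^sup>2
    <= 2 * (Lp_norm 2 (\<lambda>x. (U s x - U t x) / (s - t) - w x))\<^sup>2 + 2 * (Lp_norm 2 (\<lambda>x. (U s x - U t x) / (s - t) - w' x))\<^sup>2" .
  qed
  show "at t within {t..m} \<noteq> bot" unfolding F by simp
 qed
 then have "Lp_norm 2 (\<lambda>x. w x - w' x) = 0" by simp
 then show ?thesis by (rule Lp_norm_2_diff(2)[OF U(2,2,3)])
qed

text \<open>Both kinds of curves are local notions that do not see null sets; this is why solutions on different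
  intervals can be glued.\<close>

lemma tendsto_within_local:
 fixes t T :: real and F G :: "real => real"
 assumes S: "S \<inter> {..<T} = {0..<T}" and t: "t < T"
  and lim: "(F \<longlongrightarrow> c) (at t within {0..<T})" and eq: "!!s. s \<in> {0..<T} ==> F s = G s"
 shows "(G \<longlongrightarrow> c) (at t within S)"
proof -
 have F: "at t within S = at t within {0..<T}"
 proof (rule at_within_nhd[of t "{..<T}"])
  have "{0..<T} \<inter> {..<T} = {0..<T}" by auto
  then show "S \<inter> {..<T} - {t} = {0..<T} \<inter> {..<T} - {t}" unfolding S by (simp only:)
 qed (use t in simp_all)
 have "\<forall>\<^sub>F s in at t within {0..<T}. F s = G s"
  unfolding eventually_at_filter by (intro always_eventually allI impI eq)
 from Lim_transform_eventually[OF lim this] show ?thesis unfolding F .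
qed

lemma C0_curve_glue:
 assumes N: "!!f g :: real => real. (AE x in lborel. f x = g x) ==> N f = N g"
  and lt: "!!t. t \<in> S ==> t < T t" and int: "!!t. t \<in> S ==> S \<inter> {..<T t} = {0..<T t}"
  and loc: "!!t. t \<in> S ==> C0_curve {0..<T t} X N (U t)"
  and ut: "!!t. t \<in> S ==> u t = U t t"
  and ae: "!!t s. t \<in> S ==> s \<in> {0..<T t} ==> AE x in lborel. u s x = U t s x"
 shows "C0_curve S X N u"
 unfolding C0_curve_def
proof (intro ballI conjI)
 fix t assume t: "t \<in> S"
 have "t \<in> S \<inter> {..<T t}" using t lt[OF t] by simp
 then have t': "t \<in> {0..<T t}" unfolding int[OF t] .
 note c = loc[OF t]
 show "u t \<in> X" using c t' ut[OF t] by (simp add: C0_curve_def)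
 have lim: "((\<lambda>s. N (\<lambda>x. U t s x - U t t x)) \<longlongrightarrow> 0) (at t within {0..<T t})"
  using c t' by (simp add: C0_curve_def)
 show "((\<lambda>s. N (\<lambda>x. u s x - u t x)) \<longlongrightarrow> 0) (at t within S)"
 proof (rule tendsto_within_local[OF _ _ lim])
  fix s assume "s \<in> {0..<T t}"
  from ae[OF t this] have "AE x in lborel. U t s x - U t t x = u s x - u t x"
   unfolding ut[OF t] by eventually_elim simp
  then show "N (\<lambda>x. U t s x - U t t x) = N (\<lambda>x. u s x - u t x)" by (rule N)
 qed (rule int[OF t] lt[OF t])+
qed

text \<open>The derivatives of the pieces agree almost everywhere, so the diagonal choice \<open>W t t\<close>
  is a derivative of the glued curve.\<close>

lemma C1_curve_glue:
 assumes lt: "!!t. t \<in> S ==> t < T t" and int: "!!t. t \<in> S ==> S \<inter> {..<T t} = {0..<T t}"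
  and loc: "!!t. t \<in> S ==> C1_curve {0..<T t} (Lp_space 2) (Lp_norm 2) (U t)"
  and ut: "!!t. t \<in> S ==> u t = U t t"
  and ae: "!!t s. t \<in> S ==> s \<in> {0..<T t} ==> AE x in lborel. u s x = U t s x"
 shows "C1_curve S (Lp_space 2) (Lp_norm 2) u"
proof -
 have "\<forall>t\<in>S. \<exists>w. C0_curve {0..<T t} (Lp_space 2) (Lp_norm 2) w \<and>
   (\<forall>r\<in>{0..<T t}. ((\<lambda>s. Lp_norm 2 (\<lambda>x. (U t s x - U t r x) / (s - r) - w r x)) \<longlongrightarrow> 0) (at r within {0..<T t}))"
  by (intro ballI) (rule loc[unfolded C1_curve_def, THEN conjunct2])
 from bchoice[OF this] obtain W where W: "!!t. t \<in> S ==> C0_curve {0..<T t} (Lp_space 2) (Lp_norm 2) (W t)"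
  "!!t r. t \<in> S ==> r \<in> {0..<T t} ==> ((\<lambda>s. Lp_norm 2 (\<lambda>x. (U t s x - U t r x) / (s - r) - W t r x)) \<longlongrightarrow> 0) (at r within {0..<T t})"
  by (elim exE) (rule that; drule (1) bspec, erule conjE, (assumption | erule (1) bspec))
 define w where "w = (\<lambda>t. W t t)"
 have tt: "t \<in> {0..<T t}" if t: "t \<in> S" for t
 proof -
  have "t \<in> S \<inter> {..<T t}" using t lt[OF t] by simp
  then show ?thesis unfolding int[OF t] .
 qed
 have UL: "U t s \<in> Lp_space 2" if "t \<in> S" "s \<in> {0..<T t}" for t s
  using bspec[OF conjunct1[OF loc[OF that(1), unfolded C1_curve_def]] that(2)] .
 have WL: "W t s \<in> Lp_space 2" if "t \<in> S" "s \<in> {0..<T t}" for t s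
  using bspec[OF W(1)[OF that(1), unfolded C0_curve_def] that(2)] by (rule conjunct1)
 have wae: "AE x in lborel. w s x = W t s x" if t: "t \<in> S" and s: "s \<in> {0..<T t}" for t s
 proof -
  have sS: "s \<in> S" using s unfolding int[OF t, symmetric] by simp
  note ss = tt[OF sS]
  show ?thesis unfolding w_def
  proof (rule L2_derivative_unique[of s "T s" "T t" "U s" _ _ "U t"])
   show "AE x in lborel. U s r x = U t r x" if "0 <= r" "r < T s" "r < T t" for r
   proof -
    have r: "r \<in> {0..<T s}" "r \<in> {0..<T t}" using that by auto
    show ?thesis using ae[OF sS r(1)] ae[OF t r(2)] by eventually_elim simp
   qed
   show "0 <= s" "s < T s" "s < T t" using ss s by simp_all
   show "U s r \<in> Lp_space 2" if "r \<in> {0..<T s}" for r by (rule UL[OF sS that])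
  qed (rule WL[OF sS ss] WL[OF t s] W(2)[OF sS ss] W(2)[OF t s])+
 qed
 have "C0_curve S (Lp_space 2) (Lp_norm 2) w"
  by (rule C0_curve_glue[where T=T and U=W, OF Lp_norm_cong_AE lt int W(1) _ wae]) (simp_all only: w_def)
 moreover have "((\<lambda>s. Lp_norm 2 (\<lambda>x. (u s x - u t x) / (s - t) - w t x)) \<longlongrightarrow> 0) (at t within S)" if t: "t \<in> S" for t
 proof (rule tendsto_within_local[OF _ _ W(2)[OF t tt[OF t]]])
  fix s assume "s \<in> {0..<T t}"
  from ae[OF t this] have "AE x in lborel. (U t s x - U t t x) / (s - t) - W t t x = (u s x - u t x) / (s - t) - w t x"
   unfolding ut[OF t] w_def by eventually_elim simp
  then show "Lp_norm 2 (\<lambda>x. (U t s x - U t t x) / (s - t) - W t t x) = Lp_norm 2 (\<lambda>x. (u s x - u t x) / (s - t) - w t x)"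
   by (rule Lp_norm_cong_AE)
 qed (rule int[OF t] lt[OF t])+
 moreover have "u t \<in> Lp_space 2" if "t \<in> S" for t using UL[OF that tt[OF that]] ut[OF that] by simp
 ultimately show ?thesis unfolding C1_curve_def by blast
qed

lemma C0_curve_subset: "C0_curve S X N u ==> S' \<subseteq> S ==> C0_curve S' X N u"
 unfolding C0_curve_def by (meson subsetD tendsto_within_subset)

lemma C1_curve_subset:
 assumes "C1_curve S X N u" "S' \<subseteq> S" shows "C1_curve S' X N u"
proof -
 obtain w where w: "C0_curve S X N w" "!!t. t \<in> S ==> ((\<lambda>s. N (\<lambda>x. (u s x - u t x) / (s - t) - w t x)) \<longlongrightarrow> 0) (at t within S)"
  using assms(1) unfolding C1_curve_def by blast
 have "((\<lambda>s. N (\<lambda>x. (u s x - u t x) / (s - t) - w t x)) \<longlongrightarrow> 0) (at t within S')" if "t \<in> S'" for t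
  by (rule tendsto_within_subset[OF w(2) assms(2)]) (use that assms(2) in blast)
 moreover have "\<forall>t\<in>S'. u t \<in> X" using assms unfolding C1_curve_def by blast
 ultimately show ?thesis unfolding C1_curve_def using C0_curve_subset[OF w(1) assms(2)] by blast
qed

lemma mild_restrict:
 assumes "Nakao_mild_solution p q u0 u1 v0 v1 T u v" "0 < T'" "T' <= T"
 shows "Nakao_mild_solution p q u0 u1 v0 v1 T' u v"
proof -
 have S: "{t. 0 <= t \<and> ereal t < T'} \<subseteq> {t. 0 <= t \<and> ereal t < T}" using assms(3) by auto
 show ?thesis
  using assms(1,2) C0_curve_subset[OF _ S] C1_curve_subset[OF _ S] S unfolding Nakao_mild_solution_def Let_def
  by (metis (no_types, lifting) subsetD)
qed

lemma duhamel_cong: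
 assumes "!!s. s \<in> {0..t} ==> AE y in lborel. v s y = v' s y"
 shows "damped_duhamel p v t x
   = damped_duhamel p v' t x"
  "wave_duhamel p v t x
   = wave_duhamel p v' t x"
proof -
 have "AE y in lborel. y \<in> I --> \<bar>v s y\<bar> powr p = \<bar>v' s y\<bar> powr p" if "s \<in> {0..t}" for s I
  using assms[OF that] by eventually_elim simp
 note c = propagators_cong[OF this]
 show "damped_duhamel p v t x
   = damped_duhamel p v' t x"
  by (rule set_lebesgue_integral_cong) (use c(1) in auto)
 show "wave_duhamel p v t x
   = wave_duhamel p v' t x"
  by (rule set_lebesgue_integral_cong) (use c(2) in auto)
qed

context profiles
begin

abbreviation "mild \<equiv> Nakao_mild_solution p q u0 u1 v0 v1"

text \<open>Both solutions are represented by bounded continuous solutions of the same integral equations on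
  \<open>[0, t]\<close>.\<close>

lemma mild_unique:
 assumes m: "mild T u v" "mild T' u' v'" and t: "0 <= t" "ereal t < T" "ereal t < T'"
 shows "AE x in lborel. u t x = u' t x" "AE x in lborel. v t x = v' t x"
proof -
 from mild_to_sol[OF m(1) t(1,2)] obtain U V M where 1: "sol p q t ul vl U V" "\<forall>s x. \<bar>U s x\<bar> <= M \<and> \<bar>V s x\<bar> <= M"
  "\<forall>s\<in>{0..t}. (AE x in lborel. u s x = U s x) \<and> (AE x in lborel. v s x = V s x)" by (elim exE conjE) (rule that)
 from mild_to_sol[OF m(2) t(1,3)] obtain U' V' M' where 2: "sol p q t ul vl U' V'" "\<forall>s x. \<bar>U' s x\<bar> <= M' \<and> \<bar>V' s x\<bar> <= M'"
  "\<forall>s\<in>{0..t}. (AE x in lborel. u' s x = U' s x) \<and> (AE x in lborel. v' s x = V' s x)" by (elim exE conjE) (rule that)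
 have tt: "t \<in> {0..t}" using t by simp
 have b: "\<bar>U s x\<bar> <= max M M'" "\<bar>V s x\<bar> <= max M M'" "\<bar>U' s x\<bar> <= max M M'" "\<bar>V' s x\<bar> <= max M M'" for s x
  using 1(2)[THEN spec, THEN spec, of s x] 2(2)[THEN spec, THEN spec, of s x] by auto
 have e: "U t x = U' t x" "V t x = V' t x" for x
  by (rule sol_unique_on[OF p q t(1) 1(1) 2(1) b, of "\<lambda>_. UNIV"]; use tt in simp)+
 show "AE x in lborel. u t x = u' t x"
  using bspec[OF 1(3) tt, THEN conjunct1] bspec[OF 2(3) tt, THEN conjunct1] by eventually_elim (simp add: e)
 show "AE x in lborel. v t x = v' t x"
  using bspec[OF 1(3) tt, THEN conjunct2] bspec[OF 2(3) tt, THEN conjunct2] by eventually_elim (simp add: e)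
qed

text \<open>At each time \<open>t\<close> take the value of some solution that exists beyond \<open>t\<close>.
  By uniqueness this agrees, up to null sets, with every solution on its interval of existence.\<close>

lemma mild_glue:
 assumes ne: "0 < Ts" and ex: "!!t. 0 <= t ==> ereal t < Ts ==> \<exists>T u v. ereal t < T \<and> T <= Ts \<and> mild T u v"
 shows "\<exists>u v. mild Ts u v"
proof -
 let ?S = "{t. 0 <= t \<and> ereal t < Ts}"
 have "\<forall>t\<in>?S. \<exists>T u v. t < T \<and> ereal T <= Ts \<and> mild (ereal T) u v"
 proof
  fix t assume t: "t \<in> ?S"
  then obtain T u v where T: "ereal t < T" "T <= Ts" "mild T u v" using ex by blast
  (* A real time between t and T: the pieces then live on half open real intervals. *)
  then obtain r where r: "ereal t < ereal r" "ereal r < T" using ereal_dense2 by blast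
  have "0 < r" using t r by auto
  then have "mild (ereal r) u v" using mild_restrict[OF T(3), of "ereal r"] r by (simp add: less_imp_le)
  then show "\<exists>T u v. t < T \<and> ereal T <= Ts \<and> mild (ereal T) u v"
   using r T(2) by (intro exI[of _ r] exI[of _ u] exI[of _ v]) auto
 qed
 then have "\<forall>t\<in>?S. \<exists>z. t < fst z \<and> ereal (fst z) <= Ts \<and> mild (ereal (fst z)) (fst (snd z)) (snd (snd z))" by force
 from bchoice[OF this] obtain Z where Z: "\<forall>t\<in>?S. t < fst (Z t) \<and> ereal (fst (Z t)) <= Ts \<and>
   mild (ereal (fst (Z t))) (fst (snd (Z t))) (snd (snd (Z t)))" ..
 define T where "T = (\<lambda>t. fst (Z t))"
 define U where "U = (\<lambda>t. fst (snd (Z t)))"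
 define V where "V = (\<lambda>t. snd (snd (Z t)))"
 have TUV: "t < T t" "ereal (T t) <= Ts" "mild (ereal (T t)) (U t) (V t)" if "t \<in> ?S" for t
  using Z that unfolding T_def U_def V_def by blast+
 define u where "u = (\<lambda>t. U t t)"
 define v where "v = (\<lambda>t. V t t)"
 have sS: "s \<in> ?S" if "t \<in> ?S" "s \<in> {0..<T t}" for t s
 proof -
  have "ereal s < ereal (T t)" using that by simp
  also have "\<dots> <= Ts" by (rule TUV(2)[OF that(1)])
  finally show ?thesis using that by simp
 qed
 have inter: "?S \<inter> {..<T t} = {0..<T t}" if "t \<in> ?S" for t using sS[OF that] by auto
 have ae: "AE x in lborel. u s x = U t s x" "AE x in lborel. v s x = V t s x" if t: "t \<in> ?S" and s: "s \<in> {0..<T t}" for t s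
 proof -
  have s': "0 <= s" "ereal s < ereal (T s)" "ereal s < ereal (T t)" using s TUV(1)[OF sS[OF t s]] by auto
  show "AE x in lborel. u s x = U t s x" "AE x in lborel. v s x = V t s x"
   unfolding u_def v_def by (rule mild_unique[OF TUV(3)[OF sS[OF t s]] TUV(3)[OF t] s'])+
 qed
 have Seq: "{s. 0 <= s \<and> ereal s < ereal r} = {0..<r}" for r by auto
 have c: "C0_curve {0..<T t} H1_space H1_norm (U t)" "C1_curve {0..<T t} (Lp_space 2) (Lp_norm 2) (U t)"
  "C0_curve {0..<T t} H1_space H1_norm (V t)" "C1_curve {0..<T t} (Lp_space 2) (Lp_norm 2) (V t)"
  "!!s. s \<in> {0..<T t} ==> AE x in lebesgue. U t s x = damped_wave_prop s u0 u1 x +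
       damped_duhamel p (V t) s x"
  "!!s. s \<in> {0..<T t} ==> AE x in lebesgue. V t s x = wave_prop s v0 v1 x +
       wave_duhamel q (U t) s x"
  if t: "t \<in> ?S" for t
  using TUV(3)[OF t] unfolding Nakao_mild_solution_def Let_def Seq by simp_all
 have 1: "C0_curve ?S H1_space H1_norm u" "C1_curve ?S (Lp_space 2) (Lp_norm 2) u"
  by (rule C0_curve_glue[where T=T and U=U, OF H1_norm_cong_AE TUV(1) inter c(1) _ ae(1)]
     C1_curve_glue[where T=T and U=U, OF TUV(1) inter c(2) _ ae(1)]; simp only: u_def)+
 have 2: "C0_curve ?S H1_space H1_norm v" "C1_curve ?S (Lp_space 2) (Lp_norm 2) v"
  by (rule C0_curve_glue[where T=T and U=V, OF H1_norm_cong_AE TUV(1) inter c(3) _ ae(2)]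
     C1_curve_glue[where T=T and U=V, OF TUV(1) inter c(4) _ ae(2)]; simp only: v_def)+
 have eu: "AE x in lebesgue. u t x = damped_wave_prop t u0 u1 x +
       damped_duhamel p v t x" if t: "t \<in> ?S" for t
 proof -
  have "AE y in lborel. v s y = V t s y" if "s \<in> {0..t}" for s using ae(2)[OF t, of s] that TUV(1)[OF t] by auto
  note vae = this
  have "t \<in> {0..<T t}" using TUV(1)[OF t] t by auto
  from c(5)[OF t this] show ?thesis
  proof eventually_elim
   case (elim x)
   have "damped_duhamel p v t x
    = damped_duhamel p (V t) t x"
    by (rule duhamel_cong(1)[OF vae])
   with elim show ?case by (simp add: u_def)
  qed
 qed
 have ev: "AE x in lebesgue. v t x = wave_prop t v0 v1 x +
       wave_duhamel q u t x" if t: "t \<in> ?S" for t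
 proof -
  have "AE y in lborel. u s y = U t s y" if "s \<in> {0..t}" for s using ae(1)[OF t, of s] that TUV(1)[OF t] by auto
  note uae = this
  have "t \<in> {0..<T t}" using TUV(1)[OF t] t by auto
  from c(6)[OF t this] show ?thesis
  proof eventually_elim
   case (elim x)
   have "wave_duhamel q u t x
    = wave_duhamel q (U t) t x"
    by (rule duhamel_cong(2)[OF uae])
   with elim show ?case by (simp add: v_def)
  qed
 qed
 have "mild Ts u v" unfolding Nakao_mild_solution_def Let_def
  by (intro conjI ballI ne 1 2 eu ev)
 then show ?thesis by (intro exI)
qed

text \<open>The glued solution on the supremum of the existence times cannot be extended, and it extends every
  other solution, so it is maximal and no other existence time belongs to a maximal solution.\<close>

lemma lifespan_eq_Sup:
 assumes ex: "\<exists>T u v. mild T u v"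
 shows "Nakao_lifespan p q u0 u1 v0 v1 = Sup {T. \<exists>u v. mild T u v}"
proof -
 let ?A = "{T. \<exists>u v. mild T u v}"
 define Ts where "Ts = Sup ?A"
 have pos: "0 < T" if "mild T u v" for T u v using that by (simp add: Nakao_mild_solution_def)
 have le: "T <= Ts" if "mild T u v" for T u v
  unfolding Ts_def by (rule Sup_upper) (use that in blast)
 have Ts0: "0 < Ts" using ex pos le less_le_trans by blast
 have "\<exists>u v. mild Ts u v"
 proof (rule mild_glue[OF Ts0])
  fix t assume "0 <= t" "ereal t < Ts"
  then obtain T where "T \<in> ?A" "ereal t < T" unfolding Ts_def less_Sup_iff by blast
  then show "\<exists>T u v. ereal t < T \<and> T <= Ts \<and> mild T u v" using le by blast
 qed
 then obtain us vs where s: "mild Ts us vs" by blast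
 have max: "Nakao_maximal_solution p q u0 u1 v0 v1 Ts us vs"
  unfolding Nakao_maximal_solution_def
 proof (intro conjI s notI)
  assume "\<exists>T' u' v'. Ts < T' \<and> mild T' u' v' \<and> (\<forall>t. 0 <= t \<and> ereal t < Ts --> (AE x in lebesgue. u' t x = us t x \<and> v' t x = vs t x))"
  then obtain T' u' v' where "Ts < T'" "mild T' u' v'" by (elim exE conjE)
  then show False using le[of T' u' v'] by simp
 qed
 have uniq: "T = Ts" if H: "Nakao_maximal_solution p q u0 u1 v0 v1 T u v" for T u v
 proof (rule ccontr)
  assume "T \<noteq> Ts"
  have m: "mild T u v" using H by (simp add: Nakao_maximal_solution_def)
  then have lt: "T < Ts" using le \<open>T \<noteq> Ts\<close> by (simp add: less_le)
  have "AE x in lebesgue. us t x = u t x \<and> vs t x = v t x" if t: "0 <= t" "ereal t < T" for t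
  proof (rule AE_completion)
   have "ereal t < Ts" using t lt by (rule_tac less_trans)
   from mild_unique[OF s m t(1) this t(2)] show "AE x in lborel. us t x = u t x \<and> vs t x = v t x"
    by eventually_elim simp
  qed
  then have "\<forall>t. 0 <= t \<and> ereal t < T --> (AE x in lebesgue. us t x = u t x \<and> vs t x = v t x)" by iprover
  then have "\<exists>T' u' v'. T < T' \<and> mild T' u' v' \<and> (\<forall>t. 0 <= t \<and> ereal t < T --> (AE x in lebesgue. u' t x = u t x \<and> v' t x = v t x))"
   using lt s by iprover
  with H show False unfolding Nakao_maximal_solution_def by iprover
 qed
 show ?thesis unfolding Nakao_lifespan_def Ts_def[symmetric]
 proof (rule the_equality)
  show "\<exists>u v. Nakao_maximal_solution p q u0 u1 v0 v1 Ts u v" by (intro exI) (rule max)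
  show "T = Ts" if "\<exists>u v. Nakao_maximal_solution p q u0 u1 v0 v1 T u v" for T using that uniq by (elim exE)
 qed
qed

end

section \<open>The scaling of the lifespan\<close>

lemma free_data_scale:
 assumes "free_data R f f' g" shows "free_data R (\<lambda>x. e * f x) (\<lambda>x. e * f' x) (\<lambda>x. e * g x)"
proof -
 have wp: "weak_pair f f'" using assms by (simp add: free_data_def)
 have "weak_pair (\<lambda>x. e * f x) (\<lambda>x. e * f' x)"
  unfolding weak_pair_def
 proof (intro conjI allI impI)
  show "sq_int (\<lambda>x. e * f x)" "sq_int (\<lambda>x. e * f' x)" using wp by (auto simp: weak_pair_def intro: sq_int_cmult)
  show "continuous_on UNIV (\<lambda>x. e * f x)" using wp by (auto simp: weak_pair_def intro: continuous_on_mult_left)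
  fix a b :: real assume "a <= b"
  then have "f b - f a = (LINT y:{a..b}|lborel. f' y)" using wp unfolding weak_pair_def by blast
  then show "e * f b - e * f a = (LINT y:{a..b}|lborel. e * f' y)" by (simp add: right_diff_distrib[symmetric])
 qed
 then show ?thesis using assms by (auto simp: free_data_def supported_def intro: sq_int_cmult)
qed

lemma profiles_scale:
 assumes "profiles p q R u0 u1 v0 v1 f f' g h h' k"
 shows "profiles p q R (\<lambda>x. e * u0 x) (\<lambda>x. e * u1 x) (\<lambda>x. e * v0 x) (\<lambda>x. e * v1 x)
  (\<lambda>x. e * f x) (\<lambda>x. e * f' x) (\<lambda>x. e * g x) (\<lambda>x. e * h x) (\<lambda>x. e * h' x) (\<lambda>x. e * k x)"
proof -
 interpret profiles p q R u0 u1 v0 v1 f f' g h h' k by (rule assms)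
 have sc: "AE x in lborel. e * a x = e * b x" if "AE x in lborel. a x = b x" for a b :: "real => real"
  using that by eventually_elim simp
 show ?thesis by (unfold_locales; intro p q R free_data_scale fd hd sc aef aeg aeh aek)
qed

text \<open>For \<open>q < 3\<close> the choice \<open>a = (3 - q) / 2\<close> turns the second inequality into
  the condition on \<open>p\<close> that defines the region. For \<open>q \<ge> 3\<close> the first inequality
  holds for all positive \<open>a\<close>, and \<open>a\<close> is taken as large as the second one
  permits.\<close>

lemma Omega_exponent:
 assumes "(p, q) \<in> Omega_Nakao_1"
 shows "\<exists>a>0. - (q - 1) / 2 <= a - 1 \<and> a * ((p * q - 1) / (q + 2)) <= q - 1"
proof -
 have p: "p > 1" and q: "q > 1" using assms by (auto simp: Omega_Nakao_1_def)
 have pq: "p * q - 1 > 0" using p q less_1_mult[of p q] by simp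
 show ?thesis
 proof (cases "3 <= q")
  case True
  let ?a = "(q - 1) / ((p * q - 1) / (q + 2))"
  have "?a > 0" using pq q by simp
  moreover have "?a * ((p * q - 1) / (q + 2)) <= q - 1" using pq q by simp
  moreover have "- (q - 1) / 2 <= - 1" using True by simp
  then have "- (q - 1) / 2 <= ?a - 1" using \<open>?a > 0\<close> by linarith
  ultimately show ?thesis by blast
 next
  case False
  then have "p <= (2 * q\<^sup>2 + q - 1) / (q * (3 - q))" using assms by (auto simp: Omega_Nakao_1_def)
  moreover have "q * (3 - q) > 0" using q False by simp
  ultimately have le: "p * (q * (3 - q)) <= 2 * q\<^sup>2 + q - 1" by (simp add: pos_le_divide_eq)
  have "(3 - q) * (p * q - 1) <= (q - 1) * (2 * (q + 2))"
   using le by (simp add: algebra_simps power2_eq_square)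
  then have "(3 - q) / 2 * ((p * q - 1) / (q + 2)) <= q - 1"
   using q by (simp only: times_divide_times_eq) (simp add: pos_divide_le_eq)
  moreover have "- (q - 1) / 2 <= (3 - q) / 2 - 1" by (simp add: field_simps)
  ultimately show ?thesis using False by (intro exI[of _ "(3 - q) / 2"]) auto
 qed
qed

text \<open>With \<open>T = c \<epsilon> powr (- \<kappa>)\<close> every term of the invariance condition is at
  most a multiple of \<open>\<epsilon>\<close>. The constant \<open>K\<close> absorbs the free terms with one unit
  to spare, and \<open>c\<close> is chosen after \<open>K\<close> to make the last term at most
  \<open>\<epsilon>\<close>.\<close>

lemma existence_constants:
 fixes p q A a :: real
 assumes p: "p > 1" and q: "q > 1" and A: "A > 0" and a: "a > 0" "a * \<kappa> <= q - 1" and \<kappa>: "\<kappa> = (p * q - 1) / (q + 2)"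
 shows "\<exists>c K. 0 < c \<and> 0 < K \<and> (\<forall>\<epsilon>. 0 < \<epsilon> --> \<epsilon> <= 1 -->
  \<epsilon> * A + 2 powr q * ((\<epsilon> * A) powr q * ((1 + c * \<epsilon> powr (- \<kappa>)) powr a / a)
   + (c * \<epsilon> powr (- \<kappa>))\<^sup>2 * (c * \<epsilon> powr (- \<kappa>) * (K * \<epsilon>) powr p) powr q) <= K * \<epsilon>)"
proof -
 (* The contribution of the free part, as a multiple of the size of the data. *)
 define G where "G = 2 powr q * (A powr q * 2 powr a / a)"
 define K where "K = A + G + 1"
 have G: "G \<ge> 0" using a by (simp add: G_def)
 then have K: "K > 0" using A by (simp add: K_def)
 (* The largest value of c powr (q + 2) for which the Duhamel part stays below one unit. *)
 define X where "X = 1 / (2 powr q * K powr (p * q))"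
 have X: "X > 0" using K by (simp add: X_def)
 define c where "c = min 1 (X powr (1 / (q + 2)))"
 have c: "c > 0" "c <= 1" using X by (auto simp: c_def)
 have pq: "p * q > 1" using p q by (rule less_1_mult)
 have k0: "\<kappa> > 0" unfolding \<kappa> using pq q by simp
 have cq: "c powr (q + 2) <= X"
 proof -
  have "c powr (q + 2) <= (X powr (1 / (q + 2))) powr (q + 2)" using c q by (intro powr_mono2) (auto simp: c_def)
  also have "\<dots> = X" using X q by (simp add: powr_powr)
  finally show ?thesis .
 qed
 have main: "\<epsilon> * A + 2 powr q * ((\<epsilon> * A) powr q * ((1 + c * \<epsilon> powr (- \<kappa>)) powr a / a)
   + (c * \<epsilon> powr (- \<kappa>))\<^sup>2 * (c * \<epsilon> powr (- \<kappa>) * (K * \<epsilon>) powr p) powr q) <= K * \<epsilon>"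
  if e: "0 < \<epsilon>" "\<epsilon> <= 1" for \<epsilon> :: real
 proof -
  let ?P = "\<epsilon> powr (- \<kappa>)"
  have "\<epsilon> powr 0 <= ?P" using e k0 by (intro powr_mono') auto
  then have P: "1 <= ?P" using e by simp
  have "c * ?P <= 1 * ?P" using c by (intro mult_right_mono) auto
  then have "1 + c * ?P <= 2 * ?P" using P by linarith
  then have "(1 + c * ?P) powr a <= (2 * ?P) powr a" using c a P by (intro powr_mono2) (auto intro: add_nonneg_nonneg)
  also have "\<dots> = 2 powr a * \<epsilon> powr (- \<kappa> * a)" by (simp add: powr_mult powr_powr)
  finally have 1: "(1 + c * ?P) powr a <= 2 powr a * \<epsilon> powr (- \<kappa> * a)" .
  have ee: "\<epsilon> powr q * \<epsilon> powr (- \<kappa> * a) <= \<epsilon>"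
  proof -
   have "\<epsilon> powr q * \<epsilon> powr (- \<kappa> * a) = \<epsilon> powr (q + - \<kappa> * a)" by (simp only: powr_add)
   also have "\<dots> <= \<epsilon> powr 1" using e a(2) by (intro powr_mono') (auto simp: mult.commute)
   finally show ?thesis using e by simp
  qed
  have "(\<epsilon> * A) powr q * ((1 + c * ?P) powr a / a) <= (\<epsilon> * A) powr q * ((2 powr a * \<epsilon> powr (- \<kappa> * a)) / a)"
   using 1 a by (intro mult_left_mono divide_right_mono) auto
  also have "\<dots> = (A powr q * 2 powr a / a) * (\<epsilon> powr q * \<epsilon> powr (- \<kappa> * a))" by (simp add: powr_mult)
  also have "\<dots> <= (A powr q * 2 powr a / a) * \<epsilon>" using a by (intro mult_left_mono ee) auto
  finally have "2 powr q * ((\<epsilon> * A) powr q * ((1 + c * ?P) powr a / a)) <= 2 powr q * ((A powr q * 2 powr a / a) * \<epsilon>)"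
   by (intro mult_left_mono) auto
  then have I: "2 powr q * ((\<epsilon> * A) powr q * ((1 + c * ?P) powr a / a)) <= G * \<epsilon>" unfolding G_def by (simp only: mult.assoc)
  have cP: "c * ?P > 0" using c e by simp
  have "(c * ?P)\<^sup>2 * (c * ?P * (K * \<epsilon>) powr p) powr q = (c * ?P) powr 2 * (c * ?P) powr q * (K * \<epsilon>) powr (p * q)"
  proof -
   have "(c * ?P)\<^sup>2 = (c * ?P) powr 2" using powr_numeral[of "c * ?P" "Num.Bit0 Num.One"] cP by (simp only:)
   moreover have "(c * ?P * (K * \<epsilon>) powr p) powr q = (c * ?P) powr q * (K * \<epsilon>) powr (p * q)"
    by (simp only: powr_mult[of "c * ?P" "(K * \<epsilon>) powr p"] powr_powr)
   ultimately show ?thesis by (simp only: mult.assoc)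
  qed
  also have "(c * ?P) powr 2 * (c * ?P) powr q = (c * ?P) powr (q + 2)"
   by (simp only: powr_add[symmetric] add.commute)
  also have "(c * ?P) powr (q + 2) = c powr (q + 2) * \<epsilon> powr (- (p * q - 1))"
  proof -
   have "?P powr (q + 2) = \<epsilon> powr (- \<kappa> * (q + 2))" by (simp add: powr_powr)
   also have "- \<kappa> * (q + 2) = - (p * q - 1)" using q by (simp add: \<kappa>)
   finally show ?thesis by (simp only: powr_mult)
  qed
  also have "c powr (q + 2) * \<epsilon> powr (- (p * q - 1)) * (K * \<epsilon>) powr (p * q)
   = c powr (q + 2) * K powr (p * q) * (\<epsilon> powr (- (p * q - 1)) * \<epsilon> powr (p * q))" by (simp only: powr_mult mult_ac)
  also have "\<epsilon> powr (- (p * q - 1)) * \<epsilon> powr (p * q) = \<epsilon>" unfolding powr_add[symmetric] using e by simp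
  also have "c powr (q + 2) * K powr (p * q) * \<epsilon> <= X * K powr (p * q) * \<epsilon>"
   using cq e by (intro mult_right_mono) auto
  finally have "2 powr q * ((c * ?P)\<^sup>2 * (c * ?P * (K * \<epsilon>) powr p) powr q) <= 2 powr q * (X * K powr (p * q) * \<epsilon>)"
   by (intro mult_left_mono) auto
  also have "\<dots> = \<epsilon>" using K by (simp add: X_def)
  finally have II: "2 powr q * ((c * ?P)\<^sup>2 * (c * ?P * (K * \<epsilon>) powr p) powr q) <= \<epsilon>" .
  have "K * \<epsilon> = \<epsilon> * A + G * \<epsilon> + \<epsilon>" by (simp add: K_def algebra_simps)
  then show ?thesis using I II unfolding distrib_left by linarith
 qed
 show ?thesis
  by (rule exI[of _ c], rule exI[of _ K], intro conjI allI impI) (assumption | rule c(1) K main)+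
qed

context profiles
begin

abbreviation scaled_mild :: "real => ereal => (real => real => real) => (real => real => real) => bool" where
 "scaled_mild \<epsilon> \<equiv> Nakao_mild_solution p q (\<lambda>x. \<epsilon> * u0 x) (\<lambda>x. \<epsilon> * u1 x) (\<lambda>x. \<epsilon> * v0 x) (\<lambda>x. \<epsilon> * v1 x)"

lemma lifespan_lower_bound:
 assumes Om: "(p, q) \<in> Omega_Nakao_1"
 shows "\<exists>c>0. \<forall>\<epsilon>. 0 < \<epsilon> --> \<epsilon> <= 1 --> (\<exists>U V. scaled_mild \<epsilon> (ereal (c * \<epsilon> powr (- ((p * q - 1) / (q + 2))))) U V)"
proof -
 obtain a where a: "a > 0" "- (q - 1) / 2 <= a - 1" "a * ((p * q - 1) / (q + 2)) <= q - 1"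
  using Omega_exponent[OF Om] by blast
 have bdd: "\<exists>b\<ge>0. \<forall>x. \<bar>e x\<bar> <= b" if e: "continuous_on UNIV e" "supported R e" for e :: "real => real"
 proof -
  obtain b where b: "b \<ge> 0" "\<forall>x\<in>{-R..R}. \<bar>e x\<bar> <= b"
   using continuous_compact_bounded[of "{-R..R}" e] continuous_on_subset[OF e(1)] by auto
  have "\<bar>e x\<bar> <= b" for x
  proof (cases "x \<in> {-R..R}")
   case False
   then have "e x = 0" using e(2) by (auto simp: supported_def)
   then show ?thesis using b(1) by simp
  qed (use b(2) in blast)
  then show ?thesis using b(1) by blast
 qed
 obtain bf where bf: "bf \<ge> 0" "!!x. \<bar>f x\<bar> <= bf" using bdd[OF free_dataD(3,6)[OF fd]] by blast
 obtain bh where bh: "bh \<ge> 0" "!!x. \<bar>h x\<bar> <= bh" using bdd[OF free_dataD(3,6)[OF hd]] by blast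
 define If where "If = (LINT x|lborel. \<bar>f x\<bar>)"
 define Ig where "Ig = (LINT x|lborel. \<bar>g x\<bar>)"
 define Ik where "Ik = (LINT x|lborel. \<bar>k x\<bar>)"
 have I0: "If \<ge> 0" "Ig \<ge> 0" "Ik \<ge> 0" by (simp_all add: If_def Ig_def Ik_def)
 define A where "A = bf + If + Ig + bh + Ik + 1"
 have A: "A > 0" "bf + If + Ig <= A" "If + Ig <= A" "bh + Ik <= A" using I0 bf bh by (auto simp: A_def)
 from existence_constants[OF p q A(1) a(1,3) refl]
 obtain c K where cK': "c > 0" "K > 0" "\<forall>\<epsilon>. 0 < \<epsilon> --> \<epsilon> <= 1 -->
  \<epsilon> * A + 2 powr q * ((\<epsilon> * A) powr q * ((1 + c * \<epsilon> powr (- ((p * q - 1) / (q + 2)))) powr a / a)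
   + (c * \<epsilon> powr (- ((p * q - 1) / (q + 2))))\<^sup>2 * (c * \<epsilon> powr (- ((p * q - 1) / (q + 2))) * (K * \<epsilon>) powr p) powr q) <= K * \<epsilon>"
  by (elim exE conjE) (rule that)
 note cK = cK'(1,2) cK'(3)[rule_format]
 have main: "\<exists>U V. scaled_mild \<epsilon>
   (ereal (c * \<epsilon> powr (- ((p * q - 1) / (q + 2))))) U V" if e: "0 < \<epsilon>" "\<epsilon> <= 1" for \<epsilon>
 proof (rule profiles.existence_time[OF profiles_scale[OF profiles_axioms], where E="\<epsilon> * A" and B="K * \<epsilon>" and a=a])
  have Ie: "(LINT x|lborel. \<bar>\<epsilon> * f x\<bar>) = \<epsilon> * If" "(LINT x|lborel. \<bar>\<epsilon> * g x\<bar>) = \<epsilon> * Ig" "(LINT x|lborel. \<bar>\<epsilon> * k x\<bar>) = \<epsilon> * Ik"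
   using e by (simp_all add: abs_mult If_def Ig_def Ik_def)
  have i: "integrable lborel (\<lambda>x. \<epsilon> * f x)" "integrable lborel (\<lambda>x. \<epsilon> * g x)"
   "integrable lborel (\<lambda>x. \<epsilon> * h x)" "integrable lborel (\<lambda>x. \<epsilon> * k x)"
   using free_dataD(1,2)[OF fd] free_dataD(1,2)[OF hd] by auto
  have b: "\<bar>\<epsilon> * f x\<bar> <= \<epsilon> * bf" "\<bar>\<epsilon> * h x\<bar> <= \<epsilon> * bh" for x
   using e bf(2)[of x] bh(2)[of x] by (simp_all add: abs_mult)
  have sA: "\<epsilon> * bf + \<epsilon> * If + \<epsilon> * Ig <= \<epsilon> * A" "\<epsilon> * If + \<epsilon> * Ig <= \<epsilon> * A" "\<epsilon> * bh + \<epsilon> * Ik <= \<epsilon> * A"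
   unfolding distrib_left[symmetric] using A e by simp_all
  note ld = linear_decay[OF i(1) b(1) i(2)] and lw = linear_decay(3)[OF i(3) b(2) i(4)]
  show "0 < \<epsilon> * A" using A e by simp
  show "\<bar>damped_free (\<lambda>x. \<epsilon> * f x) (\<lambda>x. \<epsilon> * g x) t x\<bar> <= \<epsilon> * A / sqrt (1 + t)" if "0 <= t" for t x
   using ld(1)[OF that, of x] unfolding Ie
   by (rule order_trans) (use that sA(1) in \<open>intro divide_right_mono, auto\<close>)
  show "(LINT x|lborel. \<bar>damped_free (\<lambda>x. \<epsilon> * f x) (\<lambda>x. \<epsilon> * g x) t x\<bar>) <= \<epsilon> * A" if "0 <= t" for t
   using ld(2)[OF that] unfolding Ie using sA(2) by (rule order_trans)
  show "\<bar>wave_free (\<lambda>x. \<epsilon> * h x) (\<lambda>x. \<epsilon> * k x) t x\<bar> <= \<epsilon> * A" if "0 <= t" for t x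
   using lw[OF that, of x] unfolding Ie using sA(3) by (rule order_trans)
  show "0 < c * \<epsilon> powr (- ((p * q - 1) / (q + 2)))" using cK e by simp
  show "0 <= K * \<epsilon>" using cK e by simp
 qed (rule a cK(3)[OF e])+
 show ?thesis by (rule exI[of _ c], intro conjI allI impI) (assumption | rule cK(1) main)+
qed

lemma lifespan_upper_scaling:
 assumes fg: "0 < (LINT x|lborel. f x) + (LINT x|lborel. g x)" and k: "0 < (LINT x|lborel. k x)"
 shows "\<exists>C>0. \<forall>\<epsilon> T u v. 0 < \<epsilon> --> \<epsilon> <= 1 --> scaled_mild \<epsilon> T u v --> T <= ereal (C * \<epsilon> powr (- ((p * q - 1) / (q + 2))))"
proof -
 define \<kappa> where "\<kappa> = (p * q - 1) / (q + 2)"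
 have pq: "p * q > 1" using p q by (rule less_1_mult)
 have k0: "\<kappa> > 0" unfolding \<kappa>_def using pq q by simp
 define I0 where "I0 = (LINT x|lborel. f x)"
 define I1 where "I1 = (LINT x|lborel. g x)"
 define J0 where "J0 = (LINT x|lborel. h x)"
 define J1 where "J1 = (LINT x|lborel. k x)"
 have J1: "J1 > 0" and I: "I0 + I1 > 0" using fg k by (simp_all add: I0_def I1_def J1_def)
 define \<Gamma> where "\<Gamma> = 2 powr ((2 * q + 2) / (p * q - 1)) * 4 powr (2 * q + 2)"
 define b where "b = blowup_const p q * (J1 / 2) powr (p * q - 1)"
 have b: "b > 0" using J1 by (simp add: b_def blowup_const_def)
 have G: "\<Gamma> > 0" by (simp add: \<Gamma>_def)
 (* Beyond the first four entries the data integrals have the right sign and size;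
  the last entry is where the iteration starts to diverge. *)
 define C where "C = Max {1, R, \<bar>I1\<bar> / (I0 + I1), 2 * \<bar>J0\<bar> / J1, (\<Gamma> / b) powr (1 / (q + 2))}"
 have C: "1 <= C" "R <= C" "\<bar>I1\<bar> / (I0 + I1) <= C" "2 * \<bar>J0\<bar> / J1 <= C" "(\<Gamma> / b) powr (1 / (q + 2)) <= C"
  unfolding C_def by (rule Max_ge; simp)+
 have main: "T <= ereal ((4 * C) * \<epsilon> powr (- \<kappa>))"
  if e: "0 < \<epsilon>" "\<epsilon> <= 1" and m: "scaled_mild \<epsilon> T u v" for \<epsilon> T u v
 proof (rule ccontr)
  define \<tau> where "\<tau> = C * \<epsilon> powr (- \<kappa>)"
  assume "\<not> T <= ereal ((4 * C) * \<epsilon> powr (- \<kappa>))"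
  then have lt: "ereal (4 * \<tau>) < T" by (simp add: \<tau>_def mult.assoc)
  have "\<epsilon> powr 0 <= \<epsilon> powr (- \<kappa>)" using e k0 by (intro powr_mono') auto
  then have P: "1 <= \<epsilon> powr (- \<kappa>)" using e by simp
  have "C * 1 <= \<tau>" unfolding \<tau>_def using P C by (intro mult_left_mono) auto
  then have \<tau>: "C <= \<tau>" by simp
  have "blowup_const p q * \<tau> powr (q + 2) * (\<epsilon> * J1 / 2) powr (p * q - 1) < \<Gamma>"
   unfolding \<Gamma>_def
  proof (rule profiles.lifespan_upper_bound[OF profiles_scale[OF profiles_axioms] m _ _ lt])
   fix t assume t: "\<tau> <= t"
   have t1: "\<bar>I1\<bar> / (I0 + I1) <= t" "2 * \<bar>J0\<bar> / J1 <= t" "0 <= t" using t \<tau> C by linarith+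
   have "\<bar>I1\<bar> * exp (- t) <= I0 + I1"
   proof -
    have "\<bar>I1\<bar> <= t * (I0 + I1)" using t1(1) I by (simp add: pos_divide_le_eq)
    also have "\<dots> <= exp t * (I0 + I1)"
    proof (rule mult_right_mono)
     show "t <= exp t" using exp_ge_add_one_self[of t] by linarith
    qed (use I in simp)
    finally show ?thesis by (simp add: exp_minus field_simps)
   qed
   moreover have "I1 * exp (- t) <= \<bar>I1\<bar> * exp (- t)" by (intro mult_right_mono) auto
   ultimately have "I1 * exp (- t) <= I0 + I1" by (rule order_trans[rotated])
   then have "0 <= I0 + (1 - exp (- t)) * I1" by (simp add: algebra_simps)
   then have "0 <= \<epsilon> * (I0 + (1 - exp (- t)) * I1)" using e by simp
   then show "0 <= (LINT x|lborel. \<epsilon> * f x) + (1 - exp (- t)) * (LINT x|lborel. \<epsilon> * g x)"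
    by (simp add: I0_def I1_def algebra_simps)
   have "2 * \<bar>J0\<bar> <= t * J1" using t1(2) J1 by (simp add: pos_divide_le_eq)
   then have "J1 / 2 * t <= J0 + t * J1" by (simp add: mult.commute abs_if split: if_splits)
   then have "\<epsilon> * (J1 / 2 * t) <= \<epsilon> * (J0 + t * J1)" using e by (intro mult_left_mono) auto
   then show "\<epsilon> * J1 / 2 * t <= (LINT x|lborel. \<epsilon> * h x) + t * (LINT x|lborel. \<epsilon> * k x)"
    by (simp add: J0_def J1_def algebra_simps)
  qed (use \<tau> C e J1 in auto)
  moreover have "blowup_const p q * \<tau> powr (q + 2) * (\<epsilon> * J1 / 2) powr (p * q - 1) = b * C powr (q + 2)"
  proof -
   have "\<tau> powr (q + 2) = C powr (q + 2) * \<epsilon> powr (- (p * q - 1))"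
   proof -
    have "(\<epsilon> powr (- \<kappa>)) powr (q + 2) = \<epsilon> powr (- \<kappa> * (q + 2))" by (simp add: powr_powr)
    also have "- \<kappa> * (q + 2) = - (p * q - 1)" using q by (simp add: \<kappa>_def)
    finally show ?thesis unfolding \<tau>_def by (simp only: powr_mult)
   qed
   moreover have "(\<epsilon> * J1 / 2) powr (p * q - 1) = \<epsilon> powr (p * q - 1) * (J1 / 2) powr (p * q - 1)"
    unfolding times_divide_eq_right[symmetric] by (rule powr_mult)
   moreover have "\<epsilon> powr (- (p * q - 1)) * \<epsilon> powr (p * q - 1) = 1" unfolding powr_add[symmetric] using e by simp
   ultimately show ?thesis by (simp add: b_def mult_ac)
  qed
  moreover have "\<Gamma> <= b * C powr (q + 2)"
  proof -
   have "\<Gamma> / b = ((\<Gamma> / b) powr (1 / (q + 2))) powr (q + 2)" using G b q by (simp add: powr_powr)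
   also have "\<dots> <= C powr (q + 2)" using C(5) q by (intro powr_mono2) auto
   finally show ?thesis using b by (simp add: pos_divide_le_eq mult.commute)
  qed
  ultimately show False by simp
 qed
 have C4: "0 < 4 * C" using C(1) by simp
 show ?thesis unfolding \<kappa>_def[symmetric]
  by (rule exI[of _ "4 * C"], intro conjI allI impI) (assumption | rule C4 main)+
qed

end

theorem corollary2p2:
  fixes p q R :: real and u0 u1 v0 v1 :: "real \<Rightarrow> real"
  assumes "1 < p" and "1 < q"
    and "u0 \<in> H1_space \<inter> Lp_space 1"
    and "u1 \<in> Lp_space 2 \<inter> Lp_space 1 \<inter> Lp_space q"
    and "v0 \<in> H1_space"
    and "v1 \<in> Lp_space 2 \<inter> Lp_space 1"
    and "0 < R"
    and "ess_supp u0 \<union> ess_supp u1 \<union> ess_supp v0 \<union> ess_supp v1 \<subseteq> {-R..R}"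
    and "(\<integral>x. u0 x + u1 x \<partial>lebesgue) > 0"
    and "(\<integral>x. v1 x \<partial>lebesgue) > 0"
    and "(p, q) \<in> Omega_Nakao_1"
  shows "\<exists>\<epsilon>0 c C. 0 < \<epsilon>0 \<and> 0 < c \<and> c \<le> C \<and>
    (\<forall>\<epsilon>\<in>{0<..\<epsilon>0}.
       (let T = Nakao_lifespan p q (\<lambda>x. \<epsilon> * u0 x) (\<lambda>x. \<epsilon> * u1 x)
                                   (\<lambda>x. \<epsilon> * v0 x) (\<lambda>x. \<epsilon> * v1 x)
        in ereal (c * \<epsilon> powr (- (p * q - 1) / (q + 2))) \<le> T \<and>
           T \<le> ereal (C * \<epsilon> powr (- (p * q - 1) / (q + 2)))))"
proof -
 have su: "ess_supp u0 \<union> ess_supp u1 \<subseteq> {-R..R}" "ess_supp v0 \<union> ess_supp v1 \<subseteq> {-R..R}" using assms(8) by auto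
 have sp: "u0 \<in> H1_space" "u1 \<in> Lp_space 2" "v1 \<in> Lp_space 2" using assms(3,4,6) by auto
 note ex = free_data_exists[OF sp(1,2) su(1)] free_data_exists[OF assms(5) sp(3) su(2)]
 from ex(1) obtain f f' g where F: "free_data R f f' g" "AE x in lborel. u0 x = f x" "AE x in lborel. u1 x = g x"
  by (elim exE conjE) (rule that)
 from ex(2) obtain h h' k where H: "free_data R h h' k" "AE x in lborel. v0 x = h x" "AE x in lborel. v1 x = k x"
  by (elim exE conjE) (rule that)
 interpret profiles p q R u0 u1 v0 v1 f f' g h h' k
  by (unfold_locales; intro assms(1,2,7) F H)
 note fi = free_dataD(1,2)[OF F(1)] and hi = free_dataD(2)[OF H(1)]
 have "(\<integral>x. u0 x + u1 x \<partial>lebesgue) = (\<integral>x. f x + g x \<partial>lebesgue)"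
  by (rule lebesgue_integral_cong_AE(1)) (use F(2,3) in \<open>eventually_elim, simp\<close>)
 also have "\<dots> = (LINT x|lborel. f x + g x)" using fi by (intro lebesgue_eq_lborel(1)) auto
 also have "\<dots> = (LINT x|lborel. f x) + (LINT x|lborel. g x)" using fi by simp
 finally have fg: "0 < (LINT x|lborel. f x) + (LINT x|lborel. g x)" using assms(9) by simp
 have "(\<integral>x. v1 x \<partial>lebesgue) = (\<integral>x. k x \<partial>lebesgue)" by (rule lebesgue_integral_cong_AE(1)[OF H(3)])
 also have "\<dots> = (LINT x|lborel. k x)" using hi by (intro lebesgue_eq_lborel(1)) auto
 finally have kp: "0 < (LINT x|lborel. k x)" using assms(10) by simp
 define P where "P = (\<lambda>\<epsilon>::real. \<epsilon> powr (- (p * q - 1) / (q + 2)))"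
 have P: "\<epsilon> powr (- ((p * q - 1) / (q + 2))) = P \<epsilon>" for \<epsilon> unfolding P_def by (simp only: minus_divide_left)
 have P0: "P \<epsilon> \<ge> 0" for \<epsilon> by (simp add: P_def)
 from lifespan_lower_bound[OF assms(11), unfolded P]
 obtain c where c': "c > 0" "\<forall>\<epsilon>. 0 < \<epsilon> --> \<epsilon> <= 1 --> (\<exists>U V. scaled_mild \<epsilon> (ereal (c * P \<epsilon>)) U V)"
  by (elim exE conjE) (rule that)
 note c = c'(1) c'(2)[rule_format]
 from lifespan_upper_scaling[OF fg kp, unfolded P]
 obtain C where C': "\<forall>\<epsilon> T u v. 0 < \<epsilon> --> \<epsilon> <= 1 --> scaled_mild \<epsilon> T u v --> T <= ereal (C * P \<epsilon>)"
  by (elim exE conjE) (rule that)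
 note C = C'[rule_format]
 have main: "ereal (c * P \<epsilon>) <= T \<and> T <= ereal (max c C * P \<epsilon>)"
  if e: "0 < \<epsilon>" "\<epsilon> <= 1" and T: "T = Nakao_lifespan p q (\<lambda>x. \<epsilon> * u0 x) (\<lambda>x. \<epsilon> * u1 x) (\<lambda>x. \<epsilon> * v0 x) (\<lambda>x. \<epsilon> * v1 x)" for \<epsilon> T
 proof -
  let ?A = "{T. \<exists>u v. scaled_mild \<epsilon> T u v}"
  have mem: "ereal (c * P \<epsilon>) \<in> ?A" using c(2)[OF e] by simp
  have TS: "T = Sup ?A"
   unfolding T by (rule profiles.lifespan_eq_Sup[OF profiles_scale[OF profiles_axioms]], rule exI, rule c(2)[OF e])
  have "C * P \<epsilon> <= max c C * P \<epsilon>" using P0 by (intro mult_right_mono) auto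
  moreover have "T <= ereal (C * P \<epsilon>)" unfolding TS by (rule Sup_least) (elim CollectE exE, rule C[OF e])
  ultimately have "T <= ereal (max c C * P \<epsilon>)" using order_trans ereal_less_eq(3) by blast
  moreover have "ereal (c * P \<epsilon>) <= T" unfolding TS by (rule Sup_upper[OF mem])
  ultimately show ?thesis by blast
 qed
 show ?thesis
  by (rule exI[of _ 1], rule exI[of _ c], rule exI[of _ "max c C"])
    (use c(1) main in \<open>auto simp: Let_def P_def\<close>)
qed

end
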